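(* Let $\mu$ be Lebesgue measure on $[0,1]$, let $s$ be a positive integer, and let $X_1,\dots,X_n$ be i.i.d. from a probability density $f_o$ on $[0,1]$ (with respect to $\mu$) with $\log f_o\in W^s_\infty[0,1]=\{g:\|D^sg\|_{L_\infty[0,1]}<\infty\}$. Let $J=\{(k,q,L):k,q,L\text{ integers},\ k\ge0,\ q\ge1,\ L\ge1\}$. For $j=(k,q,L)\in J$ let $m_j=k+q$ and, for $i\in\{1,\dots,m_j\}$, let $B_{j,i}$ be the normalized B-spline (of order $q$) associated with the knots $y_i,\dots,y_{i+q}$, where $$(y_1,\dots,y_{2q+k})=(\underbrace{0,\dots,0}_{q\text{ times}},\tfrac1{1+k},\dots,\tfrac k{1+k},\underbrace{1,\dots,1}_{q\text{ times}}).$$ Let $B=(B_{j,1},\dots,B_{j,m_j})'$ and, for $\theta\in\mathbb R^{m_j}$, $\log f_{\theta,j}=-\psi(\theta)+\theta'B$ with $\psi(\theta)=\log\int_0^1e^{\theta'B(x)}dx$. Define $$\Theta_j=\{\theta\in\mathbb R^{m_j}:\theta'\mathbb 1_{m_j}=0,\ \|D^r\log f_{\theta,j}\|_{L_\infty[0,1]}\le L\ \ \forall r\in\{0,1,\dots,q-1\}\},$$ where $\mathbb 1_{m_j}=(1,\dots,1)'\in\mathbb R^{m_j}$. Put $$A_j=19.28\sqrt q\,(2q+1)9^{q-1}(L+1)e^{L/2}+0.06,\qquad C_j=m_j+L,$$ $$\eta_j=\frac{4m_j}{1-4\gamma}\log\left(\frac{46.2A_j\sqrt{1-4\gamma}}{\gamma}\right)+\frac{8C_j}{1-4\gamma},\qquad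 a_j=\alpha\exp\left(-\left(1+\frac{1-4\gamma}8\right)\eta_j\right),$$ where $\alpha$ is the normalizing constant such that $\sum_{j\in J}a_j=1$ and $\gamma\in(0,1/4)$ is the solution of $0.13\gamma/\sqrt{1-4\gamma}=0.0056$. Let $\pi_j$ be the (normalized) Lebesgue measure on $\Theta_j$, let $\tilde\pi_j$ be the prior on densities induced by $\pi_j$ via $\theta\mapsto f_{\theta,j}$, and let $\tilde\pi=\sum_{j\in J}a_j\tilde\pi_j$. Then there is a sequence $s_n\propto n^{-s/(1+2s)}$ such that the posterior probability $\tilde\pi(\tilde B_{d_H}(s_n)^c\mid X_1,\dots,X_n)$ converges to zero in $P_{f_o}^n$-probability as $n\to\infty$.
   Context: $\|\cdot\|_{L_\infty[0,1]}$ is the essential sup norm with respect to Lebesgue measure on $[0,1]$ and $D^r$ is the $r$-th derivative. $s_n\propto t_n$ means $s_n=Kt_n$ for a positive constant $K$ independent of $n$. $P_{f_o}^n$ is the joint law of $X_1,\dots,X_n$. Normalized B-splines: $B_{j,i}=N_i^q$, where $N_i^1=\mathbb 1_{[y_i,y_{i+1})}$ and $N_i^p(x)=\frac{x-y_i}{y_{i+p-1}-y_i}N_i^{p-1}(x)+\frac{y_{i+p}-x}{y_{i+p}-y_{i+1}}N_{i+1}^{p-1}(x)$ for $p\ge2$ (terms with zero denominator are taken as $0$; values at $x=1$ are left limits). They satisfy $\sum_iB_{j,i}=1$ on $[0,1]$. The set $\Theta_j$ lies in the hyperplane $\{\theta'\mathbb 1_{m_j}=0\}$ of dimension $m_j-1$;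 "Lebesgue measure on $\Theta_j$" is the $(m_j-1)$-dimensional Lebesgue measure restricted to $\Theta_j$, normalized to a probability measure (a point mass when $m_j=1$). Hellinger distance: $d_H(f,g)=\sqrt{\int(\sqrt f-\sqrt g)^2d\mu}$. $\tilde B_{d_H}(s)=\{f:d_H(f,f_o)\le s\}$ (among the densities $f_{\theta,j}$), and $$\tilde\pi(\tilde B_{d_H}(s)^c\mid X_1,\dots,X_n)=\frac{\sum_ja_j\int_{\{\theta\in\Theta_j:d_H(f_{\theta,j},f_o)>s\}}\prod_{i=1}^nf_{\theta,j}(X_i)\,d\pi_j(\theta)}{\sum_ja_j\int_{\Theta_j}\prod_{i=1}^nf_{\theta,j}(X_i)\,d\pi_j(\theta)} .$$ *)

theory Defs
  imports "HOL-Probability.Probability"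
begin

definition mu :: "real measure" where
  "mu = restrict_space lborel {0..1}"

definition Linf_norm :: "(real \<Rightarrow> real) \<Rightarrow> ereal" where
  "Linf_norm h = esssup mu (\<lambda>x. ereal \<bar>h x\<bar>)"

text \<open>The epsilon-delta definition; \<open>I\<close> is a finite family of intervals \<open>[c, d]\<close>, given by their
  end points, with pairwise disjoint interiors.\<close>

definition abs_continuous_on01 :: "(real \<Rightarrow> real) \<Rightarrow> bool" where
  "abs_continuous_on01 F \<longleftrightarrow>
     (\<forall>\<epsilon>>0. \<exists>\<delta>>0. \<forall>I :: (real \<times> real) set.
        finite I \<longrightarrow> (\<forall>(c, d)\<in>I. 0 \<le> c \<and> c < d \<and> d \<le> 1) \<longrightarrow>
        disjoint_family_on (\<lambda>(c, d). {c<..<d}) I \<longrightarrow>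
        (\<Sum>(c, d)\<in>I. d - c) < \<delta> \<longrightarrow> (\<Sum>(c, d)\<in>I. \<bar>F d - F c\<bar>) < \<epsilon>)"

text \<open>\<open>is_deriv r g h\<close>: the function \<open>h\<close> is a version of the \<open>r\<close>-th derivative of \<open>g\<close> on the unit
  interval in the sense of Sobolev spaces: the derivative of order \<open>r - 1\<close> has an absolutely
  continuous version, whose classical derivative equals \<open>h\<close> almost everywhere. Only the almost
  everywhere equivalence classes of \<open>g\<close> and \<open>h\<close> matter.\<close>

primrec is_deriv :: "nat \<Rightarrow> (real \<Rightarrow> real) \<Rightarrow> (real \<Rightarrow> real) \<Rightarrow> bool" where
  "is_deriv 0 g h \<longleftrightarrow> (AE x in mu. g x = h x)"
| "is_deriv (Suc r) g h \<longleftrightarrow>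
     (\<exists>U. is_deriv r g U \<and> abs_continuous_on01 U \<and>
          (AE x in mu. (U has_real_derivative h x) (at x)))"

text \<open>The essential sup norm of the \<open>r\<close>-th derivative. All versions of the derivative agree almost
  everywhere, so the infimum merely selects the measurable ones; it is \<open>\<infinity>\<close> if there is no
  derivative of order \<open>r\<close>.\<close>

definition deriv_norm :: "nat \<Rightarrow> (real \<Rightarrow> real) \<Rightarrow> ereal" where
  "deriv_norm r g = (INF h \<in> {h. is_deriv r g h}. Linf_norm h)"

definition W_inf :: "nat \<Rightarrow> (real \<Rightarrow> real) set" where
  "W_inf s = {g. deriv_norm s g < \<infinity>}"

text \<open>A model index is a triple \<open>(k, q, L)\<close>: number of interior knots, order, and bound.\<close>

type_synonym index = "nat \<times> nat \<times> nat"

definition J :: "index set" where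
  "J = {(k, q, L). q \<ge> 1 \<and> L \<ge> 1}"

fun num_basis :: "index \<Rightarrow> nat" where
  "num_basis (k, q, L) = k + q"

text \<open>Knots \<open>y\<^sub>1, \<dots>, y\<^sub>2\<^sub>q\<^sub>+\<^sub>k\<close>; values at other arguments are irrelevant.\<close>

definition knot :: "nat \<Rightarrow> nat \<Rightarrow> nat \<Rightarrow> real" where
  "knot k q i = (if i \<le> q then 0 else if i \<le> q + k then real (i - q) / (1 + real k) else 1)"

text \<open>\<open>Nspline y p i\<close> is the recursively defined \<open>N\<^sub>i\<^sup>p\<close>; order \<open>0\<close> is a dummy. Terms with zero
  denominator vanish because of \<open>x / 0 = 0\<close>.\<close>

fun Nspline :: "(nat \<Rightarrow> real) \<Rightarrow> nat \<Rightarrow> nat \<Rightarrow> real \<Rightarrow> real" where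
  "Nspline y 0 i x = 0"
| "Nspline y (Suc 0) i x = indicator {y i..<y (i + 1)} x"
| "Nspline y (Suc (Suc p)) i x =
     (x - y i) / (y (i + Suc p) - y i) * Nspline y (Suc p) i x +
     (y (i + Suc (Suc p)) - x) / (y (i + Suc (Suc p)) - y (i + 1)) * Nspline y (Suc p) (i + 1) x"

fun Bspline :: "index \<Rightarrow> nat \<Rightarrow> real \<Rightarrow> real" where
  "Bspline (k, q, L) i x =
     (if x = 1 then Lim (at_left 1) (Nspline (knot k q) q i) else Nspline (knot k q) q i x)"

text \<open>Vectors in \<open>\<real>\<^sup>m\<close> are functions on \<open>{1..m}\<close>, extensional so that they are the points of the
  product space \<open>\<Pi>\<^sub>M i\<in>{1..m}. lborel\<close>.\<close>

definition lin :: "index \<Rightarrow> (nat \<Rightarrow> real) \<Rightarrow> real \<Rightarrow> real" where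
  "lin j \<theta> x = (\<Sum>i = 1..num_basis j. \<theta> i * Bspline j i x)"

definition psi :: "index \<Rightarrow> (nat \<Rightarrow> real) \<Rightarrow> real" where
  "psi j \<theta> = ln (\<integral>x. exp (lin j \<theta> x) \<partial>mu)"

definition dens :: "index \<Rightarrow> (nat \<Rightarrow> real) \<Rightarrow> real \<Rightarrow> real" where
  "dens j \<theta> x = exp (- psi j \<theta> + lin j \<theta> x)"

fun Theta :: "index \<Rightarrow> (nat \<Rightarrow> real) set" where
  "Theta (k, q, L) =
     {\<theta> \<in> extensional {1..k + q}. (\<Sum>i = 1..k + q. \<theta> i) = 0 \<and>
        (\<forall>r \<in> {0..q - 1}. deriv_norm r (\<lambda>x. ln (dens (k, q, L) \<theta> x)) \<le> ereal (real L))}"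

text \<open>The \<open>(m - 1)\<close>-dimensional Lebesgue measure on the hyperplane of vectors in \<open>\<real>\<^sup>m\<close> with
  coordinate sum zero. The hyperplane is the graph of \<open>\<theta>\<^sub>m = - (\<theta>\<^sub>1 + \<dots> + \<theta>\<^sub>m\<^sub>-\<^sub>1)\<close>, whose area
  element is \<open>sqrt m\<close> times Lebesgue measure in the first \<open>m - 1\<close> coordinates. For \<open>m = 1\<close> this is
  the unit point mass at \<open>0\<close>.\<close>

definition hyperplane_lebesgue :: "nat \<Rightarrow> (nat \<Rightarrow> real) measure" where
  "hyperplane_lebesgue m = scale_measure (ennreal (sqrt (real m)))
     (distr (\<Pi>\<^sub>M i\<in>{1..<m}. lborel) (\<Pi>\<^sub>M i\<in>{1..m}. lborel)
        (\<lambda>t. t(m := - (\<Sum>i\<in>{1..<m}. t i))))"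

definition prior :: "index \<Rightarrow> (nat \<Rightarrow> real) measure" where
  "prior j = uniform_measure (hyperplane_lebesgue (num_basis j)) (Theta j)"

fun A_const :: "index \<Rightarrow> real" where
  "A_const (k, q, L) =
     19.28 * sqrt (real q) * (2 * real q + 1) * 9 ^ (q - 1) * (real L + 1) * exp (real L / 2) + 0.06"

fun C_const :: "index \<Rightarrow> real" where
  "C_const (k, q, L) = real (k + q) + real L"

definition eta :: "real \<Rightarrow> index \<Rightarrow> real" where
  "eta \<gamma> j = 4 * real (num_basis j) / (1 - 4 * \<gamma>) * ln (46.2 * A_const j * sqrt (1 - 4 * \<gamma>) / \<gamma>)
             + 8 * C_const j / (1 - 4 * \<gamma>)"

definition raw_weight :: "real \<Rightarrow> index \<Rightarrow> real" where
  "raw_weight \<gamma> j = exp (- (1 + (1 - 4 * \<gamma>) / 8) * eta \<gamma> j)"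

definition weight :: "real \<Rightarrow> index \<Rightarrow> real" where
  "weight \<gamma> j = 1 / (\<Sum>\<^sub>\<infinity>i\<in>J. raw_weight \<gamma> i) * raw_weight \<gamma> j"

lemma summable_on_mult_Times:
  fixes e :: "'a \<Rightarrow> real" and f :: "'b \<Rightarrow> real"
  assumes "e summable_on A" "\<And>k. e k \<ge> 0" "f summable_on B" "\<And>p. f p \<ge> 0"
  shows "(\<lambda>(k, p). e k * f p) summable_on A \<times> B"
  using assms
  by (intro summable_on_SigmaI[where g = "\<lambda>k. e k * infsum f B"])
     (auto intro!: has_sum_cmult_right has_sum_infsum summable_on_cmult_left)

text \<open>The normalizing constant exists: for the intended \<open>\<gamma>\<close> the weights do sum to one.\<close>

lemma weight_has_sum:
  assumes "0 < \<gamma>" "\<gamma> < 1 / 4" "0.13 * \<gamma> / sqrt (1 - 4 * \<gamma>) = 0.0056"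
  shows "(weight \<gamma> has_sum 1) J"
proof -
  define d where "d = sqrt (1 - 4 * \<gamma>)"
  have d: "d > 0" using assms by (simp add: d_def)
  have "0.13 * \<gamma> = 0.0056 * d"
    using assms(3) d unfolding d_def[symmetric] by (simp add: field_simps)
  then have dg: "d / \<gamma> \<ge> 1" using assms(1) d by (simp add: field_simps)
  have A: "A_const j \<ge> 0.06" for j by (cases j) simp
  have ln_nonneg: "ln (46.2 * A_const j * sqrt (1 - 4 * \<gamma>) / \<gamma>) \<ge> 0" for j
  proof -
    have "1 * 1 \<le> (46.2 * A_const j) * (d / \<gamma>)"
      using A[of j] dg by (intro mult_mono) auto
    then show ?thesis by (intro ln_ge_zero) (simp add: d_def)
  qed
  have eta: "real k + real q + real L \<le> eta \<gamma> (k, q, L)" for k q L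
  proof -
    have "8 * (real (k + q) + real L) / (1 - 4 * \<gamma>) \<ge> 8 * (real (k + q) + real L) / 1"
      using assms by (intro divide_left_mono) auto
    moreover have "4 * real (k + q) / (1 - 4 * \<gamma>) * ln (46.2 * A_const (k, q, L) * sqrt (1 - 4 * \<gamma>) / \<gamma>) \<ge> 0"
      using ln_nonneg assms by (intro mult_nonneg_nonneg) auto
    ultimately show ?thesis by (simp add: eta_def)
  qed
  have bound: "raw_weight \<gamma> (k, q, L) \<le> exp (- 1) ^ k * (exp (- 1) ^ q * exp (- 1) ^ L)" for k q L
  proof -
    have "1 * eta \<gamma> (k, q, L) \<le> (1 + (1 - 4 * \<gamma>) / 8) * eta \<gamma> (k, q, L)"
      using eta[of k q L] assms by (intro mult_right_mono) auto
    then have "raw_weight \<gamma> (k, q, L) \<le> exp (- real k + (- real q + - real L))"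
      using eta[of k q L] unfolding raw_weight_def exp_le_cancel_iff minus_mult_left[symmetric] by linarith
    also have "\<dots> = exp (- 1) ^ k * (exp (- 1) ^ q * exp (- 1) ^ L)"
      by (simp only: exp_add exp_of_nat_mult[symmetric]) simp
    finally show ?thesis .
  qed
  have g: "(\<lambda>n. exp (- 1 :: real) ^ n) summable_on UNIV"
    by (rule summable_nonneg_imp_summable_on) (auto intro: summable_geometric)
  have "(\<lambda>(k, q, L). exp (- 1 :: real) ^ k * (exp (- 1) ^ q * exp (- 1) ^ L)) summable_on UNIV \<times> UNIV \<times> UNIV"
    using summable_on_mult_Times[OF g _ summable_on_mult_Times[OF g _ g]]
    by (auto simp: case_prod_unfold)
  then have "(\<lambda>(k, q, L). exp (- 1 :: real) ^ k * (exp (- 1) ^ q * exp (- 1) ^ L)) summable_on J"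
    by (rule summable_on_subset_banach) auto
  then have sm: "raw_weight \<gamma> summable_on J"
    by (rule summable_on_comparison_test) (use bound in \<open>auto simp: raw_weight_def\<close>)
  have "(0, 1, 1) \<in> J" by (simp add: J_def)
  then have "infsum (raw_weight \<gamma>) J \<noteq> 0"
    using sm nonneg_infsum_le_0D[OF _ sm] by (force simp: raw_weight_def)
  then show ?thesis
    using has_sum_cmult_right[OF has_sum_infsum[OF sm], of "1 / infsum (raw_weight \<gamma>) J"]
    by (simp add: weight_def[abs_def])
qed

definition hellinger :: "(real \<Rightarrow> real) \<Rightarrow> (real \<Rightarrow> real) \<Rightarrow> real" where
  "hellinger f g = sqrt (\<integral>x. (sqrt (f x) - sqrt (g x))\<^sup>2 \<partial>mu)"

definition posterior_far :: "real \<Rightarrow> (real \<Rightarrow> real) \<Rightarrow> nat \<Rightarrow> real \<Rightarrow> (nat \<Rightarrow> real) \<Rightarrow> ennreal" where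
  "posterior_far \<gamma> fo n t X =
     (\<Sum>\<^sub>\<infinity>j\<in>J. ennreal (weight \<gamma> j) *
        (\<integral>\<^sup>+\<theta>\<in>{\<theta> \<in> Theta j. hellinger (dens j \<theta>) fo > t}. (\<Prod>i = 1..n. ennreal (dens j \<theta> (X i))) \<partial>prior j))
     / (\<Sum>\<^sub>\<infinity>j\<in>J. ennreal (weight \<gamma> j) *
        (\<integral>\<^sup>+\<theta>\<in>Theta j. (\<Prod>i = 1..n. ennreal (dens j \<theta> (X i))) \<partial>prior j))"

definition sample_law :: "(real \<Rightarrow> real) \<Rightarrow> nat \<Rightarrow> (nat \<Rightarrow> real) measure" where
  "sample_law fo n = (\<Pi>\<^sub>M i\<in>{1..n}. density mu (\<lambda>x. ennreal (fo x)))"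

text \<open>Measurability is part of the notion, so that the probabilities below are not the junk value
  \<open>0\<close> which \<open>measure\<close> takes on non-measurable sets.\<close>

definition tends_to_zero_in_prob :: "(nat \<Rightarrow> 'a measure) \<Rightarrow> (nat \<Rightarrow> 'a \<Rightarrow> ennreal) \<Rightarrow> bool" where
  "tends_to_zero_in_prob P Y \<longleftrightarrow>
     (\<forall>n. Y n \<in> borel_measurable (P n)) \<and>
     (\<forall>\<epsilon>>0. (\<lambda>n. measure (P n) {\<omega> \<in> space (P n). Y n \<omega> > ennreal \<epsilon>}) \<longlonglongrightarrow> 0)"

end

theory Submission
  imports Defs "HOL-Computational_Algebra.Polynomial" "HOL-Real_Asymp.Real_Asymp"
begin

text \<open>
  Write \<open>\<tau>\<^sub>n = n\<^bsup>1/(1+2s)\<^esup>\<close>, so that \<open>n s\<^sub>n\<^sup>2\<close> is a constant multiple of \<open>\<tau>\<^sub>n\<close>.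

  Denominator: a single model suffices, with splines of degree \<open>s\<close> on \<open>k + 1 = s b\<close> cells,
  \<open>b = \<lceil>\<tau>\<^sub>n\<rceil>\<close>, and a fixed \<open>L\<close>. A spline matching the derivatives of \<open>ln fo\<close> up to order \<open>s - 1\<close> at the ends
  of blocks of \<open>s\<close> cells approximates it within \<open>O(b\<^bsup>-s\<^esup>)\<close> and has bounded derivatives. A box of radius
  of order \<open>b\<^bsup>-s\<^esup>\<close> about its coefficients has prior mass at least \<open>exp (- O(b))\<close>, without a logarithmic
  factor: on \<open>Theta\<close> the bound on the \<open>s\<close>-th derivative confines each coefficient to an interval of length
  \<open>O(b\<^bsup>-s\<^esup>)\<close> determined by the \<open>s\<close> preceding ones. Averaging reciprocal likelihood ratios
  over the box bounds the evidence from below by \<open>exp (- O(\<tau>\<^sub>n))\<close> with high probability.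

  Numerator: the square root of the likelihood ratio averaged over densities within Hellinger
  distance \<open>d/2\<close> of one that has distance at least \<open>d\<close> from \<open>fo\<close> has expectation at most \<open>(1 - d\<^sup>2/8)\<^bsup>n\<^esup>\<close>, by induction
  on \<open>n\<close>. Cut each model into lattice cells for the \<open>L\<^sup>2\<close> distance of the log densities, which is Euclidean in
  suitable coordinates. The bound decays like a Gaussian in the lattice point, and the Gaussian
  sum over the lattice is at most exponential in the dimension with no logarithm of \<open>n\<close>, so the weights \<open>a\<^sub>j\<close>
  outweigh it.
\<close>

section \<open>Lebesgue measure on the unit interval and absolute continuity\<close>

text \<open>The rate balances n times the squared bias, of order \<open>n * b^(-2 * s)\<close>,
  against the number of coefficients, of order b. To lose nothing, both estimates are relative: the
  prior mass is a quotient of volumes in which the small powers of b cancel, and lattice cells are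
  weighed against exponential decay, never against the diameter of the parameter set.

  Hellinger distance and L2 distance of log densities agree only up to factors \<open>exp L\<close>,
  so the cells cost a term of order \<open>m * L\<close> in the exponent. The weights pay for it
  because \<open>A_j\<close> contains \<open>exp (L / 2)\<close> and its logarithm is multiplied by
  \<open>4 * m\<close>. Square roots of likelihood ratios enter because they are subadditive, which
  turns a union of cells into a sum; the price is that only the square root of \<open>a_j\<close> is
  available.

  A block of s cells leaves s values of the s-th derivative free, as many as there are conditions at
  its right end. Hence the approximating spline is found block by block, with constants independent
  of b.\<close>

lemma space_mu [simp]: "space mu = {0..1}"
  by (simp add: mu_def space_restrict_space)

lemma prob_space_mu: "prob_space mu"
  by (rule prob_spaceI) (simp add: mu_def emeasure_restrict_space space_restrict_space)

interpretation mu: prob_space mu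
  by (rule prob_space_mu)

lemma measurable_mu_borel: "f \<in> borel_measurable borel \<Longrightarrow> f \<in> borel_measurable mu"
  unfolding mu_def by (intro measurable_restrict_space1) simp

lemma AE_mu_iff: "(AE x in mu. P x) \<longleftrightarrow> (AE x in lborel. x \<in> {0..1} \<longrightarrow> P x)"
  unfolding mu_def by (rule AE_restrict_space_iff) simp

lemma AE_mu_not_finite: "finite F \<Longrightarrow> AE x in mu. x \<notin> F"
  unfolding AE_mu_iff
  by (rule AE_mp[OF AE_not_in[of F]]) (auto simp: finite_imp_null_set_lborel)

lemma AE_mu_open:
  assumes "finite F" shows "AE x in mu. x \<in> {0<..<1} - F"
proof -
  have "AE x in mu. x \<notin> insert 0 (insert 1 F)" by (rule AE_mu_not_finite) (use assms in auto)
  then show ?thesis using AE_space[of mu] by eventually_elim auto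
qed

lemma AE_mu_dense:
  assumes "AE x in mu. P x" "0 \<le> a" "a < b" "b \<le> 1"
  shows "\<exists>x\<in>{a<..<b}. P x"
proof (rule ccontr)
  assume "\<not> ?thesis"
  with assms have "AE x in lborel. x \<notin> {a<..<b}"
    unfolding AE_mu_iff by (auto elim!: eventually_mono)
  then have "emeasure lborel {a<..<b} = 0"
    by (subst (asm) AE_iff_measurable[of "{a<..<b}"]) auto
  with assms show False by simp
qed

lemma continuous_AE_mu_le:
  fixes F :: "real \<Rightarrow> real"
  assumes "AE x in mu. F x \<le> B" "continuous_on {0<..<1} F" "x \<in> {0<..<1}"
  shows "F x \<le> B"
proof (rule ccontr)
  assume "\<not> ?thesis"
  then have "x \<in> {0<..<1} \<inter> F -` {B<..}" using assms by auto
  moreover have "open ({0<..<1} \<inter> F -` {B<..})"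
    using assms(2) by (intro continuous_open_preimage) auto
  ultimately obtain e where e: "e > 0" "ball x e \<subseteq> {0<..<1} \<inter> F -` {B<..}"
    by (meson open_contains_ball)
  have sub: "{x-e<..<x+e} \<subseteq> {0<..<1} \<inter> F -` {B<..}"
    using e(2) by (auto simp: ball_eq_greaterThanLessThan)
  then have "{x-e<..<x+e} \<subseteq> {0<..<1}" by blast
  then have "x - e \<ge> 0" "x + e \<le> 1" using e(1)
    by (auto simp: greaterThanLessThan_subseteq_greaterThanLessThan)
  with AE_mu_dense[OF assms(1), of "x-e" "x+e"] e(1) sub show False by force
qed

lemma continuous_AE_mu_eq:
  fixes F G :: "real \<Rightarrow> real"
  assumes "AE x in mu. F x = G x" "continuous_on {0<..<1} F" "continuous_on {0<..<1} G" "x \<in> {0<..<1}"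
  shows "F x = G x"
proof -
  have "F x - G x \<le> 0" "G x - F x \<le> 0"
    by (rule continuous_AE_mu_le[where B=0 and F="\<lambda>x. F x - G x"]
         continuous_AE_mu_le[where B=0 and F="\<lambda>x. G x - F x"],
       (use assms in \<open>auto intro!: continuous_intros elim!: eventually_mono\<close>)[3])+
  then show ?thesis by simp
qed

lemma abs_continuous_on01_continuous:
  assumes "abs_continuous_on01 F" shows "continuous_on {0..1} F"
  unfolding continuous_on_iff
proof (intro ballI allI impI)
  fix x e :: real assume x: "x \<in> {0..1}" and e: "e > 0"
  then obtain d where d: "d > 0" "\<And>I :: (real \<times> real) set. finite I \<Longrightarrow> (\<forall>(c, d)\<in>I. 0 \<le> c \<and> c < d \<and> d \<le> 1) \<Longrightarrow>
        disjoint_family_on (\<lambda>(c, d). {c<..<d}) I \<Longrightarrow>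
        (\<Sum>(c, d)\<in>I. d - c) < d \<Longrightarrow> (\<Sum>(c, d)\<in>I. \<bar>F d - F c\<bar>) < e"
    using assms unfolding abs_continuous_on01_def by meson
  have *: "\<bar>F v - F u\<bar> < e" if "0 \<le> u" "u < v" "v \<le> 1" "v - u < d" for u v
    using d(2)[of "{(u,v)}"] that by (simp add: disjoint_family_on_def)
  have "dist (F y) (F x) < e" if "y \<in> {0..1}" "dist y x < d" for y
    using *[of x y] *[of y x] that x e by (cases x y rule: linorder_cases) (auto simp: dist_real_def)
  with d(1) show "\<exists>d>0. \<forall>x'\<in>{0..1}. dist x' x < d \<longrightarrow> dist (F x') (F x) < e" by blast
qed

lemma lipschitz_abs_continuous_on01:
  assumes "\<And>x y. 0 \<le> x \<Longrightarrow> x < y \<Longrightarrow> y \<le> 1 \<Longrightarrow> \<bar>F y - F x\<bar> \<le> B * (y - x)"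
  shows "abs_continuous_on01 F"
  unfolding abs_continuous_on01_def
proof (intro allI impI)
  fix e :: real assume e: "e > 0"
  show "\<exists>\<delta>>0. \<forall>I :: (real \<times> real) set.
        finite I \<longrightarrow> (\<forall>(c, d)\<in>I. 0 \<le> c \<and> c < d \<and> d \<le> 1) \<longrightarrow>
        disjoint_family_on (\<lambda>(c, d). {c<..<d}) I \<longrightarrow>
        (\<Sum>(c, d)\<in>I. d - c) < \<delta> \<longrightarrow> (\<Sum>(c, d)\<in>I. \<bar>F d - F c\<bar>) < e"
  proof (intro exI[of _ "e / (\<bar>B\<bar> + 1)"] conjI allI impI)
    fix I :: "(real \<times> real) set"
    assume I: "finite I" "\<forall>(c, d)\<in>I. 0 \<le> c \<and> c < d \<and> d \<le> 1" "(\<Sum>(c, d)\<in>I. d - c) < e / (\<bar>B\<bar> + 1)"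
    have "(\<Sum>(c, d)\<in>I. \<bar>F d - F c\<bar>) \<le> (\<Sum>(c, d)\<in>I. (\<bar>B\<bar>+1) * (d - c))"
    proof (intro sum_mono, clarify)
      fix c d assume "(c,d) \<in> I"
      then have "0 \<le> c" "c < d" "d \<le> 1" using I by auto
      then show "\<bar>F d - F c\<bar> \<le> (\<bar>B\<bar>+1) * (d - c)"
        using assms[of c d] mult_right_mono[of B "\<bar>B\<bar>+1" "d-c"] by linarith
    qed
    also have "\<dots> = (\<bar>B\<bar>+1) * (\<Sum>(c, d)\<in>I. d - c)"
      by (simp add: sum_distrib_left case_prod_unfold)
    also have "\<dots> < e" using I(3) by (simp add: field_simps)
    finally show "(\<Sum>(c, d)\<in>I. \<bar>F d - F c\<bar>) < e" .
  qed (use e in auto)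
qed

text \<open>The exceptional null set is enclosed in an open set of measure below the \<delta> that
  belongs to e. A gauge is chosen so fine that an interval tagged in the null set stays in this open
  set, while an interval tagged elsewhere obeys the derivative bound. In a fine tagged division the
  former contribute less than e by absolute continuity and the latter at most
  \<open>(B + e) * (d - c)\<close>.\<close>

lemma abs_continuous_on01_lipschitz:
  assumes ac: "abs_continuous_on01 F"
    and der: "AE x in mu. \<exists>D. (F has_real_derivative D) (at x) \<and> \<bar>D\<bar> \<le> B"
    and cd: "0 \<le> c" "c < d" "d \<le> 1"
  shows "\<bar>F d - F c\<bar> \<le> B * (d - c)"
proof -
  have B: "B \<ge> 0"
    using AE_mu_dense[OF der, of 0 1] by auto
  have main: "\<bar>F d - F c\<bar> \<le> (B + e) * (d - c) + e" if e: "e > 0" for e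
  proof -
    obtain \<delta> where \<delta>: "\<delta> > 0" "\<And>I :: (real \<times> real) set. finite I \<Longrightarrow> (\<forall>(c, d)\<in>I. 0 \<le> c \<and> c < d \<and> d \<le> 1) \<Longrightarrow>
        disjoint_family_on (\<lambda>(c, d). {c<..<d}) I \<Longrightarrow>
        (\<Sum>(c, d)\<in>I. d - c) < \<delta> \<Longrightarrow> (\<Sum>(c, d)\<in>I. \<bar>F d - F c\<bar>) < e"
      using ac e unfolding abs_continuous_on01_def by meson
    from der have "AE x in lborel. x \<in> {0..1} \<longrightarrow> (\<exists>D. (F has_real_derivative D) (at x) \<and> \<bar>D\<bar> \<le> B)"
      unfolding AE_mu_iff .
    then obtain N where N: "N \<in> null_sets lborel"
      "\<And>x. x \<in> {0..1} \<Longrightarrow> x \<notin> N \<Longrightarrow> \<exists>D. (F has_real_derivative D) (at x) \<and> \<bar>D\<bar> \<le> B"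
      by (auto elim!: AE_E3)
    have "N \<in> sets lebesgue" using N(1) by auto
    then obtain T where T: "open T" "N \<subseteq> T" "T - N \<in> lmeasurable" "emeasure lebesgue (T - N) < ennreal \<delta>"
      using sets_lebesgue_outer_open[OF _ \<delta>(1)] by metis
    have T\<delta>: "emeasure lborel T < ennreal \<delta>"
    proof -
      have "emeasure lborel T = emeasure lborel (T - N)"
        using N(1) T(1) by (intro emeasure_Diff_null_set[symmetric]) auto
      also have "\<dots> = emeasure lebesgue (T - N)" using T(1) N(1) by (subst emeasure_completion) auto
      finally show ?thesis using T(4) by simp
    qed
    have "\<exists>r>0. (x \<in> N \<longrightarrow> ball x r \<subseteq> T) \<and>
        (x \<in> {0..1} - N \<longrightarrow> (\<forall>y. \<bar>y - x\<bar> < r \<longrightarrow> \<bar>F y - F x\<bar> \<le> (B + e) * \<bar>y - x\<bar>))" for x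
    proof (cases "x \<in> N")
      case True
      then show ?thesis using T(1,2) open_contains_ball by auto
    next
      case False
      show ?thesis
      proof (cases "x \<in> {0..1}")
        case True
        then obtain D where D: "(F has_real_derivative D) (at x)" "\<bar>D\<bar> \<le> B" using N(2) False by blast
        then have "(F has_derivative (\<lambda>h. h * D)) (at x)"
          by (simp add: has_field_derivative_def mult_commute_abs)
        then obtain r where r: "r > 0" "\<And>y. \<bar>y - x\<bar> < r \<Longrightarrow> \<bar>F y - F x - (y - x) * D\<bar> \<le> e * \<bar>y - x\<bar>"
          unfolding has_derivative_at_alt using e by fastforce
        have "\<bar>F y - F x\<bar> \<le> (B + e) * \<bar>y - x\<bar>" if "\<bar>y - x\<bar> < r" for y
        proof -
          have "\<bar>F y - F x\<bar> \<le> e * \<bar>y - x\<bar> + \<bar>(y - x) * D\<bar>" using r(2)[OF that] by linarith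
          moreover have "\<bar>(y - x) * D\<bar> \<le> B * \<bar>y - x\<bar>"
            using D(2) by (simp add: abs_mult mult.commute mult_right_mono)
          ultimately show ?thesis by (simp add: algebra_simps)
        qed
        then show ?thesis using r(1) False by blast
      qed (use False zero_less_one in blast)
    qed
    then obtain r where r: "\<And>x. r x > 0" "\<And>x. x \<in> N \<Longrightarrow> ball x (r x) \<subseteq> T"
      "\<And>x y. x \<in> {0..1} - N \<Longrightarrow> \<bar>y - x\<bar> < r x \<Longrightarrow> \<bar>F y - F x\<bar> \<le> (B + e) * \<bar>y - x\<bar>"
      by metis
    have "gauge (\<lambda>x. ball x (r x))" using r(1) by (intro gauge_ball_dependent) auto
    then obtain p where p: "p tagged_division_of {c..d}" "(\<lambda>x. ball x (r x)) fine p"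
      using fine_division_exists_real by blast
    have fin: "finite p" using p(1) by auto
    have K: "\<exists>u v. K = {u..v} \<and> u \<le> x \<and> x \<le> v \<and> c \<le> u \<and> v \<le> d \<and> {u..v} \<subseteq> ball x (r x)" if "(x, K) \<in> p" for x K
    proof -
      have "x \<in> K" "K \<subseteq> {c..d}" using tagged_division_ofD(2,3)[OF p(1) that] by auto
      moreover have "\<exists>u v. K = {u..v}" using tagged_division_ofD(4)[OF p(1) that] by simp
      then obtain u v where "K = {u..v}" by blast
      moreover have "K \<subseteq> ball x (r x)" using p(2) that unfolding fine_def by blast
      ultimately show ?thesis by (intro exI[of _ u] exI[of _ v]) auto
    qed
    let ?G = "\<lambda>(x::real, K). \<bar>F (Sup K) - F (Inf K)\<bar>" and ?len = "\<lambda>(x::real, K). Sup K - Inf K :: real"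
    \<comment> \<open>Degenerate intervals are left out: absolute continuity speaks of pairs with
      \<open>c < d\<close>, and their increments are 0 anyway.\<close>
    define p1 where "p1 = {(x, K) \<in> p. x \<in> N \<and> Inf K < Sup K}"
    have p1: "p1 \<subseteq> p" "finite p1" using fin by (auto simp: p1_def intro: finite_subset[OF _ fin])
    have len: "(\<Sum>z\<in>p. ?len z) = d - c"
      using additive_tagged_division_1[OF _ p(1), of "\<lambda>x. x"] cd by simp
    have len0: "?len z \<ge> 0" if "z \<in> p" for z
      using K[of "fst z" "snd z"] that by (cases z) auto
    have "(\<Sum>z\<in>p - p1. ?G z) \<le> (\<Sum>z\<in>p - p1. (B + e) * ?len z)"
    proof (rule sum_mono, clarify)
      fix x K assume xK: "(x, K) \<in> p" "(x, K) \<notin> p1"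
      obtain u v where uv: "K = {u..v}" "u \<le> x" "x \<le> v" "c \<le> u" "v \<le> d" "{u..v} \<subseteq> ball x (r x)"
        using K[OF xK(1)] by blast
      show "\<bar>F (Sup K) - F (Inf K)\<bar> \<le> (B + e) * (Sup K - Inf K)"
      proof (cases "x \<in> N")
        case True
        then have "u = v" using xK uv by (auto simp: p1_def)
        then show ?thesis using uv(1) by simp
      next
        case False
        have "x \<in> {0..1} - N" using uv cd False by auto
        moreover have "\<bar>u - x\<bar> < r x" "\<bar>v - x\<bar> < r x"
          using uv(2,3) subsetD[OF uv(6), of u] subsetD[OF uv(6), of v] by (auto simp: dist_real_def)
        ultimately have "\<bar>F u - F x\<bar> \<le> (B + e) * \<bar>u - x\<bar>" "\<bar>F v - F x\<bar> \<le> (B + e) * \<bar>v - x\<bar>"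
          using r(3) by blast+
        then have "\<bar>F v - F u\<bar> \<le> (B + e) * (x - u) + (B + e) * (v - x)" using uv(2,3) by simp
        then show ?thesis using uv by (simp add: algebra_simps)
      qed
    qed
    also have "\<dots> \<le> (\<Sum>z\<in>p. (B + e) * ?len z)"
      using fin len0 B e by (intro sum_mono2) (auto intro!: mult_nonneg_nonneg)
    also have "\<dots> = (B + e) * (d - c)" by (simp only: sum_distrib_left[symmetric] len)
    finally have good: "(\<Sum>z\<in>p - p1. ?G z) \<le> (B + e) * (d - c)" .
    have bad: "(\<Sum>z\<in>p1. ?G z) < e"
    proof -
      let ?h = "\<lambda>(x::real, K :: real set). (Inf K, Sup K)"
      have disj: "{Inf K<..<Sup K} \<inter> {Inf K'<..<Sup K'} = {}"
        if "(x, K) \<in> p" "(x', K') \<in> p" "(x, K) \<noteq> (x', K')" for x x' K K'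
      proof -
        have "interior K \<inter> interior K' = {}" using tagged_division_ofD(5)[OF p(1) that] .
        then show ?thesis using K[OF that(1)] K[OF that(2)] by auto
      qed
      have inj: "inj_on ?h p1"
      proof (rule inj_onI, clarify)
        fix x K x' K' assume *: "(x, K) \<in> p1" "(x', K') \<in> p1" "Inf K = Inf K'" "Sup K = Sup K'"
        then have "Inf K < Sup K" by (simp add: p1_def)
        then have "{Inf K<..<Sup K} \<noteq> {}" by simp
        moreover have "(x, K) \<in> p" "(x', K') \<in> p" using * p1 by auto
        ultimately show "x = x' \<and> K = K'" using disj[of x K x' K'] * by auto
      qed
      have disj2: "disjoint_family_on (\<lambda>(x, K). {Inf K<..<Sup K}) p1"
        unfolding disjoint_family_on_def using disj p1 by fastforce
      have sum_len: "(\<Sum>z\<in>p1. ?len z) < \<delta>"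
      proof -
        have "(\<Sum>z\<in>p1. ?len z) = (\<Sum>z\<in>p1. measure lborel ((\<lambda>(x, K). {Inf K<..<Sup K}) z))"
          by (rule sum.cong) (auto simp: p1_def)
        also have "\<dots> = measure lborel (\<Union>z\<in>p1. (\<lambda>(x, K). {Inf K<..<Sup K}) z)"
          by (rule measure_finite_Union[symmetric]) (use p1 disj2 in \<open>auto simp: p1_def\<close>)
        also have "\<dots> \<le> measure lborel T"
        proof (rule measure_mono_fmeasurable)
          show "(\<Union>z\<in>p1. (\<lambda>(x, K). {Inf K<..<Sup K}) z) \<subseteq> T"
          proof clarify
            fix x K y assume *: "(x, K) \<in> p1" "y \<in> {Inf K<..<Sup K}"
            then have "(x, K) \<in> p" "x \<in> N" using p1 by (auto simp: p1_def)
            then obtain u v where "K = {u..v}" "u \<le> x" "x \<le> v" "{u..v} \<subseteq> ball x (r x)" using K by blast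
            moreover from this have "y \<in> {u..v}" using *(2) by auto
            ultimately show "y \<in> T" using r(2)[OF \<open>x \<in> N\<close>] by blast
          qed
          show "(\<Union>z\<in>p1. (\<lambda>(x, K). {Inf K<..<Sup K}) z) \<in> sets lborel"
            by (intro sets.finite_UN) (use p1 in auto)
          show "T \<in> fmeasurable lborel" using T(1) T\<delta> by (intro fmeasurableI) (auto intro: less_trans)
        qed
        also have "\<dots> < \<delta>" using T\<delta> \<delta>(1) by (cases "emeasure lborel T") (auto simp: measure_def ennreal_less_iff)
        finally show ?thesis .
      qed
      have "(\<Sum>(c, d)\<in>?h ` p1. \<bar>F d - F c\<bar>) < e"
      proof (rule \<delta>(2))
        show "\<forall>(c, d)\<in>?h ` p1. 0 \<le> c \<and> c < d \<and> d \<le> 1"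
        proof (clarify)
          fix x K assume *: "(x, K) \<in> p1"
          then have "(x, K) \<in> p" "Inf K < Sup K" using p1 by (auto simp: p1_def)
          then show "0 \<le> Inf K \<and> Inf K < Sup K \<and> Sup K \<le> 1" using K[of x K] cd by auto
        qed
        show "disjoint_family_on (\<lambda>(c, d). {c<..<d}) (?h ` p1)"
          using disj p1 unfolding disjoint_family_on_def by fastforce
        show "(\<Sum>(c, d)\<in>?h ` p1. d - c) < \<delta>"
          using sum_len unfolding sum.reindex[OF inj] by (simp add: case_prod_unfold comp_def)
      qed (use p1 in simp)
      then show ?thesis unfolding sum.reindex[OF inj] by (simp add: case_prod_unfold comp_def)
    qed
    have "\<bar>F d - F c\<bar> = \<bar>\<Sum>(x, K)\<in>p. F (Sup K) - F (Inf K)\<bar>"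
      using additive_tagged_division_1[OF _ p(1), of F] cd by simp
    also have "\<dots> \<le> (\<Sum>z\<in>p. ?G z)"
      by (rule order_trans[OF sum_abs]) (auto simp: case_prod_unfold)
    also have "\<dots> = (\<Sum>z\<in>p - p1. ?G z) + (\<Sum>z\<in>p1. ?G z)"
      using p1 fin by (intro sum.subset_diff) auto
    finally show ?thesis using good bad by linarith
  qed
  show ?thesis
  proof (rule field_le_epsilon)
    fix e :: real assume e: "e > 0"
    have "\<bar>F d - F c\<bar> \<le> (B + e/2) * (d - c) + e/2" using main[of "e/2"] e by simp
    also have "\<dots> \<le> B * (d - c) + e"
      using mult_left_mono[of "d - c" 1 "e/2"] cd e unfolding distrib_right by linarith
    finally show "\<bar>F d - F c\<bar> \<le> B * (d - c) + e" .
  qed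
qed

lemma abs_continuous_on01_diff:
  assumes "abs_continuous_on01 F" "abs_continuous_on01 G"
  shows "abs_continuous_on01 (\<lambda>x. F x - G x)"
  unfolding abs_continuous_on01_def
proof (intro allI impI)
  fix e :: real assume e: "e > 0"
  then have e2: "e / 2 > 0" by simp
  obtain \<delta>1 where 1: "\<delta>1 > 0" "\<And>I :: (real \<times> real) set. finite I \<Longrightarrow> (\<forall>(c, d)\<in>I. 0 \<le> c \<and> c < d \<and> d \<le> 1) \<Longrightarrow>
        disjoint_family_on (\<lambda>(c, d). {c<..<d}) I \<Longrightarrow>
        (\<Sum>(c, d)\<in>I. d - c) < \<delta>1 \<Longrightarrow> (\<Sum>(c, d)\<in>I. \<bar>F d - F c\<bar>) < e/2"
    using assms(1) e2 unfolding abs_continuous_on01_def by meson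
  obtain \<delta>2 where 2: "\<delta>2 > 0" "\<And>I :: (real \<times> real) set. finite I \<Longrightarrow> (\<forall>(c, d)\<in>I. 0 \<le> c \<and> c < d \<and> d \<le> 1) \<Longrightarrow>
        disjoint_family_on (\<lambda>(c, d). {c<..<d}) I \<Longrightarrow>
        (\<Sum>(c, d)\<in>I. d - c) < \<delta>2 \<Longrightarrow> (\<Sum>(c, d)\<in>I. \<bar>G d - G c\<bar>) < e/2"
    using assms(2) e2 unfolding abs_continuous_on01_def by meson
  show "\<exists>\<delta>>0. \<forall>I :: (real \<times> real) set.
        finite I \<longrightarrow> (\<forall>(c, d)\<in>I. 0 \<le> c \<and> c < d \<and> d \<le> 1) \<longrightarrow>
        disjoint_family_on (\<lambda>(c, d). {c<..<d}) I \<longrightarrow>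
        (\<Sum>(c, d)\<in>I. d - c) < \<delta> \<longrightarrow> (\<Sum>(c, d)\<in>I. \<bar>F d - G d - (F c - G c)\<bar>) < e"
  proof (intro exI[of _ "min \<delta>1 \<delta>2"] conjI allI impI)
    fix I :: "(real \<times> real) set"
    assume I: "finite I" "\<forall>(c, d)\<in>I. 0 \<le> c \<and> c < d \<and> d \<le> 1" "disjoint_family_on (\<lambda>(c, d). {c<..<d}) I"
      "(\<Sum>(c, d)\<in>I. d - c) < min \<delta>1 \<delta>2"
    have "(\<Sum>(c, d)\<in>I. \<bar>F d - G d - (F c - G c)\<bar>) \<le> (\<Sum>(c, d)\<in>I. \<bar>F d - F c\<bar> + \<bar>G d - G c\<bar>)"
      by (intro sum_mono) auto
    also have "\<dots> = (\<Sum>(c, d)\<in>I. \<bar>F d - F c\<bar>) + (\<Sum>(c, d)\<in>I. \<bar>G d - G c\<bar>)"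
      by (simp add: sum.distrib case_prod_unfold)
    also have "\<dots> < e"
      using 1(2)[OF I(1-3)] 2(2)[OF I(1-3)] I(4) by simp
    finally show "(\<Sum>(c, d)\<in>I. \<bar>F d - G d - (F c - G c)\<bar>) < e" .
  qed (use 1 2 in auto)
qed

text \<open>\<open>F\<close> minus the integral of \<open>U\<close> is absolutely continuous with
  derivative 0 almost everywhere, hence constant by the Lipschitz bound with constant 0. The
  derivative therefore exists at every point, one-sided at the end points.\<close>

lemma abs_continuous_on01_derivative_continuous:
  assumes ac: "abs_continuous_on01 F" and der: "AE x in mu. (F has_real_derivative U x) (at x)"
    and U: "continuous_on {0..1} U" and x: "x \<in> {0..1}"
  shows "(F has_real_derivative U x) (at x within {0..1})"
proof -
  define I where "I x = integral {0..x} U" for x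
  have I: "(I has_real_derivative U x) (at x within {0..1})" if "x \<in> {0..1}" for x
    unfolding I_def using integral_has_real_derivative[OF U that] .
  obtain B where B: "\<And>x. x \<in> {0..1} \<Longrightarrow> \<bar>U x\<bar> \<le> B"
    using compact_imp_bounded[OF compact_continuous_image[OF U compact_Icc]] unfolding bounded_iff
    by (metis image_eqI real_norm_def)
  have "abs_continuous_on01 I"
  proof (rule lipschitz_abs_continuous_on01[where B=B])
    fix x y :: real assume "0 \<le> x" "x < y" "y \<le> 1"
    then show "\<bar>I y - I x\<bar> \<le> B * (y - x)"
      using field_differentiable_bound[of "{0..1}" I U B y x] I B by auto
  qed
  then have ac2: "abs_continuous_on01 (\<lambda>x. F x - I x)" using ac abs_continuous_on01_diff by blast
  have "AE x in mu. \<exists>D. ((\<lambda>x. F x - I x) has_real_derivative D) (at x) \<and> \<bar>D\<bar> \<le> 0"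
    using der AE_mu_open[OF finite.emptyI]
  proof eventually_elim
    case (elim x)
    have "x \<in> interior {0..1}" using elim by simp
    then have "(I has_real_derivative U x) (at x)"
      using I[of x] elim at_within_interior[of x "{0..1}"] by auto
    then show ?case using DERIV_diff[OF elim(1)] by (intro exI[of _ 0]) force
  qed
  note const = abs_continuous_on01_lipschitz[OF ac2 this, of 0]
  have eq: "F y = F 0 + I y" if "y \<in> {0..1}" for y
    using that const[of y] by (cases "y = 0") (auto simp: I_def)
  have "((\<lambda>y. F 0 + I y) has_real_derivative U x) (at x within {0..1})"
    using DERIV_add[OF DERIV_const I[OF x]] by simp
  then show ?thesis
    by (rule has_field_derivative_transform_within[OF _ zero_less_one x]) (rule eq[symmetric])
qed

text \<open>An absolutely continuous function whose derivative has a continuous version is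
  classically differentiable everywhere. So the versions at the successive orders line up to one
  chain of classical derivatives that ends in \<open>U\<close>.\<close>

lemma is_deriv_chain:
  assumes "is_deriv r g U" "abs_continuous_on01 U"
  shows "\<exists>G. G r = U \<and> (AE x in mu. g x = G 0 x) \<and>
     (\<forall>i<r. \<forall>x\<in>{0..1}. (G i has_real_derivative G (Suc i) x) (at x within {0..1}))"
  using assms
proof (induction r arbitrary: U)
  case 0
  then show ?case by (intro exI[of _ "\<lambda>_. U"]) auto
next
  case (Suc r)
  then obtain V where V: "is_deriv r g V" "abs_continuous_on01 V" "AE x in mu. (V has_real_derivative U x) (at x)"
    by auto
  from Suc.IH[OF V(1,2)] obtain G where G: "G r = V" "AE x in mu. g x = G 0 x"
    "\<forall>i<r. \<forall>x\<in>{0..1}. (G i has_real_derivative G (Suc i) x) (at x within {0..1})" by auto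
  have "(V has_real_derivative U x) (at x within {0..1})" if "x \<in> {0..1}" for x
    using abs_continuous_on01_derivative_continuous[OF V(2,3) abs_continuous_on01_continuous[OF Suc.prems(2)] that] .
  then show ?case using G
    by (intro exI[of _ "G(Suc r := U)"]) (auto simp: less_Suc_eq)
qed

text \<open>The Sobolev space in the form of C^(s-1,1): for i < s, \<open>G i\<close> is the i-th
  classical derivative, one-sided at the end points, and the last one is Lipschitz. This is the form
  in which Taylor expansion uses the smoothness of \<open>ln fo\<close>.\<close>

definition smooth_chain :: "nat \<Rightarrow> (real \<Rightarrow> real) \<Rightarrow> (nat \<Rightarrow> real \<Rightarrow> real) \<Rightarrow> real \<Rightarrow> bool" where
  "smooth_chain s g G B \<longleftrightarrow> (AE x in mu. g x = G 0 x) \<and>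
    (\<forall>i x. Suc i < s \<longrightarrow> x \<in> {0..1} \<longrightarrow> (G i has_real_derivative G (Suc i) x) (at x within {0..1})) \<and>
    (\<forall>x y. 0 \<le> x \<longrightarrow> x < y \<longrightarrow> y \<le> 1 \<longrightarrow> \<bar>G (s - 1) y - G (s - 1) x\<bar> \<le> B * (y - x))"

lemma W_inf_smooth_chain:
  assumes "g \<in> W_inf s" "s \<ge> 1"
  shows "\<exists>G B. smooth_chain s g G B"
proof -
  obtain r where r: "s = Suc r" using assms(2) by (cases s) auto
  from assms(1) obtain h where h: "is_deriv s g h" "Linf_norm h < \<infinity>"
    unfolding W_inf_def deriv_norm_def mem_Collect_eq INF_less_iff by blast
  obtain B where B: "Linf_norm h < ereal (real B)" using less_PInf_Ex_of_nat h(2) by auto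
  from h(1) obtain U where U: "is_deriv r g U" "abs_continuous_on01 U" "AE x in mu. (U has_real_derivative h x) (at x)"
    unfolding r by auto
  have "AE x in mu. ereal \<bar>h x\<bar> \<le> Linf_norm h" unfolding Linf_norm_def by (rule esssup_AE)
  with U(3) have "AE x in mu. \<exists>D. (U has_real_derivative D) (at x) \<and> \<bar>D\<bar> \<le> real B"
  proof eventually_elim
    case (elim x)
    then have "ereal \<bar>h x\<bar> < ereal (real B)" using B by (meson le_less_trans)
    then show ?case using elim by (intro exI[of _ "h x"]) auto
  qed
  note lip = abs_continuous_on01_lipschitz[OF U(2) this]
  from is_deriv_chain[OF U(1,2)] obtain G where G: "G r = U" "AE x in mu. g x = G 0 x"
     "\<forall>i<r. \<forall>x\<in>{0..1}. (G i has_real_derivative G (Suc i) x) (at x within {0..1})" by auto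
  have "smooth_chain s g G (real B)"
    unfolding smooth_chain_def using G lip r by auto
  then show ?thesis by blast
qed

text \<open>By induction the continuous versions of the preceding order agree on the open interval,
  so at almost every point they have one and the same derivative.\<close>

lemma is_deriv_unique:
  assumes "is_deriv r g h" "is_deriv r g h'"
  shows "AE x in mu. h x = h' x"
  using assms
proof (induction r arbitrary: h h')
  case 0
  then show ?case by auto
next
  case (Suc r)
  then obtain U U' where U: "is_deriv r g U" "abs_continuous_on01 U" "AE x in mu. (U has_real_derivative h x) (at x)"
    "is_deriv r g U'" "abs_continuous_on01 U'" "AE x in mu. (U' has_real_derivative h' x) (at x)" by auto
  have "continuous_on {0<..<1} U" "continuous_on {0<..<1} U'"
    using abs_continuous_on01_continuous[OF U(2)] abs_continuous_on01_continuous[OF U(5)]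
    by (auto elim!: continuous_on_subset)
  from continuous_AE_mu_eq[OF Suc.IH[OF U(1,4)] this]
  have eq: "U x = U' x" if "x \<in> {0<..<1}" for x using that by blast
  from U(3,6) AE_mu_open[OF finite.emptyI] show ?case
  proof eventually_elim
    case (elim x)
    have "(U' has_real_derivative h x) (at x)"
      using has_field_derivative_transform_within_open[OF elim(1), of "{0<..<1}"] elim(3) eq by auto
    then show ?case using DERIV_unique elim(2) by blast
  qed
qed

text \<open>By uniqueness all versions with measurable absolute value share one essential supremum,
  and the others have the value \<infinity>. One measurable version therefore computes the
  infimum.\<close>

lemma deriv_norm_le_iff:
  assumes h: "is_deriv r g h" "h \<in> borel_measurable mu"
  shows "deriv_norm r g \<le> ereal L \<longleftrightarrow> (AE x in mu. \<bar>h x\<bar> \<le> L)"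
proof -
  have hm: "(\<lambda>x. ereal \<bar>h x\<bar>) \<in> borel_measurable mu" using h(2) by measurable
  have "Linf_norm h \<le> Linf_norm h'" if "is_deriv r g h'" for h'
  proof (cases "(\<lambda>x. ereal \<bar>h' x\<bar>) \<in> borel_measurable mu")
    case True
    have "AE x in mu. ereal \<bar>h x\<bar> = ereal \<bar>h' x\<bar>"
      using is_deriv_unique[OF h(1) that] by eventually_elim simp
    then show ?thesis unfolding Linf_norm_def using esssup_AE_cong[OF hm True] by simp
  qed (simp add: Linf_norm_def esssup_non_measurable)
  then have "deriv_norm r g = Linf_norm h"
    unfolding deriv_norm_def using h(1) by (intro antisym INF_lower INF_greatest) auto
  moreover have "Linf_norm h \<le> ereal L \<longleftrightarrow> (AE x in mu. \<bar>h x\<bar> \<le> L)"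
  proof
    assume *: "Linf_norm h \<le> ereal L"
    have "AE x in mu. ereal \<bar>h x\<bar> \<le> Linf_norm h" unfolding Linf_norm_def by (rule esssup_AE)
    then show "AE x in mu. \<bar>h x\<bar> \<le> L"
      by eventually_elim (use * in \<open>auto dest: order_trans\<close>)
  qed (use hm in \<open>auto simp: Linf_norm_def intro!: esssup_I\<close>)
  ultimately show ?thesis by simp
qed

text \<open>The next derivative has to be taken from an absolutely continuous version, while a
  spline as defined may jump at the end points. An almost everywhere equal \<open>U\<close> may
  replace \<open>h\<close>, because \<open>is_deriv\<close> sees only equivalence classes.\<close>

lemma is_deriv_SucI:
  assumes "is_deriv r g h" "AE x in mu. h x = U x" "abs_continuous_on01 U"
    "AE x in mu. (U has_real_derivative h' x) (at x)"
  shows "is_deriv (Suc r) g h'"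
proof -
  have "is_deriv r g U"
  proof (cases r)
    case 0
    have "AE x in mu. g x = h x" using assms(1) 0 by simp
    then have "AE x in mu. g x = U x" using assms(2) by eventually_elim simp
    then show ?thesis using 0 by simp
  next
    case (Suc n)
    then obtain V where V: "is_deriv n g V" "abs_continuous_on01 V" "AE x in mu. (V has_real_derivative h x) (at x)"
      using assms(1) by auto
    have "AE x in mu. (V has_real_derivative U x) (at x)"
      using V(3) assms(2) by eventually_elim simp
    with V Suc show ?thesis by auto
  qed
  then show ?thesis using assms by auto
qed

section \<open>B-splines and their derivatives\<close>

text \<open>The clamped form holds for all indices, also beyond the knot sequence, so monotonicity
  and index shifts need no distinction of cases.\<close>

lemma knot_eq_clamp: "knot k p i = max 0 (min 1 ((real i - real p) / (1 + real k)))"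
  by (auto simp: knot_def max_def min_def field_simps of_nat_diff)

lemma knot_mono: "i \<le> j \<Longrightarrow> knot k p i \<le> knot k p j"
  unfolding knot_eq_clamp by (intro max.mono min.mono divide_right_mono) auto

text \<open>Raising the order by one prepends one zero to the knot sequence. With the matching index
  shift the recursion relates splines of order p + 1 to splines of order p, each over its own knot
  sequence.\<close>

lemma knot_Suc_Suc: "knot k (Suc p) (Suc i) = knot k p i"
  by (simp add: knot_eq_clamp)

definition knots :: "nat \<Rightarrow> real set" where
  "knots k = (\<lambda>j. real j / (1 + real k)) ` {..k + 1}"

lemma finite_knots [simp]: "finite (knots k)"
  by (simp add: knots_def)

lemma knot_in_knots: "knot k p i \<in> knots k"
proof -
  have "0 \<in> knots k" "1 \<in> knots k"
    unfolding knots_def by (auto intro!: image_eqI[of 0 _ 0] image_eqI[of 1 _ "k + 1"])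
  moreover have "real (i - p) / (1 + real k) \<in> knots k" if "i \<le> p + k"
    unfolding knots_def using that by auto
  ultimately show ?thesis by (auto simp: knot_def simp del: of_nat_diff)
qed

definition bs :: "nat \<Rightarrow> nat \<Rightarrow> nat \<Rightarrow> real \<Rightarrow> real" where
  "bs k p i = Nspline (knot k p) p i"

text \<open>The length of the support of the i-th spline of order p, which is the denominator in
  both the recursion and the derivative formula.\<close>

definition gap :: "nat \<Rightarrow> nat \<Rightarrow> nat \<Rightarrow> real" where
  "gap k p i = knot k p (i + p) - knot k p i"

text \<open>In this index range a support contains at least one full cell and at most p cells, even
  where knots coalesce at the ends. So every gap is comparable to the mesh 1 / (1 + k), uniformly in
  the position.\<close>

lemma gap_bounds:
  assumes "1 \<le> i" "i \<le> k + p" "1 \<le> p"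
  shows "1 / (1 + real k) \<le> gap k p i" "gap k p i \<le> real p / (1 + real k)"
proof -
  define n where "n = 1 + real k"
  have *: "n > 0" "real i \<le> n + real p - 1" "1 \<le> real i" "1 \<le> real p" using assms by (auto simp: n_def)
  have g: "gap k p i = max 0 (min 1 (real i / n)) - max 0 (min 1 ((real i - real p) / n))"
    by (simp add: gap_def knot_eq_clamp n_def)
  have "1 / n \<le> gap k p i"
  proof (cases "i \<le> p")
    case True
    then have "(real i - real p) / n \<le> 0" using * by (simp add: divide_nonpos_pos)
    moreover have "1 / n \<le> real i / n" "1 / n \<le> 1" using * by (auto simp: divide_right_mono n_def)
    ultimately show ?thesis using * unfolding g by (auto simp: max_def min_def)
  next
    case False
    then have p: "1 + real p \<le> real i" by linarith
    then have "(real i - real p) / n + 1 / n \<le> real i / n" "(real i - real p) / n + 1 / n \<le> 1" "0 \<le> (real i - real p) / n"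
      using * by (auto simp: divide_simps)
    moreover have "0 < 1 / n" using * by simp
    ultimately have "gap k p i = min 1 (real i / n) - (real i - real p) / n"
      unfolding g by linarith
    moreover have "(real i - real p) / n + 1 / n \<le> min 1 (real i / n)"
      using \<open>_ \<le> real i / n\<close> \<open>_ \<le> 1\<close> by simp
    ultimately show ?thesis by linarith
  qed
  then show "1 / (1 + real k) \<le> gap k p i" by (simp add: n_def)
  have "real i / n - (real i - real p) / n = real p / n" "0 \<le> real p / n" using *(1) by (auto simp: divide_simps)
  then have "gap k p i \<le> real p / n"
    unfolding g by (auto simp: max_def min_def)
  then show "gap k p i \<le> real p / (1 + real k)" by (simp add: n_def)
qed

section \<open>Support, positivity, partition of unity and continuity of B-splines\<close>

lemma Nspline_shift: "Nspline y p (Suc i) x = Nspline (\<lambda>j. y (Suc j)) p i x"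
  by (induction y p i x rule: Nspline.induct) auto

lemma Nspline_support:
  fixes y :: "nat \<Rightarrow> real"
  assumes "mono y" "Nspline y p i x \<noteq> 0"
  shows "y i \<le> x \<and> x < y (i + p)"
  using assms(2)
proof (induction p arbitrary: i rule: induct_nat_012)
  case (ge2 p)
  have y: "y i \<le> y (i + 1)" "y (i + Suc p) \<le> y (i + Suc (Suc p))" using assms(1) by (auto simp: mono_def)
  from ge2(3) have "Nspline y (Suc p) i x \<noteq> 0 \<or> Nspline y (Suc p) (i + 1) x \<noteq> 0" by auto
  then show ?case using ge2(2)[of i] ge2(2)[of "i + 1"] y by force
qed (auto simp: indicator_def split: if_splits)

lemma Nspline_nonneg:
  fixes y :: "nat \<Rightarrow> real"
  assumes "mono y"
  shows "0 \<le> Nspline y p i x"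
proof (induction p arbitrary: i rule: induct_nat_012)
  case (ge2 p)
  have "0 \<le> (x - y i) / (y (i + Suc p) - y i) * Nspline y (Suc p) i x"
    using Nspline_support[OF assms, of "Suc p" i x] ge2(2)[of i]
    by (cases "Nspline y (Suc p) i x = 0") (auto intro!: mult_nonneg_nonneg divide_nonneg_nonneg)
  moreover have "0 \<le> (y (i + Suc (Suc p)) - x) / (y (i + Suc (Suc p)) - y (i + 1)) * Nspline y (Suc p) (i + 1) x"
    using Nspline_support[OF assms, of "Suc p" "i + 1" x] ge2(2)[of "i + 1"]
    by (cases "Nspline y (Suc p) (i + 1) x = 0") (auto intro!: mult_nonneg_nonneg divide_nonneg_nonneg)
  ultimately show ?case by simp
qed auto

lemma Nspline_measurable [measurable]: "Nspline y p i \<in> borel_measurable borel"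
proof (induction p arbitrary: i rule: induct_nat_012)
  case 0
  have "Nspline y 0 i = (\<lambda>x. 0)" by (rule ext) simp
  then show ?case by simp
next
  case 1
  have "Nspline y (Suc 0) i = indicator {y i..<y (i + 1)}" by (rule ext) simp
  then show ?case by simp
next
  case (ge2 p)
  note [measurable] = ge2(2)
  have "Nspline y (Suc (Suc p)) i = (\<lambda>x. (x - y i) / (y (i + Suc p) - y i) * Nspline y (Suc p) i x +
     (y (i + Suc (Suc p)) - x) / (y (i + Suc (Suc p)) - y (i + 1)) * Nspline y (Suc p) (i + 1) x)"
    by (rule ext) (simp only: Nspline.simps)
  then show ?case by (simp del: Nspline.simps)
qed

lemma bs_measurable [measurable]: "bs k p i \<in> borel_measurable borel"
  unfolding bs_def by measurable

lemma bs_nonneg: "0 \<le> bs k p i x"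
  unfolding bs_def by (rule Nspline_nonneg) (auto simp: mono_def knot_mono)

lemma bs_support: "bs k p i x \<noteq> 0 \<Longrightarrow> knot k p i \<le> x \<and> x < knot k p (i + p)"
  unfolding bs_def by (rule Nspline_support) (auto simp: mono_def knot_mono)

lemma bs_outside: "i = 0 \<or> i > k + p \<Longrightarrow> bs k p i x = 0"
  using bs_support[of k p i x] by (force simp: knot_def)

lemma bs_rec: "bs k (Suc (Suc p)) (Suc i) x =
    (x - knot k (Suc p) i) / gap k (Suc p) i * bs k (Suc p) i x +
    (knot k (Suc p) (i + Suc (Suc p)) - x) / gap k (Suc p) (Suc i) * bs k (Suc p) (Suc i) x"
  unfolding bs_def gap_def by (simp add: Nspline_shift knot_Suc_Suc)

lemma knot_1: "1 \<le> i \<Longrightarrow> i \<le> k + 2 \<Longrightarrow> knot k (Suc 0) i = (real i - 1) / (1 + real k)"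
  using divide_le_eq_1_pos[of "1 + real k" "real i - 1"] by (simp add: knot_eq_clamp)

lemma bs_1:
  "bs k (Suc 0) i x = (if 1 \<le> i \<and> i \<le> k + 1 \<and> real i - 1 \<le> (1 + real k) * x \<and> (1 + real k) * x < real i then 1 else 0)"
proof (cases "1 \<le> i \<and> i \<le> k + 1")
  case True
  then have "knot k (Suc 0) i = (real i - 1) / (1 + real k)" "knot k (Suc 0) (Suc i) = real i / (1 + real k)"
    using knot_1[of i k] knot_1[of "Suc i" k] by auto
  then have "bs k (Suc 0) i x = indicator {(real i - 1) / (1 + real k)..<real i / (1 + real k)} x"
    by (simp add: bs_def)
  then show ?thesis using True
    by (auto simp: indicator_def pos_divide_le_eq pos_less_divide_eq mult.commute)
next
  case False
  then show ?thesis by (subst bs_outside) auto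
qed

text \<open>Summing the recursion, each spline of lower order occurs with the weights
  \<open>(x - y_i)\<close> and \<open>(y_(i+p) - x)\<close> over the same gap, which add up to 1.
  The surplus terms at both ends of the range belong to splines that vanish identically.\<close>

lemma bs_partition:
  assumes "x \<in> {0..<1}"
  shows "(\<Sum>i=1..k + Suc p. bs k (Suc p) i x) = 1"
proof (induction p)
  case 0
  define i0 where "i0 = nat \<lfloor>(1 + real k) * x\<rfloor> + 1"
  have nn: "0 \<le> (1 + real k) * x" "(1 + real k) * x < 1 + real k"
  proof -
    show "0 \<le> (1 + real k) * x" using assms by simp
    show "(1 + real k) * x < 1 + real k" using assms mult_strict_left_mono[of x 1 "1 + real k"] by simp
  qed
  have "\<lfloor>(1 + real k) * x\<rfloor> < 1 + int k"
    using nn(2) by (simp only: floor_less_iff of_int_add of_int_of_nat_eq of_int_1)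
  then have "i0 \<le> k + 1"
    unfolding i0_def by linarith
  moreover have "(real i - 1 \<le> (1 + real k) * x \<and> (1 + real k) * x < real i) \<longleftrightarrow> i = i0" if "1 \<le> i" for i
  proof -
    have "(real i - 1 \<le> (1 + real k) * x \<and> (1 + real k) * x < real i) \<longleftrightarrow> \<lfloor>(1 + real k) * x\<rfloor> = int i - 1"
      by (auto simp: floor_eq_iff)
    also have "\<dots> \<longleftrightarrow> i = i0" using nn that by (auto simp: i0_def)
    finally show ?thesis .
  qed
  ultimately have "(\<Sum>i=1..k + Suc 0. bs k (Suc 0) i x) = (\<Sum>i=1..k + Suc 0. if i = i0 then 1 else 0)"
    by (intro sum.cong) (auto simp: bs_1)
  then show ?case using \<open>i0 \<le> k + 1\<close> by (simp add: i0_def)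
next
  case (Suc p)
  let ?a = "\<lambda>i. (x - knot k (Suc p) i) / gap k (Suc p) i * bs k (Suc p) i x"
  let ?b = "\<lambda>i. (knot k (Suc p) (i + Suc p) - x) / gap k (Suc p) i * bs k (Suc p) i x"
  have "(\<Sum>i=1..k + Suc (Suc p). bs k (Suc (Suc p)) i x) = (\<Sum>i=0..k + Suc p. bs k (Suc (Suc p)) (Suc i) x)"
    by (subst sum.shift_bounds_cl_Suc_ivl[symmetric]) simp
  also have "\<dots> = (\<Sum>i=0..k + Suc p. ?a i) + (\<Sum>i=0..k + Suc p. ?b (Suc i))"
    by (simp add: bs_rec sum.distrib)
  also have "(\<Sum>i=0..k + Suc p. ?a i) = (\<Sum>i=1..k + Suc p. ?a i)"
    by (subst sum.atLeast_Suc_atMost) (auto simp: bs_outside)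
  also have "(\<Sum>i=0..k + Suc p. ?b (Suc i)) = (\<Sum>i=1..k + Suc p. ?b i)"
  proof -
    have "(\<Sum>i=0..k + Suc p. ?b (Suc i)) = (\<Sum>i=Suc 0..Suc (k + Suc p). ?b i)"
      by (rule sum.shift_bounds_cl_Suc_ivl[symmetric])
    also have "\<dots> = (\<Sum>i=1..k + Suc p. ?b i)"
      by (subst sum.cl_ivl_Suc) (simp add: bs_outside)
    finally show ?thesis .
  qed
  also have "(\<Sum>i=1..k + Suc p. ?a i) + (\<Sum>i=1..k + Suc p. ?b i) = (\<Sum>i=1..k + Suc p. bs k (Suc p) i x)"
    unfolding sum.distrib[symmetric]
  proof (rule sum.cong[OF refl])
    fix i assume i: "i \<in> {1..k + Suc p}"
    then have "0 < 1 / (1 + real k)" "1 / (1 + real k) \<le> gap k (Suc p) i" using gap_bounds[of i k "Suc p"] by auto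
    then have "gap k (Suc p) i > 0" by linarith
    then show "?a i + ?b i = bs k (Suc p) i x"
      unfolding distrib_right[symmetric] add_divide_distrib[symmetric] by (simp add: gap_def)
  qed
  finally show ?case using Suc by simp
qed

text \<open>Consequently the value of a spline at 0 is its first coefficient, which is how
  derivatives at the left end are prescribed and read off later.\<close>

lemma bs_at_0: "bs k (Suc p) i 0 = (if i = 1 then 1 else 0)"
proof (induction p arbitrary: i)
  case 0
  show ?case by (auto simp: bs_1)
next
  case (Suc p)
  show ?case
  proof (cases i)
    case 0 then show ?thesis by (simp add: bs_outside)
  next
    case (Suc i')
    have "knot k (Suc p) (Suc 0) = 0" "knot k (Suc p) (Suc (Suc p)) \<noteq> 0" by (auto simp: knot_def)
    then show ?thesis unfolding Suc bs_rec Suc.IH by (auto simp: gap_def)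
  qed
qed

lemma bs_2:
  assumes "x \<in> {0..<1}"
  shows "bs k (Suc (Suc 0)) i x = max 0 (1 - \<bar>(1 + real k) * x - (real i - 1)\<bar>)"
proof (cases i)
  case 0 then show ?thesis using assms by (simp add: bs_outside)
next
  case (Suc j)
  have nx: "0 \<le> (1 + real k) * x" "(1 + real k) * x < 1 + real k"
  proof -
    show "0 \<le> (1 + real k) * x" using assms by simp
    show "(1 + real k) * x < 1 + real k" using assms mult_strict_left_mono[of x 1 "1 + real k"] by simp
  qed
  have g: "knot k (Suc 0) j = (real j - 1) / (1 + real k) \<and> gap k (Suc 0) j = 1 / (1 + real k)" if "1 \<le> j" "j \<le> k + 1" for j
  proof -
    have "knot k (Suc 0) j = (real j - 1) / (1 + real k)" "knot k (Suc 0) (Suc j) = real j / (1 + real k)"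
      using that knot_1[of j k] knot_1[of "Suc j" k] by auto
    then show ?thesis by (simp add: gap_def diff_divide_distrib)
  qed
  have quot: "(a / (1 + real k) - x) / (1 / (1 + real k)) = a - (1 + real k) * x"
    "(x - a / (1 + real k)) / (1 / (1 + real k)) = (1 + real k) * x - a" for a
    using add_pos_nonneg[OF zero_less_one of_nat_0_le_iff[of k]] by (auto simp: left_diff_distrib)
  have "knot k (Suc 0) (Suc (Suc j)) = (real j + 1) / (1 + real k)" if "j \<le> k"
    using that knot_1[of "Suc (Suc j)" k] by simp
  then have 2: "(knot k (Suc 0) (j + Suc (Suc 0)) - x) / gap k (Suc 0) (Suc j) * bs k (Suc 0) (Suc j) x =
     (if real j \<le> (1 + real k) * x \<and> (1 + real k) * x < real j + 1 then real j + 1 - (1 + real k) * x else 0)"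
  proof (cases "j \<le> k")
    case False
    then have "1 + real k \<le> real j" by linarith
    then have "\<not> (real j \<le> (1 + real k) * x)" using nx(2) by linarith
    then show ?thesis using False by (simp add: bs_1)
  qed (use g[of "Suc j"] quot in \<open>auto simp: bs_1\<close>)
  have 1: "(x - knot k (Suc 0) j) / gap k (Suc 0) j * bs k (Suc 0) j x =
     (if real j - 1 \<le> (1 + real k) * x \<and> (1 + real k) * x < real j then (1 + real k) * x - (real j - 1) else 0)"
  proof (cases "j \<le> k + 1")
    case False
    then have "\<not> (real j - 1 \<le> (1 + real k) * x)" using nx(2) by linarith
    then show ?thesis using False by (simp add: bs_1)
  next
    case True
    then show ?thesis
    proof (cases "j = 0")
      case True
      then have "\<not> ((1 + real k) * x < real j)" using nx(1) by linarith
      then show ?thesis using True by (simp add: bs_1)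
    qed (use g[of j] quot True in \<open>auto simp: bs_1\<close>)
  qed
  show ?thesis unfolding Suc bs_rec 1 2 by (auto simp: max_def)
qed

text \<open>The recursively defined splines are 0 outside [0, 1), so the first one jumps at 0 and
  the last one at 1; continuity can only be claimed for an extension from the half-open interval. At
  order 2 this is the explicit hat function, and the recursion preserves it.\<close>

lemma bs_continuous_extension:
  "\<exists>f. continuous_on UNIV f \<and> (\<forall>x\<in>{0..<1}. f x = bs k (Suc (Suc p)) i x)"
proof (induction p arbitrary: i)
  case 0
  show ?case
    by (intro exI[of _ "\<lambda>x. max 0 (1 - \<bar>(1 + real k) * x - (real i - 1)\<bar>)"])
       (auto simp: bs_2 intro!: continuous_intros)
next
  case (Suc p)
  show ?case
  proof (cases i)
    case 0 then show ?thesis by (intro exI[of _ "\<lambda>_. 0"]) (auto simp: bs_outside)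
  next
    case (Suc j)
    obtain f g where fg: "continuous_on UNIV f" "\<forall>x\<in>{0..<1}. f x = bs k (Suc (Suc p)) j x"
      "continuous_on UNIV g" "\<forall>x\<in>{0..<1}. g x = bs k (Suc (Suc p)) (Suc j) x"
      using Suc.IH by metis
    show ?thesis unfolding Suc
      by (intro exI[of _ "\<lambda>x. (x - knot k (Suc (Suc p)) j) / gap k (Suc (Suc p)) j * f x +
          (knot k (Suc (Suc p)) (j + Suc (Suc (Suc p))) - x) / gap k (Suc (Suc p)) (Suc j) * g x"] conjI)
         (use fg in \<open>auto simp: bs_rec divide_inverse intro!: continuous_intros\<close>)
  qed
qed

section \<open>Derivatives of splines\<close>

lemma indicator_ivl_deriv:
  fixes a b x :: real
  assumes "x \<noteq> a" "x \<noteq> b"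
  shows "((indicator {a..<b} :: real \<Rightarrow> real) has_real_derivative 0) (at x)"
proof (cases "a < x \<and> x < b")
  case True
  show ?thesis
    by (rule has_field_derivative_transform_within_open[where f="\<lambda>_. 1" and S="{a<..<b}"]) (use True in auto)
next
  case False
  show ?thesis
    by (rule has_field_derivative_transform_within_open[where f="\<lambda>_. 0" and S="- {a..b}"]) (use False assms in auto)
qed

lemma DERIV_affine_quotient:
  "((\<lambda>x::real. (x - a) / b) has_real_derivative 1 / b) (at x)"
  "((\<lambda>x::real. (a - x) / b) has_real_derivative - 1 / b) (at x)"
  using DERIV_cdivide[OF DERIV_diff[OF DERIV_ident DERIV_const], of a b x UNIV]
    DERIV_cdivide[OF DERIV_diff[OF DERIV_const DERIV_ident], of a b x UNIV] by simp_all

text \<open>Differentiating the recursion yields the two lower-order splines, divided by their outer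
  gaps, plus weighted derivatives of them. By the induction hypothesis the latter reproduce the same
  difference, because in each half the two contributions of the middle spline add up to
  \<open>n1 / d1\<close>; thus the factor rises by one.\<close>

lemma Nspline_deriv:
  assumes y: "mono y" and x: "x \<notin> range y"
  shows "(Nspline y (Suc (Suc p)) i has_real_derivative
     real (Suc p) * (Nspline y (Suc p) i x / (y (i + Suc p) - y i)
        - Nspline y (Suc p) (i + 1) x / (y (i + Suc (Suc p)) - y (i + 1)))) (at x)"
proof (induction p arbitrary: i)
  case 0
  have d: "(Nspline y (Suc 0) i has_real_derivative 0) (at x)" for i
  proof -
    have "Nspline y (Suc 0) i = indicator {y i..<y (i + 1)}" by (simp add: fun_eq_iff)
    then show ?thesis using indicator_ivl_deriv[of x "y i" "y (i+1)"] x by auto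
  qed
  have eq2: "Nspline y (Suc (Suc 0)) i = (\<lambda>x. (x - y i) / (y (i + Suc 0) - y i) * Nspline y (Suc 0) i x +
     (y (i + Suc (Suc 0)) - x) / (y (i + Suc (Suc 0)) - y (i + 1)) * Nspline y (Suc 0) (i + 1) x)"
    by (rule ext) (simp only: Nspline.simps)
  show ?case unfolding eq2
    by (rule DERIV_cong[OF DERIV_add[OF DERIV_mult'[OF DERIV_affine_quotient(1) d] DERIV_mult'[OF DERIV_affine_quotient(2) d]]])
       (simp add: divide_inverse algebra_simps)
next
  case (Suc p)
  have eq: "Nspline y (Suc (Suc (Suc p))) i = (\<lambda>x. (x - y i) / (y (i + Suc (Suc p)) - y i) * Nspline y (Suc (Suc p)) i x +
     (y (i + Suc (Suc (Suc p))) - x) / (y (i + Suc (Suc (Suc p))) - y (i + 1)) * Nspline y (Suc (Suc p)) (i + 1) x)"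
    by (rule ext) (simp only: Nspline.simps)
  define n0 n1 n2 where n: "n0 = Nspline y (Suc p) i x" "n1 = Nspline y (Suc p) (i + 1) x" "n2 = Nspline y (Suc p) (i + 2) x"
  define d0 d1 d2 where d: "d0 = y (i + Suc p) - y i" "d1 = y (i + Suc (Suc p)) - y (i + 1)" "d2 = y (i + Suc (Suc (Suc p))) - y (i + 2)"
  define e0 e1 where e: "e0 = y (i + Suc (Suc p)) - y i" "e1 = y (i + Suc (Suc (Suc p))) - y (i + 1)"
  define P where "P = real (Suc p)"
  have N0: "Nspline y (Suc (Suc p)) i x = (x - y i) / d0 * n0 + (y (i + Suc (Suc p)) - x) / d1 * n1"
    unfolding n d by simp
  have N1: "Nspline y (Suc (Suc p)) (i+1) x = (x - y (i+1)) / d1 * n1 + (y (i + Suc (Suc (Suc p))) - x) / d2 * n2"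
    unfolding n d by (simp add: numeral_2_eq_2)
  have D0: "(Nspline y (Suc (Suc p)) i has_real_derivative P * (n0 / d0 - n1 / d1)) (at x)"
    using Suc.IH[of i] unfolding n d P_def .
  have D1: "(Nspline y (Suc (Suc p)) (i+1) has_real_derivative P * (n1 / d1 - n2 / d2)) (at x)"
    using Suc.IH[of "i+1"] unfolding n d P_def by (simp add: numeral_2_eq_2 del: Nspline.simps)
  \<comment> \<open>Under \<open>x / 0 = 0\<close> a vanishing outer denominator is harmless only if
    the inner ones vanish too, which monotonicity of the knots ensures.\<close>
  have z0: "d0 = 0 \<and> d1 = 0" if "e0 = 0"
  proof -
    have "y i \<le> y (i+1)" "y (i+1) \<le> y (i + Suc p)" "y (i + Suc p) \<le> y (i + Suc (Suc p))"
      using y by (auto simp: mono_def)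
    then show ?thesis using that unfolding d e by auto
  qed
  have z1: "d1 = 0 \<and> d2 = 0" if "e1 = 0"
  proof -
    have "y (i+1) \<le> y (i+2)" "y (i+2) \<le> y (i + Suc (Suc p))" "y (i + Suc (Suc p)) \<le> y (i + Suc (Suc (Suc p)))"
      using y by (auto simp: mono_def)
    then show ?thesis using that unfolding d e by auto
  qed
  have der: "((\<lambda>x. (x - y i) / e0 * Nspline y (Suc (Suc p)) i x +
     (y (i + Suc (Suc (Suc p))) - x) / e1 * Nspline y (Suc (Suc p)) (i + 1) x) has_real_derivative
     (1 / e0 * ((x - y i) / d0 * n0 + (y (i + Suc (Suc p)) - x) / d1 * n1) + (x - y i) / e0 * (P * (n0 / d0 - n1 / d1)) +
     (- 1 / e1 * ((x - y (i+1)) / d1 * n1 + (y (i + Suc (Suc (Suc p))) - x) / d2 * n2) +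
      (y (i + Suc (Suc (Suc p))) - x) / e1 * (P * (n1 / d1 - n2 / d2))))) (at x)"
    unfolding N0[symmetric] N1[symmetric]
    by (rule DERIV_cong[OF DERIV_add[OF DERIV_mult'[OF DERIV_affine_quotient(1) D0] DERIV_mult'[OF DERIV_affine_quotient(2) D1]]])
       (simp add: algebra_simps)
  have LR: "(x - y i) / e0 * (n0 / d0 - n1 / d1) + (y (i + Suc (Suc (Suc p))) - x) / e1 * (n1 / d1 - n2 / d2) =
     ((x - y i) / d0 * n0 + (y (i + Suc (Suc p)) - x) / d1 * n1) / e0 -
     ((x - y (i+1)) / d1 * n1 + (y (i + Suc (Suc (Suc p))) - x) / d2 * n2) / e1" (is "?L = ?R")
  proof -
    have A: "(x - y i) / e0 * (n1 / d1) + (y (i + Suc (Suc p)) - x) / d1 * n1 / e0 = n1 / d1"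
    proof (cases "e0 = 0")
      case True then show ?thesis using z0 by simp
    next
      case False
      have "(x - y i) / e0 * (n1 / d1) + (y (i + Suc (Suc p)) - x) / d1 * n1 / e0
        = ((x - y i) + (y (i + Suc (Suc p)) - x)) / e0 * (n1 / d1)"
        by (simp add: divide_inverse algebra_simps)
      also have "(x - y i) + (y (i + Suc (Suc p)) - x) = e0" by (simp add: e)
      finally show ?thesis using False by simp
    qed
    have B: "(y (i + Suc (Suc (Suc p))) - x) / e1 * (n1 / d1) + (x - y (i+1)) / d1 * n1 / e1 = n1 / d1"
    proof (cases "e1 = 0")
      case True then show ?thesis using z1 by simp
    next
      case False
      have "(y (i + Suc (Suc (Suc p))) - x) / e1 * (n1 / d1) + (x - y (i+1)) / d1 * n1 / e1
        = ((y (i + Suc (Suc (Suc p))) - x) + (x - y (i+1))) / e1 * (n1 / d1)"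
        by (simp add: divide_inverse algebra_simps)
      also have "(y (i + Suc (Suc (Suc p))) - x) + (x - y (i+1)) = e1" by (simp add: e)
      finally show ?thesis using False by simp
    qed
    have "?L - ?R = ((y (i + Suc (Suc (Suc p))) - x) / e1 * (n1 / d1) + (x - y (i+1)) / d1 * n1 / e1)
       - ((x - y i) / e0 * (n1 / d1) + (y (i + Suc (Suc p)) - x) / d1 * n1 / e0)"
      by (simp add: divide_inverse algebra_simps)
    then show ?thesis unfolding A B by simp
  qed
  have *: "1 / e0 * A + u * (P * v) + (- 1 / e1 * B + w * (P * z)) = real (Suc (Suc p)) * (A / e0 - B / e1)"
    if "u * v + w * z = A / e0 - B / e1" for A B u v w z
  proof -
    have "1 / e0 * A + u * (P * v) + (- 1 / e1 * B + w * (P * z)) = A / e0 - B / e1 + P * (u * v + w * z)"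
      by (simp add: algebra_simps)
    then show ?thesis unfolding that by (simp add: P_def algebra_simps)
  qed
  show ?case
    unfolding eq e[symmetric] N0 N1
    by (rule DERIV_cong[OF der *[OF LR]])
qed

definition sp :: "nat \<Rightarrow> nat \<Rightarrow> (nat \<Rightarrow> real) \<Rightarrow> real \<Rightarrow> real" where
  "sp k p c x = (\<Sum>i=1..k + p. c i * bs k p i x)"

text \<open>The coefficients of the derivative of a spline of order \<open>p + 1\<close>, as a spline of order \<open>p\<close>.\<close>

definition dc :: "nat \<Rightarrow> nat \<Rightarrow> (nat \<Rightarrow> real) \<Rightarrow> nat \<Rightarrow> real" where
  "dc k p c i = real p * (c (Suc i) - c i) / gap k p i"

lemma sp_measurable [measurable]: "sp k p c \<in> borel_measurable borel"
  unfolding sp_def[abs_def] by measurable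

lemma sp_diff: "sp k p (\<lambda>i. c i - d i) x = sp k p c x - sp k p d x"
  by (simp add: sp_def left_diff_distrib sum_subtractf)

lemma sp_const: "x \<in> {0..<1} \<Longrightarrow> sp k (Suc p) (\<lambda>_. a) x = a"
  using bs_partition[of x k p] by (simp add: sp_def sum_distrib_left[symmetric])

lemma sp_at_0: "sp k (Suc p) c 0 = c 1"
proof -
  have "sp k (Suc p) c 0 = (\<Sum>i=1..k + Suc p. if i = 1 then c i else 0)"
    unfolding sp_def by (intro sum.cong) (auto simp: bs_at_0)
  then show ?thesis by simp
qed

lemma sp_1:
  assumes "1 \<le> i" "i \<le> k + 1" "real i - 1 \<le> (1 + real k) * x" "(1 + real k) * x < real i"
  shows "sp k (Suc 0) c x = c i"
proof -
  have "sp k (Suc 0) c x = (\<Sum>j=1..k + Suc 0. if j = i then c j else 0)"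
    unfolding sp_def
  proof (intro sum.cong refl)
    fix j assume "j \<in> {1..k + Suc 0}"
    then show "c j * bs k (Suc 0) j x = (if j = i then c j else 0)" using assms by (auto simp: bs_1)
  qed
  then show ?thesis using assms by simp
qed

lemma sp_bound:
  assumes "x \<in> {0..<1}" "\<And>i. 1 \<le> i \<Longrightarrow> i \<le> k + Suc p \<Longrightarrow> \<bar>c i\<bar> \<le> M"
  shows "\<bar>sp k (Suc p) c x\<bar> \<le> M"
proof -
  have "\<bar>sp k (Suc p) c x\<bar> \<le> (\<Sum>i=1..k + Suc p. M * bs k (Suc p) i x)"
    unfolding sp_def using assms(2) bs_nonneg
    by (intro order_trans[OF sum_abs] sum_mono) (auto simp: abs_mult intro!: mult_right_mono)
  also have "\<dots> = M" using bs_partition[OF assms(1)] by (simp add: sum_distrib_left[symmetric])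
  finally show ?thesis .
qed

lemma bs_deriv:
  assumes "x \<notin> knots k"
  shows "(bs k (Suc (Suc p)) (Suc i) has_real_derivative
     real (Suc p) * (bs k (Suc p) i x / gap k (Suc p) i - bs k (Suc p) (Suc i) x / gap k (Suc p) (Suc i))) (at x)"
proof -
  have "mono (knot k (Suc (Suc p)))" by (simp add: mono_def knot_mono)
  moreover have "x \<notin> range (knot k (Suc (Suc p)))" using assms knot_in_knots by auto
  ultimately show ?thesis
    using Nspline_deriv[of "knot k (Suc (Suc p))" x p "Suc i"]
    by (simp add: bs_def gap_def Nspline_shift knot_Suc_Suc del: Nspline.simps)
qed

text \<open>Summation by parts. The boundary terms vanish because the splines with indices just
  outside the range are identically 0.\<close>

lemma sp_deriv:
  assumes "x \<notin> knots k"
  shows "(sp k (Suc (Suc p)) c has_real_derivative sp k (Suc p) (dc k (Suc p) c) x) (at x)"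
proof -
  let ?D = "\<lambda>i. bs k (Suc p) i x / gap k (Suc p) i"
  have eq: "sp k (Suc (Suc p)) c = (\<lambda>x. \<Sum>i=0..k + Suc p. c (Suc i) * bs k (Suc (Suc p)) (Suc i) x)"
    unfolding sp_def by (rule ext, subst sum.shift_bounds_cl_Suc_ivl[symmetric]) simp
  have "(sp k (Suc (Suc p)) c has_real_derivative
     (\<Sum>i=0..k + Suc p. c (Suc i) * (real (Suc p) * (?D i - ?D (Suc i))))) (at x)"
    unfolding eq by (intro DERIV_sum DERIV_cmult bs_deriv assms)
  moreover have "(\<Sum>i=0..k + Suc p. c (Suc i) * (real (Suc p) * (?D i - ?D (Suc i)))) =
     real (Suc p) * ((\<Sum>i=0..k + Suc p. c (Suc i) * ?D i) - (\<Sum>i=0..k + Suc p. c (Suc i) * ?D (Suc i)))"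
    unfolding sum_subtractf[symmetric] sum_distrib_left by (intro sum.cong) (auto simp: algebra_simps)
  moreover have "(\<Sum>i=0..k + Suc p. c (Suc i) * ?D i) = (\<Sum>i=1..k + Suc p. c (Suc i) * ?D i)"
    by (subst sum.atLeast_Suc_atMost) (auto simp: bs_outside)
  moreover have "(\<Sum>i=0..k + Suc p. c (Suc i) * ?D (Suc i)) = (\<Sum>i=1..k + Suc p. c i * ?D i)"
  proof -
    have "(\<Sum>i=0..k + Suc p. c (Suc i) * ?D (Suc i)) = (\<Sum>i=Suc 0..Suc (k + Suc p). c i * ?D i)"
      by (rule sum.shift_bounds_cl_Suc_ivl[symmetric])
    also have "\<dots> = (\<Sum>i=1..k + Suc p. c i * ?D i)"
      by (subst sum.cl_ivl_Suc) (simp add: bs_outside)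
    finally show ?thesis .
  qed
  moreover have "real (Suc p) * ((\<Sum>i=1..k + Suc p. c (Suc i) * ?D i) - (\<Sum>i=1..k + Suc p. c i * ?D i)) =
     sp k (Suc p) (dc k (Suc p) c) x"
    unfolding sum_subtractf[symmetric] sum_distrib_left sp_def dc_def
    by (intro sum.cong) (auto simp: diff_divide_distrib algebra_simps)
  ultimately show ?thesis by simp
qed

lemma sp_continuous_extension:
  "\<exists>f. continuous_on UNIV f \<and> (\<forall>x\<in>{0..<1}. f x = sp k (Suc (Suc p)) c x)"
proof -
  obtain f where f: "\<And>i. continuous_on UNIV (f i)" "\<And>i x. x\<in>{0..<1} \<Longrightarrow> f i x = bs k (Suc (Suc p)) i x"
    using bs_continuous_extension[of k p] by metis
  show ?thesis
    by (intro exI[of _ "\<lambda>x. \<Sum>i=1..k + Suc (Suc p). c i * f i x"])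
       (use f in \<open>auto simp: sp_def intro!: continuous_intros\<close>)
qed

lemma sp_continuous: "continuous_on {0..<1} (sp k (Suc (Suc p)) c)"
proof -
  obtain f where "continuous_on UNIV f" "\<forall>x\<in>{0..<1}. f x = sp k (Suc (Suc p)) c x"
    using sp_continuous_extension by blast
  then show ?thesis by (metis continuous_on_cong continuous_on_subset subset_UNIV)
qed

lemma has_integral_deriv_bound:
  fixes F :: "real \<Rightarrow> real"
  assumes "finite S" "a \<le> b" "continuous_on {a..b} F"
    "\<And>x. x \<in> {a<..<b} - S \<Longrightarrow> (F has_real_derivative F' x) (at x)"
    "\<And>x. x \<in> {a<..<b} - S \<Longrightarrow> \<bar>F' x\<bar> \<le> M" "0 \<le> M"
  shows "\<bar>F b - F a\<bar> \<le> M * (b - a)"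
proof -
  define h where "h x = (if x \<in> {a<..<b} - S then F' x else 0)" for x
  have "(h has_integral F b - F a) {a..b}"
    by (rule fundamental_theorem_of_calculus_interior_strong[OF assms(1,2)])
       (use assms in \<open>auto simp: h_def has_real_derivative_iff_has_vector_derivative[symmetric]\<close>)
  from has_integral_bound[of M h "F b - F a" a b] this show ?thesis
    using assms by (auto simp: h_def cbox_interval)
qed

text \<open>The continuous extension serves as the absolutely continuous version; it is Lipschitz
  because off the knots its derivative is a bounded spline. The constant a stands for
  \<open>- psi\<close>, present at order 0 and gone after one differentiation.\<close>

lemma is_deriv_sp_Suc:
  assumes "is_deriv r g (\<lambda>x. a + sp k (Suc (Suc p)) c x)"
  shows "is_deriv (Suc r) g (sp k (Suc p) (dc k (Suc p) c))"
proof -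
  obtain f where f: "continuous_on UNIV f" "\<And>x. x\<in>{0..<1} \<Longrightarrow> f x = sp k (Suc (Suc p)) c x"
    using sp_continuous_extension by blast
  define M where "M = (\<Sum>i=1..k + Suc p. \<bar>dc k (Suc p) c i\<bar>)"
  have M: "\<bar>sp k (Suc p) (dc k (Suc p) c) x\<bar> \<le> M" if "x \<in> {0..<1}" for x
    unfolding M_def by (rule sp_bound[OF that]) (rule member_le_sum, auto)
  have der: "(f has_real_derivative sp k (Suc p) (dc k (Suc p) c) x) (at x)" if "x \<in> {0<..<1} - knots k" for x
    by (rule has_field_derivative_transform_within_open[OF sp_deriv, where S="{0<..<1}"]) (use that f in auto)
  show ?thesis
  proof (rule is_deriv_SucI[OF assms, where U="\<lambda>x. a + f x"])
    show "AE x in mu. a + sp k (Suc (Suc p)) c x = a + f x"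
      using AE_mu_open[OF finite.emptyI] by eventually_elim (use f in auto)
    show "abs_continuous_on01 (\<lambda>x. a + f x)"
    proof (rule lipschitz_abs_continuous_on01[where B=M])
      fix x y :: real assume xy: "0 \<le> x" "x < y" "y \<le> 1"
      have "\<bar>f y - f x\<bar> \<le> M * (y - x)"
        by (rule has_integral_deriv_bound[OF finite_knots[of k], where F'="sp k (Suc p) (dc k (Suc p) c)"])
           (use xy der M f(1) in \<open>auto intro: continuous_on_subset simp: M_def sum_nonneg\<close>)
      then show "\<bar>a + f y - (a + f x)\<bar> \<le> M * (y - x)" by simp
    qed
    show "AE x in mu. ((\<lambda>x. a + f x) has_real_derivative sp k (Suc p) (dc k (Suc p) c) x) (at x)"
      using AE_mu_open[OF finite_knots[of k]]
    proof eventually_elim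
      case (elim x)
      show ?case using DERIV_add[OF DERIV_const der[OF elim], of a] by simp
    qed
  qed
qed

text \<open>The coefficients of the r-th derivative of a spline of order q, as a spline of order
  \<open>q - r\<close>; up to factors they are divided differences of \<open>c\<close>.\<close>

fun dcs :: "nat \<Rightarrow> nat \<Rightarrow> (nat \<Rightarrow> real) \<Rightarrow> nat \<Rightarrow> nat \<Rightarrow> real" where
  "dcs k q c 0 = c"
| "dcs k q c (Suc r) = dc k (q - Suc r) (dcs k q c r)"

lemma is_deriv_sp:
  assumes "r < q" "AE x in mu. g x = a + sp k q c x"
  shows "is_deriv r g (\<lambda>x. (if r = 0 then a else 0) + sp k (q - r) (dcs k q c r) x)"
  using assms(1)
proof (induction r)
  case 0
  then show ?case using assms(2) by simp
next
  case (Suc r)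
  then obtain p where "q - r = Suc (Suc p)" "q - Suc r = Suc p" by (metis Suc_diff_Suc Suc_lessD)
  then show ?case using is_deriv_sp_Suc[of r g "if r = 0 then a else 0" k p "dcs k q c r"] Suc by simp
qed

lemma lin_eq_sp: "x \<in> {0..<1} \<Longrightarrow> lin (k, q, L) \<theta> x = sp k q \<theta> x"
  by (simp add: lin_def sp_def bs_def)

lemma deriv_norm_ln_dens_le_iff:
  assumes "r < q"
  shows "deriv_norm r (\<lambda>x. ln (dens (k, q, L) \<theta> x)) \<le> ereal B \<longleftrightarrow>
    (AE x in mu. \<bar>(if r = 0 then - psi (k, q, L) \<theta> else 0) + sp k (q - r) (dcs k q \<theta> r) x\<bar> \<le> B)"
proof (rule deriv_norm_le_iff)
  have "AE x in mu. ln (dens (k, q, L) \<theta> x) = - psi (k, q, L) \<theta> + sp k q \<theta> x"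
    using AE_mu_open[OF finite.emptyI] by eventually_elim (auto simp: dens_def lin_eq_sp)
  from is_deriv_sp[OF assms this]
  show "is_deriv r (\<lambda>x. ln (dens (k, q, L) \<theta> x)) (\<lambda>x. (if r = 0 then - psi (k, q, L) \<theta> else 0) + sp k (q - r) (dcs k q \<theta> r) x)" .
qed (intro measurable_mu_borel, measurable)

lemma dcs_shift: "dcs k (Suc q) c (Suc r) = dcs k q (dc k q c) r"
  by (induction r) auto

lemma dcs_cong:
  assumes "\<And>i. 1 \<le> i \<Longrightarrow> i \<le> k + q \<Longrightarrow> c i = d i" "1 \<le> i" "i \<le> k + q - r" "r \<le> q"
  shows "dcs k q c r i = dcs k q d r i"
  using assms(2-)
proof (induction r arbitrary: i)
  case (Suc r)
  then show ?case by (auto simp: dc_def)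
qed (use assms(1) in auto)

lemma dcs_diff:
  "dcs k q (\<lambda>i. c i - d i) r i = dcs k q c r i - dcs k q d r i"
proof (induction r arbitrary: i)
  case (Suc r)
  show ?case
    by (simp only: dcs.simps dc_def Suc.IH) (simp add: diff_divide_distrib add_divide_distrib algebra_simps)
qed auto

lemma dc_step:
  assumes "1 \<le> i" "i \<le> k + p" "1 \<le> p"
  shows "c (Suc i) = c i + gap k p i / real p * dc k p c i"
    and "0 \<le> gap k p i / real p" "gap k p i / real p \<le> 1 / (1 + real k)"
proof -
  have g: "0 < 1 / (1 + real k)" "1 / (1 + real k) \<le> gap k p i" "gap k p i \<le> real p / (1 + real k)"
    using gap_bounds[OF assms] by auto
  then have "gap k p i > 0" by linarith
  then show "c (Suc i) = c i + gap k p i / real p * dc k p c i" "0 \<le> gap k p i / real p"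
    using assms by (auto simp: dc_def)
  show "gap k p i / real p \<le> 1 / (1 + real k)"
    using g(3) assms by (simp add: divide_simps mult.commute)
qed

text \<open>The k + 1 values of the s-th derivative on the cells and the s derivatives at 0 are as
  many data as there are coefficients. They are realized by summing up coefficients once per order,
  with the prescribed derivative at 0 as the first coefficient.\<close>

lemma spline_with_derivatives:
  "\<exists>c. (\<forall>i. 1 \<le> i \<and> i \<le> k + 1 \<longrightarrow> dcs k (Suc s) c s i = v i) \<and> (\<forall>r<s. dcs k (Suc s) c r 1 = a r)"
proof (induction s arbitrary: a)
  case 0
  show ?case by (intro exI[of _ v]) auto
next
  case (Suc s)
  obtain c' where c': "\<And>i. 1 \<le> i \<Longrightarrow> i \<le> k + 1 \<Longrightarrow> dcs k (Suc s) c' s i = v i" "\<And>r. r < s \<Longrightarrow> dcs k (Suc s) c' r 1 = a (Suc r)"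
    using Suc.IH[of "\<lambda>r. a (Suc r)"] by auto
  define c where "c i = a 0 + (\<Sum>j\<in>{1..<i}. gap k (Suc s) j / real (Suc s) * c' j)" for i
  have dc: "dc k (Suc s) c i = c' i" if "1 \<le> i" "i \<le> k + Suc s" for i
  proof -
    have "0 < 1 / (1 + real k)" "1 / (1 + real k) \<le> gap k (Suc s) i"
      using gap_bounds[OF that] by auto
    then have "gap k (Suc s) i > 0" by linarith
    then show ?thesis using that by (simp add: dc_def c_def)
  qed
  have eq: "dcs k (Suc (Suc s)) c (Suc r) i = dcs k (Suc s) c' r i" if "1 \<le> i" "i \<le> k + Suc s - r" "r \<le> Suc s" for i r
    unfolding dcs_shift by (rule dcs_cong[OF dc that]) auto
  show ?case
  proof (intro exI[of _ c] conjI allI impI)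
    fix i assume "1 \<le> i \<and> i \<le> k + 1"
    then show "dcs k (Suc (Suc s)) c (Suc s) i = v i" using eq[of i s] c'(1) by auto
  next
    fix r assume "r < Suc s"
    then show "dcs k (Suc (Suc s)) c r 1 = a r"
      using eq[of 1 "r - 1"] c'(2)[of "r - 1"] by (cases r) (auto simp: c_def)
  qed
qed

text \<open>Passing from derivative r + 1 to derivative r adds up at most k + s coefficients with
  weights of at most 1 / (1 + k). Each order thus costs a factor of at most s + 2, whatever k
  is.\<close>

lemma dcs_bound:
  assumes top: "\<And>i. 1 \<le> i \<Longrightarrow> i \<le> k + 1 \<Longrightarrow> \<bar>dcs k (Suc s) c s i\<bar> \<le> D"
    and left: "\<And>r. r < s \<Longrightarrow> \<bar>dcs k (Suc s) c r 1\<bar> \<le> D"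
    and "r \<le> s" "1 \<le> i" "i \<le> k + Suc s - r"
  shows "\<bar>dcs k (Suc s) c r i\<bar> \<le> (real s + 2) ^ s * D"
proof -
  have D: "0 \<le> D" using top[of 1] by auto
  have "\<bar>dcs k (Suc s) c r i\<bar> \<le> (real s + 2) ^ (s - r) * D" if "r \<le> s" "1 \<le> i" "i \<le> k + Suc s - r" for i r
    using that
  proof (induction r arbitrary: i rule: inc_induct)
    case base
    then show ?case using top by auto
  next
    case (step r)
    define p where "p = s - r"
    have p: "1 \<le> p" "Suc s - Suc r = p" "s - r = Suc (s - Suc r)" using step.hyps by (auto simp: p_def)
    define E where "E = (real s + 2) ^ (s - Suc r) * D"
    have E: "0 \<le> E" "D \<le> E" using D mult_right_mono[OF one_le_power[of "real s + 2" "s - Suc r"] D] by (auto simp: E_def)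
    have c': "\<bar>dc k p (dcs k (Suc s) c r) i\<bar> \<le> E" if "1 \<le> i" "i \<le> k + p" for i
      using step.IH[of i] that p step.hyps by (auto simp: E_def)
    have "\<bar>dcs k (Suc s) c r i\<bar> \<le> D + real (i - 1) * (E / (1 + real k))" if "1 \<le> i" "i \<le> k + Suc p" for i
      using that
    proof (induction i rule: nat_induct_at_least)
      case base
      then show ?case using left[of r] step.hyps by auto
    next
      case (Suc i)
      let ?g = "gap k p i / real p"
      have i: "1 \<le> i" "i \<le> k + p" using Suc by auto
      have "\<bar>?g * dc k p (dcs k (Suc s) c r) i\<bar> \<le> 1 / (1 + real k) * E"
        unfolding abs_mult[of ?g] using dc_step(2,3)[OF i p(1)] c'[OF i] by (intro mult_mono) auto
      then have "\<bar>?g * dc k p (dcs k (Suc s) c r) i\<bar> \<le> E / (1 + real k)" by simp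
      then have "\<bar>dcs k (Suc s) c r (Suc i)\<bar> \<le> \<bar>dcs k (Suc s) c r i\<bar> + E / (1 + real k)"
        unfolding dc_step(1)[OF i p(1), of "dcs k (Suc s) c r"] by linarith
      also have "\<dots> \<le> D + real (i - 1) * (E / (1 + real k)) + E / (1 + real k)"
        using Suc by simp
      also have "\<dots> = D + (real (i - 1) + 1) * (E / (1 + real k))"
        unfolding distrib_right by simp
      also have "\<dots> = D + real (Suc i - 1) * (E / (1 + real k))"
        using i(1) by (cases i) auto
      finally show ?case .
    qed
    then have "\<bar>dcs k (Suc s) c r i\<bar> \<le> D + real (i - 1) * (E / (1 + real k))"
      using step.prems p by (auto simp: p_def)
    also have "\<dots> \<le> E + (real s + 1) * E"
    proof -
      have "real (i - 1) \<le> (real s + 1) * (1 + real k)"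
      proof -
        have "i - 1 \<le> (s + 1) * (1 + k)" using step.prems by auto
        then have "real (i - 1) \<le> real ((s + 1) * (1 + k))" by (simp only: of_nat_le_iff)
        then show ?thesis by (simp only: of_nat_mult of_nat_add of_nat_1)
      qed
      then have "real (i - 1) * (E / (1 + real k)) \<le> (real s + 1) * (1 + real k) * (E / (1 + real k))"
        using E by (intro mult_right_mono) auto
      also have "\<dots> = (real s + 1) * E" by simp
      finally show ?thesis using E by linarith
    qed
    also have "\<dots> = (real s + 2) ^ (s - r) * D" unfolding p(3) E_def by (simp add: algebra_simps)
    finally show ?case .
  qed
  from this[OF assms(3-5)] have "\<bar>dcs k (Suc s) c r i\<bar> \<le> (real s + 2) ^ (s - r) * D" .
  also have "\<dots> \<le> (real s + 2) ^ s * D"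
    using D by (intro mult_right_mono power_increasing) auto
  finally show ?thesis .
qed

section \<open>Spline approximation\<close>

text \<open>\<open>a i\<close> pairs the coefficient vector of the i-th Lagrange polynomial for the
  nodes 0, ..., s with the data. Expanding each monomial in the Lagrange basis shows that this
  solves the Vandermonde system, with a constant that depends on s only.\<close>

lemma interpolating_moments:
  fixes s :: nat
  shows "\<exists>C\<ge>0. \<forall>(T :: nat \<Rightarrow> real) M. (\<forall>e\<le>s. \<bar>T e\<bar> \<le> M) \<longrightarrow>
    (\<exists>a. (\<forall>i\<le>s. \<bar>a i\<bar> \<le> C * M) \<and> (\<forall>e\<le>s. (\<Sum>i\<le>s. a i * real i ^ e) = T e))"
proof -
  define l :: "nat \<Rightarrow> real poly" where
    "l i = (\<Prod>j\<in>{..s} - {i}. [: - real j / (real i - real j), 1 / (real i - real j) :])" for i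
  have deg: "degree (l i) \<le> s" if "i \<le> s" for i
  proof -
    have "degree (l i) \<le> (\<Sum>j\<in>{..s} - {i}. degree [: - real j / (real i - real j), 1 / (real i - real j) :])"
      unfolding l_def using degree_prod_sum_le[of "{..s} - {i}" "\<lambda>j. [: - real j / (real i - real j), 1 / (real i - real j) :]"]
      by (simp only: comp_def) auto
    also have "\<dots> \<le> (\<Sum>j\<in>{..s} - {i}. 1)" by (intro sum_mono) (simp add: degree_pCons_le)
    also have "\<dots> = s" using that by simp
    finally show ?thesis .
  qed
  have at: "poly (l i) (real j) = (if i = j then 1 else 0)" if "i \<le> s" "j \<le> s" for i j
  proof (cases "i = j")
    case True
    have "- real m / (real i - real m) + real i * (1 / (real i - real m)) = 1" if "m \<noteq> i" for m
      using that by (simp add: divide_simps)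
    then show ?thesis unfolding l_def poly_prod True by (intro trans[OF prod.neutral]) (auto simp: True)
  next
    case False
    then show ?thesis using that unfolding l_def poly_prod
      by (auto intro!: bexI[of _ j] simp: divide_simps)
  qed
  have monom: "monom 1 e = (\<Sum>i\<le>s. smult (real i ^ e) (l i))" if "e \<le> s" for e
  proof (rule poly_eqI_degree[where A="real ` {..s}"])
    show "card (real ` {..s}) > degree (monom (1::real) e)"
      using that by (simp add: card_image inj_on_def degree_monom_eq)
    have "degree (\<Sum>i\<le>s. smult (real i ^ e) (l i)) \<le> s"
      by (intro degree_sum_le) (auto intro: order_trans[OF degree_smult_le] deg)
    then show "card (real ` {..s}) > degree (\<Sum>i\<le>s. smult (real i ^ e) (l i))"
      by (simp add: card_image inj_on_def)
    fix x assume "x \<in> real ` {..s}"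
    then obtain j where j: "j \<le> s" "x = real j" by auto
    have "poly (\<Sum>i\<le>s. smult (real i ^ e) (l i)) x = (\<Sum>i\<le>s. if i = j then real j ^ e else 0)"
      unfolding poly_sum j(2) by (intro sum.cong) (use at j in auto)
    then show "poly (monom 1 e) x = poly (\<Sum>i\<le>s. smult (real i ^ e) (l i)) x"
      using j by (simp add: poly_monom)
  qed
  define C where "C = (\<Sum>i\<le>s. \<Sum>e\<le>s. \<bar>coeff (l i) e\<bar>)"
  show ?thesis
  proof (intro exI[of _ C] conjI allI impI)
    show "0 \<le> C" by (auto simp: C_def intro!: sum_nonneg)
    fix T :: "nat \<Rightarrow> real" and M assume T: "\<forall>e\<le>s. \<bar>T e\<bar> \<le> M"
    define a where "a i = (\<Sum>e\<le>s. coeff (l i) e * T e)" for i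
    show "\<exists>a. (\<forall>i\<le>s. \<bar>a i\<bar> \<le> C * M) \<and> (\<forall>e\<le>s. (\<Sum>i\<le>s. a i * real i ^ e) = T e)"
    proof (intro exI[of _ a] conjI allI impI)
      fix i assume i: "i \<le> s"
      have "0 \<le> M" using T by (metis abs_ge_zero order_trans zero_le)
      have "\<bar>a i\<bar> \<le> (\<Sum>e\<le>s. \<bar>coeff (l i) e\<bar> * M)"
        unfolding a_def using T by (intro order_trans[OF sum_abs] sum_mono) (auto simp: abs_mult intro!: mult_left_mono)
      also have "\<dots> = (\<Sum>e\<le>s. \<bar>coeff (l i) e\<bar>) * M" by (simp add: sum_distrib_right)
      also have "\<dots> \<le> C * M"
        unfolding C_def using i \<open>0 \<le> M\<close>
        by (intro mult_right_mono member_le_sum[where f="\<lambda>i. \<Sum>e\<le>s. \<bar>coeff (l i) e\<bar>"]) (auto intro: sum_nonneg)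
      finally show "\<bar>a i\<bar> \<le> C * M" .
    next
      fix e assume e: "e \<le> s"
      have "(\<Sum>i\<le>s. a i * real i ^ e) = (\<Sum>i\<le>s. \<Sum>e'\<le>s. real i ^ e * coeff (l i) e' * T e')"
        unfolding a_def sum_distrib_right by (intro sum.cong refl) (simp add: mult_ac)
      also have "\<dots> = (\<Sum>e'\<le>s. coeff (\<Sum>i\<le>s. smult (real i ^ e) (l i)) e' * T e')"
        by (subst sum.swap) (simp add: coeff_sum sum_distrib_right)
      also have "\<dots> = (\<Sum>e'\<le>s. if e' = e then T e else 0)"
        unfolding monom[OF e, symmetric] by (intro sum.cong) auto
      finally show "(\<Sum>i\<le>s. a i * real i ^ e) = T e" using e by simp
    qed
  qed
qed

text \<open>Node weights become step values by summation by parts: \<open>v\<close> collects the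
  tail sums of \<open>a\<close>, in reversed order. In the application \<open>v l\<close> is the
  s-th derivative on cell l of a block, and the bracket is proportional to the effect of that cell
  on the Taylor remainder of order e at the right end of the block.\<close>

lemma step_moments:
  fixes s :: nat
  shows "\<exists>C\<ge>0. \<forall>(T :: nat \<Rightarrow> real) M. 0 \<le> M \<longrightarrow> (\<forall>e\<in>{1..s}. \<bar>T e\<bar> \<le> M) \<longrightarrow>
    (\<exists>v. (\<forall>l<s. \<bar>v l\<bar> \<le> C * M) \<and>
       (\<forall>e\<in>{1..s}. (\<Sum>l<s. v l * (real (s - l) ^ e - real (s - Suc l) ^ e)) = T e))"
proof -
  obtain C where C: "C \<ge> 0" "\<And>(T :: nat \<Rightarrow> real) M. (\<forall>e\<le>s. \<bar>T e\<bar> \<le> M) \<Longrightarrow>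
    (\<exists>a. (\<forall>i\<le>s. \<bar>a i\<bar> \<le> C * M) \<and> (\<forall>e\<le>s. (\<Sum>i\<le>s. a i * real i ^ e) = T e))"
    using interpolating_moments[of s] by blast
  show ?thesis
  proof (intro exI[of _ "real (s + 1) * C"] conjI allI impI)
    show "0 \<le> real (s + 1) * C" using C(1) by simp
    fix T :: "nat \<Rightarrow> real" and M assume M: "0 \<le> M" and T: "\<forall>e\<in>{1..s}. \<bar>T e\<bar> \<le> M"
    \<comment> \<open>Only moments of positive order are prescribed; the moment of order 0 is set to
      0 so that the bound \<open>M\<close> persists.\<close>
    have "\<forall>e\<le>s. \<bar>(if e = 0 then 0 else T e)\<bar> \<le> M" using T M by auto
    from C(2)[OF this] obtain a where a: "\<And>i. i \<le> s \<Longrightarrow> \<bar>a i\<bar> \<le> C * M"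
      "\<And>e. e \<le> s \<Longrightarrow> (\<Sum>i\<le>s. a i * real i ^ e) = (if e = 0 then 0 else T e)" by blast
    define v where "v j = (\<Sum>i\<in>{Suc j..s}. a i)" for j
    show "\<exists>v. (\<forall>l<s. \<bar>v l\<bar> \<le> real (s + 1) * C * M) \<and>
       (\<forall>e\<in>{1..s}. (\<Sum>l<s. v l * (real (s - l) ^ e - real (s - Suc l) ^ e)) = T e)"
    proof (intro exI[of _ "\<lambda>l. v (s - Suc l)"] conjI allI impI ballI)
      fix l
      have "\<bar>v (s - Suc l)\<bar> \<le> (\<Sum>i\<in>{Suc (s - Suc l)..s}. C * M)"
        unfolding v_def using a(1) by (intro order_trans[OF sum_abs] sum_mono) auto
      also have "\<dots> \<le> real (s + 1) * (C * M)"
        using C(1) M by (auto intro!: mult_right_mono)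
      finally show "\<bar>v (s - Suc l)\<bar> \<le> real (s + 1) * C * M" by simp
    next
      fix e assume e: "e \<in> {1..s}"
      have "(\<Sum>l<s. v (s - Suc l) * (real (s - l) ^ e - real (s - Suc l) ^ e)) =
        (\<Sum>l<s. v (s - Suc l) * (real (Suc (s - Suc l)) ^ e - real (s - Suc l) ^ e))"
        by (intro sum.cong) (auto simp: Suc_diff_Suc)
      also have "\<dots> = (\<Sum>j<s. v j * (real (Suc j) ^ e - real j ^ e))"
        by (rule sum.nat_diff_reindex)
      also have "\<dots> = (\<Sum>j<s. \<Sum>i\<le>s. if j < i then a i * (real (Suc j) ^ e - real j ^ e) else 0)"
      proof (intro sum.cong refl)
        fix j assume "j \<in> {..<s}"
        have "(\<Sum>i\<le>s. if j < i then a i * (real (Suc j) ^ e - real j ^ e) else 0) =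
          (\<Sum>i\<in>{Suc j..s}. a i * (real (Suc j) ^ e - real j ^ e))"
          by (rule sum.mono_neutral_cong_right) auto
        then show "v j * (real (Suc j) ^ e - real j ^ e) = (\<Sum>i\<le>s. if j < i then a i * (real (Suc j) ^ e - real j ^ e) else 0)"
          by (simp add: v_def sum_distrib_right)
      qed
      also have "\<dots> = (\<Sum>i\<le>s. \<Sum>j<s. if j < i then a i * (real (Suc j) ^ e - real j ^ e) else 0)"
        by (rule sum.swap)
      also have "\<dots> = (\<Sum>i\<le>s. a i * real i ^ e)"
      proof (intro sum.cong refl)
        fix i assume i: "i \<in> {..s}"
        have "(\<Sum>j<s. if j < i then a i * (real (Suc j) ^ e - real j ^ e) else 0) = (\<Sum>j<i. a i * (real (Suc j) ^ e - real j ^ e))"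
          by (rule sum.mono_neutral_cong_right) (use i in auto)
        also have "\<dots> = a i * (real i ^ e - real 0 ^ e)"
          unfolding sum_distrib_left[symmetric] by (subst sum_lessThan_telescope) simp
        finally show "(\<Sum>j<s. if j < i then a i * (real (Suc j) ^ e - real j ^ e) else 0) = a i * real i ^ e"
          using e by (simp add: power_0_left)
      qed
      finally show "(\<Sum>l<s. v (s - Suc l) * (real (s - l) ^ e - real (s - Suc l) ^ e)) = T e"
        using a(2)[of e] e by auto
    qed
  qed
qed

section \<open>Taylor expansion with a moving centre\<close>

lemma taylor_cancel:
  fixes c :: real
  shows "c * - (real (Suc m) * z) / fact (Suc m) = - (c * z / fact m)"
proof -
  have "c * - (a * z) / (a * f) = - (c * z / f)" if "a \<noteq> 0" for a f :: real using that by simp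
  then show ?thesis unfolding fact_Suc by simp
qed

text \<open>Differentiation is in the centre x, with the evaluation point y fixed, so all terms
  telescope except the last.\<close>

lemma DERIV_taylor_sum:
  assumes "\<And>i. i \<le> n \<Longrightarrow> (F i has_real_derivative F (Suc i) x) (at x)"
  shows "((\<lambda>x. \<Sum>e\<le>n. F e x * (y - x) ^ e / fact e) has_real_derivative F (Suc n) x * (y - x) ^ n / fact n) (at x)"
  using assms
proof (induction n)
  case 0
  then show ?case by simp
next
  case (Suc n)
  have d: "((\<lambda>x. (y - x) ^ Suc n) has_real_derivative - (real (Suc n) * (y - x) ^ n)) (at x)"
    by (rule DERIV_cong[OF DERIV_power[OF DERIV_diff[OF DERIV_const DERIV_ident]]]) simp
  have "((\<lambda>x. F (Suc n) x * (y - x) ^ Suc n / fact (Suc n)) has_real_derivative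
      (F (Suc n) x * - (real (Suc n) * (y - x) ^ n) + F (Suc (Suc n)) x * (y - x) ^ Suc n) / fact (Suc n)) (at x)"
    by (rule DERIV_cdivide, rule DERIV_mult'[OF Suc.prems d]) simp
  from DERIV_add[OF Suc.IH this] Suc.prems show ?case
    unfolding add_divide_distrib taylor_cancel by (simp del: fact_Suc power_Suc)
qed

lemma taylor_sum_at_end: "(\<Sum>e\<le>n. F e * ((0::real) ^ e) / fact e) = F 0"
  by (subst sum.remove[of _ 0]) (auto intro!: sum.neutral simp: power_0_left)

text \<open>The highest Taylor coefficient is frozen at \<open>x0\<close> while the centre moves
  from \<open>x0\<close> to \<open>x1\<close>. The derivative of this expression contains only the
  increment \<open>F n x - F n x0\<close>, to which the Lipschitz bound applies.\<close>

lemma taylor_lipschitz_bound: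
  fixes F :: "nat \<Rightarrow> real \<Rightarrow> real"
  assumes fin: "finite S" and xy: "x0 \<le> x1"
    and cont: "\<And>i. i \<le> n \<Longrightarrow> continuous_on {x0..x1} (F i)"
    and der: "\<And>i x. i < n \<Longrightarrow> x \<in> {x0<..<x1} - S \<Longrightarrow> (F i has_real_derivative F (Suc i) x) (at x)"
    and lip: "\<And>x. x \<in> {x0..x1} \<Longrightarrow> \<bar>F n x - F n x0\<bar> \<le> B * (x - x0)" and B: "0 \<le> B"
  shows "\<bar>F 0 x1 - (\<Sum>e\<le>n. F e x0 * (x1 - x0) ^ e / fact e)\<bar> \<le> B * (x1 - x0) ^ Suc n"
proof (cases n)
  case 0
  then show ?thesis using lip[of x1] xy by simp
next
  case (Suc m)
  define P where "P x = (\<Sum>e\<le>m. F e x * (x1 - x) ^ e / fact e) + F n x0 * (x1 - x) ^ n / fact n" for x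
  have P1: "P x1 = F 0 x1" using taylor_sum_at_end[of "\<lambda>e. F e x1" m] by (simp add: P_def Suc)
  have P0: "P x0 = (\<Sum>e\<le>n. F e x0 * (x1 - x0) ^ e / fact e)" by (simp add: P_def Suc)
  have "\<bar>P x1 - P x0\<bar> \<le> (B * (x1 - x0) ^ n) * (x1 - x0)"
  proof (rule has_integral_deriv_bound[OF fin xy, where F'="\<lambda>x. (F n x - F n x0) * (x1 - x) ^ m / fact m"])
    have "continuous_on {x0..x1} (F e)" if "e \<le> m" for e using cont that Suc by simp
    then show "continuous_on {x0..x1} P" unfolding P_def by (intro continuous_intros) auto
    show "0 \<le> B * (x1 - x0) ^ n" using B xy by simp
    fix x assume x: "x \<in> {x0<..<x1} - S"
    have 1: "((\<lambda>x. \<Sum>e\<le>m. F e x * (x1 - x) ^ e / fact e) has_real_derivative F n x * (x1 - x) ^ m / fact m) (at x)"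
      unfolding Suc by (rule DERIV_taylor_sum, rule der[OF _ x]) (simp add: Suc)
    have 2: "((\<lambda>x. (x1 - x) ^ n) has_real_derivative - (real n * (x1 - x) ^ m)) (at x)"
      by (rule DERIV_cong[OF DERIV_power[OF DERIV_diff[OF DERIV_const DERIV_ident]]]) (simp add: Suc)
    have "(P has_real_derivative F n x * (x1 - x) ^ m / fact m + F n x0 * - (real n * (x1 - x) ^ m) / fact n) (at x)"
      unfolding P_def by (intro DERIV_add 1 DERIV_cdivide DERIV_cmult 2)
    moreover have "F n x0 * - (real n * (x1 - x) ^ m) / fact n = - (F n x0 * (x1 - x) ^ m / fact m)"
      unfolding Suc by (rule taylor_cancel)
    ultimately show "(P has_real_derivative (F n x - F n x0) * (x1 - x) ^ m / fact m) (at x)"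
      unfolding left_diff_distrib diff_divide_distrib by (simp only: add_uminus_conv_diff)
    have "\<bar>(F n x - F n x0) * (x1 - x) ^ m / fact m\<bar> \<le> \<bar>F n x - F n x0\<bar> * \<bar>x1 - x\<bar> ^ m / 1"
      unfolding abs_divide abs_mult power_abs by (rule divide_left_mono) auto
    also have "\<dots> \<le> (B * (x1 - x0)) * (x1 - x0) ^ m"
    proof -
      have "\<bar>F n x - F n x0\<bar> \<le> B * (x1 - x0)"
      proof -
        have "B * (x - x0) \<le> B * (x1 - x0)" using x B by (intro mult_left_mono) auto
        moreover have "\<bar>F n x - F n x0\<bar> \<le> B * (x - x0)" using x by (intro lip) auto
        ultimately show ?thesis by linarith
      qed
      moreover have "\<bar>x1 - x\<bar> ^ m \<le> (x1 - x0) ^ m" using x by (intro power_mono) auto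
      moreover have "0 \<le> B * (x1 - x0)" using B xy by simp
      ultimately show ?thesis unfolding div_by_1 by (intro mult_mono) simp_all
    qed
    finally show "\<bar>(F n x - F n x0) * (x1 - x) ^ m / fact m\<bar> \<le> B * (x1 - x0) ^ n"
      unfolding Suc power_Suc mult.assoc .
  qed
  then show ?thesis unfolding P1 P0 by (simp only: power_Suc2 mult.assoc)
qed

text \<open>Moving the centre across a cell on which the derivative of order n + 1 is the constant v
  changes the Taylor polynomial at y by an explicit amount linear in v. Summed over a block, these
  changes are the left-hand sides of the moment problem.\<close>

lemma taylor_constant_top:
  fixes F :: "nat \<Rightarrow> real \<Rightarrow> real"
  assumes fin: "finite S" and xy: "x0 \<le> x1"
    and cont: "\<And>i. i \<le> n \<Longrightarrow> continuous_on {x0..x1} (F i)"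
    and der: "\<And>i x. i \<le> n \<Longrightarrow> x \<in> {x0<..<x1} - S \<Longrightarrow> (F i has_real_derivative F (Suc i) x) (at x)"
    and const: "\<And>x. x \<in> {x0<..<x1} - S \<Longrightarrow> F (Suc n) x = v"
  shows "(\<Sum>e\<le>n. F e x1 * (y - x1) ^ e / fact e) - (\<Sum>e\<le>n. F e x0 * (y - x0) ^ e / fact e)
    = v * ((y - x0) ^ Suc n - (y - x1) ^ Suc n) / fact (Suc n)"
proof -
  define P where "P x = (\<Sum>e\<le>n. F e x * (y - x) ^ e / fact e) + v * (y - x) ^ Suc n / fact (Suc n)" for x
  have "\<bar>P x1 - P x0\<bar> \<le> 0 * (x1 - x0)"
  proof (rule has_integral_deriv_bound[OF fin xy, where F'="\<lambda>x. 0"])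
    show "continuous_on {x0..x1} P" unfolding P_def using cont by (intro continuous_intros) auto
    fix x assume x: "x \<in> {x0<..<x1} - S"
    have 1: "((\<lambda>x. \<Sum>e\<le>n. F e x * (y - x) ^ e / fact e) has_real_derivative v * (y - x) ^ n / fact n) (at x)"
      using DERIV_taylor_sum[of n F x y, OF der[OF _ x]] unfolding const[OF x] .
    have 2: "((\<lambda>x. (y - x) ^ Suc n) has_real_derivative - (real (Suc n) * (y - x) ^ n)) (at x)"
      by (rule DERIV_cong[OF DERIV_power[OF DERIV_diff[OF DERIV_const DERIV_ident]]]) simp
    have "(P has_real_derivative v * (y - x) ^ n / fact n + v * - (real (Suc n) * (y - x) ^ n) / fact (Suc n)) (at x)"
      unfolding P_def by (intro DERIV_add 1 DERIV_cdivide DERIV_cmult 2)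
    moreover have "v * - (real (Suc n) * (y - x) ^ n) / fact (Suc n) = - (v * (y - x) ^ n / fact n)"
      by (rule taylor_cancel)
    ultimately show "(P has_real_derivative 0) (at x)" by (simp only: add.right_inverse)
    show "\<bar>0::real\<bar> \<le> 0" by simp
  qed simp
  then have P: "P x1 = P x0" by (simp only: mult_zero_left abs_le_zero_iff right_minus_eq)
  have algebra: "a - b = v * (q - r) / f" if "a + v * r / f = b + v * q / f" for a b q r f :: real
  proof -
    have "v * (q - r) / f = v * q / f - v * r / f" by (simp only: right_diff_distrib diff_divide_distrib)
    then show ?thesis using that by linarith
  qed
  show ?thesis by (rule algebra[OF P[unfolded P_def]])
qed

text \<open>Given agreement of all derivatives of order below s at the left end of a block, the s
  step values on the block are chosen to give agreement at its right end; this is a moment problem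
  whose data, measured in units of the mesh, are bounded uniformly in b. Inside a block the error
  then has s vanishing Taylor coefficients at the left end and a Lipschitz derivative of order s -
  1, hence size \<open>b^(-s)\<close>.\<close>

lemma spline_approximation:
  fixes G :: "nat \<Rightarrow> real \<Rightarrow> real" and s :: nat
  assumes s: "s \<ge> 1"
    and der: "\<And>i x. Suc i < s \<Longrightarrow> x \<in> {0..1} \<Longrightarrow> (G i has_real_derivative G (Suc i) x) (at x within {0..1})"
    and lip: "\<And>x y. 0 \<le> x \<Longrightarrow> x < y \<Longrightarrow> y \<le> 1 \<Longrightarrow> \<bar>G (s - 1) y - G (s - 1) x\<bar> \<le> B * (y - x)"
  shows "\<exists>K D. \<forall>b\<ge>1. \<exists>c.
    (\<forall>x\<in>{0..<1}. \<bar>sp (s * b - 1) (Suc s) c x - G 0 x\<bar> \<le> K / real b ^ s) \<and>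
    (\<forall>r i. r \<le> s \<longrightarrow> 1 \<le> i \<longrightarrow> i \<le> s * b - 1 + Suc s - r \<longrightarrow> \<bar>dcs (s * b - 1) (Suc s) c r i\<bar> \<le> D)"
proof -
  have B: "0 \<le> B" using lip[of 0 1] by auto
  have lip': "\<bar>G (s - 1) y - G (s - 1) x\<bar> \<le> B * (y - x)" if "0 \<le> x" "x \<le> y" "y \<le> 1" for x y
    using lip[of x y] that by (cases "x = y") auto
  have contG: "continuous_on {0..1} (G i)" if "i < s" for i
  proof (cases "Suc i < s")
    case True
    then show ?thesis using der DERIV_continuous_on by blast
  next
    case False
    then have i: "i = s - 1" using that by auto
    have "B-lipschitz_on {0..1} (G i)"
    proof (rule lipschitz_onI[OF _ B])
      fix x y :: real assume "x \<in> {0..1}" "y \<in> {0..1}"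
      then show "dist (G i x) (G i y) \<le> B * dist x y"
        using lip'[of x y] lip'[of y x] unfolding i by (cases "x \<le> y") (auto simp: dist_real_def abs_minus_commute)
    qed
    then show ?thesis by (rule lipschitz_on_continuous_on)
  qed
  have derG: "(G i has_real_derivative G (Suc i) x) (at x)" if "Suc i < s" "x \<in> {0<..<1}" for i x
    using der[OF that(1), of x] that(2) at_within_interior[of x "{0..1}"] by auto
  obtain C where C: "C \<ge> 0" "\<And>(T :: nat \<Rightarrow> real) M. 0 \<le> M \<Longrightarrow> (\<forall>e\<in>{1..s}. \<bar>T e\<bar> \<le> M) \<Longrightarrow>
    (\<exists>v. (\<forall>l<s. \<bar>v l\<bar> \<le> C * M) \<and>
       (\<forall>e\<in>{1..s}. (\<Sum>l<s. v l * (real (s - l) ^ e - real (s - Suc l) ^ e)) = T e))"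
    using step_moments[of s] by blast
  \<comment> \<open>Over a block of length s / N the Taylor remainder of order e is at most
    \<open>B * (s / N)^e\<close>; the rescaling in \<open>T\<close> multiplies it by
    \<open>fact e * N^e\<close>.\<close>
  define M where "M = fact s * real s ^ s * B"
  define V where "V = C * M"
  have M: "0 \<le> M" and V: "0 \<le> V" using B C(1) by (auto simp: M_def V_def)
  define D where "D = V + (\<Sum>r<s. \<bar>G r 0\<bar>)"
  show ?thesis
  proof (rule exI[of _ "V + B"], rule exI[of _ "(real s + 2) ^ s * D"], intro allI impI)
    fix b :: nat assume b: "b \<ge> 1"
    define k where "k = s * b - 1"
    define N where "N = 1 + real k"
    have sb: "s * b \<ge> 1" using s b by (metis mult_le_mono nat_mult_1)
    have N: "N = real s * real b" "N > 0"
    proof -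
      have "N = real (s * b)" using sb by (simp add: N_def k_def of_nat_diff del: of_nat_mult)
      then show "N = real s * real b" by simp
      show "N > 0" by (simp add: N_def)
    qed
    define X where "X \<beta> = real \<beta> / real b" for \<beta>
    have X: "0 \<le> X \<beta>" "X \<beta> < 1" "X (Suc \<beta>) \<le> 1" "X (Suc \<beta>) = X \<beta> + real s / N" "N * X \<beta> = real (s * \<beta>)" if "\<beta> < b" for \<beta>
      using that b s unfolding X_def N(1) by (auto simp: divide_simps)
    \<comment> \<open>The Taylor remainder of the derivative of order s - e over block \<beta>, in
      units of the mesh: what the step values of the block have to produce.\<close>
    define T where "T \<beta> e = fact e * N ^ e * (G (s - e) (X (Suc \<beta>)) - (\<Sum>i\<le>e - 1. G (s - e + i) (X \<beta>) * (X (Suc \<beta>) - X \<beta>) ^ i / fact i))" for \<beta> e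
    have T: "\<bar>T \<beta> e\<bar> \<le> M" if \<beta>: "\<beta> < b" and e: "e \<in> {1..s}" for \<beta> e
    proof -
      have w: "X (Suc \<beta>) - X \<beta> = real s / N" using X(4)[OF \<beta>] by simp
      have "\<bar>G (s - e + 0) (X (Suc \<beta>)) - (\<Sum>i\<le>e - 1. G (s - e + i) (X \<beta>) * (X (Suc \<beta>) - X \<beta>) ^ i / fact i)\<bar> \<le> B * (X (Suc \<beta>) - X \<beta>) ^ Suc (e - 1)"
      proof (rule taylor_lipschitz_bound[of "{}" _ _ _ "\<lambda>i. G (s - e + i)"])
        show "X \<beta> \<le> X (Suc \<beta>)" by (simp add: X_def divide_right_mono)
        show "continuous_on {X \<beta>..X (Suc \<beta>)} (G (s - e + i))" if "i \<le> e - 1" for i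
        proof (rule continuous_on_subset[OF contG])
          show "s - e + i < s" using that e by auto
        qed (use X[OF \<beta>] in auto)
        show "(G (s - e + i) has_real_derivative G (s - e + Suc i) x) (at x)" if "i < e - 1" "x \<in> {X \<beta><..<X (Suc \<beta>)} - {}" for i x
        proof -
          have "Suc (s - e + i) < s" using that e by auto
          moreover have "x \<in> {0<..<1}" using that X[OF \<beta>] by auto
          ultimately show ?thesis using derG[of "s - e + i" x] by simp
        qed
        show "\<bar>G (s - e + (e - 1)) x - G (s - e + (e - 1)) (X \<beta>)\<bar> \<le> B * (x - X \<beta>)" if "x \<in> {X \<beta>..X (Suc \<beta>)}" for x
        proof -
          have "s - e + (e - 1) = s - 1" using e by auto
          then show ?thesis using lip'[of "X \<beta>" x] that X[OF \<beta>] by auto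
        qed
      qed (use B in auto)
      moreover have "Suc (e - 1) = e" using e by simp
      ultimately have "\<bar>G (s - e) (X (Suc \<beta>)) - (\<Sum>i\<le>e - 1. G (s - e + i) (X \<beta>) * (X (Suc \<beta>) - X \<beta>) ^ i / fact i)\<bar> \<le> B * (real s / N) ^ e"
        unfolding w add_0_right by (simp only:)
      from mult_left_mono[OF this, of "fact e * N ^ e"]
      have "\<bar>T \<beta> e\<bar> \<le> fact e * N ^ e * (B * (real s / N) ^ e)"
        unfolding T_def abs_mult using N(2) by simp
      also have "\<dots> = fact e * (real s) ^ e * B"
        using N(2) by (simp add: power_divide)
      also have "\<dots> \<le> M"
        unfolding M_def using s e B by (intro mult_right_mono mult_mono power_increasing fact_mono) auto
      finally show ?thesis .
    qed
    have "\<exists>v. (\<forall>l<s. \<bar>v l\<bar> \<le> V) \<and>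
       (\<forall>e\<in>{1..s}. (\<Sum>l<s. v l * (real (s - l) ^ e - real (s - Suc l) ^ e)) = T \<beta> e)" if "\<beta> < b" for \<beta>
      unfolding V_def by (rule C(2)[OF M]) (use T[OF that] in blast)
    then have "\<forall>\<beta>. \<exists>v. \<beta> < b \<longrightarrow> (\<forall>l<s. \<bar>v l\<bar> \<le> V) \<and>
       (\<forall>e\<in>{1..s}. (\<Sum>l<s. v l * (real (s - l) ^ e - real (s - Suc l) ^ e)) = T \<beta> e)"
      by blast
    from choice[OF this] obtain v where v: "\<And>\<beta> l. \<beta> < b \<Longrightarrow> l < s \<Longrightarrow> \<bar>v \<beta> l\<bar> \<le> V"
      "\<And>\<beta> e. \<beta> < b \<Longrightarrow> e \<in> {1..s} \<Longrightarrow> (\<Sum>l<s. v \<beta> l * (real (s - l) ^ e - real (s - Suc l) ^ e)) = T \<beta> e"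
      by blast
    \<comment> \<open>Coefficient i of the s-th derivative is its value on cell i, which is cell
      \<open>(i - 1) mod s\<close> of block \<open>(i - 1) div s\<close>, both counted from
      0.\<close>
    obtain c where c: "\<And>i. 1 \<le> i \<Longrightarrow> i \<le> k + 1 \<Longrightarrow> dcs k (Suc s) c s i = v ((i - 1) div s) ((i - 1) mod s)"
      "\<And>r. r < s \<Longrightarrow> dcs k (Suc s) c r 1 = G r 0"
      using spline_with_derivatives[of k s "\<lambda>i. v ((i - 1) div s) ((i - 1) mod s)" "\<lambda>r. G r 0"] by blast
    have top: "\<bar>dcs k (Suc s) c s i\<bar> \<le> V" if "1 \<le> i" "i \<le> k + 1" for i
    proof -
      have "(i - 1) div s < b"
        using that sb s unfolding k_def by (subst div_less_iff_less_mult) (auto simp: mult.commute)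
      then show ?thesis using c(1)[OF that] v(1) s by auto
    qed
    define I where "I r = sp k (Suc s - r) (dcs k (Suc s) c r)" for r
    have derI: "(I r has_real_derivative I (Suc r) x) (at x)" if "r < s" "x \<notin> knots k" for r x
    proof -
      have "Suc s - r = Suc (Suc (s - r - 1))" "Suc s - Suc r = Suc (s - r - 1)" using that(1) by auto
      then show ?thesis using sp_deriv[OF that(2), of "s - r - 1" "dcs k (Suc s) c r"] by (simp add: I_def)
    qed
    have contI: "continuous_on {0..<1} (I r)" if "r < s" for r
    proof -
      have "Suc s - r = Suc (Suc (s - r - 1))" using that by auto
      then show ?thesis using sp_continuous[of k "s - r - 1" "dcs k (Suc s) c r"] by (simp add: I_def)
    qed
    have topI: "I s x = v \<beta> l" if "\<beta> < b" "l < s" "X \<beta> + real l / N \<le> x" "x < X \<beta> + real (Suc l) / N" for \<beta> l x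
    proof -
      have "s * \<beta> + s \<le> s * b" using that(1) by (metis Suc_leI mult_Suc_right mult_le_mono2 add.commute)
      then have i: "s * \<beta> + l + 1 \<le> k + 1" using that(2) sb by (simp add: k_def)
      have "N * X \<beta> + real l \<le> N * x" "N * x < N * X \<beta> + real (Suc l)"
        using that(3,4) N(2) by (auto simp: field_simps)
      then have "I s x = dcs k (Suc s) c s (s * \<beta> + l + 1)"
        unfolding I_def X(5)[OF that(1)] using i
        by (simp, intro sp_1) (auto simp: N_def)
      also have "\<dots> = v \<beta> l" using c(1)[OF _ i] that(2) by simp
      finally show ?thesis .
    qed
    have "\<bar>I s x\<bar> \<le> V" if "x \<in> {0..<1}" for x
      using sp_bound[OF that, of k 0 "dcs k (Suc s) c s" V] top by (auto simp: I_def)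
    note topI_bound = this
    \<comment> \<open>Induction over the blocks. Agreement at the left end identifies the Taylor
      polynomials of spline and target there, so the step values only have to supply the
      remainder.\<close>
    have match: "\<forall>r<s. I r (X \<beta>) = G r (X \<beta>)" if "\<beta> < b" for \<beta>
      using that
    proof (induction \<beta>)
      case 0
      have "I r 0 = G r 0" if "r < s" for r
        using sp_at_0[of k "s - r" "dcs k (Suc s) c r"] c(2)[OF that] that by (simp add: I_def Suc_diff_le)
      then show ?case by (simp add: X_def)
    next
      case (Suc \<beta>)
      then have \<beta>: "\<beta> < b" by simp
      show ?case
      proof (intro allI impI)
        fix r assume r: "r < s"
        define n where "n = s - r - 1"
        have n: "Suc n = s - r" "s - Suc n = r" using r by (auto simp: n_def)
        define Y where "Y l = X \<beta> + real l / N" for l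
        have Ys: "Y s = X (Suc \<beta>)" "Y 0 = X \<beta>" using X(4)[OF \<beta>] by (auto simp: Y_def)
        have Ymono: "Y l \<le> Y l'" if "l \<le> l'" for l l' using that N(2) by (auto simp: Y_def divide_right_mono)
        have Y: "0 \<le> Y l" "Y l < 1" if "l \<le> s" for l
        proof -
          show "0 \<le> Y l" using X(1)[OF \<beta>] N(2) by (auto simp: Y_def)
          have "Y l \<le> X (Suc \<beta>)" using Ymono[OF that] Ys by simp
          then show "Y l < 1" using X(2)[OF Suc.prems] by simp
        qed
        \<comment> \<open>The Taylor polynomial of the r-th derivative of the spline, centred at
          \<open>Y l\<close> and evaluated at the right end of the block. As l runs from 0 to s it
          turns from an extrapolation into the actual value.\<close>
        define P where "P l = (\<Sum>e\<le>n. I (r + e) (Y l) * (Y s - Y l) ^ e / fact e)" for l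
        have step: "P (Suc l) - P l = v \<beta> l * ((Y s - Y l) ^ Suc n - (Y s - Y (Suc l)) ^ Suc n) / fact (Suc n)" if "l < s" for l
          unfolding P_def
        proof (rule taylor_constant_top[OF finite_knots[of k], where F="\<lambda>e. I (r + e)"])
          show "Y l \<le> Y (Suc l)" by (rule Ymono) simp
          show "continuous_on {Y l..Y (Suc l)} (I (r + i))" if "i \<le> n" for i
          proof (rule continuous_on_subset[OF contI])
            show "r + i < s" using that n r by auto
          qed (use Y[of l] Y[of "Suc l"] \<open>l < s\<close> in auto)
          show "(I (r + i) has_real_derivative I (r + Suc i) x) (at x)" if "i \<le> n" "x \<in> {Y l<..<Y (Suc l)} - knots k" for i x
            using derI[of "r + i" x] that n r by auto
          show "I (r + Suc n) x = v \<beta> l" if "x \<in> {Y l<..<Y (Suc l)} - knots k" for x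
            using topI[OF \<beta> \<open>l < s\<close>, of x] that n r by (auto simp: Y_def)
        qed
        have diff: "Y s - Y l = real (s - l) / N" if "l \<le> s" for l
          using that by (simp add: Y_def diff_divide_distrib of_nat_diff)
        have "P s - P 0 = (\<Sum>l<s. P (Suc l) - P l)" by (rule sum_lessThan_telescope[symmetric])
        also have "\<dots> = (\<Sum>l<s. v \<beta> l * (real (s - l) ^ Suc n - real (s - Suc l) ^ Suc n) / (N ^ Suc n * fact (Suc n)))"
          by (intro sum.cong refl) (simp add: step diff power_divide diff_divide_distrib[symmetric] del: power_Suc fact_Suc)
        also have "\<dots> = T \<beta> (Suc n) / (N ^ Suc n * fact (Suc n))"
          unfolding sum_divide_distrib[symmetric] using v(2)[OF \<beta>, of "Suc n"] n by (simp del: power_Suc fact_Suc)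
        also have "\<dots> = G r (X (Suc \<beta>)) - (\<Sum>i\<le>n. G (r + i) (X \<beta>) * (X (Suc \<beta>) - X \<beta>) ^ i / fact i)"
          using N(2) unfolding T_def n(2) by (simp del: power_Suc fact_Suc)
        also have "(\<Sum>i\<le>n. G (r + i) (X \<beta>) * (X (Suc \<beta>) - X \<beta>) ^ i / fact i) = P 0"
          unfolding P_def Ys by (intro sum.cong refl) (use Suc.IH[OF \<beta>] n r in auto)
        finally have "P s = G r (X (Suc \<beta>))" by simp
        moreover have "P s = I r (X (Suc \<beta>))"
          unfolding P_def using taylor_sum_at_end[of "\<lambda>e. I (r + e) (Y s)" n] Ys by simp
        ultimately show "I r (X (Suc \<beta>)) = G r (X (Suc \<beta>))" by simp
      qed
    qed
    have approx: "\<bar>I 0 x - G 0 x\<bar> \<le> (V + B) / real b ^ s" if x: "x \<in> {0..<1}" for x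
    proof -
      define \<beta> where "\<beta> = nat \<lfloor>real b * x\<rfloor>"
      have bx: "0 \<le> real b * x" "real b * x < real b" using x b by auto
      have \<beta>: "\<beta> < b" using bx unfolding \<beta>_def by (simp add: nat_less_iff floor_less_iff del: mult_less_cancel_left2)
      have \<beta>': "real \<beta> \<le> real b * x" "real b * x < real \<beta> + 1" using bx unfolding \<beta>_def by auto
      have X0: "X \<beta> \<le> x" "x - X \<beta> \<le> 1 / real b"
      proof -
        have "real \<beta> / real b \<le> x" "x \<le> (real \<beta> + 1) / real b"
          using \<beta>' b by (auto simp: pos_divide_le_eq pos_le_divide_eq mult.commute)
        then show "X \<beta> \<le> x" "x - X \<beta> \<le> 1 / real b" by (auto simp: X_def add_divide_distrib)
      qed
      obtain n where n: "s = Suc n" using s by (cases s) auto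
      have "\<bar>(I 0 x - G 0 x) - (\<Sum>e\<le>n. (I e (X \<beta>) - G e (X \<beta>)) * (x - X \<beta>) ^ e / fact e)\<bar> \<le> (V + B) * (x - X \<beta>) ^ Suc n"
      proof (rule taylor_lipschitz_bound[OF finite_knots[of k] X0(1), where F="\<lambda>i x. I i x - G i x"])
        show "continuous_on {X \<beta>..x} (\<lambda>x. I i x - G i x)" if "i \<le> n" for i
          using contI[of i] contG[of i] that n X[OF \<beta>] x
          by (intro continuous_intros) (auto elim!: continuous_on_subset)
        show "((\<lambda>x. I i x - G i x) has_real_derivative I (Suc i) y - G (Suc i) y) (at y)" if "i < n" "y \<in> {X \<beta><..<x} - knots k" for i y
          using that n X[OF \<beta>] x by (intro DERIV_diff derI derG) auto
        show "\<bar>I n y - G n y - (I n (X \<beta>) - G n (X \<beta>))\<bar> \<le> (V + B) * (y - X \<beta>)" if y: "y \<in> {X \<beta>..x}" for y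
        proof -
          have "\<bar>I n y - I n (X \<beta>)\<bar> \<le> V * (y - X \<beta>)"
          proof (rule has_integral_deriv_bound[OF finite_knots[of k], where F'="I s"])
            show "continuous_on {X \<beta>..y} (I n)"
              using contI[of n] n X[OF \<beta>] x y by (auto elim!: continuous_on_subset)
            show "(I n has_real_derivative I s z) (at z)" if "z \<in> {X \<beta><..<y} - knots k" for z
              using derI[of n z] that n by auto
            show "\<bar>I s z\<bar> \<le> V" if "z \<in> {X \<beta><..<y} - knots k" for z
              using topI_bound[of z] that x y X[OF \<beta>] by auto
          qed (use y V in auto)
          moreover have "\<bar>G n y - G n (X \<beta>)\<bar> \<le> B * (y - X \<beta>)"
            using lip'[of "X \<beta>" y] X[OF \<beta>] x y n by auto
          ultimately show ?thesis unfolding distrib_right by linarith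
        qed
      qed (use V B in auto)
      moreover have "(\<Sum>e\<le>n. (I e (X \<beta>) - G e (X \<beta>)) * (x - X \<beta>) ^ e / fact e) = 0"
        using match[OF \<beta>] n by (intro sum.neutral) auto
      moreover have "(V + B) * (x - X \<beta>) ^ Suc n \<le> (V + B) * (1 / real b) ^ Suc n"
        using X0 V B by (intro mult_left_mono power_mono) auto
      moreover have "(V + B) * (1 / real b) ^ Suc n = (V + B) / real b ^ s"
        unfolding n by (simp add: power_divide)
      ultimately show ?thesis by linarith
    qed
    have D: "\<bar>dcs k (Suc s) c r i\<bar> \<le> (real s + 2) ^ s * D" if "r \<le> s" "1 \<le> i" "i \<le> k + Suc s - r" for r i
    proof (rule dcs_bound[OF _ _ that])
      show "\<bar>dcs k (Suc s) c s i\<bar> \<le> D" if "1 \<le> i" "i \<le> k + 1" for i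
        using top[OF that] by (auto simp: D_def intro!: order_trans[OF _ le_add_same_cancel1[THEN iffD2]] sum_nonneg)
      show "\<bar>dcs k (Suc s) c r 1\<bar> \<le> D" if "r < s" for r
      proof -
        have "\<bar>G r 0\<bar> \<le> (\<Sum>r<s. \<bar>G r 0\<bar>)" by (rule member_le_sum) (use that in auto)
        then show ?thesis using V c(2)[OF that] by (simp add: D_def)
      qed
    qed
    show "\<exists>c. (\<forall>x\<in>{0..<1}. \<bar>sp (s * b - 1) (Suc s) c x - G 0 x\<bar> \<le> (V + B) / real b ^ s) \<and>
      (\<forall>r i. r \<le> s \<longrightarrow> 1 \<le> i \<longrightarrow> i \<le> s * b - 1 + Suc s - r \<longrightarrow> \<bar>dcs (s * b - 1) (Suc s) c r i\<bar> \<le> (real s + 2) ^ s * D)"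
      using approx D unfolding I_def k_def[symmetric] by (intro exI[of _ c]) auto
  qed
qed

section \<open>Prior mass of the spline models\<close>

abbreviation coords :: "nat \<Rightarrow> (nat \<Rightarrow> real) measure" where
  "coords m \<equiv> \<Pi>\<^sub>M i\<in>{1..m}. lborel"

interpretation lborel_product: product_sigma_finite "\<lambda>_::nat. lborel :: real measure"
  by standard

section \<open>Log-spline densities and measurability of the parameter sets\<close>

lemma measurable_pair_mu:
  assumes "f \<in> borel_measurable (N \<Otimes>\<^sub>M borel)"
  shows "f \<in> borel_measurable (N \<Otimes>\<^sub>M mu)"
proof -
  have "snd \<in> N \<Otimes>\<^sub>M mu \<rightarrow>\<^sub>M borel"
    using measurable_compose[OF measurable_snd measurable_mu_borel[OF measurable_ident]] by simp
  then have "(\<lambda>z. (fst z, snd z)) \<in> N \<Otimes>\<^sub>M mu \<rightarrow>\<^sub>M N \<Otimes>\<^sub>M borel"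
    by (intro measurable_Pair) auto
  from measurable_compose[OF this assms] show ?thesis by simp
qed

lemma Bspline_measurable [measurable]: "Bspline j i \<in> borel_measurable borel"
proof (cases j)
  case (fields k q L)
  have "Bspline j i = (\<lambda>x. if x = 1 then Lim (at_left 1) (Nspline (knot k q) q i) else Nspline (knot k q) q i x)"
    unfolding fields by (rule ext) simp
  then show ?thesis by simp
qed

lemma lin_measurable_pair [measurable]:
  "(\<lambda>(\<theta>, x). lin j \<theta> x) \<in> borel_measurable (coords (num_basis j) \<Otimes>\<^sub>M borel)"
  unfolding lin_def case_prod_beta by measurable

lemma lin_measurable [measurable]: "lin j \<theta> \<in> borel_measurable borel"
  unfolding lin_def[abs_def] by measurable

lemma lin_bounded: "\<exists>M. \<forall>x\<in>{0..1}. \<bar>lin j \<theta> x\<bar> \<le> M"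
proof (cases j)
  case (fields k q L)
  show ?thesis
  proof (cases q)
    case 0
    have "\<bar>lin j \<theta> x\<bar> \<le> \<bar>lin j \<theta> 1\<bar>" if "x \<in> {0..1}" for x
    proof (cases "x = 1")
      case False
      then show ?thesis by (auto simp: lin_def fields 0)
    qed simp
    then show ?thesis by blast
  next
    case (Suc p)
    \<comment> \<open>The value at 1 is defined by a \<open>Lim\<close> and is simply added to the
      bound as a number.\<close>
    define M where "M = (\<Sum>i=1..k + Suc p. \<bar>\<theta> i\<bar>) + \<bar>lin j \<theta> 1\<bar>"
    have "\<bar>lin j \<theta> x\<bar> \<le> M" if "x \<in> {0..1}" for x
    proof (cases "x = 1")
      case True then show ?thesis by (auto simp: M_def intro: sum_nonneg)
    next
      case False
      then have x: "x \<in> {0..<1}" using that by auto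
      have "\<bar>sp k (Suc p) \<theta> x\<bar> \<le> (\<Sum>i=1..k + Suc p. \<bar>\<theta> i\<bar>)"
        by (rule sp_bound[OF x]) (rule member_le_sum, auto)
      then show ?thesis using lin_eq_sp[OF x, of k "Suc p" L \<theta>] by (simp add: M_def fields Suc del: sum.cl_ivl_Suc)
    qed
    then show ?thesis by blast
  qed
qed

lemma measure_mu_01 [simp]: "measure mu {0..1} = 1"
  using mu.prob_space by simp

lemma lin_measurable_mu [measurable]: "lin j \<theta> \<in> borel_measurable mu"
  by (rule measurable_mu_borel) measurable

lemma integrable_mu_bounded:
  fixes f :: "real \<Rightarrow> real"
  assumes "f \<in> borel_measurable mu" "AE x in mu. \<bar>f x\<bar> \<le> M"
  shows "integrable mu f"
  by (rule mu.integrable_const_bound[where B=M]) (use assms in auto)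

lemma integrable_exp_lin: "integrable mu (\<lambda>x. exp (lin j \<theta> x))"
proof -
  obtain M where M: "\<And>x. x \<in> {0..1} \<Longrightarrow> \<bar>lin j \<theta> x\<bar> \<le> M" using lin_bounded by blast
  show ?thesis
    by (rule integrable_mu_bounded[where M="exp M"]) (use M in \<open>force intro!: AE_I2\<close>)+
qed

lemma exp_bound_imp_psi_bound:
  assumes "AE x in mu. a \<le> lin j \<theta> x" "AE x in mu. lin j \<theta> x \<le> b"
  shows "a \<le> psi j \<theta>" "psi j \<theta> \<le> b"
proof -
  have "(\<integral>x. exp a \<partial>mu) \<le> (\<integral>x. exp (lin j \<theta> x) \<partial>mu)"
    by (rule integral_mono_AE) (use assms(1) in \<open>auto simp: integrable_exp_lin\<close>)
  then have 1: "exp a \<le> (\<integral>x. exp (lin j \<theta> x) \<partial>mu)" by (simp add: mu.prob_space)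
  then have pos: "0 < (\<integral>x. exp (lin j \<theta> x) \<partial>mu)" using exp_gt_zero[of a] by linarith
  have "(\<integral>x. exp (lin j \<theta> x) \<partial>mu) \<le> (\<integral>x. exp b \<partial>mu)"
    by (rule integral_mono_AE) (use assms(2) in \<open>auto simp: integrable_exp_lin\<close>)
  then have 2: "(\<integral>x. exp (lin j \<theta> x) \<partial>mu) \<le> exp b" by (simp add: mu.prob_space)
  show "a \<le> psi j \<theta>" unfolding psi_def using 1 pos by (simp add: ln_ge_iff)
  show "psi j \<theta> \<le> b" unfolding psi_def using 2 pos by (metis exp_gt_zero ln_exp ln_le_cancel_iff)
qed

lemma dens_pos: "0 < dens j \<theta> x"
  by (simp add: dens_def)

lemma dens_measurable [measurable]: "dens j \<theta> \<in> borel_measurable borel"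
  unfolding dens_def[abs_def] by measurable

lemma integral_exp_lin_pos: "0 < (\<integral>x. exp (lin j \<theta> x) \<partial>mu)"
proof -
  obtain M where M: "\<And>x. x \<in> {0..1} \<Longrightarrow> \<bar>lin j \<theta> x\<bar> \<le> M" using lin_bounded by blast
  have "(\<integral>x. exp (- M) \<partial>mu) \<le> (\<integral>x. exp (lin j \<theta> x) \<partial>mu)"
    by (rule integral_mono_AE) (use M in \<open>force simp: integrable_exp_lin intro!: AE_I2\<close>)+
  then have "exp (- M) \<le> (\<integral>x. exp (lin j \<theta> x) \<partial>mu)" by (simp add: mu.prob_space)
  then show ?thesis using exp_gt_zero[of "- M"] by linarith
qed

lemma dens_integral:
  shows "integrable mu (dens j \<theta>)" and "(\<integral>x. dens j \<theta> x \<partial>mu) = 1"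
proof -
  have eq: "dens j \<theta> = (\<lambda>x. exp (- psi j \<theta>) * exp (lin j \<theta> x))" by (rule ext) (simp add: dens_def exp_add[symmetric])
  show "integrable mu (dens j \<theta>)" unfolding eq using integrable_exp_lin by simp
  show "(\<integral>x. dens j \<theta> x \<partial>mu) = 1" unfolding eq using integral_exp_lin_pos[of j \<theta>]
    by (simp add: psi_def exp_minus)
qed

lemma nn_integral_dens: "(\<integral>\<^sup>+x. ennreal (dens j \<theta> x) \<partial>mu) = 1"
  using dens_integral[of j \<theta>] dens_pos[of j \<theta>]
  by (subst nn_integral_eq_integral) (auto simp: less_imp_le)

lemma psi_measurable [measurable]: "psi j \<in> borel_measurable (coords (num_basis j))"
proof -
  have "(\<lambda>(\<theta>, x). exp (lin j \<theta> x)) \<in> borel_measurable (coords (num_basis j) \<Otimes>\<^sub>M mu)"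
    by (rule measurable_pair_mu) measurable
  then have "(\<lambda>\<theta>. \<integral>x. exp (lin j \<theta> x) \<partial>mu) \<in> borel_measurable (coords (num_basis j))"
    by (rule mu.borel_measurable_lebesgue_integral)
  then show ?thesis unfolding psi_def[abs_def] by measurable
qed

lemma dens_measurable_pair [measurable]:
  "(\<lambda>(\<theta>, x). dens j \<theta> x) \<in> borel_measurable (coords (num_basis j) \<Otimes>\<^sub>M borel)"
  unfolding dens_def case_prod_beta lin_def by measurable

lemma dcs_measurable:
  "1 \<le> i \<Longrightarrow> i + r \<le> m \<Longrightarrow> (\<lambda>\<theta>. dcs k q \<theta> r i) \<in> borel_measurable (coords m)"
proof (induction r arbitrary: i)
  case (Suc r)
  have [measurable]: "(\<lambda>\<theta>. dcs k q \<theta> r i) \<in> borel_measurable (coords m)"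
    "(\<lambda>\<theta>. dcs k q \<theta> r (Suc i)) \<in> borel_measurable (coords m)"
    using Suc.IH[of i] Suc.IH[of "Suc i"] Suc.prems by auto
  show ?case unfolding dcs.simps dc_def by measurable
next
  case 0
  then have "i \<in> {1..m}" by auto
  then show ?case unfolding dcs.simps by measurable
qed

text \<open>The r-th derivative of the log density on [0, 1); the normalizing constant contributes
  at order 0 only.\<close>

definition dlog :: "nat \<Rightarrow> index \<Rightarrow> (nat \<Rightarrow> real) \<Rightarrow> real \<Rightarrow> real" where
  "dlog r j \<theta> x = (case j of (k, q, L) \<Rightarrow> (if r = 0 then - psi j \<theta> else 0) + sp k (q - r) (dcs k q \<theta> r) x)"

lemma Theta_iff:
  assumes "q \<ge> 1"
  shows "\<theta> \<in> Theta (k, q, L) \<longleftrightarrow> \<theta> \<in> extensional {1..k + q} \<and> (\<Sum>i = 1..k + q. \<theta> i) = 0 \<and>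
     (\<forall>r<q. AE x in mu. \<bar>dlog r (k, q, L) \<theta> x\<bar> \<le> real L)"
proof -
  have "{0..q - 1} = {..<q}" using assms by auto
  then show ?thesis by (auto simp: deriv_norm_ln_dens_le_iff dlog_def)
qed

lemma dlog_measurable:
  assumes "r < q"
  shows "(\<lambda>(\<theta>, x). dlog r (k, q, L) \<theta> x) \<in> borel_measurable (coords (k + q) \<Otimes>\<^sub>M mu)"
proof -
  have [measurable]: "psi (k, q, L) \<in> borel_measurable (coords (k + q))"
    using psi_measurable[of "(k, q, L)"] by simp
  have [measurable]: "(\<lambda>\<theta>. dcs k q \<theta> r i) \<in> borel_measurable (coords (k + q))" if "i \<in> {1..k + (q - r)}" for i
    using that assms by (intro dcs_measurable) auto
  show ?thesis
    by (rule measurable_pair_mu, unfold dlog_def sp_def case_prod_beta prod.case fst_conv snd_conv) measurable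
qed

text \<open>Since \<open>ennreal\<close> truncates at 0, the condition says that the integral of the
  positive part of \<open>f - L\<close> vanishes, and this integral is measurable in the
  parameter.\<close>

lemma sets_Collect_AE_mu:
  assumes "(\<lambda>(\<theta>, x). f \<theta> x) \<in> borel_measurable (N \<Otimes>\<^sub>M mu)"
  shows "{\<theta> \<in> space N. AE x in mu. f \<theta> x \<le> (L::real)} \<in> sets N"
proof -
  have meas[measurable]: "(\<lambda>(\<theta>, x). ennreal (f \<theta> x - L)) \<in> borel_measurable (N \<Otimes>\<^sub>M mu)"
    using assms unfolding case_prod_beta by measurable
  have "(AE x in mu. f \<theta> x \<le> L) \<longleftrightarrow> (\<integral>\<^sup>+x. ennreal (f \<theta> x - L) \<partial>mu) = 0" if "\<theta> \<in> space N" for \<theta>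
  proof -
    have "(\<lambda>x. ennreal (f \<theta> x - L)) \<in> borel_measurable mu"
      using measurable_Pair2[OF meas that] by simp
    then show ?thesis by (subst nn_integral_0_iff_AE) (auto simp: ennreal_eq_0_iff)
  qed
  then have "{\<theta> \<in> space N. AE x in mu. f \<theta> x \<le> L} = {\<theta> \<in> space N. (\<integral>\<^sup>+x. ennreal (f \<theta> x - L) \<partial>mu) = 0}"
    by auto
  moreover have "(\<lambda>\<theta>. \<integral>\<^sup>+x. ennreal (f \<theta> x - L) \<partial>mu) \<in> borel_measurable N"
    using mu.borel_measurable_nn_integral[OF meas] .
  ultimately show ?thesis by simp
qed

lemma Theta_sets [measurable]:
  assumes "j \<in> J"
  shows "Theta j \<in> sets (coords (num_basis j))"
proof (cases j)
  case (fields k q L)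
  have q: "q \<ge> 1" using assms by (auto simp: J_def fields)
  have [measurable]: "{\<theta> \<in> space (coords (k + q)). AE x in mu. \<bar>dlog r (k, q, L) \<theta> x\<bar> \<le> real L} \<in> sets (coords (k + q))" if "r < q" for r
    by (rule sets_Collect_AE_mu) (use dlog_measurable[OF that, of k L] in \<open>simp add: case_prod_beta\<close>)
  have "Theta j = {\<theta> \<in> space (coords (k + q)). (\<Sum>i = 1..k + q. \<theta> i) = 0 \<and>
     (\<forall>r\<in>{..<q}. AE x in mu. \<bar>dlog r (k, q, L) \<theta> x\<bar> \<le> real L)}"
    unfolding fields using Theta_iff[OF q] by (auto simp: space_PiM PiE_def)
  also have "\<dots> \<in> sets (coords (k + q))"
  proof (intro sets.sets_Collect_conj sets.sets_Collect_finite_All')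
    show "{\<theta> \<in> space (coords (k + q)). (\<Sum>i = 1..k + q. \<theta> i) = 0} \<in> sets (coords (k + q))"
      by measurable
  qed (use q in \<open>auto simp del: One_nat_def simp: lessThan_empty_iff\<close>)
  finally show ?thesis by (simp add: fields)
qed

section \<open>Sheared boxes and the hyperplane measure\<close>

lemma measurable_restrict_prefix:
  fixes F :: "(nat \<Rightarrow> real) \<Rightarrow> real"
  assumes "F \<in> borel_measurable (\<Pi>\<^sub>M i\<in>{1..<i}. lborel)" "i \<le> m"
    and "\<And>t t'. (\<And>j. 1 \<le> j \<Longrightarrow> j < i \<Longrightarrow> t j = t' j) \<Longrightarrow> F t = F t'"
  shows "F \<in> borel_measurable (\<Pi>\<^sub>M i\<in>{1..<m}. lborel)"
proof -
  have "(\<lambda>t. F (restrict t {1..<i})) \<in> borel_measurable (\<Pi>\<^sub>M i\<in>{1..<m}. lborel)"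
    by (rule measurable_compose[OF measurable_restrict_subset assms(1)]) (use assms(2) in auto)
  moreover have "F (restrict t {1..<i}) = F t" for t by (rule assms(3)) auto
  ultimately show ?thesis by simp
qed

text \<open>A triangularly sheared box: the position of side i may depend on the earlier
  coordinates, its length may not. It serves as an outer approximation of the parameter set and as
  an inner approximation of balls in the hyperplane.\<close>

definition seqbox :: "nat \<Rightarrow> (nat \<Rightarrow> (nat \<Rightarrow> real) \<Rightarrow> real) \<Rightarrow> (nat \<Rightarrow> real) \<Rightarrow> (nat \<Rightarrow> real) set" where
  "seqbox m F l = {t \<in> space (\<Pi>\<^sub>M i\<in>{1..<m}. lborel). \<forall>i\<in>{1..<m}. F i t \<le> t i \<and> t i \<le> F i t + l i}"

text \<open>Integrating out the last coordinate leaves a section of length \<open>l m\<close> over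
  every point of the lower-dimensional box, wherever \<open>F m\<close> puts it.\<close>

lemma seqbox:
  assumes dep: "\<And>i t t'. (\<And>j. 1 \<le> j \<Longrightarrow> j < i \<Longrightarrow> t j = t' j) \<Longrightarrow> F i t = F i t'"
    and meas: "\<And>i. F i \<in> borel_measurable (\<Pi>\<^sub>M i\<in>{1..<i}. lborel)"
    and l: "\<And>i. 0 \<le> l i"
  shows "seqbox m F l \<in> sets (\<Pi>\<^sub>M i\<in>{1..<m}. lborel)"
    and "emeasure (\<Pi>\<^sub>M i\<in>{1..<m}. lborel) (seqbox m F l) = (\<Prod>i\<in>{1..<m}. ennreal (l i))"
proof -
  have F[measurable]: "F i \<in> borel_measurable (\<Pi>\<^sub>M i\<in>{1..<m}. lborel)" if "i \<in> {1..<m}" for i m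
    using measurable_restrict_prefix[OF meas _ dep, of i m] that by auto
  show sets: "seqbox m F l \<in> sets (\<Pi>\<^sub>M i\<in>{1..<m}. lborel)" for m
    unfolding seqbox_def
  proof (intro sets.sets_Collect_finite_All sets.sets_Collect_conj)
    fix i assume i: "i \<in> {1..<m}"
    note [measurable] = F[OF i]
    show "{t \<in> space (\<Pi>\<^sub>M i\<in>{1..<m}. lborel). F i t \<le> t i} \<in> sets (\<Pi>\<^sub>M i\<in>{1..<m}. lborel)"
      "{t \<in> space (\<Pi>\<^sub>M i\<in>{1..<m}. lborel). t i \<le> F i t + l i} \<in> sets (\<Pi>\<^sub>M i\<in>{1..<m}. lborel)"
      using i by measurable
  qed auto
  show "emeasure (\<Pi>\<^sub>M i\<in>{1..<m}. lborel) (seqbox m F l) = (\<Prod>i\<in>{1..<m}. ennreal (l i))"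
  proof (induction m)
    case 0
    show ?case by (simp add: seqbox_def space_PiM)
  next
    case (Suc m)
    show ?case
    proof (cases "m = 0")
      case True
      then show ?thesis by (simp add: seqbox_def space_PiM)
    next
      case False
      then have ins: "{1..<Suc m} = insert m {1..<m}" by auto
      let ?P = "\<Pi>\<^sub>M i\<in>{1..<m}. lborel :: real measure"
      have "emeasure (\<Pi>\<^sub>M i\<in>{1..<Suc m}. lborel) (seqbox (Suc m) F l) =
        (\<integral>\<^sup>+t. indicator (seqbox (Suc m) F l) t \<partial>(\<Pi>\<^sub>M i\<in>insert m {1..<m}. lborel))"
        using sets[of "Suc m"] unfolding ins by simp
      also have "\<dots> = (\<integral>\<^sup>+t. (\<integral>\<^sup>+y. indicator (seqbox (Suc m) F l) (t(m := y)) \<partial>lborel) \<partial>?P)"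
        using sets[of "Suc m"] unfolding ins by (intro lborel_product.product_nn_integral_insert) auto
      also have "\<dots> = (\<integral>\<^sup>+t. ennreal (l m) * indicator (seqbox m F l) t \<partial>?P)"
      proof (intro nn_integral_cong)
        fix t assume t: "t \<in> space ?P"
        have Feq: "F i (t(m := y)) = F i t" if "i \<le> m" for i y by (rule dep) (use that in auto)
        have "indicator (seqbox (Suc m) F l) (t(m := y)) = (indicator (seqbox m F l) t * indicator {F m t..F m t + l m} y :: ennreal)" for y
        proof -
          have "t(m := y) \<in> space (\<Pi>\<^sub>M i\<in>{1..<Suc m}. lborel :: real measure)"
            using t unfolding ins by (auto simp: space_PiM PiE_def extensional_def)
          then have "t(m := y) \<in> seqbox (Suc m) F l \<longleftrightarrow> t \<in> seqbox m F l \<and> y \<in> {F m t..F m t + l m}"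
            unfolding seqbox_def ins using t Feq by auto
          then show ?thesis by (simp add: indicator_def)
        qed
        then have "(\<integral>\<^sup>+y. indicator (seqbox (Suc m) F l) (t(m := y)) \<partial>lborel) = indicator (seqbox m F l) t * emeasure lborel {F m t..F m t + l m}"
          by (simp add: nn_integral_cmult)
        also have "\<dots> = ennreal (l m) * indicator (seqbox m F l) t" using l[of m] by (simp add: mult.commute)
        finally show "(\<integral>\<^sup>+y. indicator (seqbox (Suc m) F l) (t(m := y)) \<partial>lborel) = ennreal (l m) * indicator (seqbox m F l) t" .
      qed
      also have "\<dots> = ennreal (l m) * emeasure ?P (seqbox m F l)"
        using sets[of m] by (subst nn_integral_cmult) auto
      also have "\<dots> = (\<Prod>i\<in>{1..<Suc m}. ennreal (l i))" unfolding ins Suc.IH by simp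
      finally show ?thesis .
    qed
  qed
qed

definition to_hyperplane :: "nat \<Rightarrow> (nat \<Rightarrow> real) \<Rightarrow> nat \<Rightarrow> real" where
  "to_hyperplane m t = t(m := - (\<Sum>i\<in>{1..<m}. t i))"

lemma to_hyperplane_measurable:
  assumes "1 \<le> m"
  shows "to_hyperplane m \<in> (\<Pi>\<^sub>M i\<in>{1..<m}. lborel) \<rightarrow>\<^sub>M coords m"
proof -
  have "(\<lambda>t. t(m := - (\<Sum>i\<in>{1..<m}. t i))) \<in> (\<Pi>\<^sub>M i\<in>{1..<m}. lborel) \<rightarrow>\<^sub>M coords m"
  proof (rule measurable_fun_upd[where J="{1..<m}"])
    have "(\<lambda>t. - (\<Sum>i\<in>{1..<m}. t i)) \<in> borel_measurable (\<Pi>\<^sub>M i\<in>{1..<m}. lborel :: real measure)"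
      by measurable
    then show "(\<lambda>t. - (\<Sum>i\<in>{1..<m}. t i)) \<in> (\<Pi>\<^sub>M i\<in>{1..<m}. lborel) \<rightarrow>\<^sub>M lborel" by simp
  qed (use assms in auto)
  then show ?thesis by (simp add: to_hyperplane_def[abs_def])
qed

lemma emeasure_hyperplane:
  assumes "1 \<le> m" "A \<in> sets (coords m)"
  shows "emeasure (hyperplane_lebesgue m) A =
    ennreal (sqrt m) * emeasure (\<Pi>\<^sub>M i\<in>{1..<m}. lborel) (to_hyperplane m -` A \<inter> space (\<Pi>\<^sub>M i\<in>{1..<m}. lborel))"
proof -
  have "hyperplane_lebesgue m = scale_measure (ennreal (sqrt m)) (distr (\<Pi>\<^sub>M i\<in>{1..<m}. lborel) (coords m) (to_hyperplane m))"
    by (simp add: hyperplane_lebesgue_def to_hyperplane_def[abs_def])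
  then show ?thesis using emeasure_distr[OF to_hyperplane_measurable[OF assms(1)] assms(2)] by simp
qed

lemma sets_hyperplane [simp, measurable_cong]: "sets (hyperplane_lebesgue m) = sets (coords m)"
  by (simp add: hyperplane_lebesgue_def sets_scale_measure)

lemma space_hyperplane [simp]: "space (hyperplane_lebesgue m) = space (coords m)"
  by (rule sets_eq_imp_space_eq) simp

lemma to_hyperplane_props:
  assumes "1 \<le> m" "t \<in> space (\<Pi>\<^sub>M i\<in>{1..<m}. lborel)"
  shows "to_hyperplane m t \<in> space (coords m)" "(\<Sum>i=1..m. to_hyperplane m t i) = 0"
    "i < m \<Longrightarrow> to_hyperplane m t i = t i" "to_hyperplane m t m = - (\<Sum>i\<in>{1..<m}. t i)"
proof -
  show "to_hyperplane m t \<in> space (coords m)"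
    using measurable_space[OF to_hyperplane_measurable[OF assms(1)] assms(2)] .
  have "{1..m} = insert m {1..<m}" using assms(1) by auto
  then show "(\<Sum>i=1..m. to_hyperplane m t i) = 0"
    by (simp add: to_hyperplane_def)
qed (auto simp: to_hyperplane_def)

lemma prior_emeasure:
  assumes "j \<in> J" "A \<in> sets (coords (num_basis j))"
  shows "emeasure (prior j) A = emeasure (hyperplane_lebesgue (num_basis j)) (Theta j \<inter> A) /
     emeasure (hyperplane_lebesgue (num_basis j)) (Theta j)"
  unfolding prior_def using Theta_sets[OF assms(1)] assms(2)
  by (intro emeasure_uniform_measure) auto

section \<open>Divided differences and the volume of the parameter set\<close>

lemma dcs_local:
  assumes "\<And>j. i \<le> j \<Longrightarrow> j \<le> i + r \<Longrightarrow> c j = d j"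
  shows "dcs k q c r i = dcs k q d r i"
  using assms
proof (induction r arbitrary: i)
  case (Suc r)
  have "dcs k q c r i = dcs k q d r i" "dcs k q c r (Suc i) = dcs k q d r (Suc i)"
    by (rule Suc.IH, rule Suc.prems, auto)+
  then show ?case by (simp add: dc_def)
qed auto

lemma dcs_const: "dcs k q (\<lambda>_. a) r i = (if r = 0 then a else 0)"
proof (induction r arbitrary: i)
  case (Suc r)
  then show ?case by (simp add: dc_def)
qed auto

text \<open>Of the coefficients \<open>c i, ..., c (i + r)\<close> in the r-th difference, the last
  one enters with the product of the factors \<open>p / gap\<close>, each at least 1 + k; \<rho> is
  the reciprocal of this product.\<close>

lemma dcs_unit:
  assumes "1 \<le> i" "i + r \<le> k + q" "r < q"
  shows "\<exists>\<rho>>0. \<rho> \<le> 1 / (1 + real k) ^ r \<and> (\<forall>a. \<rho> * dcs k q (\<lambda>j. if j = i + r then a else 0) r i = a)"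
  using assms
proof (induction r arbitrary: i)
  case 0
  then show ?case by (intro exI[of _ 1]) auto
next
  case (Suc r)
  obtain \<rho> where \<rho>: "\<rho> > 0" "\<rho> \<le> 1 / (1 + real k) ^ r" "\<And>a. \<rho> * dcs k q (\<lambda>j. if j = Suc i + r then a else 0) r (Suc i) = a"
    using Suc.IH[of "Suc i"] Suc.prems by auto
  define p where "p = q - Suc r"
  have p: "1 \<le> i" "i \<le> k + p" "1 \<le> p" using Suc.prems by (auto simp: p_def)
  have "0 < 1 / (1 + real k)" "1 / (1 + real k) \<le> gap k p i" using gap_bounds[OF p] by auto
  then have g: "gap k p i > 0" by linarith
  show ?case
  proof (intro exI[of _ "gap k p i / real p * \<rho>"] conjI allI)
    show "0 < gap k p i / real p * \<rho>" using g p \<rho> by simp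
    have "gap k p i / real p * \<rho> \<le> 1 / (1 + real k) * (1 / (1 + real k) ^ r)"
      using dc_step(2,3)[OF p] \<rho> by (intro mult_mono) auto
    then show "gap k p i / real p * \<rho> \<le> 1 / (1 + real k) ^ Suc r" by simp
    fix a
    have "dcs k q (\<lambda>j. if j = i + Suc r then a else 0) r i = dcs k q (\<lambda>j. 0) r i"
      by (rule dcs_local) auto
    then have "dcs k q (\<lambda>j. if j = i + Suc r then a else 0) r i = 0" by (simp add: dcs_const)
    then have "dcs k q (\<lambda>j. if j = i + Suc r then a else 0) (Suc r) i =
        real p * dcs k q (\<lambda>j. if j = Suc i + r then a else 0) r (Suc i) / gap k p i"
      by (simp add: dc_def p_def)
    then show "gap k p i / real p * \<rho> * dcs k q (\<lambda>j. if j = i + Suc r then a else 0) (Suc r) i = a"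
      using \<rho>(3)[of a] g p by simp
  qed
qed

text \<open>The s-th difference has slope at least \<open>(1 + k)^s\<close> in its last coefficient,
  so its size controls the distance of this coefficient from the value that would make it 0.
  Overwriting the coefficient by 0 makes that predicted value a function of the preceding ones
  only.\<close>

lemma dcs_predict:
  assumes "1 \<le> i" "i + s \<le> k + Suc s"
  shows "\<exists>\<rho>>0. \<rho> \<le> 1 / (1 + real k) ^ s \<and>
    (\<forall>c. \<bar>c (i + s) - - \<rho> * dcs k (Suc s) (c(i + s := 0)) s i\<bar> \<le> 1 / (1 + real k) ^ s * \<bar>dcs k (Suc s) c s i\<bar>)"
proof -
  obtain \<rho> where \<rho>: "\<rho> > 0" "\<rho> \<le> 1 / (1 + real k) ^ s" "\<And>a. \<rho> * dcs k (Suc s) (\<lambda>j. if j = i + s then a else 0) s i = a"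
    using dcs_unit[of i s k "Suc s"] assms by auto
  have "\<bar>c (i + s) - - \<rho> * dcs k (Suc s) (c(i + s := 0)) s i\<bar> \<le> 1 / (1 + real k) ^ s * \<bar>dcs k (Suc s) c s i\<bar>" for c
  proof -
    have "c(i + s := 0) = (\<lambda>j. c j - (if j = i + s then c (i + s) else 0))" by auto
    then have "dcs k (Suc s) (c(i + s := 0)) s i = dcs k (Suc s) c s i - dcs k (Suc s) (\<lambda>j. if j = i + s then c (i + s) else 0) s i"
      by (simp only: dcs_diff)
    then have "c (i + s) - - \<rho> * dcs k (Suc s) (c(i + s := 0)) s i = \<rho> * dcs k (Suc s) c s i"
      by (simp only: mult_minus_left right_diff_distrib \<rho>(3))
    moreover have "\<rho> * \<bar>dcs k (Suc s) c s i\<bar> \<le> 1 / (1 + real k) ^ s * \<bar>dcs k (Suc s) c s i\<bar>"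
      using \<rho>(2) by (intro mult_right_mono) auto
    ultimately show ?thesis using \<rho>(1) by (simp add: abs_mult)
  qed
  then show ?thesis using \<rho>(1,2) by blast
qed

text \<open>A difference at most doubles the size, is multiplied by at most q and divided by a gap
  of at least 1 / (1 + k). A perturbation of size \<open>(1 + k)^(-s)\<close> therefore changes all
  derivatives up to order s by a bounded amount.\<close>

lemma dcs_growth:
  assumes "\<And>i. 1 \<le> i \<Longrightarrow> i \<le> k + q \<Longrightarrow> \<bar>c i\<bar> \<le> M" "r < q" "1 \<le> i" "i + r \<le> k + q"
  shows "\<bar>dcs k q c r i\<bar> \<le> (2 * real q * (1 + real k)) ^ r * M"
  using assms(2-)
proof (induction r arbitrary: i)
  case 0
  then show ?case using assms(1) by simp
next
  case (Suc r)
  define p where "p = q - Suc r"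
  have p: "1 \<le> i" "i \<le> k + p" "1 \<le> p" "p \<le> q" using Suc.prems by (auto simp: p_def)
  have g: "0 < 1 / (1 + real k)" "1 / (1 + real k) \<le> gap k p i" using gap_bounds[OF p(1-3)] by auto
  then have g0: "gap k p i > 0" by linarith
  have ig: "1 / gap k p i \<le> 1 + real k" using g g0 by (simp add: field_simps)
  define E where "E = (2 * real q * (1 + real k)) ^ r * M"
  have "\<bar>dcs k q c r i\<bar> \<le> E" "\<bar>dcs k q c r (Suc i)\<bar> \<le> E" using Suc by (auto simp: E_def)
  then have "\<bar>dcs k q c r (Suc i) - dcs k q c r i\<bar> \<le> 2 * E" by linarith
  then have "real p * \<bar>dcs k q c r (Suc i) - dcs k q c r i\<bar> * (1 / gap k p i) \<le> real q * (2 * E) * (1 + real k)"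
    using p ig g0 by (intro mult_mono) auto
  then show ?case using g0 by (simp add: dc_def p_def[symmetric] abs_mult E_def) (simp only: mult_ac)
qed

lemma AE_mu_bound_at_0:
  assumes "continuous_on {0..<1} f" "AE x in mu. \<bar>f x\<bar> \<le> (L::real)"
  shows "\<bar>f 0\<bar> \<le> L"
proof (rule ccontr)
  assume "\<not> ?thesis"
  then have "0 < \<bar>f 0\<bar> - L" by simp
  then obtain d where d: "d > 0" "\<And>x. x \<in> {0..<1} \<Longrightarrow> dist x 0 < d \<Longrightarrow> dist (f x) (f 0) < \<bar>f 0\<bar> - L"
    using assms(1) unfolding continuous_on_iff by (metis atLeastLessThan_iff order_refl zero_less_one)
  obtain x where x: "x \<in> {0<..<min d 1}" "\<bar>f x\<bar> \<le> L"
    using AE_mu_dense[OF assms(2), of 0 "min d 1"] d(1) by auto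
  then show False using d(2)[of x] by (auto simp: dist_real_def)
qed

text \<open>By the partition of unity, subtracting \<open>psi\<close> from all coefficients
  subtracts it from the spline and leaves derivatives of positive order alone. This removes the
  special role of order 0.\<close>

lemma dlog_shift:
  assumes "r \<le> s" "x \<in> {0..<1}"
  shows "dlog r (k, Suc s, L) \<theta> x = sp k (Suc s - r) (dcs k (Suc s) (\<lambda>i. \<theta> i - psi (k, Suc s, L) \<theta>) r) x"
proof (cases r)
  case 0
  then show ?thesis using sp_const[OF assms(2)] by (simp add: dlog_def sp_diff)
next
  case (Suc r')
  have "dcs k (Suc s) (\<lambda>i. \<theta> i - psi (k, Suc s, L) \<theta>) r = dcs k (Suc s) \<theta> r"
    by (rule ext, simp only: dcs_diff dcs_const Suc) simp
  then show ?thesis using Suc by (simp only: dlog_def) simp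
qed

text \<open>For the coefficients shifted by \<open>- psi\<close>, the derivatives at 0 are first
  coefficients and the s-th derivative is piecewise constant; bounds on functions thus become bounds
  on these coefficients and, by discrete integration, on all. Since \<theta> has mean 0,
  \<open>psi\<close> is minus the mean of the shifted coefficients and obeys the same bound, whence
  the factor 2.\<close>

lemma Theta_coefficient_bounds:
  assumes \<theta>: "\<theta> \<in> Theta (k, Suc s, L)"
  shows "1 \<le> i \<Longrightarrow> i \<le> k + 1 \<Longrightarrow> s \<ge> 1 \<Longrightarrow> \<bar>dcs k (Suc s) \<theta> s i\<bar> \<le> real L"
    and "1 \<le> i \<Longrightarrow> i \<le> k + Suc s \<Longrightarrow> \<bar>\<theta> i\<bar> \<le> 2 * ((real s + 2) ^ s * real L)"
proof -
  define p where "p = psi (k, Suc s, L) \<theta>"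
  define \<theta>' where "\<theta>' i = \<theta> i - p" for i
  have AE: "AE x in mu. \<bar>sp k (Suc s - r) (dcs k (Suc s) \<theta>' r) x\<bar> \<le> real L" if "r \<le> s" for r
  proof -
    have "AE x in mu. \<bar>dlog r (k, Suc s, L) \<theta> x\<bar> \<le> real L"
      using \<theta> that by (subst (asm) Theta_iff) auto
    then show ?thesis using AE_mu_open[OF finite.emptyI]
      by eventually_elim (use dlog_shift[OF that, of _ k L \<theta>] in \<open>auto simp: \<theta>'_def[abs_def] p_def\<close>)
  qed
  have left: "\<bar>dcs k (Suc s) \<theta>' r 1\<bar> \<le> real L" if "r < s" for r
  proof -
    have r: "Suc s - r = Suc (Suc (s - r - 1))" using that by auto
    have "\<bar>sp k (Suc s - r) (dcs k (Suc s) \<theta>' r) 0\<bar> \<le> real L"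
      by (rule AE_mu_bound_at_0) (use AE[of r] that in \<open>auto simp only: r sp_continuous less_imp_le\<close>)
    then show ?thesis unfolding r sp_at_0 .
  qed
  have top: "\<bar>dcs k (Suc s) \<theta>' s i\<bar> \<le> real L" if i: "1 \<le> i" "i \<le> k + 1" for i
  proof -
    define n where "n = 1 + real k"
    have n: "n > 0" "real i \<le> n" by (use i in \<open>auto simp: n_def\<close>)
    have "0 \<le> (real i - 1) / n" "(real i - 1) / n < real i / n" "real i / n \<le> 1"
      using i n by (auto simp: divide_strict_right_mono)
    from AE_mu_dense[OF AE[OF order_refl] this] obtain x where
      x: "(real i - 1) / n < x" "x < real i / n" "\<bar>sp k (Suc 0) (dcs k (Suc s) \<theta>' s) x\<bar> \<le> real L" by auto
    have "real i - 1 \<le> n * x" "n * x < real i" using x(1,2) n(1) by (auto simp: pos_divide_less_eq pos_less_divide_eq mult.commute)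
    then show ?thesis using sp_1[OF i, of x "dcs k (Suc s) \<theta>' s"] x(3) by (simp add: n_def)
  qed
  have bound: "\<bar>\<theta>' i\<bar> \<le> (real s + 2) ^ s * real L" if "1 \<le> i" "i \<le> k + Suc s" for i
    using dcs_bound[of k s \<theta>' "real L" 0 i] top left that by auto
  show "\<bar>dcs k (Suc s) \<theta> s i\<bar> \<le> real L" if "1 \<le> i" "i \<le> k + 1" "s \<ge> 1"
  proof -
    have "dcs k (Suc s) \<theta>' s i = dcs k (Suc s) \<theta> s i"
      using that(3) unfolding \<theta>'_def dcs_diff dcs_const by simp
    then show ?thesis using top[OF that(1,2)] by simp
  qed
  have "(\<Sum>i=1..k + Suc s. \<theta> i) = 0" using \<theta> by simp
  then have "(\<Sum>i=1..k + Suc s. \<theta>' i) = - (real (k + Suc s) * p)" by (simp add: \<theta>'_def sum_subtractf)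
  then have "real (k + Suc s) * \<bar>p\<bar> = \<bar>\<Sum>i=1..k + Suc s. \<theta>' i\<bar>" by (simp add: abs_mult del: sum.cl_ivl_Suc)
  also have "\<dots> \<le> (\<Sum>i=1..k + Suc s. (real s + 2) ^ s * real L)"
    using bound by (intro order_trans[OF sum_abs] sum_mono) auto
  also have "\<dots> = real (k + Suc s) * ((real s + 2) ^ s * real L)" by simp
  finally have "\<bar>p\<bar> \<le> (real s + 2) ^ s * real L"
    by (subst (asm) mult_le_cancel_left_pos) auto
  then show "\<bar>\<theta> i\<bar> \<le> 2 * ((real s + 2) ^ s * real L)" if "1 \<le> i" "i \<le> k + Suc s"
    using bound[OF that] by (simp add: \<theta>'_def)
qed

lemma dcs_update_measurable:
  "1 \<le> l \<Longrightarrow> l + r \<le> i \<Longrightarrow> (\<lambda>t. dcs k q (t(i := 0)) r l) \<in> borel_measurable (\<Pi>\<^sub>M i\<in>{1..<i}. lborel)"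
proof (induction r arbitrary: l)
  case (Suc r)
  have [measurable]: "(\<lambda>t. dcs k q (t(i := 0)) r l) \<in> borel_measurable (\<Pi>\<^sub>M i\<in>{1..<i}. lborel)"
    "(\<lambda>t. dcs k q (t(i := 0)) r (Suc l)) \<in> borel_measurable (\<Pi>\<^sub>M i\<in>{1..<i}. lborel)"
    by (rule Suc.IH; use Suc.prems in simp)+
  show ?case unfolding dcs.simps dc_def by measurable
next
  case 0
  show ?case
  proof (cases "l = i")
    case False
    then have "l \<in> {1..<i}" using 0 by auto
    then show ?thesis using False by simp measurable
  qed simp
qed

text \<open>Of the k + s free coordinates the first s range over an interval of length
  \<open>4 * D\<close>, and each further one over an interval of length
  \<open>2 * L / (1 + k)^s\<close> around its predicted value. Together these form a sheared
  box.\<close>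

lemma hyperplane_Theta_le:
  fixes k s L
  assumes s: "s \<ge> 1" and L: "L \<ge> 1"
  defines "D \<equiv> (real s + 2) ^ s * real L"
  shows "emeasure (hyperplane_lebesgue (k + Suc s)) (Theta (k, Suc s, L)) \<le>
    ennreal (sqrt (real (k + Suc s)) * ((4 * D) ^ s * (2 * real L / (1 + real k) ^ s) ^ k))"
proof -
  define m where "m = k + Suc s"
  define h where "h = real L / (1 + real k) ^ s"
  have h: "0 \<le> h" and D: "0 \<le> D" by (auto simp: h_def D_def)
  have "\<exists>\<rho>. i \<in> {1..k + 1} \<longrightarrow> (\<forall>c. \<bar>c (i + s) - - \<rho> * dcs k (Suc s) (c(i + s := 0)) s i\<bar> \<le> 1 / (1 + real k) ^ s * \<bar>dcs k (Suc s) c s i\<bar>)" for i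
  proof (cases "i \<in> {1..k + 1}")
    case True
    then show ?thesis using dcs_predict[of i s k] by auto
  qed auto
  then obtain \<rho> where \<rho>: "\<And>i c. i \<in> {1..k + 1} \<Longrightarrow> \<bar>c (i + s) - - \<rho> i * dcs k (Suc s) (c(i + s := 0)) s i\<bar> \<le> 1 / (1 + real k) ^ s * \<bar>dcs k (Suc s) c s i\<bar>"
    by metis
  define F where "F i t = (if i \<le> s then - 2 * D else - \<rho> (i - s) * dcs k (Suc s) (t(i := 0)) s (i - s) - h)" for i t
  define l where "l i = (if i \<le> s then 4 * D else 2 * h)" for i
  have l: "0 \<le> l i" for i using h D by (simp add: l_def)
  have dep: "F i t = F i t'" if "\<And>j. 1 \<le> j \<Longrightarrow> j < i \<Longrightarrow> t j = t' j" for i t t'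
  proof (cases "i \<le> s")
    case False
    have "dcs k (Suc s) (t(i := 0)) s (i - s) = dcs k (Suc s) (t'(i := 0)) s (i - s)"
      by (rule dcs_local) (use that False in auto)
    then show ?thesis by (simp add: F_def)
  qed (simp add: F_def)
  have meas: "F i \<in> borel_measurable (\<Pi>\<^sub>M i\<in>{1..<i}. lborel)" for i
  proof (cases "i \<le> s")
    case False
    have [measurable]: "(\<lambda>t. dcs k (Suc s) (t(i := 0)) s (i - s)) \<in> borel_measurable (\<Pi>\<^sub>M i\<in>{1..<i}. lborel)"
      by (rule dcs_update_measurable) (use False in auto)
    have "(\<lambda>t. - \<rho> (i - s) * dcs k (Suc s) (t(i := 0)) s (i - s) - h) \<in> borel_measurable (\<Pi>\<^sub>M i\<in>{1..<i}. lborel)"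
      by measurable
    then show ?thesis using False by (simp add: F_def[abs_def])
  qed (simp add: F_def[abs_def])
  have sub: "to_hyperplane m -` Theta (k, Suc s, L) \<inter> space (\<Pi>\<^sub>M i\<in>{1..<m}. lborel) \<subseteq> seqbox m F l"
  proof
    fix t assume t: "t \<in> to_hyperplane m -` Theta (k, Suc s, L) \<inter> space (\<Pi>\<^sub>M i\<in>{1..<m}. lborel)"
    define \<theta> where "\<theta> = to_hyperplane m t"
    have \<theta>: "\<theta> \<in> Theta (k, Suc s, L)" using t by (simp add: \<theta>_def)
    have eq: "\<theta> i = t i" if "i < m" for i using that by (simp add: \<theta>_def to_hyperplane_def)
    have "F i t \<le> t i \<and> t i \<le> F i t + l i" if i: "i \<in> {1..<m}" for i
    proof (cases "i \<le> s")
      case True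
      then show ?thesis using Theta_coefficient_bounds(2)[OF \<theta>, of i, folded D_def] i eq[of i]
        by (auto simp: F_def l_def m_def abs_le_iff)
    next
      case False
      then have i': "i - s \<in> {1..k + 1}" "i - s + s = i" using i by (auto simp: m_def)
      have "\<bar>\<theta> i - - \<rho> (i - s) * dcs k (Suc s) (\<theta>(i := 0)) s (i - s)\<bar> \<le> 1 / (1 + real k) ^ s * \<bar>dcs k (Suc s) \<theta> s (i - s)\<bar>"
        using \<rho>[OF i'(1), of \<theta>] unfolding i'(2) .
      also have "\<dots> \<le> 1 / (1 + real k) ^ s * real L"
        using Theta_coefficient_bounds(1)[OF \<theta>, of "i - s"] i' s by (intro mult_left_mono) auto
      finally have "\<bar>\<theta> i - - \<rho> (i - s) * dcs k (Suc s) (\<theta>(i := 0)) s (i - s)\<bar> \<le> h" by (simp add: h_def)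
      moreover have "dcs k (Suc s) (\<theta>(i := 0)) s (i - s) = dcs k (Suc s) (t(i := 0)) s (i - s)"
        by (rule dcs_local) (use eq i i' in auto)
      ultimately have "\<bar>t i - - \<rho> (i - s) * dcs k (Suc s) (t(i := 0)) s (i - s)\<bar> \<le> h" using eq[of i] i by simp
      then show ?thesis using False by (simp add: F_def l_def abs_le_iff)
    qed
    then show "t \<in> seqbox m F l" using t by (auto simp: seqbox_def)
  qed
  have "(k, Suc s, L) \<in> J" using L by (simp add: J_def)
  from Theta_sets[OF this] have Th: "Theta (k, Suc s, L) \<in> sets (coords m)" by (simp add: m_def)
  have "emeasure (\<Pi>\<^sub>M i\<in>{1..<m}. lborel) (to_hyperplane m -` Theta (k, Suc s, L) \<inter> space (\<Pi>\<^sub>M i\<in>{1..<m}. lborel))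
     \<le> emeasure (\<Pi>\<^sub>M i\<in>{1..<m}. lborel) (seqbox m F l)"
    by (rule emeasure_mono[OF sub seqbox(1)[OF dep meas l]])
  also have "\<dots> = (\<Prod>i\<in>{1..<m}. ennreal (l i))" by (rule seqbox(2)[OF dep meas l])
  also have "\<dots> = ennreal (\<Prod>i\<in>{1..<m}. l i)" using l by (simp add: prod_ennreal)
  also have "(\<Prod>i\<in>{1..<m}. l i) = (4 * D) ^ s * (2 * h) ^ k"
  proof -
    have "{1..<m} = {1..s} \<union> {Suc s..<m}" by (auto simp: m_def)
    then have "(\<Prod>i\<in>{1..<m}. l i) = (\<Prod>i\<in>{1..s}. l i) * (\<Prod>i\<in>{Suc s..<m}. l i)"
      by (simp only:) (rule prod.union_disjoint, auto)
    also have "(\<Prod>i\<in>{1..s}. l i) = (4 * D) ^ s" by (simp add: l_def)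
    also have "(\<Prod>i\<in>{Suc s..<m}. l i) = (2 * h) ^ k" by (simp add: l_def m_def)
    finally show ?thesis .
  qed
  finally have "emeasure (hyperplane_lebesgue m) (Theta (k, Suc s, L)) \<le> ennreal (sqrt m) * ennreal ((4 * D) ^ s * (2 * h) ^ k)"
    using Th by (subst emeasure_hyperplane) (auto simp: m_def intro: mult_left_mono)
  also have "\<dots> = ennreal (sqrt m * ((4 * D) ^ s * (2 * real L / (1 + real k) ^ s) ^ k))"
    using D h by (simp add: ennreal_mult h_def)
  finally show ?thesis by (simp add: m_def)
qed

text \<open>While the partial sum is nonnegative the next increment lies in [-r, 0], otherwise in
  [0, r]; such a walk cannot leave [-r, r].\<close>

lemma seqbox_partial_sums:
  fixes t :: "nat \<Rightarrow> real"
  assumes "\<And>i. i \<in> {1..<m} \<Longrightarrow> (if 0 \<le> (\<Sum>j\<in>{1..<i}. t j - \<theta> j) then - r else 0) \<le> t i - \<theta> i"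
    "\<And>i. i \<in> {1..<m} \<Longrightarrow> t i - \<theta> i \<le> (if 0 \<le> (\<Sum>j\<in>{1..<i}. t j - \<theta> j) then - r else 0) + r" "0 \<le> r" "i \<le> m"
  shows "\<bar>\<Sum>j\<in>{1..<i}. t j - \<theta> j\<bar> \<le> r"
  using assms(4)
proof (induction i)
  case 0 then show ?case using assms(3) by simp
next
  case (Suc i)
  show ?case
  proof (cases "i = 0")
    case True then show ?thesis using assms(3) by simp
  next
    case False
    then have "{1..<Suc i} = insert i {1..<i}" by auto
    then have "(\<Sum>j\<in>{1..<Suc i}. t j - \<theta> j) = (t i - \<theta> i) + (\<Sum>j\<in>{1..<i}. t j - \<theta> j)" by simp
    moreover have "\<bar>\<Sum>j\<in>{1..<i}. t j - \<theta> j\<bar> \<le> r" using Suc by simp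
    moreover have "i \<in> {1..<m}" using Suc.prems False by auto
    ultimately show ?thesis using assms(1,2)[of i] assms(3) by (auto split: if_splits)
  qed
qed

definition hball :: "nat \<Rightarrow> (nat \<Rightarrow> real) \<Rightarrow> real \<Rightarrow> (nat \<Rightarrow> real) set" where
  "hball m \<theta> r = {\<theta>' \<in> space (coords m). (\<Sum>i=1..m. \<theta>' i) = 0 \<and> (\<forall>i\<in>{1..m}. \<bar>\<theta>' i - \<theta> i\<bar> \<le> r)}"

lemma hball_sets: "hball m \<theta> r \<in> sets (coords m)"
  unfolding hball_def
proof (intro sets.sets_Collect_conj sets.sets_Collect_finite_All)
  fix i assume "i \<in> {1..m}"
  then show "{\<theta>' \<in> space (coords m). \<bar>\<theta>' i - \<theta> i\<bar> \<le> r} \<in> sets (coords m)" by measurable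
next
  show "{\<theta> \<in> space (coords m). (\<Sum>i=1..m. \<theta> i) = 0} \<in> sets (coords m)" by measurable
qed auto

text \<open>Choosing the sign of each increment opposite to the current partial sum keeps all partial
  sums, and hence the dependent last coordinate, within \<open>r\<close>.\<close>

lemma hyperplane_hball_ge:
  assumes m: "1 \<le> m" and r: "0 \<le> r" and \<theta>: "(\<Sum>i=1..m. \<theta> i) = 0"
  shows "ennreal (sqrt m * r ^ (m - 1)) \<le> emeasure (hyperplane_lebesgue m) (hball m \<theta> r)"
proof -
  define F where "F i t = \<theta> i + (if 0 \<le> (\<Sum>j\<in>{1..<i}. t j - \<theta> j) then - r else 0)" for i and t :: "nat \<Rightarrow> real"
  have dep: "F i t = F i t'" if "\<And>j. 1 \<le> j \<Longrightarrow> j < i \<Longrightarrow> t j = t' j" for i t t'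
  proof -
    have "(\<Sum>j\<in>{1..<i}. t j - \<theta> j) = (\<Sum>j\<in>{1..<i}. t' j - \<theta> j)" by (intro sum.cong) (use that in auto)
    then show ?thesis by (simp add: F_def)
  qed
  have meas: "F i \<in> borel_measurable (\<Pi>\<^sub>M i\<in>{1..<i}. lborel)" for i
    unfolding F_def by measurable
  have sub: "seqbox m F (\<lambda>_. r) \<subseteq> to_hyperplane m -` hball m \<theta> r \<inter> space (\<Pi>\<^sub>M i\<in>{1..<m}. lborel)"
  proof
    fix t assume t: "t \<in> seqbox m F (\<lambda>_. r)"
    then have sp: "t \<in> space (\<Pi>\<^sub>M i\<in>{1..<m}. lborel :: real measure)" by (simp add: seqbox_def)
    have 1: "(if 0 \<le> (\<Sum>j\<in>{1..<i}. t j - \<theta> j) then - r else 0) \<le> t i - \<theta> i"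
      "t i - \<theta> i \<le> (if 0 \<le> (\<Sum>j\<in>{1..<i}. t j - \<theta> j) then - r else 0) + r" if "i \<in> {1..<m}" for i
    proof -
      have "F i t \<le> t i" "t i \<le> F i t + r" using t that by (simp_all add: seqbox_def)
      then show "(if 0 \<le> (\<Sum>j\<in>{1..<i}. t j - \<theta> j) then - r else 0) \<le> t i - \<theta> i"
        "t i - \<theta> i \<le> (if 0 \<le> (\<Sum>j\<in>{1..<i}. t j - \<theta> j) then - r else 0) + r"
        unfolding F_def by linarith+
    qed
    note P = seqbox_partial_sums[OF 1 r order_refl]
    have ins: "{1..m} = insert m {1..<m}" using m by auto
    have "\<bar>to_hyperplane m t i - \<theta> i\<bar> \<le> r" if i: "i \<in> {1..m}" for i
    proof (cases "i = m")
      case True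
      have "(\<Sum>i=1..m. \<theta> i) = \<theta> m + (\<Sum>i\<in>{1..<m}. \<theta> i)" unfolding ins by simp
      then have "to_hyperplane m t m - \<theta> m = - (\<Sum>j\<in>{1..<m}. t j - \<theta> j)"
        using \<theta> by (simp add: to_hyperplane_def sum_subtractf)
      then show ?thesis using P True by simp
    next
      case False
      then show ?thesis using i 1[of i] r by (auto simp: to_hyperplane_def split: if_splits)
    qed
    then show "t \<in> to_hyperplane m -` hball m \<theta> r \<inter> space (\<Pi>\<^sub>M i\<in>{1..<m}. lborel)"
      using sp to_hyperplane_props(1,2)[OF m sp] by (simp add: hball_def)
  qed
  have "ennreal (r ^ (m - 1)) = emeasure (\<Pi>\<^sub>M i\<in>{1..<m}. lborel) (seqbox m F (\<lambda>_. r))"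
    using r by (subst seqbox(2)[OF dep meas]) (auto simp: ennreal_power)
  also have "\<dots> \<le> emeasure (\<Pi>\<^sub>M i\<in>{1..<m}. lborel) (to_hyperplane m -` hball m \<theta> r \<inter> space (\<Pi>\<^sub>M i\<in>{1..<m}. lborel))"
    by (rule emeasure_mono[OF sub measurable_sets[OF to_hyperplane_measurable[OF m] hball_sets]])
  finally have "ennreal (sqrt m) * ennreal (r ^ (m - 1)) \<le> emeasure (hyperplane_lebesgue m) (hball m \<theta> r)"
    unfolding emeasure_hyperplane[OF m hball_sets] by (rule mult_left_mono) simp
  then show ?thesis using r by (simp add: ennreal_mult)
qed

text \<open>With \<open>r = (1 + k)^(-s)\<close> the ball has volume at least
  \<open>r^(s + k)\<close> and the parameter set at most a constant times
  \<open>(2 * L * r)^k\<close>, both up to the common factor \<open>sqrt m\<close>. The powers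
  \<open>r^k\<close> cancel. What remains is \<open>r^s\<close>, polynomial in b, and a constant to
  the power -k, both at least \<open>exp (- O(b))\<close>.\<close>

lemma prior_mass:
  fixes s :: nat and fo G :: "real \<Rightarrow> real" and K D :: real
  assumes s: "s \<ge> 1"
    and fo: "fo \<in> borel_measurable mu" "(\<integral>\<^sup>+x. ennreal (fo x) \<partial>mu) = 1" "AE x in mu. fo x = exp (G x)"
    and approx: "\<And>b. b \<ge> 1 \<Longrightarrow> \<exists>c. (\<forall>x\<in>{0..<1}. \<bar>sp (s * b - 1) (Suc s) c x - G x\<bar> \<le> K / real b ^ s) \<and>
      (\<forall>r i. r \<le> s \<longrightarrow> 1 \<le> i \<longrightarrow> i \<le> s * b - 1 + Suc s - r \<longrightarrow> \<bar>dcs (s * b - 1) (Suc s) c r i\<bar> \<le> D)"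
  shows "\<exists>L \<kappa>. 1 \<le> L \<and> (\<forall>b\<ge>1. \<exists>S\<in>sets (coords (s * b - 1 + Suc s)). S \<subseteq> Theta (s * b - 1, Suc s, L) \<and>
     ennreal (exp (- (\<kappa> * real b))) \<le> emeasure (prior (s * b - 1, Suc s, L)) S \<and>
     (\<forall>\<theta>\<in>S. AE x in mu. \<bar>ln (dens (s * b - 1, Suc s, L) \<theta> x) - ln (fo x)\<bar> \<le> 2 * (1 + K) / real b ^ s))"
proof -
  obtain c1 where "(\<forall>x\<in>{0..<1}. \<bar>sp (s * 1 - 1) (Suc s) c1 x - G x\<bar> \<le> K / real 1 ^ s)"
    "\<forall>r i. r \<le> s \<longrightarrow> 1 \<le> i \<longrightarrow> i \<le> s * 1 - 1 + Suc s - r \<longrightarrow> \<bar>dcs (s * 1 - 1) (Suc s) c1 r i\<bar> \<le> D"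
    using approx[of 1] by auto
  from this(1)[rule_format, of 0] this(2)[rule_format, of 0 1] have K: "0 \<le> K" and D: "0 \<le> D" by auto
  \<comment> \<open>Order 0 needs twice \<open>2 * D + 1\<close>, for the spline and for
    \<open>psi\<close>. Positive orders need D for the approximating spline and
    \<open>(2 * (s + 1))^s\<close> for the perturbation. The sum covers both and is independent of
    b.\<close>
  define L where "L = nat \<lceil>4 * D + 2 + (2 * real (Suc s)) ^ s\<rceil>"
  have L: "4 * D + 2 + (2 * real (Suc s)) ^ s \<le> real L" unfolding L_def by linarith
  have pw: "0 \<le> (2 * real (Suc s)) ^ s" by simp
  have L1: "1 \<le> L" using L D pw by linarith
  define E where "E = (real s + 2) ^ s * real L"
  have E: "0 < E" using L1 by (simp add: E_def)
  \<comment> \<open>The three terms bound, by \<open>x \<le> exp x\<close>, the contributions of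
    \<open>n^(s * s)\<close>, \<open>(4 * E)^s\<close> and \<open>(2 * L)^k\<close> to the quotient
    of volumes, where n is the number of cells.\<close>
  define \<kappa> where "\<kappa> = real s ^ 3 + 4 * E * real s + 2 * real L * real s"
  show ?thesis
  proof (rule exI[of _ L], rule exI[of _ \<kappa>], intro conjI allI impI)
    show "1 \<le> L" by (rule L1)
    fix b :: nat assume b: "1 \<le> b"
    define k where "k = s * b - 1"
    define m where "m = k + Suc s"
    define n where "n = 1 + real k"
    have sb: "s * b \<ge> 1" using s b by (metis mult_le_mono nat_mult_1)
    have n: "n = real s * real b" "n \<ge> 1" "n \<ge> real b"
    proof -
      have "n = real (s * b)" using sb by (simp add: n_def k_def of_nat_diff del: of_nat_mult)
      then show n: "n = real s * real b" by simp
      show "n \<ge> 1" by (simp add: n_def)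
      show "n \<ge> real b" unfolding n using s mult_right_mono[of 1 "real s" "real b"] by simp
    qed
    define j where "j = (k, Suc s, L)"
    have j: "j \<in> J" "num_basis j = m" using L1 by (auto simp: j_def J_def m_def)
    obtain c where c: "\<And>x. x \<in> {0..<1} \<Longrightarrow> \<bar>sp k (Suc s) c x - G x\<bar> \<le> K / real b ^ s"
      "\<And>r i. r \<le> s \<Longrightarrow> 1 \<le> i \<Longrightarrow> i \<le> k + Suc s - r \<Longrightarrow> \<bar>dcs k (Suc s) c r i\<bar> \<le> D"
      using approx[OF b] unfolding k_def by blast
    have cD: "\<bar>c i\<bar> \<le> D" if "1 \<le> i" "i \<le> m" for i using c(2)[of 0 i] that by (simp add: m_def)
    define a where "a = (\<Sum>i=1..m. c i) / real m"
    have m: "1 \<le> m" "real m > 0" by (auto simp: m_def)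
    have a: "\<bar>a\<bar> \<le> D"
    proof -
      have "\<bar>\<Sum>i=1..m. c i\<bar> \<le> (\<Sum>i=1..m. D)" using cD by (intro order_trans[OF sum_abs] sum_mono) auto
      then show ?thesis using m by (simp add: a_def abs_divide divide_le_eq mult.commute)
    qed
    \<comment> \<open>Subtracting the mean moves the coefficients into the hyperplane. The density
      does not change, since \<open>psi\<close> changes by the same constant.\<close>
    define \<theta>0 where "\<theta>0 i = c i - a" for i
    have sum0: "(\<Sum>i=1..m. \<theta>0 i) = 0" using m by (simp add: \<theta>0_def a_def sum_subtractf)
    define r where "r = 1 / n ^ s"
    have r: "0 < r" "r \<le> 1" "r \<le> 1 / real b ^ s"
    proof -
      show "0 < r" "r \<le> 1" using n by (auto simp: r_def divide_le_eq)
      show "r \<le> 1 / real b ^ s" unfolding r_def using n b by (intro divide_left_mono power_mono) auto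
    qed
    define S where "S = hball m \<theta>0 r"
    have S: "S \<in> sets (coords m)" unfolding S_def by (rule hball_sets)
    have diff: "\<bar>\<theta> i - \<theta>0 i\<bar> \<le> r" if "\<theta> \<in> S" "1 \<le> i" "i \<le> m" for \<theta> i
      using that by (auto simp: S_def hball_def)
    have lin_bd: "AE x in mu. \<bar>lin j \<theta> x\<bar> \<le> 2 * D + 1" if \<theta>: "\<theta> \<in> S" for \<theta>
      using AE_mu_open[OF finite.emptyI]
    proof eventually_elim
      case (elim x)
      then have x: "x \<in> {0..<1}" by auto
      have "\<bar>sp k (Suc s) \<theta> x\<bar> \<le> 2 * D + 1"
      proof (rule sp_bound[OF x])
        fix i assume "1 \<le> i" "i \<le> k + Suc s"
        then show "\<bar>\<theta> i\<bar> \<le> 2 * D + 1"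
          using diff[OF \<theta>, of i] cD[of i] a r(2) by (auto simp: \<theta>0_def m_def)
      qed
      then show ?case using lin_eq_sp[OF x] by (simp add: j_def)
    qed
    have sub: "S \<subseteq> Theta j"
    proof
      fix \<theta> assume \<theta>: "\<theta> \<in> S"
      have "AE x in mu. \<bar>dlog r' j \<theta> x\<bar> \<le> real L" if r': "r' < Suc s" for r'
      proof (cases "r' = 0")
        case True
        have "AE x in mu. - (2 * D + 1) \<le> lin j \<theta> x" "AE x in mu. lin j \<theta> x \<le> 2 * D + 1"
          using lin_bd[OF \<theta>] by (auto elim!: eventually_mono)
        from exp_bound_imp_psi_bound[OF this] have psi: "\<bar>psi j \<theta>\<bar> \<le> 2 * D + 1" by simp
        show ?thesis using lin_bd[OF \<theta>] AE_mu_open[OF finite.emptyI]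
        proof eventually_elim
          case (elim x)
          then have "dlog r' j \<theta> x = - psi j \<theta> + lin j \<theta> x"
            using True lin_eq_sp[of x k "Suc s" L \<theta>] by (simp add: dlog_def j_def)
          then show ?case using elim psi L pw D by linarith
        qed
      next
        case False
        show ?thesis using AE_mu_open[OF finite.emptyI]
        proof eventually_elim
          case (elim x)
          then have x: "x \<in> {0..<1}" by auto
          have q: "Suc s - r' = Suc (s - r')" using r' by auto
          have "\<bar>sp k (Suc s - r') (dcs k (Suc s) \<theta> r') x\<bar> \<le> real L"
            unfolding q
          proof (rule sp_bound[OF x])
            fix i assume i: "1 \<le> i" "i \<le> k + Suc (s - r')"
            have "dcs k (Suc s) (\<lambda>i. \<theta> i - \<theta>0 i) r' i = dcs k (Suc s) \<theta> r' i - (dcs k (Suc s) c r' i - 0)"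
              unfolding \<theta>0_def dcs_diff dcs_const using False by simp
            moreover have "\<bar>dcs k (Suc s) c r' i\<bar> \<le> D" using c(2)[of r' i] i r' by simp
            moreover have "\<bar>dcs k (Suc s) (\<lambda>i. \<theta> i - \<theta>0 i) r' i\<bar> \<le> (2 * real (Suc s) * (1 + real k)) ^ r' * r"
              by (rule dcs_growth) (use diff[OF \<theta>] i r' in \<open>auto simp: m_def\<close>)
            moreover have "(2 * real (Suc s) * (1 + real k)) ^ r' * r \<le> (2 * real (Suc s)) ^ s"
            proof -
              have "(2 * real (Suc s) * (1 + real k)) ^ r' * r = (2 * real (Suc s)) ^ r' * (n ^ r' / n ^ s)"
                by (simp add: r_def n_def power_mult_distrib)
              also have "\<dots> \<le> (2 * real (Suc s)) ^ s * 1"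
                using r' n(2) by (intro mult_mono power_increasing) (auto simp: power_increasing divide_le_eq)
              finally show ?thesis by simp
            qed
            ultimately show "\<bar>dcs k (Suc s) \<theta> r' i\<bar> \<le> real L" using L D by linarith
          qed
          then show ?case using False by (simp add: dlog_def j_def)
        qed
      qed
      then show "\<theta> \<in> Theta j" using \<theta> unfolding j_def
        by (subst Theta_iff) (auto simp: S_def hball_def space_PiM PiE_def m_def)
    qed
    \<comment> \<open>The integral of \<open>exp (lin j \<theta>)\<close> lies within a factor
      \<open>exp \<epsilon>\<close> of the integral of \<open>exp (- a) * fo\<close>, which is
      \<open>exp (- a)\<close>. So \<open>psi\<close> adds a second error of at most \<epsilon>,
      whence the factor 2.\<close>
    have close: "AE x in mu. \<bar>ln (dens j \<theta> x) - ln (fo x)\<bar> \<le> 2 * (1 + K) / real b ^ s" if \<theta>: "\<theta> \<in> S" for \<theta>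
    proof -
      define \<epsilon> where "\<epsilon> = (1 + K) / real b ^ s"
      have lin: "AE x in mu. \<bar>lin j \<theta> x - (ln (fo x) - a)\<bar> \<le> \<epsilon> \<and> fo x > 0"
        using AE_mu_open[OF finite.emptyI] fo(3)
      proof eventually_elim
        case (elim x)
        then have x: "x \<in> {0..<1}" by auto
        have "\<bar>sp k (Suc s) (\<lambda>i. \<theta> i - \<theta>0 i) x\<bar> \<le> r"
          by (rule sp_bound[OF x]) (use diff[OF \<theta>] in \<open>auto simp: m_def\<close>)
        moreover have "sp k (Suc s) (\<lambda>i. \<theta> i - \<theta>0 i) x = sp k (Suc s) \<theta> x - (sp k (Suc s) c x - a)"
          unfolding \<theta>0_def sp_diff using sp_const[OF x, of k s a] by simp
        moreover have "\<bar>sp k (Suc s) c x - G x\<bar> \<le> K / real b ^ s" by (rule c(1)[OF x])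
        moreover have "lin j \<theta> x = sp k (Suc s) \<theta> x" using lin_eq_sp[OF x] by (simp add: j_def)
        moreover have "\<epsilon> = 1 / real b ^ s + K / real b ^ s" by (simp add: \<epsilon>_def add_divide_distrib)
        ultimately show ?case using r(3) elim by auto
      qed
      have int_fo: "integrable mu fo" "(\<integral>x. fo x \<partial>mu) = 1"
      proof -
        have pos: "AE x in mu. 0 \<le> fo x" using fo(3) by eventually_elim simp
        show "integrable mu fo"
          by (rule integrableI_nonneg) (use fo pos in auto)
        show "(\<integral>x. fo x \<partial>mu) = 1"
          using fo pos by (subst integral_eq_nn_integral) auto
      qed
      have "(\<integral>x. exp (- \<epsilon> - a) * fo x \<partial>mu) \<le> (\<integral>x. exp (lin j \<theta> x) \<partial>mu)"
      proof (rule integral_mono_AE)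
        show "AE x in mu. exp (- \<epsilon> - a) * fo x \<le> exp (lin j \<theta> x)" using lin
        proof eventually_elim
          case (elim x)
          then have "exp (- \<epsilon> - a) * fo x = exp (- \<epsilon> - a + ln (fo x))" by (simp only: exp_add exp_ln)
          then show ?case using elim by (simp only: exp_le_cancel_iff) linarith
        qed
      qed (use int_fo integrable_exp_lin in auto)
      then have 1: "exp (- \<epsilon> - a) \<le> (\<integral>x. exp (lin j \<theta> x) \<partial>mu)" using int_fo by simp
      have "(\<integral>x. exp (lin j \<theta> x) \<partial>mu) \<le> (\<integral>x. exp (\<epsilon> - a) * fo x \<partial>mu)"
      proof (rule integral_mono_AE)
        show "AE x in mu. exp (lin j \<theta> x) \<le> exp (\<epsilon> - a) * fo x" using lin
        proof eventually_elim
          case (elim x)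
          then have "exp (\<epsilon> - a) * fo x = exp (\<epsilon> - a + ln (fo x))" by (simp only: exp_add exp_ln)
          then show ?case using elim by (simp only: exp_le_cancel_iff) linarith
        qed
      qed (use int_fo integrable_exp_lin in auto)
      then have 2: "(\<integral>x. exp (lin j \<theta> x) \<partial>mu) \<le> exp (\<epsilon> - a)" using int_fo by simp
      have 3: "- \<epsilon> - a \<le> psi j \<theta>" "psi j \<theta> \<le> \<epsilon> - a"
        unfolding psi_def using 1 2 integral_exp_lin_pos[of j \<theta>]
        by (simp add: ln_ge_iff, metis exp_gt_zero ln_exp ln_le_cancel_iff)
      show ?thesis using lin
      proof eventually_elim
        case (elim x)
        have "ln (dens j \<theta> x) = - psi j \<theta> + lin j \<theta> x" by (simp add: dens_def)
        moreover have "2 * (1 + K) / real b ^ s = 2 * \<epsilon>" by (simp add: \<epsilon>_def)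
        ultimately show ?case using elim 3 by linarith
      qed
    qed
    have mass: "ennreal (exp (- (\<kappa> * real b))) \<le> emeasure (prior j) S"
    proof -
      define V where "V = sqrt (real m) * ((4 * E) ^ s * (2 * real L / n ^ s) ^ k)"
      define U where "U = sqrt (real m) * r ^ (m - 1)"
      have U: "ennreal U \<le> emeasure (hyperplane_lebesgue m) S"
        unfolding U_def S_def by (rule hyperplane_hball_ge) (use m r sum0 in auto)
      have V: "emeasure (hyperplane_lebesgue m) (Theta j) \<le> ennreal V"
        using hyperplane_Theta_le[OF s L1, of k] by (simp add: j_def m_def V_def E_def n_def)
      have mono: "emeasure (hyperplane_lebesgue m) S \<le> emeasure (hyperplane_lebesgue m) (Theta j)"
        using sub Theta_sets[OF j(1)] j(2) by (intro emeasure_mono) auto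
      have Upos: "0 < U" using m r by (simp add: U_def)
      have Vpos: "0 < V" using m E L1 n by (simp add: V_def)
      obtain x where x: "emeasure (hyperplane_lebesgue m) S = ennreal x" "0 \<le> x"
        using mono V by (metis ennreal_cases ennreal_less_top leD le_less_trans top_greatest)
      obtain y where y: "emeasure (hyperplane_lebesgue m) (Theta j) = ennreal y" "0 \<le> y"
        using V by (metis ennreal_cases ennreal_less_top leD)
      have xU: "U \<le> x" using U x Upos by (simp add: ennreal_le_iff)
      have yV: "y \<le> V" using V y Vpos by (simp add: ennreal_le_iff)
      have xy: "x \<le> y" using mono x y by (simp add: ennreal_le_iff)
      have "Theta j \<inter> S = S" using sub by auto
      then have "emeasure (prior j) S = ennreal x / ennreal y"
        using prior_emeasure[OF j(1)] S x y j(2) by simp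
      also have "\<dots> = ennreal (x / y)" using x xU Upos xy by (intro divide_ennreal) auto
      finally have eq: "emeasure (prior j) S = ennreal (x / y)" .
      have "U / V \<le> x / y" using xU yV Upos Vpos xy by (intro frac_le) auto
      moreover have "exp (- (\<kappa> * real b)) \<le> U / V"
      proof -
        have "m - 1 = s + k" by (simp add: m_def)
        then have "U / V = r ^ s * r ^ k / ((4 * E) ^ s * (2 * real L / n ^ s) ^ k)"
          using m by (simp add: U_def V_def power_add)
        also have "(2 * real L / n ^ s) ^ k = (2 * real L) ^ k * r ^ k"
          by (simp add: r_def power_divide)
        also have "r ^ s * r ^ k / ((4 * E) ^ s * ((2 * real L) ^ k * r ^ k)) = r ^ s / ((4 * E) ^ s * (2 * real L) ^ k)"
          using r(1) by simp
        also have "\<dots> = 1 / (n ^ (s * s) * ((4 * E) ^ s * (2 * real L) ^ k))"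
          by (simp add: r_def power_divide power_mult)
        finally have UV: "U / V = 1 / (n ^ (s * s) * ((4 * E) ^ s * (2 * real L) ^ k))" .
        have le_exp: "x ^ i \<le> exp (x * real i)" if "0 \<le> x" for x :: real and i
        proof -
          have "x \<le> exp x" using exp_ge_add_one_self[of x] by linarith
          then have "x ^ i \<le> exp x ^ i" using that by (intro power_mono) auto
          then show ?thesis by (simp add: exp_of_nat2_mult)
        qed
        have "n ^ (s * s) * ((4 * E) ^ s * (2 * real L) ^ k) \<le> exp (n * real (s * s)) * (exp (4 * E * real s) * exp (2 * real L * real k))"
          using n E by (intro mult_mono le_exp) auto
        also have "\<dots> = exp (n * real (s * s) + 4 * E * real s + 2 * real L * real k)" by (simp add: exp_add)
        also have "\<dots> \<le> exp (\<kappa> * real b)"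
        proof -
          have "n * real (s * s) = real s ^ 3 * real b" by (simp add: n(1) power3_eq_cube)
          moreover have "4 * E * real s * 1 \<le> 4 * E * real s * real b" using E b by (intro mult_left_mono) auto
          moreover have "2 * real L * real k \<le> 2 * real L * (real s * real b)"
            using n(1) by (intro mult_left_mono) (auto simp: n_def)
          ultimately show ?thesis by (simp add: \<kappa>_def algebra_simps)
        qed
        finally have "1 / exp (\<kappa> * real b) \<le> U / V"
          unfolding UV using n E L1 by (intro divide_left_mono) auto
        then show ?thesis by (simp add: exp_minus field_simps)
      qed
      ultimately show ?thesis unfolding eq by (intro ennreal_leI) linarith
    qed
    show "\<exists>S\<in>sets (coords (s * b - 1 + Suc s)). S \<subseteq> Theta (s * b - 1, Suc s, L) \<and>
     ennreal (exp (- (\<kappa> * real b))) \<le> emeasure (prior (s * b - 1, Suc s, L)) S \<and>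
     (\<forall>\<theta>\<in>S. AE x in mu. \<bar>ln (dens (s * b - 1, Suc s, L) \<theta> x) - ln (fo x)\<bar> \<le> 2 * (1 + K) / real b ^ s)"
      using S sub mass close unfolding m_def j_def k_def by (intro bexI[of _ S]) auto
  qed
qed

section \<open>Hellinger affinity of products and mixtures\<close>

text \<open>A square root on all of \<open>ennreal\<close>, so that integrals can be treated before
  they are known to be finite.\<close>

definition esqrt :: "ennreal \<Rightarrow> ennreal" where
  "esqrt x = (if x = top then top else ennreal (sqrt (enn2real x)))"

lemma esqrt_ennreal [simp]: "0 \<le> x \<Longrightarrow> esqrt (ennreal x) = ennreal (sqrt x)"
  by (simp add: esqrt_def)

lemma esqrt_top [simp]: "esqrt top = top"
  by (simp add: esqrt_def)

lemma esqrt_0 [simp]: "esqrt 0 = 0"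
  by (simp add: esqrt_def)

lemma esqrt_1 [simp]: "esqrt 1 = 1"
  by (simp add: esqrt_def)

lemma esqrt_measurable [measurable]: "esqrt \<in> borel_measurable borel"
  unfolding esqrt_def[abs_def] by measurable

lemma esqrt_square: "esqrt x * esqrt x = x"
  by (cases x) (auto simp: ennreal_mult[symmetric])

lemma esqrt_mono: "x \<le> y \<Longrightarrow> esqrt x \<le> esqrt y"
  by (cases x; cases y) (auto simp: top_unique)

lemma esqrt_of_square: "esqrt (x * x) = x"
  by (cases x) (auto simp: ennreal_mult[symmetric] ennreal_mult_eq_top_iff ennreal_top_mult)

lemma esqrt_mult: "esqrt (x * y) = esqrt x * esqrt y"
proof -
  have "x * y = (esqrt x * esqrt y) * (esqrt x * esqrt y)"
    using esqrt_square[of x] esqrt_square[of y] by (metis mult.assoc mult.commute)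
  then show ?thesis by (simp only: esqrt_of_square)
qed

lemma esqrt_add_le: "esqrt (x + y) \<le> esqrt x + esqrt y"
proof -
  have "x + y = esqrt x * esqrt x + esqrt y * esqrt y" by (simp only: esqrt_square)
  also have "\<dots> \<le> (esqrt x + esqrt y) * (esqrt x + esqrt y)"
    unfolding distrib_left distrib_right by (intro add_mono order_refl) simp_all
  finally have "esqrt (x + y) \<le> esqrt ((esqrt x + esqrt y) * (esqrt x + esqrt y))" by (rule esqrt_mono)
  then show ?thesis by (simp only: esqrt_of_square)
qed

lemma esqrt_sum_le: "esqrt (\<Sum>i\<in>I. f i) \<le> (\<Sum>i\<in>I. esqrt (f i))"
proof (induction I rule: infinite_finite_induct)
  case (insert i I)
  have "esqrt (f i + (\<Sum>i\<in>I. f i)) \<le> esqrt (f i) + esqrt (\<Sum>i\<in>I. f i)" by (rule esqrt_add_le)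
  also have "\<dots> \<le> esqrt (f i) + (\<Sum>i\<in>I. esqrt (f i))" by (intro add_mono insert order_refl)
  finally show ?case using insert by simp
qed auto

lemma esqrt_suminf_le: "esqrt (\<Sum>i. f i) \<le> (\<Sum>i. esqrt (f i))"
proof -
  let ?S = "\<Sum>i. esqrt (f i)"
  have "(\<Sum>i. f i) \<le> ?S * ?S"
  proof (rule suminf_le_const)
    fix n
    have "(\<Sum>i<n. f i) = esqrt (\<Sum>i<n. f i) * esqrt (\<Sum>i<n. f i)" by (simp only: esqrt_square)
    also have "\<dots> \<le> ?S * ?S"
      using order_trans[OF esqrt_sum_le sum_le_suminf[of "\<lambda>i. esqrt (f i)" "{..<n}"]] by (intro mult_mono) auto
    finally show "(\<Sum>i<n. f i) \<le> ?S * ?S" .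
  qed auto
  from esqrt_mono[OF this] show ?thesis by (simp only: esqrt_of_square)
qed

text \<open>The one-observation bound is assumed for every weight w. This lets the induction absorb
  the likelihood of the first n observations into the weight and apply the bound to the last
  observation with the others fixed, although a mixture of products is not a product.\<close>

lemma affinity_power:
  fixes M :: "'a measure" and P :: "real measure" and g :: "'a \<Rightarrow> real \<Rightarrow> ennreal"
  assumes "sigma_finite_measure M" "sigma_finite_measure P"
    and g: "(\<lambda>(\<theta>, x). g \<theta> x) \<in> borel_measurable (M \<Otimes>\<^sub>M P)"
    and step: "\<And>w. w \<in> borel_measurable M \<Longrightarrow>
      (\<integral>\<^sup>+x. esqrt (\<integral>\<^sup>+\<theta>. w \<theta> * g \<theta> x \<partial>M) \<partial>P) \<le> \<rho> * esqrt (\<integral>\<^sup>+\<theta>. w \<theta> \<partial>M)"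
    and w: "w \<in> borel_measurable M"
  shows "(\<integral>\<^sup>+X. esqrt (\<integral>\<^sup>+\<theta>. w \<theta> * (\<Prod>i=1..n. g \<theta> (X i)) \<partial>M) \<partial>(\<Pi>\<^sub>M i\<in>{1..n}. P))
    \<le> \<rho> ^ n * esqrt (\<integral>\<^sup>+\<theta>. w \<theta> \<partial>M)"
proof -
  interpret M: sigma_finite_measure M by fact
  interpret P: product_sigma_finite "\<lambda>_::nat. P" using assms(2) by (simp add: product_sigma_finite_def)
  have g3: "(\<lambda>x. g (f x) (h x)) \<in> borel_measurable N" if [measurable]: "f \<in> N \<rightarrow>\<^sub>M M" "h \<in> N \<rightarrow>\<^sub>M P" for f h and N :: "((nat \<Rightarrow> real) \<times> 'a) measure"
  proof -
    have "(\<lambda>x. (f x, h x)) \<in> N \<rightarrow>\<^sub>M M \<Otimes>\<^sub>M P" by measurable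
    from measurable_compose[OF this g] show ?thesis by simp
  qed
  show ?thesis
  proof (induction n)
    case 0
    then show ?case by (simp add: PiM_empty)
  next
    case (Suc n)
    have prod_meas: "(\<lambda>(X, \<theta>). w \<theta> * (\<Prod>i=1..n. g \<theta> (X i))) \<in> borel_measurable ((\<Pi>\<^sub>M i\<in>I. P) \<Otimes>\<^sub>M M)"
      if "{1..n} \<subseteq> I" for n and I :: "nat set"
    proof -
      have "(\<lambda>z. g (snd z) (fst z i)) \<in> borel_measurable ((\<Pi>\<^sub>M i\<in>I. P) \<Otimes>\<^sub>M M)" if "i \<in> {1..n}" for i
        by (rule g3[where f=snd and h="\<lambda>z. fst z i"], measurable) (use that \<open>{1..n} \<subseteq> I\<close> in auto)
      then show ?thesis using w unfolding case_prod_beta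
        by (intro borel_measurable_times_ennreal borel_measurable_prod_ennreal measurable_compose[OF measurable_snd]) auto
    qed
    have ins: "{1..Suc n} = insert (Suc n) {1..n}" by auto
    let ?f = "\<lambda>X. esqrt (\<integral>\<^sup>+\<theta>. w \<theta> * (\<Prod>i=1..Suc n. g \<theta> (X i)) \<partial>M)"
    have meas: "?f \<in> borel_measurable (\<Pi>\<^sub>M i\<in>{1..Suc n}. P)"
      by (intro measurable_compose[OF _ esqrt_measurable] M.borel_measurable_nn_integral prod_meas) auto
    have "(\<integral>\<^sup>+X. ?f X \<partial>(\<Pi>\<^sub>M i\<in>{1..Suc n}. P)) = (\<integral>\<^sup>+X. (\<integral>\<^sup>+y. ?f (X(Suc n := y)) \<partial>P) \<partial>(\<Pi>\<^sub>M i\<in>{1..n}. P))"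
      using meas unfolding ins by (intro P.product_nn_integral_insert) auto
    also have "\<dots> \<le> (\<integral>\<^sup>+X. \<rho> * esqrt (\<integral>\<^sup>+\<theta>. w \<theta> * (\<Prod>i=1..n. g \<theta> (X i)) \<partial>M) \<partial>(\<Pi>\<^sub>M i\<in>{1..n}. P))"
    proof (intro nn_integral_mono)
      fix X assume X: "X \<in> space (\<Pi>\<^sub>M i\<in>{1..n}. P)"
      have "(\<integral>\<^sup>+y. ?f (X(Suc n := y)) \<partial>P) = (\<integral>\<^sup>+y. esqrt (\<integral>\<^sup>+\<theta>. (w \<theta> * (\<Prod>i=1..n. g \<theta> (X i))) * g \<theta> y \<partial>M) \<partial>P)"
        by (intro nn_integral_cong arg_cong[where f=esqrt]) (simp add: prod.cl_ivl_Suc mult.assoc)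
      also have "\<dots> \<le> \<rho> * esqrt (\<integral>\<^sup>+\<theta>. w \<theta> * (\<Prod>i=1..n. g \<theta> (X i)) \<partial>M)"
        using measurable_Pair2[OF prod_meas[OF order_refl] X] by (intro step) simp
      finally show "(\<integral>\<^sup>+y. ?f (X(Suc n := y)) \<partial>P) \<le> \<rho> * esqrt (\<integral>\<^sup>+\<theta>. w \<theta> * (\<Prod>i=1..n. g \<theta> (X i)) \<partial>M)" .
    qed
    also have "\<dots> = \<rho> * (\<integral>\<^sup>+X. esqrt (\<integral>\<^sup>+\<theta>. w \<theta> * (\<Prod>i=1..n. g \<theta> (X i)) \<partial>M) \<partial>(\<Pi>\<^sub>M i\<in>{1..n}. P))"
      by (intro nn_integral_cmult measurable_compose[OF _ esqrt_measurable] M.borel_measurable_nn_integral prod_meas) auto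
    also have "\<dots> \<le> \<rho> * (\<rho> ^ n * esqrt (\<integral>\<^sup>+\<theta>. w \<theta> \<partial>M))"
      by (intro mult_left_mono Suc.IH) auto
    finally show ?case by (simp add: mult.assoc)
  qed
qed

section \<open>Hellinger distance and affinity\<close>

definition prob_density :: "(real \<Rightarrow> real) \<Rightarrow> bool" where
  "prob_density f \<longleftrightarrow> f \<in> borel_measurable mu \<and> (AE x in mu. 0 < f x) \<and> (\<integral>\<^sup>+x. ennreal (f x) \<partial>mu) = 1"

lemma prob_density_dens: "prob_density (dens j \<theta>)"
  by (simp add: prob_density_def dens_pos nn_integral_dens measurable_mu_borel)

lemma prob_densityD:
  assumes "prob_density f"
  shows "f \<in> borel_measurable mu" "AE x in mu. 0 < f x" "integrable mu f" "(\<integral>x. f x \<partial>mu) = 1"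
proof -
  show f: "f \<in> borel_measurable mu" "AE x in mu. 0 < f x" using assms by (auto simp: prob_density_def)
  then have nn: "AE x in mu. 0 \<le> f x" by (auto elim: eventually_mono)
  show "integrable mu f" using assms f nn by (intro integrableI_nonneg) (auto simp: prob_density_def)
  show "(\<integral>x. f x \<partial>mu) = 1" using assms f nn by (subst integral_eq_nn_integral) (auto simp: prob_density_def)
qed

lemma integrable_sqrt_mult:
  assumes "prob_density f" "prob_density g"
  shows "integrable mu (\<lambda>x. sqrt (f x * g x))"
proof (rule Bochner_Integration.integrable_bound)
  show "integrable mu (\<lambda>x. (f x + g x) / 2)" using assms prob_densityD(3) by auto
  show "(\<lambda>x. sqrt (f x * g x)) \<in> borel_measurable mu" using assms[THEN prob_densityD(1)] by measurable
  show "AE x in mu. norm (sqrt (f x * g x)) \<le> norm ((f x + g x) / 2)"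
    using assms[THEN prob_densityD(2)]
  proof eventually_elim
    case (elim x)
    then show ?case using arith_geo_mean_sqrt[of "f x" "g x"] by simp
  qed
qed

lemma hellinger_square:
  assumes "prob_density f" "prob_density g"
  shows "(hellinger f g)\<^sup>2 = 2 - 2 * (\<integral>x. sqrt (f x * g x) \<partial>mu)"
    and "integrable mu (\<lambda>x. (sqrt (f x) - sqrt (g x))\<^sup>2)"
proof -
  have eq: "AE x in mu. (sqrt (f x) - sqrt (g x))\<^sup>2 = f x + g x - 2 * sqrt (f x * g x)"
    using assms[THEN prob_densityD(2)]
    by eventually_elim (simp add: power2_diff real_sqrt_mult)
  note [measurable] = assms[THEN prob_densityD(1)]
  have "integrable mu (\<lambda>x. f x + g x - 2 * sqrt (f x * g x))"
    using assms[THEN prob_densityD(3)] integrable_sqrt_mult[OF assms] by simp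
  then show int: "integrable mu (\<lambda>x. (sqrt (f x) - sqrt (g x))\<^sup>2)"
    by (subst integrable_cong_AE[OF _ _ eq]) measurable
  have "(\<integral>x. (sqrt (f x) - sqrt (g x))\<^sup>2 \<partial>mu) = (\<integral>x. f x + g x - 2 * sqrt (f x * g x) \<partial>mu)"
    by (rule integral_cong_AE[OF _ _ eq]) measurable
  also have "\<dots> = 2 - 2 * (\<integral>x. sqrt (f x * g x) \<partial>mu)"
    using assms[THEN prob_densityD(3)] integrable_sqrt_mult[OF assms] assms[THEN prob_densityD(4)] by simp
  moreover have "0 \<le> (\<integral>x. (sqrt (f x) - sqrt (g x))\<^sup>2 \<partial>mu)" by simp
  ultimately show "(hellinger f g)\<^sup>2 = 2 - 2 * (\<integral>x. sqrt (f x * g x) \<partial>mu)"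
    by (simp add: hellinger_def)
qed

lemma hellinger_nonneg: "0 \<le> hellinger f g"
  by (simp add: hellinger_def)

lemma hellinger_square_triangle:
  assumes "prob_density f" "prob_density g" "prob_density h"
  shows "(hellinger f h)\<^sup>2 \<le> 2 * (hellinger f g)\<^sup>2 + 2 * (hellinger g h)\<^sup>2"
proof -
  have "(\<integral>x. (sqrt (f x) - sqrt (h x))\<^sup>2 \<partial>mu) \<le> (\<integral>x. 2 * (sqrt (f x) - sqrt (g x))\<^sup>2 + 2 * (sqrt (g x) - sqrt (h x))\<^sup>2 \<partial>mu)"
  proof (rule integral_mono)
    fix x
    have "(a - c)\<^sup>2 \<le> 2 * (a - b)\<^sup>2 + 2 * (b - c)\<^sup>2" for a b c :: real
    proof -
      have "2 * (a - b)\<^sup>2 + 2 * (b - c)\<^sup>2 - (a - c)\<^sup>2 = ((a - b) - (b - c))\<^sup>2" by algebra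
      then show ?thesis by (metis diff_ge_0_iff_ge zero_le_power2)
    qed
    then show "(sqrt (f x) - sqrt (h x))\<^sup>2 \<le> 2 * (sqrt (f x) - sqrt (g x))\<^sup>2 + 2 * (sqrt (g x) - sqrt (h x))\<^sup>2" .
  qed (use hellinger_square(2) assms in auto)
  then show ?thesis using hellinger_square(2) assms by (simp add: hellinger_def)
qed

lemma hellinger_commute: "hellinger f g = hellinger g f"
  by (simp add: hellinger_def power2_commute)

lemma nn_integral_sqrt_mult:
  assumes "prob_density f" "prob_density g"
  shows "(\<integral>\<^sup>+x. ennreal (sqrt (f x * g x)) \<partial>mu) = ennreal (1 - (hellinger f g)\<^sup>2 / 2)"
proof -
  have "AE x in mu. 0 \<le> sqrt (f x * g x)"
    using assms[THEN prob_densityD(2)] by eventually_elim simp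
  then have "(\<integral>\<^sup>+x. ennreal (sqrt (f x * g x)) \<partial>mu) = ennreal (\<integral>x. sqrt (f x * g x) \<partial>mu)"
    by (intro nn_integral_eq_integral integrable_sqrt_mult assms)
  then show ?thesis using hellinger_square(1)[OF assms] by (simp add: diff_divide_distrib)
qed

lemma hellinger_square_le_2:
  assumes "prob_density f" "prob_density g"
  shows "(hellinger f g)\<^sup>2 \<le> 2"
proof -
  have "0 \<le> (\<integral>x. sqrt (f x * g x) \<partial>mu)"
    using assms[THEN prob_densityD(2)] by (intro integral_nonneg_AE) (auto elim: eventually_elim2)
  then show ?thesis using hellinger_square(1)[OF assms] by simp
qed

text \<open>By the tangent bound \<open>sqrt a \<le> (a / t + t) / 2\<close> at \<open>t = sqrt p\<close>.\<close>

lemma nn_integral_sqrt_le: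
  fixes f :: "'a \<Rightarrow> real"
  assumes [measurable]: "v \<in> borel_measurable M" "f \<in> borel_measurable M" and f: "\<And>\<theta>. 0 < f \<theta>"
    and v: "(\<integral>\<^sup>+\<theta>. v \<theta> \<partial>M) \<le> 1" and p: "0 \<le> p" "(\<integral>\<^sup>+\<theta>. v \<theta> * ennreal (f \<theta>) \<partial>M) = ennreal p"
  shows "(\<integral>\<^sup>+\<theta>. v \<theta> * ennreal (sqrt (f \<theta>)) \<partial>M) \<le> ennreal (sqrt p)"
proof (cases "p = 0")
  case True
  then have "(\<integral>\<^sup>+\<theta>. v \<theta> * ennreal (f \<theta>) \<partial>M) = 0" using p(2) by simp
  then have "AE \<theta> in M. v \<theta> * ennreal (f \<theta>) = 0"
    by (subst (asm) nn_integral_0_iff_AE) auto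
  then have "AE \<theta> in M. v \<theta> * ennreal (sqrt (f \<theta>)) = 0"
    by eventually_elim (use f in \<open>auto simp: ennreal_eq_0_iff dest: leD\<close>)
  then have "(\<integral>\<^sup>+\<theta>. v \<theta> * ennreal (sqrt (f \<theta>)) \<partial>M) = (\<integral>\<^sup>+\<theta>. 0 \<partial>M)" by (rule nn_integral_cong_AE)
  then show ?thesis by simp
next
  case False
  define t where "t = sqrt p"
  have t: "t > 0" "t * t = p" using False p(1) by (auto simp: t_def)
  have "(\<integral>\<^sup>+\<theta>. v \<theta> * ennreal (sqrt (f \<theta>)) \<partial>M) \<le> (\<integral>\<^sup>+\<theta>. ennreal (1 / (2 * t)) * (v \<theta> * ennreal (f \<theta>)) + ennreal (t / 2) * v \<theta> \<partial>M)"
  proof (rule nn_integral_mono)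
    fix \<theta>
    have "0 \<le> (sqrt (f \<theta>) - t)\<^sup>2" by simp
    then have "0 \<le> (sqrt (f \<theta>))\<^sup>2 + t\<^sup>2 - 2 * sqrt (f \<theta>) * t" by (simp only: power2_diff)
    then have "2 * t * sqrt (f \<theta>) \<le> f \<theta> + t * t" using f[of \<theta>] by (simp add: power2_eq_square[of t] mult_ac)
    then have "sqrt (f \<theta>) \<le> (f \<theta> + t * t) / (2 * t)"
      using t(1) by (simp add: pos_le_divide_eq mult.commute)
    also have "\<dots> = 1 / (2 * t) * f \<theta> + t / 2" using t(1) by (simp add: add_divide_distrib)
    finally have "ennreal (sqrt (f \<theta>)) \<le> ennreal (1 / (2 * t)) * ennreal (f \<theta>) + ennreal (t / 2)"
      using t(1) f[of \<theta>] by (simp add: ennreal_mult[symmetric] ennreal_plus[symmetric] less_imp_le del: ennreal_plus)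
    from mult_left_mono[OF this, of "v \<theta>"]
    show "v \<theta> * ennreal (sqrt (f \<theta>)) \<le> ennreal (1 / (2 * t)) * (v \<theta> * ennreal (f \<theta>)) + ennreal (t / 2) * v \<theta>"
      by (simp add: distrib_left mult_ac)
  qed
  also have "\<dots> = ennreal (1 / (2 * t)) * ennreal p + ennreal (t / 2) * (\<integral>\<^sup>+\<theta>. v \<theta> \<partial>M)"
    by (simp add: nn_integral_add nn_integral_cmult p(2))
  also have "\<dots> \<le> ennreal (1 / (2 * t)) * ennreal p + ennreal (t / 2) * 1"
    by (intro add_mono mult_left_mono v order_refl) auto
  also have "\<dots> = ennreal (p / (2 * t) + t / 2)"
    using t p(1) by (simp add: ennreal_mult[symmetric] ennreal_plus[symmetric] del: ennreal_plus)
  also have "p / (2 * t) + t / 2 = t" using t by (simp add: t(2)[symmetric])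
  finally show ?thesis by (simp add: t_def)
qed

text \<open>After normalizing w the mixture is itself a density q. By concavity of the square root
  its affinity to \<open>f1\<close> is at least the average over the components, so q stays within d
  / 2 of \<open>f1\<close>. The squared triangle inequality leaves \<open>d^2 / 4\<close> for the
  squared distance from q to \<open>fo\<close>, hence affinity at most \<open>1 - d^2 / 8\<close>,
  and homogeneity restores the factor \<open>esqrt W\<close>.\<close>

lemma mixture_affinity:
  fixes M :: "'a measure" and f :: "'a \<Rightarrow> real \<Rightarrow> real"
  assumes "sigma_finite_measure M" and f: "(\<lambda>(\<theta>, x). f \<theta> x) \<in> borel_measurable (M \<Otimes>\<^sub>M mu)"
    and pos: "\<And>\<theta> x. 0 < f \<theta> x" and dens: "\<And>\<theta>. \<theta> \<in> space M \<Longrightarrow> prob_density (f \<theta>)"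
    and f1: "prob_density f1" "\<And>x. 0 < f1 x" and fo: "prob_density fo"
    and near: "AE \<theta> in M. (hellinger f1 (f \<theta>))\<^sup>2 \<le> d\<^sup>2 / 4" and far: "d\<^sup>2 \<le> (hellinger f1 fo)\<^sup>2"
    and w[measurable]: "w \<in> borel_measurable M"
  shows "(\<integral>\<^sup>+x. esqrt (\<integral>\<^sup>+\<theta>. w \<theta> * ennreal (f \<theta> x / fo x) \<partial>M) \<partial>(density mu (\<lambda>x. ennreal (fo x))))
    \<le> ennreal (1 - d\<^sup>2 / 8) * esqrt (\<integral>\<^sup>+\<theta>. w \<theta> \<partial>M)"
proof -
  interpret M: sigma_finite_measure M by fact
  interpret PS: pair_sigma_finite M mu ..
  note [measurable] = f prob_densityD(1)[OF f1(1)] prob_densityD(1)[OF fo]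
  have fm[measurable]: "(\<lambda>z. f (snd z) (fst z)) \<in> borel_measurable (mu \<Otimes>\<^sub>M M)"
    using measurable_compose[OF measurable_pair_swap' f] by (simp add: case_prod_beta)
  have fx[measurable]: "(\<lambda>\<theta>. f \<theta> x) \<in> borel_measurable M" if "x \<in> space mu" for x
    using measurable_Pair1[OF f that] by simp
  define W where "W = (\<integral>\<^sup>+\<theta>. w \<theta> \<partial>M)"
  have d2: "d\<^sup>2 \<le> 2" using far hellinger_square_le_2[OF f1(1) fo] by linarith
  \<comment> \<open>Total masses 0 and \<infinity> cannot be normalized. In the first case the
    left-hand side is 0; in the second the right-hand side is \<infinity>, because
    \<open>1 - d^2 / 8\<close> is positive.\<close>
  consider "W = 0" | "W = top" | "W \<noteq> 0" "W \<noteq> top" by blast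
  then show ?thesis
  proof cases
    case 1
    then have "AE \<theta> in M. w \<theta> = 0" unfolding W_def by (subst (asm) nn_integral_0_iff_AE) auto
    then have "(\<integral>\<^sup>+\<theta>. w \<theta> * ennreal (f \<theta> x / fo x) \<partial>M) = (\<integral>\<^sup>+\<theta>. 0 \<partial>M)" for x
      by (intro nn_integral_cong_AE) (auto elim: eventually_mono)
    then show ?thesis by simp
  next
    case 2
    then show ?thesis using d2 by (simp add: W_def ennreal_mult_top)
  next
    case 3
    then obtain Wr where Wr: "W = ennreal Wr" "0 < Wr"
      by (cases W) (auto simp: ennreal_eq_0_iff less_le)
    define v where "v \<theta> = ennreal (1 / Wr) * w \<theta>" for \<theta>
    have [measurable]: "v \<in> borel_measurable M" unfolding v_def by measurable
    have wv: "w \<theta> = ennreal Wr * v \<theta>" for \<theta>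
      using Wr(2) by (simp add: v_def mult.assoc[symmetric] ennreal_mult[symmetric])
    have v1: "(\<integral>\<^sup>+\<theta>. v \<theta> \<partial>M) = 1"
      using Wr unfolding v_def by (simp add: nn_integral_cmult W_def[symmetric] ennreal_mult[symmetric])
    define p where "p x = (\<integral>\<^sup>+\<theta>. v \<theta> * ennreal (f \<theta> x) \<partial>M)" for x
    have p_meas[measurable]: "p \<in> borel_measurable mu"
      unfolding p_def by (intro M.borel_measurable_nn_integral) (simp add: case_prod_beta)
    have p1: "(\<integral>\<^sup>+x. p x \<partial>mu) = 1"
    proof -
      have "(\<integral>\<^sup>+x. p x \<partial>mu) = (\<integral>\<^sup>+\<theta>. (\<integral>\<^sup>+x. v \<theta> * ennreal (f \<theta> x) \<partial>mu) \<partial>M)"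
        unfolding p_def by (rule PS.Fubini') (simp add: case_prod_beta)
      also have "\<dots> = (\<integral>\<^sup>+\<theta>. v \<theta> \<partial>M)"
      proof (intro nn_integral_cong)
        fix \<theta> assume "\<theta> \<in> space M"
        from dens[OF this] show "(\<integral>\<^sup>+x. v \<theta> * ennreal (f \<theta> x) \<partial>mu) = v \<theta>"
          by (subst nn_integral_cmult) (auto simp: prob_density_def)
      qed
      finally show ?thesis using v1 by simp
    qed
    have p_fin: "AE x in mu. p x \<noteq> top"
      using nn_integral_PInf_AE[OF p_meas] p1 by simp
    define q where "q x = enn2real (p x)" for x
    have q0: "0 \<le> q x" for x by (simp add: q_def)
    have pq: "AE x in mu. p x = ennreal (q x)" using p_fin by eventually_elim (simp add: q_def less_top)
    have [measurable]: "q \<in> borel_measurable mu" unfolding q_def by measurable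
    have q1: "(\<integral>\<^sup>+x. ennreal (q x) \<partial>mu) = 1"
      using p1 nn_integral_cong_AE[OF pq] by simp
    have q_pos: "AE x in mu. 0 < q x"
      using pq AE_space[of mu]
    proof eventually_elim
      case (elim x)
      have "p x \<noteq> 0"
      proof
        assume "p x = 0"
        then have "AE \<theta> in M. v \<theta> * ennreal (f \<theta> x) = 0"
          unfolding p_def using elim by (subst (asm) nn_integral_0_iff_AE) auto
        then have "AE \<theta> in M. v \<theta> = 0"
          by eventually_elim (use pos in \<open>auto simp: ennreal_eq_0_iff dest: leD\<close>)
        then have "(\<integral>\<^sup>+\<theta>. v \<theta> \<partial>M) = (\<integral>\<^sup>+\<theta>. 0 \<partial>M)" by (rule nn_integral_cong_AE)
        then show False using v1 by simp
      qed
      then show ?case using elim q0[of x] by (cases "q x = 0") auto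
    qed
    have q: "prob_density q" using q_pos q1 by (simp add: prob_density_def)
    have near_q: "(hellinger f1 q)\<^sup>2 \<le> d\<^sup>2 / 4"
    proof -
      have "ennreal (1 - d\<^sup>2 / 8) = (\<integral>\<^sup>+\<theta>. v \<theta> * ennreal (1 - d\<^sup>2 / 8) \<partial>M)"
        by (simp add: nn_integral_multc v1)
      also have "\<dots> \<le> (\<integral>\<^sup>+\<theta>. v \<theta> * (\<integral>\<^sup>+x. ennreal (sqrt (f1 x * f \<theta> x)) \<partial>mu) \<partial>M)"
      proof (rule nn_integral_mono_AE)
        show "AE \<theta> in M. v \<theta> * ennreal (1 - d\<^sup>2 / 8) \<le> v \<theta> * (\<integral>\<^sup>+x. ennreal (sqrt (f1 x * f \<theta> x)) \<partial>mu)"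
          using near AE_space[of M]
        proof eventually_elim
          case (elim \<theta>)
          show ?case unfolding nn_integral_sqrt_mult[OF f1(1) dens[OF elim(2)]]
            using elim by (intro mult_left_mono ennreal_leI) auto
        qed
      qed
      also have "\<dots> = (\<integral>\<^sup>+\<theta>. (\<integral>\<^sup>+x. v \<theta> * ennreal (sqrt (f1 x * f \<theta> x)) \<partial>mu) \<partial>M)"
      proof (intro nn_integral_cong)
        fix \<theta> assume "\<theta> \<in> space M"
        from prob_densityD(1)[OF dens[OF this]] have [measurable]: "f \<theta> \<in> borel_measurable mu" .
        show "v \<theta> * (\<integral>\<^sup>+x. ennreal (sqrt (f1 x * f \<theta> x)) \<partial>mu) = (\<integral>\<^sup>+x. v \<theta> * ennreal (sqrt (f1 x * f \<theta> x)) \<partial>mu)"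
          by (rule nn_integral_cmult[symmetric]) measurable
      qed
      also have "\<dots> = (\<integral>\<^sup>+x. (\<integral>\<^sup>+\<theta>. v \<theta> * ennreal (sqrt (f1 x * f \<theta> x)) \<partial>M) \<partial>mu)"
        by (rule PS.Fubini'[symmetric]) (simp add: case_prod_beta)
      also have "\<dots> \<le> (\<integral>\<^sup>+x. ennreal (sqrt (f1 x * q x)) \<partial>mu)"
      proof (rule nn_integral_mono_AE)
        show "AE x in mu. (\<integral>\<^sup>+\<theta>. v \<theta> * ennreal (sqrt (f1 x * f \<theta> x)) \<partial>M) \<le> ennreal (sqrt (f1 x * q x))"
          using pq AE_space[of mu]
        proof eventually_elim
        case (elim x)
        have "(\<integral>\<^sup>+\<theta>. v \<theta> * ennreal (sqrt (f1 x * f \<theta> x)) \<partial>M) = (\<integral>\<^sup>+\<theta>. ennreal (sqrt (f1 x)) * (v \<theta> * ennreal (sqrt (f \<theta> x))) \<partial>M)"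
          using f1(2) pos by (intro nn_integral_cong) (simp add: real_sqrt_mult ennreal_mult less_imp_le mult_ac)
        also have "\<dots> = ennreal (sqrt (f1 x)) * (\<integral>\<^sup>+\<theta>. v \<theta> * ennreal (sqrt (f \<theta> x)) \<partial>M)"
          using elim(2) by (intro nn_integral_cmult) measurable
        also have "\<dots> \<le> ennreal (sqrt (f1 x)) * ennreal (sqrt (q x))"
          using elim pos q0 v1 by (intro mult_left_mono nn_integral_sqrt_le) (auto simp: p_def)
        finally show ?case using f1(2)[of x] q0[of x] by (simp add: real_sqrt_mult ennreal_mult less_imp_le)
        qed
      qed
      also have "\<dots> = ennreal (1 - (hellinger f1 q)\<^sup>2 / 2)" by (rule nn_integral_sqrt_mult[OF f1(1) q])
      finally have "1 - d\<^sup>2 / 8 \<le> 1 - (hellinger f1 q)\<^sup>2 / 2"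
        using hellinger_square_le_2[OF f1(1) q] by (subst (asm) ennreal_le_iff) auto
      then show ?thesis by simp
    qed
    have "(hellinger f1 fo)\<^sup>2 \<le> 2 * (hellinger f1 q)\<^sup>2 + 2 * (hellinger q fo)\<^sup>2"
      by (rule hellinger_square_triangle[OF f1(1) q fo])
    then have aff: "1 - (hellinger q fo)\<^sup>2 / 2 \<le> 1 - d\<^sup>2 / 8" using near_q far by simp
    have "(\<integral>\<^sup>+x. esqrt (\<integral>\<^sup>+\<theta>. w \<theta> * ennreal (f \<theta> x / fo x) \<partial>M) \<partial>(density mu (\<lambda>x. ennreal (fo x)))) =
      (\<integral>\<^sup>+x. ennreal (fo x) * esqrt (\<integral>\<^sup>+\<theta>. w \<theta> * ennreal (f \<theta> x / fo x) \<partial>M) \<partial>mu)"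
    proof (rule nn_integral_density)
      have "(\<lambda>x. \<integral>\<^sup>+\<theta>. w \<theta> * ennreal (f \<theta> x / fo x) \<partial>M) \<in> borel_measurable mu"
        by (intro M.borel_measurable_nn_integral) (simp add: case_prod_beta)
      then show "(\<lambda>x. esqrt (\<integral>\<^sup>+\<theta>. w \<theta> * ennreal (f \<theta> x / fo x) \<partial>M)) \<in> borel_measurable mu" by measurable
    qed measurable
    also have "\<dots> = (\<integral>\<^sup>+x. esqrt W * ennreal (sqrt (q x * fo x)) \<partial>mu)"
    proof (rule nn_integral_cong_AE)
      show "AE x in mu. ennreal (fo x) * esqrt (\<integral>\<^sup>+\<theta>. w \<theta> * ennreal (f \<theta> x / fo x) \<partial>M) = esqrt W * ennreal (sqrt (q x * fo x))"
        using pq prob_densityD(2)[OF fo] AE_space[of mu]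
      proof eventually_elim
      case (elim x)
      have "(\<integral>\<^sup>+\<theta>. w \<theta> * ennreal (f \<theta> x / fo x) \<partial>M) = (\<integral>\<^sup>+\<theta>. (W * ennreal (1 / fo x)) * (v \<theta> * ennreal (f \<theta> x)) \<partial>M)"
      proof (intro nn_integral_cong)
        fix \<theta>
        have "ennreal (f \<theta> x / fo x) = ennreal (1 / fo x) * ennreal (f \<theta> x)"
          using elim pos[of \<theta> x] by (simp add: ennreal_mult[symmetric])
        then show "w \<theta> * ennreal (f \<theta> x / fo x) = (W * ennreal (1 / fo x)) * (v \<theta> * ennreal (f \<theta> x))"
          by (simp add: wv Wr(1) mult_ac)
      qed
      also have "\<dots> = W * ennreal (1 / fo x) * p x"
        unfolding p_def using elim by (intro nn_integral_cmult) measurable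
      also have "\<dots> = W * ennreal (q x / fo x)"
        using elim q0[of x] by (simp add: mult.assoc ennreal_mult[symmetric])
      finally have "esqrt (\<integral>\<^sup>+\<theta>. w \<theta> * ennreal (f \<theta> x / fo x) \<partial>M) = esqrt W * ennreal (sqrt (q x / fo x))"
        using elim q0[of x] by (simp add: esqrt_mult)
      moreover have "ennreal (fo x) * ennreal (sqrt (q x / fo x)) = ennreal (sqrt (q x * fo x))"
      proof -
        have "fo x * sqrt (q x / fo x) = sqrt (fo x * fo x) * sqrt (q x / fo x)" using elim by simp
        also have "\<dots> = sqrt (q x * fo x)" unfolding real_sqrt_mult[symmetric] using elim by (simp add: mult.commute)
        finally show ?thesis using elim q0[of x] by (simp add: ennreal_mult[symmetric])
      qed
      ultimately show ?case by (simp add: mult_ac)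
      qed
    qed
    also have "\<dots> = esqrt W * ennreal (1 - (hellinger q fo)\<^sup>2 / 2)"
      by (subst nn_integral_cmult) (auto simp: nn_integral_sqrt_mult[OF q fo])
    also have "\<dots> \<le> esqrt W * ennreal (1 - d\<^sup>2 / 8)"
      by (intro mult_left_mono ennreal_leI aff) auto
    finally show ?thesis by (simp add: W_def mult.commute)
  qed
qed

section \<open>Posterior mass far from the true density\<close>

text \<open>Completing the square in the last variable reduces the form to the Schur complement if
  the pivot \<beta> is positive. As the form is only semidefinite, \<beta> may be 0; then the mixed
  terms vanish, since otherwise the form would be affine and unbounded below in the last
  variable.\<close>

lemma sum_of_squares:
  fixes b :: "nat \<Rightarrow> nat \<Rightarrow> real"
  assumes "\<And>i l. b i l = b l i" "\<And>u. 0 \<le> (\<Sum>i<N. \<Sum>l<N. b i l * u i * u l)"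
  shows "\<exists>a. \<forall>u. (\<Sum>i<N. \<Sum>l<N. b i l * u i * u l) = (\<Sum>l<N. (\<Sum>i<N. a l i * u i)\<^sup>2)"
  using assms
proof (induction N arbitrary: b)
  case (Suc N)
  define \<beta> where "\<beta> = b N N"
  define lf where "lf u = (\<Sum>i<N. b i N * u i)" for u
  define Q where "Q u = (\<Sum>i<N. \<Sum>l<N. b i l * u i * u l)" for u
  have expand: "(\<Sum>i<Suc N. \<Sum>l<Suc N. b i l * u i * u l) = Q u + 2 * u N * lf u + \<beta> * (u N)\<^sup>2" for u
  proof -
    have "(\<Sum>i<N. b i N * u i * u N) = u N * lf u" "(\<Sum>l<N. b N l * u N * u l) = u N * lf u"
      unfolding lf_def sum_distrib_left using Suc.prems(1)[of N] by (auto intro!: sum.cong simp: mult_ac)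
    then show ?thesis by (simp add: Q_def \<beta>_def sum.distrib power2_eq_square)
  qed
  have ext: "Q (u(N := t)) = Q u" "lf (u(N := t)) = lf u" for u t
    by (simp_all add: Q_def lf_def)
  have nn: "0 \<le> Q u + 2 * t * lf u + \<beta> * t\<^sup>2" for u t
    using Suc.prems(2)[of "u(N := t)"] unfolding expand ext by simp
  have "\<beta> \<ge> 0" using nn[of "\<lambda>_. 0" 1] by (simp add: Q_def lf_def)
  then consider "\<beta> > 0" | "\<beta> = 0" by linarith
  then show ?case
  proof cases
    case 1
    have eq: "(\<Sum>i<N. \<Sum>l<N. (b i l - b i N * b l N / \<beta>) * u i * u l) = Q u - (lf u)\<^sup>2 / \<beta>" for u
    proof -
      have "(lf u)\<^sup>2 / \<beta> = (\<Sum>i<N. \<Sum>l<N. b i N * b l N / \<beta> * u i * u l)"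
        unfolding power2_eq_square lf_def sum_product sum_divide_distrib by (intro sum.cong refl) (simp add: mult_ac)
      then show ?thesis by (simp add: Q_def sum_subtractf left_diff_distrib)
    qed
    have "0 \<le> Q u - (lf u)\<^sup>2 / \<beta>" for u
    proof -
      have "2 * (- lf u / \<beta>) * lf u = - 2 * ((lf u)\<^sup>2 / \<beta>)" "\<beta> * (- lf u / \<beta>)\<^sup>2 = (lf u)\<^sup>2 / \<beta>"
        using 1 by (simp_all add: power2_eq_square)
      then show ?thesis using nn[of u "- lf u / \<beta>"] by linarith
    qed
    then have psd: "0 \<le> (\<Sum>i<N. \<Sum>l<N. (b i l - b i N * b l N / \<beta>) * u i * u l)" for u
      unfolding eq .
    have sym: "b i l - b i N * b l N / \<beta> = b l i - b l N * b i N / \<beta>" for i l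
    proof -
      have "b i l = b l i" by (rule Suc.prems(1))
      then show ?thesis by (simp only: mult.commute)
    qed
    obtain a where a: "\<And>u. Q u - (lf u)\<^sup>2 / \<beta> = (\<Sum>l<N. (\<Sum>i<N. a l i * u i)\<^sup>2)"
      using Suc.IH[OF sym psd] unfolding eq by blast
    define a' where "a' l i = (if l < N then (if i < N then a l i else 0) else if i < N then b i N / sqrt \<beta> else sqrt \<beta>)" for l i
    show ?thesis
    proof (intro exI[of _ a'] allI)
      fix u
      have s: "sqrt \<beta> > 0" "sqrt \<beta> * sqrt \<beta> = \<beta>" using 1 by auto
      have "(\<Sum>l<Suc N. (\<Sum>i<Suc N. a' l i * u i)\<^sup>2) = (\<Sum>l<N. (\<Sum>i<N. a l i * u i)\<^sup>2) + (lf u / sqrt \<beta> + sqrt \<beta> * u N)\<^sup>2"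
        by (simp add: a'_def lf_def sum_divide_distrib)
      also have "(lf u / sqrt \<beta> + sqrt \<beta> * u N)\<^sup>2 = (lf u)\<^sup>2 / \<beta> + 2 * u N * lf u + \<beta> * (u N)\<^sup>2"
        using s 1 by (simp add: power2_sum power_divide power_mult_distrib)
      finally show "(\<Sum>i<Suc N. \<Sum>l<Suc N. b i l * u i * u l) = (\<Sum>l<Suc N. (\<Sum>i<Suc N. a' l i * u i)\<^sup>2)"
        unfolding expand a[symmetric] by simp
    qed
  next
    case 2
    have lf0: "lf u = 0" for u
    proof (rule ccontr)
      assume "lf u \<noteq> 0"
      \<comment> \<open>This choice of the last variable gives the form the value -1.\<close>
      then have "2 * (- (Q u + 1) / (2 * lf u)) * lf u = - (Q u + 1)" by (simp add: field_simps)
      then show False using nn[of u "- (Q u + 1) / (2 * lf u)"] 2 by (simp only: mult_zero_left)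
    qed
    have psd: "0 \<le> (\<Sum>i<N. \<Sum>l<N. b i l * u i * u l)" for u using nn[of u 0] by (simp add: Q_def)
    obtain a where a: "\<And>u. Q u = (\<Sum>l<N. (\<Sum>i<N. a l i * u i)\<^sup>2)"
      using Suc.IH[OF Suc.prems(1) psd] unfolding Q_def by blast
    show ?thesis
      by (intro exI[of _ "\<lambda>l i. if l < N \<and> i < N then a l i else 0"] allI, unfold expand)
         (simp add: 2 lf0 a)
  qed
qed auto

text \<open>For integers the truncated square dominates |z| - 1, so a two-sided geometric series
  bounds the sum, uniformly in Z. The constant 12 is 3 * 4, from \<open>exp \<kappa> \<le> 3\<close>
  and \<open>1 - exp (- \<kappa>) \<ge> \<kappa> / 2\<close>.\<close>

lemma lattice_sum_bound:
  fixes \<kappa> :: real and Z :: int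
  assumes "0 < \<kappa>" "\<kappa> \<le> 1"
  shows "(\<Sum>z\<in>{-Z..Z}. exp (- (\<kappa> * (max 0 (\<bar>real_of_int z\<bar> - 1))\<^sup>2))) \<le> 12 / \<kappa>"
proof (cases "0 \<le> Z")
  case True
  define r where "r = exp (- \<kappa>)"
  have r: "0 < r" "r < 1" using assms by (auto simp: r_def)
  have tb: "exp (- (\<kappa> * (max 0 (\<bar>real_of_int z\<bar> - 1))\<^sup>2)) \<le> exp \<kappa> * r ^ nat \<bar>z\<bar>" for z :: int
  proof -
    have "\<bar>real_of_int z\<bar> - 1 \<le> (max 0 (\<bar>real_of_int z\<bar> - 1))\<^sup>2"
    proof (cases "\<bar>z\<bar> \<le> 1")
      case True
      then have "\<bar>real_of_int z\<bar> \<le> 1" by linarith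
      then show ?thesis by (smt (verit) zero_le_power2)
    next
      case False
      then have "1 \<le> \<bar>real_of_int z\<bar> - 1" by linarith
      then show ?thesis using self_le_power[of "\<bar>real_of_int z\<bar> - 1" 2] by simp
    qed
    then have "\<kappa> * (\<bar>real_of_int z\<bar> - 1) \<le> \<kappa> * (max 0 (\<bar>real_of_int z\<bar> - 1))\<^sup>2"
      using assms by (intro mult_left_mono) auto
    then have "exp (- (\<kappa> * (max 0 (\<bar>real_of_int z\<bar> - 1))\<^sup>2)) \<le> exp (\<kappa> + real (nat \<bar>z\<bar>) * - \<kappa>)"
      by (simp add: algebra_simps)
    also have "\<dots> = exp \<kappa> * r ^ nat \<bar>z\<bar>" unfolding exp_add r_def exp_of_nat_mult ..
    finally show ?thesis .
  qed
  have geo: "(\<Sum>i<n. r ^ i) \<le> 1 / (1 - r)" for n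
    unfolding sum_gp_strict using r by (simp add: divide_right_mono)
  have "(\<Sum>z\<in>{-Z..Z}. r ^ nat \<bar>z\<bar>) \<le> (\<Sum>z\<in>{0..Z}. r ^ nat \<bar>z\<bar>) + (\<Sum>z\<in>{-Z..0}. r ^ nat \<bar>z\<bar>)"
  proof -
    have "{-Z..Z} = {0..Z} \<union> {-Z..0}" using True by auto
    moreover have "0 \<le> (\<Sum>z\<in>{0..Z} \<inter> {-Z..0}. r ^ nat \<bar>z\<bar>)" using r by (intro sum_nonneg) auto
    ultimately show ?thesis
      using sum.union_inter[of "{0..Z}" "{-Z..0}" "\<lambda>z. r ^ nat \<bar>z\<bar>"] by simp
  qed
  also have "(\<Sum>z\<in>{-Z..0}. r ^ nat \<bar>z\<bar>) = (\<Sum>z\<in>{0..Z}. r ^ nat \<bar>z\<bar>)"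
    by (rule sum.reindex_bij_witness[of _ uminus uminus]) auto
  also have "(\<Sum>z\<in>{0..Z}. r ^ nat \<bar>z\<bar>) = (\<Sum>i<Suc (nat Z). r ^ i)"
    by (rule sum.reindex_bij_witness[of _ int nat]) (use True in auto)
  also have "\<dots> + \<dots> \<le> 2 / (1 - r)" using geo[of "Suc (nat Z)"] by simp
  finally have sum: "(\<Sum>z\<in>{-Z..Z}. r ^ nat \<bar>z\<bar>) \<le> 2 / (1 - r)" .
  have "\<kappa> / 2 \<le> \<kappa> / (1 + \<kappa>)" using assms by (intro divide_left_mono) auto
  also have "\<dots> = 1 - 1 / (1 + \<kappa>)" using assms by (simp add: field_simps)
  also have "\<dots> \<le> 1 - r"
  proof -
    have "r = 1 / exp \<kappa>" by (simp add: r_def exp_minus inverse_eq_divide)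
    also have "\<dots> \<le> 1 / (1 + \<kappa>)" using assms exp_ge_add_one_self[of \<kappa>] by (intro divide_left_mono) auto
    finally show ?thesis by simp
  qed
  finally have "2 / (1 - r) \<le> 2 / (\<kappa> / 2)" using assms by (intro divide_left_mono) auto
  then have s4: "(\<Sum>z\<in>{-Z..Z}. r ^ nat \<bar>z\<bar>) \<le> 4 / \<kappa>" using sum by simp
  have "exp \<kappa> \<le> exp 1" using assms by simp
  then have e3: "exp \<kappa> \<le> 3" using exp_le by linarith
  have "(\<Sum>z\<in>{-Z..Z}. exp (- (\<kappa> * (max 0 (\<bar>real_of_int z\<bar> - 1))\<^sup>2))) \<le> (\<Sum>z\<in>{-Z..Z}. exp \<kappa> * r ^ nat \<bar>z\<bar>)"
    by (intro sum_mono tb)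
  also have "\<dots> = exp \<kappa> * (\<Sum>z\<in>{-Z..Z}. r ^ nat \<bar>z\<bar>)" by (simp add: sum_distrib_left)
  also have "\<dots> \<le> 3 * (4 / \<kappa>)" using e3 s4 r by (intro mult_mono) (auto intro!: sum_nonneg)
  finally show ?thesis by simp
qed (use assms in auto)

lemma exp_diff_bounds:
  fixes x y l :: real
  assumes "\<bar>x\<bar> \<le> l" "\<bar>y\<bar> \<le> l"
  shows "exp (- l) * \<bar>x - y\<bar> \<le> \<bar>exp x - exp y\<bar>" "\<bar>exp x - exp y\<bar> \<le> exp l * \<bar>x - y\<bar>"
proof -
  have *: "exp (- l) * (b - a) \<le> exp b - exp a \<and> exp b - exp a \<le> exp l * (b - a)"
    if "a \<le> b" "\<bar>a\<bar> \<le> l" "\<bar>b\<bar> \<le> l" for a b :: real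
  proof
    have "exp (- l) * (b - a) \<le> exp a * (exp (b - a) - 1)"
    proof (intro mult_mono)
      show "b - a \<le> exp (b - a) - 1" using exp_ge_add_one_self[of "b - a"] by linarith
    qed (use that in auto)
    also have "\<dots> = exp b - exp a" by (simp add: right_diff_distrib exp_add[symmetric])
    finally show "exp (- l) * (b - a) \<le> exp b - exp a" .
    have "exp b * (1 - exp (a - b)) \<le> exp l * (b - a)"
    proof (intro mult_mono)
      show "1 - exp (a - b) \<le> b - a" using exp_ge_add_one_self[of "a - b"] by linarith
    qed (use that in auto)
    then show "exp b - exp a \<le> exp l * (b - a)" by (simp add: right_diff_distrib exp_add[symmetric])
  qed
  show "exp (- l) * \<bar>x - y\<bar> \<le> \<bar>exp x - exp y\<bar>" "\<bar>exp x - exp y\<bar> \<le> exp l * \<bar>x - y\<bar>"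
    using *[of x y] *[of y x] assms by (cases "x \<le> y"; simp add: abs_if split: if_splits; linarith)+
qed

text \<open>The main term of \<open>A_j\<close> is \<open>exp (L / 2)\<close> times factors of at
  least 1, and the equation for \<gamma> makes \<open>sqrt (1 - 4 * \<gamma>) / \<gamma>\<close>
  equal to 0.13 / 0.0056. So the logarithm is at least L / 2 and contributes
  \<open>2 * m * L\<close>; the term with \<open>C_j\<close> contributes
  \<open>8 * (m + L)\<close>.\<close>

lemma eta_lower_bounds:
  assumes \<gamma>: "0 < \<gamma>" "\<gamma> < 1 / 4" "0.13 * \<gamma> / sqrt (1 - 4 * \<gamma>) = 0.0056" and q: "q \<ge> 1"
  shows "2 * real (k + q) * real L + 8 * real (k + q) \<le> eta \<gamma> (k, q, L)"
    "8 * (real (k + q) + real L) \<le> eta \<gamma> (k, q, L)"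
proof -
  define d where "d = sqrt (1 - 4 * \<gamma>)"
  have d: "d > 0" using \<gamma> by (simp add: d_def)
  have "0.13 * \<gamma> = 0.0056 * d" using \<gamma>(3) d unfolding d_def[symmetric] by (simp add: field_simps)
  then have dg: "d / \<gamma> \<ge> 1" using \<gamma>(1) d by (simp add: field_simps)
  have "1 * 1 * 1 * 1 * 1 * exp (real L / 2) \<le> 19.28 * sqrt (real q) * (2 * real q + 1) * 9 ^ (q - 1) * (real L + 1) * exp (real L / 2)"
    using q by (intro mult_mono) auto
  then have A: "exp (real L / 2) \<le> A_const (k, q, L)" unfolding A_const.simps mult_1_left by (rule add_increasing2[rotated]) simp
  have "1 * exp (real L / 2) * 1 \<le> 46.2 * A_const (k, q, L) * (d / \<gamma>)"
    using A dg by (intro mult_mono) auto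
  then have Y: "exp (real L / 2) \<le> 46.2 * A_const (k, q, L) * d / \<gamma>"
    by (simp only: mult_1_left mult_1_right times_divide_eq_right)
  have "ln (exp (real L / 2)) \<le> ln (46.2 * A_const (k, q, L) * d / \<gamma>)"
    by (rule ln_le_cancel_iff[THEN iffD2, OF _ less_le_trans[OF _ Y] Y]) simp_all
  then have ln: "real L / 2 \<le> ln (46.2 * A_const (k, q, L) * sqrt (1 - 4 * \<gamma>) / \<gamma>)"
    by (simp add: d_def del: A_const.simps)
  define X where "X = ln (46.2 * A_const (k, q, L) * sqrt (1 - 4 * \<gamma>) / \<gamma>)"
  define c where "c = 1 / (1 - 4 * \<gamma>)"
  define m where "m = real (k + q)"
  have c: "1 \<le> c" using \<gamma> by (simp add: c_def)
  have eta: "eta \<gamma> (k, q, L) = c * (4 * m * X) + c * (8 * (m + real L))"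
    by (simp add: eta_def X_def c_def m_def del: A_const.simps)
  have m: "0 \<le> m" by (simp add: m_def)
  have X: "real L / 2 \<le> X" using ln by (simp add: X_def)
  have "1 * (4 * m * (real L / 2)) \<le> c * (4 * m * X)"
    using c m X by (intro mult_mono) auto
  then have 1: "2 * m * real L \<le> c * (4 * m * X)" by simp
  have 2: "1 * (8 * (m + real L)) \<le> c * (8 * (m + real L))"
    using c m by (intro mult_right_mono) auto
  have "0 \<le> 2 * m * real L" using m by simp
  then show "8 * (real (k + q) + real L) \<le> eta \<gamma> (k, q, L)"
    using 1 2 unfolding eta m_def[symmetric] by linarith
  have "8 * m \<le> 8 * (m + real L)" by simp
  then show "2 * real (k + q) * real L + 8 * real (k + q) \<le> eta \<gamma> (k, q, L)"
    using 1 2 unfolding eta m_def[symmetric] by linarith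
qed

text \<open>Again by the tangent of the square root, here at the mean of \<open>Y\<close>; means 0
  and \<infinity> are treated separately.\<close>

lemma esqrt_jensen:
  assumes "prob_space P" and [measurable]: "Y \<in> borel_measurable P"
  shows "(\<integral>\<^sup>+x. esqrt (Y x) \<partial>P) \<le> esqrt (\<integral>\<^sup>+x. Y x \<partial>P)"
proof -
  interpret P: prob_space P by fact
  define I where "I = (\<integral>\<^sup>+x. Y x \<partial>P)"
  consider "I = 0" | "I = top" | r where "I = ennreal r" "r > 0"
    by (cases I) (auto simp: less_le)
  then show ?thesis
  proof cases
    case 1
    then have "AE x in P. Y x = 0" unfolding I_def by (subst (asm) nn_integral_0_iff_AE) auto
    then have "(\<integral>\<^sup>+x. esqrt (Y x) \<partial>P) = (\<integral>\<^sup>+x. 0 \<partial>P)"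
      by (intro nn_integral_cong_AE) (auto elim: eventually_mono)
    then show ?thesis by simp
  next
    case 3
    define t where "t = sqrt r"
    have t: "t > 0" "t * t = r" using 3 by (auto simp: t_def)
    have "(\<integral>\<^sup>+x. esqrt (Y x) \<partial>P) \<le> (\<integral>\<^sup>+x. ennreal (1 / (2 * t)) * Y x + ennreal (t / 2) \<partial>P)"
    proof (rule nn_integral_mono)
      fix x
      show "esqrt (Y x) \<le> ennreal (1 / (2 * t)) * Y x + ennreal (t / 2)"
      proof (cases "Y x")
        case (real y)
        have "0 \<le> (sqrt y - t)\<^sup>2" by simp
        then have "0 \<le> (sqrt y)\<^sup>2 + t\<^sup>2 - 2 * sqrt y * t" by (simp only: power2_diff)
        then have "2 * t * sqrt y \<le> y + t * t" using real by (simp add: power2_eq_square[of t] mult_ac)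
        then have "sqrt y \<le> (y + t * t) / (2 * t)" using t(1) by (simp add: pos_le_divide_eq mult.commute)
        also have "\<dots> = 1 / (2 * t) * y + t / 2" using t(1) by (simp add: add_divide_distrib)
        finally show ?thesis using real t(1)
          by (simp add: ennreal_mult[symmetric] ennreal_plus[symmetric] del: ennreal_plus)
      qed (use t in \<open>simp add: ennreal_mult_top\<close>)
    qed
    also have "\<dots> = ennreal (1 / (2 * t)) * ennreal r + ennreal (t / 2)"
      using 3 by (simp add: nn_integral_add nn_integral_cmult I_def P.emeasure_space_1)
    also have "\<dots> = ennreal (r / (2 * t) + t / 2)"
      using t 3 by (simp add: ennreal_mult[symmetric] ennreal_plus[symmetric] del: ennreal_plus)
    also have "r / (2 * t) + t / 2 = t" using t by (simp add: t(2)[symmetric])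
    finally show ?thesis using 3 by (simp add: t_def I_def[symmetric])
  qed (simp add: I_def)
qed

text \<open>In \<open>ennreal\<close> the quotient x / x is at most 1 also for x = 0 and x =
  \<infinity>, so mass at most 1 holds for every model, whatever the volume of its parameter
  set.\<close>

lemma finite_measure_prior:
  assumes "j \<in> J"
  shows "finite_measure (prior j)" "A \<in> sets (coords (num_basis j)) \<Longrightarrow> emeasure (prior j) A \<le> 1"
    "sets (prior j) = sets (coords (num_basis j))" "space (prior j) = space (coords (num_basis j))"
proof -
  show sets: "sets (prior j) = sets (coords (num_basis j))" by (simp add: prior_def)
  show sp: "space (prior j) = space (coords (num_basis j))" by (rule sets_eq_imp_space_eq[OF sets])
  have le: "emeasure (prior j) A \<le> 1" if "A \<in> sets (coords (num_basis j))" for A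
  proof -
    have "emeasure (hyperplane_lebesgue (num_basis j)) (Theta j \<inter> A) \<le> emeasure (hyperplane_lebesgue (num_basis j)) (Theta j)"
      using Theta_sets[OF assms] by (intro emeasure_mono) auto
    then have "emeasure (prior j) A \<le> emeasure (hyperplane_lebesgue (num_basis j)) (Theta j) / emeasure (hyperplane_lebesgue (num_basis j)) (Theta j)"
      unfolding prior_emeasure[OF assms that] by (rule divide_right_mono_ennreal)
    also have "\<dots> \<le> 1"
    proof -
      have "x / x \<le> 1" for x :: ennreal
        by (cases "x = 0 \<or> x = top") (auto simp: less_top)
      then show ?thesis .
    qed
    finally show ?thesis .
  qed
  then show "A \<in> sets (coords (num_basis j)) \<Longrightarrow> emeasure (prior j) A \<le> 1" .
  show "finite_measure (prior j)"
    using le[OF sets.top] by (intro finite_measureI) (auto simp: sp top_unique)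
qed

lemma hellinger_measurable:
  assumes [measurable]: "fo \<in> borel_measurable mu"
  shows "(\<lambda>\<theta>. hellinger (dens j \<theta>) fo) \<in> borel_measurable (coords (num_basis j))"
proof -
  have [measurable]: "(\<lambda>z. dens j (fst z) (snd z)) \<in> borel_measurable (coords (num_basis j) \<Otimes>\<^sub>M mu)"
    using measurable_pair_mu[OF dens_measurable_pair] by (simp add: case_prod_beta)
  have "(\<lambda>\<theta>. \<integral>x. (sqrt (dens j \<theta> x) - sqrt (fo x))\<^sup>2 \<partial>mu) \<in> borel_measurable (coords (num_basis j))"
    by (rule mu.borel_measurable_lebesgue_integral) (unfold case_prod_beta, measurable)
  then show ?thesis unfolding hellinger_def by measurable
qed

section \<open>Hellinger distance against the L2 distance of log densities\<close>

lemma Theta_ln_dens_bound: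
  assumes "j \<in> J" "\<theta> \<in> Theta j"
  shows "AE x in mu. \<bar>ln (dens j \<theta> x)\<bar> \<le> real (snd (snd j))"
proof -
  obtain k q L where j: "j = (k, q, L)" by (cases j) auto
  have q: "0 < q" using assms by (auto simp: J_def j)
  have "AE x in mu. \<bar>dlog 0 (k, q, L) \<theta> x\<bar> \<le> real L"
    using assms(2) q unfolding j by (subst (asm) Theta_iff) auto
  then show ?thesis using AE_mu_open[OF finite.emptyI]
    by eventually_elim (use lin_eq_sp[of _ k q L \<theta>] in \<open>auto simp: j dlog_def dens_def\<close>)
qed

definition logdist2 :: "index \<Rightarrow> (nat \<Rightarrow> real) \<Rightarrow> (nat \<Rightarrow> real) \<Rightarrow> real" where
  "logdist2 j \<theta> \<theta>' = (\<integral>x. (ln (dens j \<theta> x) - ln (dens j \<theta>' x))\<^sup>2 \<partial>mu)"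

text \<open>Square roots of densities are exponentials of half the log densities, which are bounded
  by L / 2; there exp is bi-Lipschitz with constants \<open>exp (- L / 2)\<close> and
  \<open>exp (L / 2)\<close>. Squaring gives \<open>exp (- L)\<close> and \<open>exp L\<close>, and
  the halves give 1 / 4.\<close>

lemma hellinger_logdist2:
  assumes j: "j \<in> J" "\<theta> \<in> Theta j" "\<theta>' \<in> Theta j"
  defines "L \<equiv> real (snd (snd j))"
  shows "exp (- L) / 4 * logdist2 j \<theta> \<theta>' \<le> (hellinger (dens j \<theta>) (dens j \<theta>'))\<^sup>2"
    "(hellinger (dens j \<theta>) (dens j \<theta>'))\<^sup>2 \<le> exp L / 4 * logdist2 j \<theta> \<theta>'"
    "logdist2 j \<theta> \<theta>' \<le> 4 * L\<^sup>2"
proof -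
  let ?a = "\<lambda>x. ln (dens j \<theta> x)" and ?b = "\<lambda>x. ln (dens j \<theta>' x)"
  have bd: "AE x in mu. \<bar>?a x\<bar> \<le> L \<and> \<bar>?b x\<bar> \<le> L"
    using Theta_ln_dens_bound[OF j(1,2)] Theta_ln_dens_bound[OF j(1,3)] unfolding L_def by eventually_elim simp
  have [measurable]: "dens j \<theta> \<in> borel_measurable mu" "dens j \<theta>' \<in> borel_measurable mu"
    by (auto intro: measurable_mu_borel)
  have sq: "AE x in mu. (?a x - ?b x)\<^sup>2 \<le> 4 * L\<^sup>2"
    using bd
  proof eventually_elim
    case (elim x)
    then have "(?a x - ?b x)\<^sup>2 \<le> (2 * L)\<^sup>2" by (intro abs_le_square_iff[THEN iffD1]) auto
    then show ?case by (simp add: power_mult_distrib)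
  qed
  have int: "integrable mu (\<lambda>x. (?a x - ?b x)\<^sup>2)"
    by (rule integrable_mu_bounded[where M="4 * L\<^sup>2"]) (use sq in auto)
  have h: "(hellinger (dens j \<theta>) (dens j \<theta>'))\<^sup>2 = (\<integral>x. (sqrt (dens j \<theta> x) - sqrt (dens j \<theta>' x))\<^sup>2 \<partial>mu)"
    unfolding hellinger_def by (intro real_sqrt_pow2 integral_nonneg) simp
  note inth = hellinger_square(2)[OF prob_density_dens[of j \<theta>] prob_density_dens[of j \<theta>']]
  have pw: "AE x in mu. exp (- L) / 4 * (?a x - ?b x)\<^sup>2 \<le> (sqrt (dens j \<theta> x) - sqrt (dens j \<theta>' x))\<^sup>2 \<and>
     (sqrt (dens j \<theta> x) - sqrt (dens j \<theta>' x))\<^sup>2 \<le> exp L / 4 * (?a x - ?b x)\<^sup>2"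
    using bd
  proof eventually_elim
    case (elim x)
    have sq: "sqrt (dens j \<theta> x) = exp (ln (dens j \<theta> x) / 2)" for \<theta>
      using dens_pos[of j \<theta> x] by (intro real_sqrt_unique) (simp_all add: power2_eq_square exp_add[symmetric])
    have D: "\<bar>?a x / 2 - ?b x / 2\<bar> = \<bar>?a x - ?b x\<bar> / 2" by (simp add: diff_divide_distrib[symmetric])
    note bounds = exp_diff_bounds[of "?a x / 2" "L / 2" "?b x / 2", unfolded D]
    have e2: "(exp (L / 2))\<^sup>2 = exp L" "(exp (- (L / 2)))\<^sup>2 = exp (- L)"
      by (simp_all add: power2_eq_square exp_add[symmetric])
    have pre: "\<bar>?a x / 2\<bar> \<le> L / 2" "\<bar>?b x / 2\<bar> \<le> L / 2" using elim by auto
    have "(exp (- (L / 2)) * (\<bar>?a x - ?b x\<bar> / 2))\<^sup>2 \<le> \<bar>exp (?a x / 2) - exp (?b x / 2)\<bar>\<^sup>2"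
      "\<bar>exp (?a x / 2) - exp (?b x / 2)\<bar>\<^sup>2 \<le> (exp (L / 2) * (\<bar>?a x - ?b x\<bar> / 2))\<^sup>2"
      by (rule power_mono[OF bounds(1)[OF pre]], simp, rule power_mono[OF bounds(2)[OF pre]], simp)
    then show ?case unfolding sq by (simp add: power_mult_distrib power_divide e2)
  qed
  have "exp (- L) / 4 * logdist2 j \<theta> \<theta>' = (\<integral>x. exp (- L) / 4 * (?a x - ?b x)\<^sup>2 \<partial>mu)" by (simp add: logdist2_def)
  also have "\<dots> \<le> (hellinger (dens j \<theta>) (dens j \<theta>'))\<^sup>2"
    unfolding h by (rule integral_mono_AE) (use int inth pw in auto)
  finally show "exp (- L) / 4 * logdist2 j \<theta> \<theta>' \<le> (hellinger (dens j \<theta>) (dens j \<theta>'))\<^sup>2" .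
  have "(hellinger (dens j \<theta>) (dens j \<theta>'))\<^sup>2 \<le> (\<integral>x. exp L / 4 * (?a x - ?b x)\<^sup>2 \<partial>mu)"
    unfolding h by (rule integral_mono_AE) (use int inth pw in auto)
  then show "(hellinger (dens j \<theta>) (dens j \<theta>'))\<^sup>2 \<le> exp L / 4 * logdist2 j \<theta> \<theta>'" by (simp add: logdist2_def)
  have "logdist2 j \<theta> \<theta>' \<le> (\<integral>x. 4 * L\<^sup>2 \<partial>mu)"
    unfolding logdist2_def by (rule integral_mono_AE) (use int sq in auto)
  then show "logdist2 j \<theta> \<theta>' \<le> 4 * L\<^sup>2" by simp
qed

text \<open>Write the quadratic form \<open>u \<mapsto> \<integral>(u\<^sub>0 + \<Sum>\<^sub>i u\<^sub>i B\<^sub>i)\<^sup>2\<close> as a sum of squares and put \<open>u\<^sub>0 = - psi \<theta>\<close>.\<close>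

lemma logdist2_coordinates:
  "\<exists>c. (\<forall>l. c l \<in> borel_measurable (coords (num_basis j))) \<and>
     (\<forall>\<theta> \<theta>'. logdist2 j \<theta> \<theta>' = (\<Sum>l<Suc (num_basis j). (c l \<theta> - c l \<theta>')\<^sup>2))"
proof -
  define N where "N = Suc (num_basis j)"
  define e where "e i x = (if i = 0 then 1 else Bspline j i x)" for i and x :: real
  define u where "u \<theta> i = (if i = 0 then - psi j \<theta> else \<theta> i)" for \<theta> and i :: nat
  have em[measurable]: "e i \<in> borel_measurable mu" for i
    unfolding e_def[abs_def] by (cases "i = 0") (auto intro: measurable_mu_borel)
  have eb: "\<exists>B. \<forall>x\<in>{0..1}. \<bar>e i x\<bar> \<le> B" if "i < N" for i
  proof (cases "i = 0")
    case False
    have "lin j (\<lambda>l. if l = i then 1 else 0) x = e i x" for x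
    proof -
      have "lin j (\<lambda>l. if l = i then 1 else 0) x = (\<Sum>l=1..num_basis j. if l = i then e i x else 0)"
        unfolding lin_def using False by (intro sum.cong) (auto simp: e_def)
      then show ?thesis using False that by (simp add: N_def)
    qed
    then show ?thesis using lin_bounded[of j "\<lambda>l. if l = i then 1 else 0"] by simp
  qed (auto simp: e_def)
  have int: "integrable mu (\<lambda>x. e i x * e l x)" if i: "i < N" and l: "l < N" for i l
  proof -
    obtain B where B: "\<And>x. x \<in> {0..1} \<Longrightarrow> \<bar>e i x\<bar> \<le> B" using eb[OF i] by blast
    obtain B' where B': "\<And>x. x \<in> {0..1} \<Longrightarrow> \<bar>e l x\<bar> \<le> B'" using eb[OF l] by blast
    from B B' have "\<bar>e i x * e l x\<bar> \<le> B * B'" if "x \<in> {0..1}" for x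
      unfolding abs_mult using that by (intro mult_mono) force+
    then show ?thesis
      by (intro integrable_mu_bounded[where M="B * B'"]) (auto intro!: AE_I2)
  qed
  define b where "b i l = (\<integral>x. e i x * e l x \<partial>mu)" for i l
  have form: "(\<Sum>i<N. \<Sum>l<N. b i l * v i * v l) = (\<integral>x. (\<Sum>i<N. v i * e i x)\<^sup>2 \<partial>mu)" for v
  proof -
    have "(\<integral>x. (\<Sum>i<N. v i * e i x)\<^sup>2 \<partial>mu) = (\<integral>x. (\<Sum>i<N. \<Sum>l<N. v i * v l * (e i x * e l x)) \<partial>mu)"
      unfolding power2_eq_square sum_product by (simp add: mult_ac)
    also have "\<dots> = (\<Sum>i<N. \<Sum>l<N. v i * v l * b i l)"
      unfolding b_def using int
      by (subst Bochner_Integration.integral_sum, auto intro!: Bochner_Integration.integrable_sum sum.cong)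
    finally show ?thesis by (simp add: mult_ac)
  qed
  obtain a where a: "\<And>v. (\<Sum>i<N. \<Sum>l<N. b i l * v i * v l) = (\<Sum>l<N. (\<Sum>i<N. a l i * v i)\<^sup>2)"
    using sum_of_squares[of b N] unfolding form by (auto simp: b_def mult.commute)
  define c where "c l \<theta> = (\<Sum>i<N. a l i * u \<theta> i)" for l \<theta>
  have "c l \<in> borel_measurable (coords (num_basis j))" for l
  proof -
    have "(\<lambda>\<theta>. u \<theta> i) \<in> borel_measurable (coords (num_basis j))" if "i < N" for i
    proof (cases "i = 0")
      case False
      then have "i \<in> {1..num_basis j}" using that by (auto simp: N_def)
      then show ?thesis using False unfolding u_def by simp measurable
    next
      case True
      have "(\<lambda>\<theta>. - psi j \<theta>) \<in> borel_measurable (coords (num_basis j))" by measurable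
      then show ?thesis using True by (simp add: u_def)
    qed
    then show ?thesis unfolding c_def[abs_def] by measurable
  qed
  moreover have "logdist2 j \<theta> \<theta>' = (\<Sum>l<Suc (num_basis j). (c l \<theta> - c l \<theta>')\<^sup>2)" for \<theta> \<theta>'
  proof -
    have ln: "ln (dens j \<theta> x) = (\<Sum>i<N. u \<theta> i * e i x)" for \<theta> x
    proof -
      have "{..<N} = insert 0 {1..num_basis j}" by (auto simp: N_def)
      then have "(\<Sum>i<N. u \<theta> i * e i x) = - psi j \<theta> + (\<Sum>i=1..num_basis j. u \<theta> i * e i x)"
        by (simp add: u_def e_def)
      also have "(\<Sum>i=1..num_basis j. u \<theta> i * e i x) = lin j \<theta> x"
        unfolding lin_def by (intro sum.cong) (auto simp: u_def e_def)
      finally show ?thesis by (simp add: dens_def)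
    qed
    have "logdist2 j \<theta> \<theta>' = (\<integral>x. (\<Sum>i<N. (u \<theta> i - u \<theta>' i) * e i x)\<^sup>2 \<partial>mu)"
      unfolding logdist2_def ln sum_subtractf[symmetric] left_diff_distrib ..
    also have "\<dots> = (\<Sum>l<N. (c l \<theta> - c l \<theta>')\<^sup>2)"
      unfolding form[symmetric] a c_def by (simp add: right_diff_distrib sum_subtractf)
    finally show ?thesis by (simp add: N_def)
  qed
  ultimately show ?thesis by blast
qed

text \<open>The expected square root of the likelihood ratio integrated over \<open>A\<close>:
  subadditive in \<open>A\<close>, and through Markov's inequality a bound in probability for the
  integrated ratio itself.\<close>

definition piece :: "(real \<Rightarrow> real) \<Rightarrow> nat \<Rightarrow> index \<Rightarrow> (nat \<Rightarrow> real) set \<Rightarrow> ennreal" where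
  "piece fo n j A = (\<integral>\<^sup>+X. esqrt (\<integral>\<^sup>+\<theta>. indicator A \<theta> * (\<Prod>i=1..n. ennreal (dens j \<theta> (X i) / fo (X i))) \<partial>prior j) \<partial>sample_law fo n)"

section \<open>Expected square roots of integrated likelihood ratios\<close>

context
  fixes fo :: "real \<Rightarrow> real" and j :: index
  assumes fo: "prob_density fo" and j: "j \<in> J"
begin

lemma fo_measurable [measurable]: "fo \<in> borel_measurable mu"
  using prob_densityD(1)[OF fo] .

lemma prob_space_fo: "prob_space (density mu (\<lambda>x. ennreal (fo x)))"
proof (rule prob_spaceI)
  have "emeasure (density mu (\<lambda>x. ennreal (fo x))) (space mu) = (\<integral>\<^sup>+x. ennreal (fo x) * indicator (space mu) x \<partial>mu)"
    using sets.top[of mu] by (subst emeasure_density) auto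
  also have "\<dots> = (\<integral>\<^sup>+x. ennreal (fo x) \<partial>mu)" by (intro nn_integral_cong) simp
  finally show "emeasure (density mu (\<lambda>x. ennreal (fo x))) (space (density mu (\<lambda>x. ennreal (fo x)))) = 1"
    using fo by (simp add: prob_density_def)
qed

lemma sets_prior [measurable_cong]: "sets (prior j) = sets (coords (num_basis j))"
  using finite_measure_prior[OF j] by simp

lemma likelihood_measurable:
  assumes "sets M = sets (coords (num_basis j))"
  shows "(\<lambda>(\<theta>, x). ennreal (dens j \<theta> x / fo x)) \<in> borel_measurable (M \<Otimes>\<^sub>M density mu (\<lambda>x. ennreal (fo x)))"
proof -
  have [measurable]: "(\<lambda>z. dens j (fst z) (snd z)) \<in> borel_measurable (coords (num_basis j) \<Otimes>\<^sub>M mu)"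
    using measurable_pair_mu[OF dens_measurable_pair] by (simp add: case_prod_beta)
  have "(\<lambda>(\<theta>, x). ennreal (dens j \<theta> x / fo x)) \<in> borel_measurable (coords (num_basis j) \<Otimes>\<^sub>M mu)"
    unfolding case_prod_beta by measurable
  then show ?thesis
    using assms by (subst measurable_cong_sets[OF sets_pair_measure_cong refl]) simp_all
qed

text \<open>Restricting the prior to \<open>A\<close> by a density makes \<open>piece\<close> the
  case w = 1 of the product bound, with total mass at most 1.\<close>

lemma piece_power:
  assumes A: "A \<in> sets (coords (num_basis j))"
    and step: "\<And>w. w \<in> borel_measurable (coords (num_basis j)) \<Longrightarrow>
      (\<integral>\<^sup>+x. esqrt (\<integral>\<^sup>+\<theta>. w \<theta> * ennreal (dens j \<theta> x / fo x) \<partial>density (prior j) (indicator A)) \<partial>(density mu (\<lambda>x. ennreal (fo x))))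
       \<le> \<rho> * esqrt (\<integral>\<^sup>+\<theta>. w \<theta> \<partial>density (prior j) (indicator A))"
  shows "piece fo n j A \<le> \<rho> ^ n"
proof -
  let ?M = "density (prior j) (indicator A)" and ?P = "density mu (\<lambda>x. ennreal (fo x))"
  have [measurable]: "A \<in> sets (prior j)" using A by (simp add: sets_prior)
  have M1: "emeasure ?M (space ?M) \<le> 1"
  proof -
    have "emeasure ?M (space ?M) = (\<integral>\<^sup>+\<theta>. indicator A \<theta> * indicator (space (prior j)) \<theta> \<partial>prior j)"
      by (subst emeasure_density) auto
    also have "\<dots> = (\<integral>\<^sup>+\<theta>. indicator A \<theta> \<partial>prior j)" by (intro nn_integral_cong) simp
    also have "\<dots> = emeasure (prior j) A" by simp
    finally show ?thesis using finite_measure_prior(2)[OF j A] by simp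
  qed
  then have "finite_measure ?M" by (intro finite_measureI) (auto simp: top_unique)
  then have sf: "sigma_finite_measure ?M" by (rule finite_measure.axioms(1))
  have sP: "sigma_finite_measure ?P" using prob_space_fo by (simp add: prob_space_imp_sigma_finite)
  have setsM: "sets ?M = sets (coords (num_basis j))" by (simp add: sets_prior)
  have "(\<integral>\<^sup>+X. esqrt (\<integral>\<^sup>+\<theta>. 1 * (\<Prod>i=1..n. ennreal (dens j \<theta> (X i) / fo (X i))) \<partial>?M) \<partial>(\<Pi>\<^sub>M i\<in>{1..n}. ?P))
    \<le> \<rho> ^ n * esqrt (\<integral>\<^sup>+\<theta>. 1 \<partial>?M)"
    by (rule affinity_power[OF sf sP likelihood_measurable[OF setsM]])
       (use step setsM in \<open>auto cong: measurable_cong_sets\<close>)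
  also have "\<dots> \<le> \<rho> ^ n * 1"
    using esqrt_mono[OF M1] by (intro mult_left_mono) auto
  also have "(\<integral>\<^sup>+X. esqrt (\<integral>\<^sup>+\<theta>. 1 * (\<Prod>i=1..n. ennreal (dens j \<theta> (X i) / fo (X i))) \<partial>?M) \<partial>(\<Pi>\<^sub>M i\<in>{1..n}. ?P)) = piece fo n j A"
    unfolding piece_def sample_law_def
  proof (intro nn_integral_cong arg_cong[where f=esqrt])
    fix X assume X: "X \<in> space (\<Pi>\<^sub>M i\<in>{1..n}. ?P)"
    have "(\<lambda>\<theta>. \<Prod>i=1..n. ennreal (dens j \<theta> (X i) / fo (X i))) \<in> borel_measurable (prior j)"
    proof (intro borel_measurable_prod_ennreal)
      fix i assume "i \<in> {1..n}"
      then have "X i \<in> space ?P" using X by (auto simp: space_PiM)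
      from measurable_Pair1[OF likelihood_measurable[OF sets_prior] this]
      show "(\<lambda>\<theta>. ennreal (dens j \<theta> (X i) / fo (X i))) \<in> borel_measurable (prior j)" by simp
    qed
    then show "(\<integral>\<^sup>+\<theta>. 1 * (\<Prod>i=1..n. ennreal (dens j \<theta> (X i) / fo (X i))) \<partial>?M) =
      (\<integral>\<^sup>+\<theta>. indicator A \<theta> * (\<Prod>i=1..n. ennreal (dens j \<theta> (X i) / fo (X i))) \<partial>prior j)"
      by (subst nn_integral_density) auto
  qed
  finally show ?thesis by simp
qed

text \<open>The one-step factor is 1: Jensen's inequality takes the square root out of the integral,
  and every likelihood ratio has mean 1 under \<open>fo\<close>.\<close>

lemma piece_le_1:
  assumes A: "A \<in> sets (coords (num_basis j))"
  shows "piece fo n j A \<le> 1"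
proof -
  have "piece fo n j A \<le> 1 ^ n"
  proof (rule piece_power[OF A])
    fix w :: "(nat \<Rightarrow> real) \<Rightarrow> ennreal" assume w: "w \<in> borel_measurable (coords (num_basis j))"
    let ?M = "density (prior j) (indicator A)" and ?P = "density mu (\<lambda>x. ennreal (fo x))"
    interpret fin: finite_measure "prior j" by (rule finite_measure_prior(1)[OF j])
    have [measurable]: "A \<in> sets (prior j)" using A by (simp add: sets_prior)
    have "emeasure ?M (space ?M) = (\<integral>\<^sup>+\<theta>. indicator A \<theta> * indicator (space (prior j)) \<theta> \<partial>prior j)"
      by (subst emeasure_density) auto
    also have "\<dots> = (\<integral>\<^sup>+\<theta>. indicator A \<theta> \<partial>prior j)" by (intro nn_integral_cong) simp
    also have "\<dots> = emeasure (prior j) A" by simp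
    finally interpret M: finite_measure ?M by (intro finite_measureI) simp
    interpret P: prob_space ?P by (rule prob_space_fo)
    interpret PS: pair_sigma_finite ?M ?P ..
    have setsM: "sets ?M = sets (coords (num_basis j))" by (simp add: sets_prior)
    have wM[measurable]: "w \<in> borel_measurable ?M" using w setsM by (simp cong: measurable_cong_sets)
    have L: "(\<lambda>(\<theta>, x). ennreal (dens j \<theta> x / fo x)) \<in> borel_measurable (?M \<Otimes>\<^sub>M ?P)"
      by (rule likelihood_measurable[OF setsM])
    then have [measurable]: "(\<lambda>z. ennreal (dens j (fst z) (snd z) / fo (snd z))) \<in> borel_measurable (?M \<Otimes>\<^sub>M ?P)"
      by (simp add: case_prod_beta)
    have wL: "(\<lambda>(\<theta>, x). w \<theta> * ennreal (dens j \<theta> x / fo x)) \<in> borel_measurable (?M \<Otimes>\<^sub>M ?P)"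
      unfolding case_prod_beta by measurable
    have wL': "(\<lambda>(x, \<theta>). w \<theta> * ennreal (dens j \<theta> x / fo x)) \<in> borel_measurable (?P \<Otimes>\<^sub>M ?M)"
      using measurable_compose[OF measurable_pair_swap' wL] by (simp add: case_prod_beta)
    have one: "(\<integral>\<^sup>+x. ennreal (dens j \<theta> x / fo x) \<partial>?P) = 1" for \<theta>
    proof -
      have [measurable]: "dens j \<theta> \<in> borel_measurable mu" by (intro measurable_mu_borel) simp
      have "(\<integral>\<^sup>+x. ennreal (dens j \<theta> x / fo x) \<partial>?P) = (\<integral>\<^sup>+x. ennreal (fo x) * ennreal (dens j \<theta> x / fo x) \<partial>mu)"
        by (subst nn_integral_density) auto
      also have "\<dots> = (\<integral>\<^sup>+x. ennreal (dens j \<theta> x) \<partial>mu)"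
        using prob_densityD(2)[OF fo]
        by (intro nn_integral_cong_AE) (auto elim!: eventually_mono simp: ennreal_mult[symmetric] dens_pos less_imp_le)
      finally show ?thesis by (simp add: nn_integral_dens)
    qed
    have "(\<integral>\<^sup>+x. esqrt (\<integral>\<^sup>+\<theta>. w \<theta> * ennreal (dens j \<theta> x / fo x) \<partial>?M) \<partial>?P)
      \<le> esqrt (\<integral>\<^sup>+x. (\<integral>\<^sup>+\<theta>. w \<theta> * ennreal (dens j \<theta> x / fo x) \<partial>?M) \<partial>?P)"
      by (rule esqrt_jensen[OF prob_space_fo M.borel_measurable_nn_integral[OF wL']])
    also have "(\<integral>\<^sup>+x. (\<integral>\<^sup>+\<theta>. w \<theta> * ennreal (dens j \<theta> x / fo x) \<partial>?M) \<partial>?P) =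
      (\<integral>\<^sup>+\<theta>. (\<integral>\<^sup>+x. w \<theta> * ennreal (dens j \<theta> x / fo x) \<partial>?P) \<partial>?M)"
      by (rule PS.Fubini'[OF wL])
    also have "\<dots> = (\<integral>\<^sup>+\<theta>. w \<theta> \<partial>?M)"
    proof (intro nn_integral_cong)
      fix \<theta> assume "\<theta> \<in> space ?M"
      from measurable_Pair2[OF L this] show "(\<integral>\<^sup>+x. w \<theta> * ennreal (dens j \<theta> x / fo x) \<partial>?P) = w \<theta>"
        by (subst nn_integral_cmult) (auto simp: one)
    qed
    finally show "(\<integral>\<^sup>+x. esqrt (\<integral>\<^sup>+\<theta>. w \<theta> * ennreal (dens j \<theta> x / fo x) \<partial>?M) \<partial>?P) \<le> 1 * esqrt (\<integral>\<^sup>+\<theta>. w \<theta> \<partial>?M)"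
      by simp
  qed
  then show ?thesis by simp
qed

text \<open>The mixture bound with centre \<theta>1 supplies the one-step factor
  \<open>1 - d^2 / 8\<close>, which is at most \<open>exp (- d^2 / 8)\<close>.\<close>

lemma piece_near:
  assumes A: "A \<in> sets (coords (num_basis j))" and \<theta>1: "d\<^sup>2 \<le> (hellinger (dens j \<theta>1) fo)\<^sup>2"
    and near: "\<And>\<theta>. \<theta> \<in> A \<Longrightarrow> (hellinger (dens j \<theta>1) (dens j \<theta>))\<^sup>2 \<le> d\<^sup>2 / 4"
  shows "piece fo n j A \<le> ennreal (exp (- (real n * d\<^sup>2 / 8)))"
proof -
  have d2: "d\<^sup>2 \<le> 2" using \<theta>1 hellinger_square_le_2[OF prob_density_dens fo, of j \<theta>1] by linarith
  have "piece fo n j A \<le> ennreal (1 - d\<^sup>2 / 8) ^ n"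
  proof (rule piece_power[OF A])
    fix w :: "(nat \<Rightarrow> real) \<Rightarrow> ennreal" assume w: "w \<in> borel_measurable (coords (num_basis j))"
    let ?M = "density (prior j) (indicator A)"
    interpret fin: finite_measure "prior j" by (rule finite_measure_prior(1)[OF j])
    have [measurable]: "A \<in> sets (prior j)" using A by (simp add: sets_prior)
    have "emeasure ?M (space ?M) = (\<integral>\<^sup>+\<theta>. indicator A \<theta> * indicator (space (prior j)) \<theta> \<partial>prior j)"
      by (subst emeasure_density) auto
    also have "\<dots> = (\<integral>\<^sup>+\<theta>. indicator A \<theta> \<partial>prior j)" by (intro nn_integral_cong) simp
    also have "\<dots> = emeasure (prior j) A" by simp
    finally interpret M: finite_measure ?M by (intro finite_measureI) simp
    have setsM: "sets ?M = sets (coords (num_basis j))" by (simp add: sets_prior)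
    have wM: "w \<in> borel_measurable ?M" using w setsM by (simp cong: measurable_cong_sets)
    have f: "(\<lambda>(\<theta>, x). dens j \<theta> x) \<in> borel_measurable (?M \<Otimes>\<^sub>M mu)"
      using measurable_pair_mu[OF dens_measurable_pair[of j]] setsM
      by (subst measurable_cong_sets[OF sets_pair_measure_cong refl]) simp_all
    show "(\<integral>\<^sup>+x. esqrt (\<integral>\<^sup>+\<theta>. w \<theta> * ennreal (dens j \<theta> x / fo x) \<partial>?M) \<partial>density mu (\<lambda>x. ennreal (fo x)))
       \<le> ennreal (1 - d\<^sup>2 / 8) * esqrt (\<integral>\<^sup>+\<theta>. w \<theta> \<partial>?M)"
    proof (rule mixture_affinity[where f="dens j" and ?f1.0="dens j \<theta>1", OF M.sigma_finite_measure_axioms f])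
      show "AE \<theta> in ?M. (hellinger (dens j \<theta>1) (dens j \<theta>))\<^sup>2 \<le> d\<^sup>2 / 4"
        using near by (subst AE_density) (auto simp: indicator_def)
    qed (use \<theta>1 fo wM prob_density_dens dens_pos in auto)
  qed
  also have "\<dots> = ennreal ((1 - d\<^sup>2 / 8) ^ n)" using d2 by (simp add: ennreal_power)
  also have "\<dots> \<le> ennreal (exp (- (d\<^sup>2 / 8)) ^ n)"
    using d2 exp_ge_add_one_self[of "- (d\<^sup>2 / 8)"] by (intro ennreal_leI power_mono) auto
  also have "exp (- (d\<^sup>2 / 8)) ^ n = exp (- (real n * d\<^sup>2 / 8))" by (simp add: exp_of_nat_mult[symmetric])
  finally show ?thesis .
qed

lemma piece_Union_le:
  assumes "finite I" "F \<subseteq> (\<Union>i\<in>I. A i)" "F \<in> sets (coords (num_basis j))" "\<And>i. i \<in> I \<Longrightarrow> A i \<in> sets (coords (num_basis j))"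
  shows "piece fo n j F \<le> (\<Sum>i\<in>I. piece fo n j (A i))"
proof -
  interpret fin: finite_measure "prior j" by (rule finite_measure_prior(1)[OF j])
  let ?P = "density mu (\<lambda>x. ennreal (fo x))"
  have meas: "(\<lambda>(X, \<theta>). indicator B \<theta> * (\<Prod>i=1..n. ennreal (dens j \<theta> (X i) / fo (X i)))) \<in> borel_measurable (sample_law fo n \<Otimes>\<^sub>M prior j)"
    if "B \<in> sets (coords (num_basis j))" for B
  proof -
    have [measurable]: "B \<in> sets (prior j)" using that by (simp add: sets_prior)
    have "(\<lambda>z. ennreal (dens j (snd z) (fst z i) / fo (fst z i))) \<in> borel_measurable (sample_law fo n \<Otimes>\<^sub>M prior j)" if "i \<in> {1..n}" for i
    proof -
      have "(\<lambda>z. (snd z, fst z i)) \<in> sample_law fo n \<Otimes>\<^sub>M prior j \<rightarrow>\<^sub>M prior j \<Otimes>\<^sub>M ?P"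
        unfolding sample_law_def using that by measurable
      from measurable_compose[OF this likelihood_measurable[OF sets_prior]] show ?thesis by (simp add: case_prod_beta)
    qed
    then show ?thesis unfolding case_prod_beta by measurable
  qed
  have inner: "(\<lambda>\<theta>. indicator B \<theta> * (\<Prod>i=1..n. ennreal (dens j \<theta> (X i) / fo (X i)))) \<in> borel_measurable (prior j)"
    if "B \<in> sets (coords (num_basis j))" "X \<in> space (sample_law fo n)" for B X
    using measurable_Pair2[OF meas[OF that(1)] that(2)] by simp
  have "piece fo n j F \<le> (\<integral>\<^sup>+X. (\<Sum>i\<in>I. esqrt (\<integral>\<^sup>+\<theta>. indicator (A i) \<theta> * (\<Prod>i=1..n. ennreal (dens j \<theta> (X i) / fo (X i))) \<partial>prior j)) \<partial>sample_law fo n)"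
    unfolding piece_def
  proof (rule nn_integral_mono)
    fix X assume X: "X \<in> space (sample_law fo n)"
    let ?g = "\<lambda>\<theta>. (\<Prod>i=1..n. ennreal (dens j \<theta> (X i) / fo (X i)))"
    have "(\<integral>\<^sup>+\<theta>. indicator F \<theta> * ?g \<theta> \<partial>prior j) \<le> (\<integral>\<^sup>+\<theta>. (\<Sum>i\<in>I. indicator (A i) \<theta> * ?g \<theta>) \<partial>prior j)"
    proof (rule nn_integral_mono)
      fix \<theta>
      show "indicator F \<theta> * ?g \<theta> \<le> (\<Sum>i\<in>I. indicator (A i) \<theta> * ?g \<theta>)"
      proof (cases "\<theta> \<in> F")
        case True
        then obtain i where "i \<in> I" "\<theta> \<in> A i" using assms(2) by auto
        then have "indicator F \<theta> * ?g \<theta> = indicator (A i) \<theta> * ?g \<theta>" using True by simp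
        also have "\<dots> \<le> (\<Sum>i\<in>I. indicator (A i) \<theta> * ?g \<theta>)"
          using \<open>i \<in> I\<close> assms(1) by (intro member_le_sum) auto
        finally show ?thesis .
      qed simp
    qed
    also have "\<dots> = (\<Sum>i\<in>I. \<integral>\<^sup>+\<theta>. indicator (A i) \<theta> * ?g \<theta> \<partial>prior j)"
      by (rule nn_integral_sum) (rule inner[OF assms(4) X])
    finally have "esqrt (\<integral>\<^sup>+\<theta>. indicator F \<theta> * ?g \<theta> \<partial>prior j) \<le> esqrt (\<Sum>i\<in>I. \<integral>\<^sup>+\<theta>. indicator (A i) \<theta> * ?g \<theta> \<partial>prior j)"
      by (rule esqrt_mono)
    also have "\<dots> \<le> (\<Sum>i\<in>I. esqrt (\<integral>\<^sup>+\<theta>. indicator (A i) \<theta> * ?g \<theta> \<partial>prior j))" by (rule esqrt_sum_le)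
    finally show "esqrt (\<integral>\<^sup>+\<theta>. indicator F \<theta> * ?g \<theta> \<partial>prior j) \<le> (\<Sum>i\<in>I. esqrt (\<integral>\<^sup>+\<theta>. indicator (A i) \<theta> * ?g \<theta> \<partial>prior j))" .
  qed
  also have "\<dots> = (\<Sum>i\<in>I. piece fo n j (A i))"
    unfolding piece_def
  proof (rule nn_integral_sum)
    fix i assume "i \<in> I"
    from measurable_compose[OF fin.borel_measurable_nn_integral[OF meas[OF assms(4)[OF this]]] esqrt_measurable]
    show "(\<lambda>X. esqrt (\<integral>\<^sup>+\<theta>. indicator (A i) \<theta> * (\<Prod>i=1..n. ennreal (dens j \<theta> (X i) / fo (X i))) \<partial>prior j)) \<in> borel_measurable (sample_law fo n)" .
  qed
  finally show ?thesis .
qed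

end

text \<open>With \<open>E = eta \<gamma> j\<close>, the exponent on the right is one twelfth of
  \<open>3 * E - n * t^2 / 16\<close>. If the latter is positive, the trivial bound 1 suffices.
  Otherwise the lattice argument gives the full exponent \<open>3 * E - n * t^2 / 16\<close>, which
  is smaller still; here \<open>3 * E\<close> dominates the logarithm of the Gaussian sum, N times
  \<open>2 * L + 13\<close>.\<close>

lemma model_bound:
  assumes fo: "prob_density fo" and j: "j \<in> J" and t: "0 < t"
    and \<gamma>: "0 < \<gamma>" "\<gamma> < 1 / 4" "0.13 * \<gamma> / sqrt (1 - 4 * \<gamma>) = 0.0056"
  shows "piece fo n j {\<theta> \<in> Theta j. hellinger (dens j \<theta>) fo > t}
    \<le> ennreal (exp (eta \<gamma> j / 4 - real n * t\<^sup>2 / 192))"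
proof -
  obtain k q L where jk: "j = (k, q, L)" by (cases j) auto
  have q: "1 \<le> q" and L1: "1 \<le> L" using j by (auto simp: J_def jk)
  define m where "m = real (num_basis j)"
  define N where "N = Suc (num_basis j)"
  have m1: "1 \<le> m" using q by (simp add: m_def jk)
  have N2: "real N \<le> 2 * m" "1 \<le> real N" using m1 by (auto simp: N_def m_def)
  define E where "E = eta \<gamma> j"
  have E: "2 * m * real L + 8 * m \<le> E"
    using eta_lower_bounds(1)[OF \<gamma> q, of k L] by (simp add: E_def m_def jk)
  have mL: "m \<le> m * real L" using m1 L1 by simp
  define F where "F = {\<theta> \<in> Theta j. hellinger (dens j \<theta>) fo > t}"
  have F_sets: "F \<in> sets (coords (num_basis j))"
  proof -
    have "F = Theta j \<inter> {\<theta> \<in> space (coords (num_basis j)). hellinger (dens j \<theta>) fo > t}"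
      using sets.sets_into_space[OF Theta_sets[OF j]] by (auto simp: F_def)
    moreover have "{\<theta> \<in> space (coords (num_basis j)). hellinger (dens j \<theta>) fo > t} \<in> sets (coords (num_basis j))"
      using hellinger_measurable[OF prob_densityD(1)[OF fo], of j] by measurable
    ultimately show ?thesis using Theta_sets[OF j] by auto
  qed
  show ?thesis unfolding F_def[symmetric] E_def[symmetric]
  proof (cases "real n * t\<^sup>2 / 16 < 3 * E")
    case True
    have "piece fo n j F \<le> ennreal 1" using piece_le_1[OF fo j F_sets] by simp
    also have "\<dots> \<le> ennreal (exp (E / 4 - real n * t\<^sup>2 / 192))" using True by (intro ennreal_leI) simp
    finally show "piece fo n j F \<le> ennreal (exp (E / 4 - real n * t\<^sup>2 / 192))" .
  next
    case False
    show "piece fo n j F \<le> ennreal (exp (E / 4 - real n * t\<^sup>2 / 192))"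
    proof (cases "F = {}")
      case True
      then show ?thesis by (simp add: piece_def)
    next
      case nonempty: False
      \<comment> \<open>The Gaussian decay over the lattice has rate proportional to
        \<open>n * t^2 / N\<close>. That this is at least 1 makes the sum exponential in N with a
        base free of n and t.\<close>
      have Nnt: "real N \<le> real n * t\<^sup>2"
      proof -
        have "0 \<le> m * real L" using m1 by simp
        then have "4 * real N \<le> E" using E N2 by linarith
        then show ?thesis using False N2 by linarith
      qed
      obtain c where c: "\<And>l. c l \<in> borel_measurable (coords (num_basis j))"
        "\<And>\<theta> \<theta>'. logdist2 j \<theta> \<theta>' = (\<Sum>l<N. (c l \<theta> - c l \<theta>')\<^sup>2)"
        using logdist2_coordinates[of j] unfolding N_def by blast
      have far: "t < hellinger (dens j \<theta>) fo" if "\<theta> \<in> F" for \<theta> using that by (simp add: F_def)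
      \<comment> \<open>The lattice is centred at an almost nearest point \<theta>0 of
        \<open>F\<close>, so that the distance of any point of \<open>F\<close> to \<open>fo\<close>
        controls its distance to \<theta>0. The infimum need not be attained; a point within a
        factor 2 exists because the infimum is at least t and hence positive.\<close>
      define I where "I = Inf ((\<lambda>\<theta>. hellinger (dens j \<theta>) fo) ` F)"
      have bdd: "bdd_below ((\<lambda>\<theta>. hellinger (dens j \<theta>) fo) ` F)"
        by (intro bdd_belowI[of _ 0]) (auto simp: hellinger_nonneg)
      have "t \<le> I" unfolding I_def using nonempty far by (intro cInf_greatest) (auto intro: less_imp_le)
      then have "I < 2 * I" using t by simp
      then obtain x where "x \<in> (\<lambda>\<theta>. hellinger (dens j \<theta>) fo) ` F" "x < 2 * I"
        using cInf_lessD[of "(\<lambda>\<theta>. hellinger (dens j \<theta>) fo) ` F" "2 * I"] nonempty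
        unfolding I_def[symmetric] by blast
      then obtain \<theta>0 where \<theta>0: "\<theta>0 \<in> F" "hellinger (dens j \<theta>0) fo < 2 * I" by blast
      have near0: "hellinger (dens j \<theta>0) fo \<le> 2 * hellinger (dens j \<theta>) fo" if "\<theta> \<in> F" for \<theta>
      proof -
        have "I \<le> hellinger (dens j \<theta>) fo" unfolding I_def using bdd that by (intro cInf_lower) auto
        then show ?thesis using \<theta>0(2) by linarith
      qed
      \<comment> \<open>Two points of one cell differ by at most \<delta> in each of N coordinates.
        Their squared log distance is then at most \<open>exp (- L) * t^2\<close> and their squared
        Hellinger distance at most \<open>t^2 / 4\<close>.\<close>
      define \<delta> where "\<delta> = exp (- (real L / 2)) * t / sqrt (real N)"
      have N0: "0 < real N" using N2 by linarith
      have \<delta>: "0 < \<delta>" using t N0 by (simp add: \<delta>_def)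
      have \<delta>2: "\<delta>\<^sup>2 = exp (- real L) * t\<^sup>2 / real N"
        using N0 by (simp add: \<delta>_def power_divide power_mult_distrib power2_eq_square[of "exp _"] exp_add[symmetric])
      define z where "z l \<theta> = \<lfloor>(c l \<theta> - c l \<theta>0) / \<delta>\<rfloor>" for l \<theta>
      \<comment> \<open>The squared log distance is at most \<open>4 * L^2\<close>, so finitely many
        cells cover \<open>F\<close>. Z does not enter the final bound, since the lattice sum is
        bounded uniformly in it.\<close>
      define Z where "Z = \<lceil>2 * real L / \<delta>\<rceil> + 1"
      define A where "A y = {\<theta> \<in> F. \<forall>l\<in>{..<N}. z l \<theta> = y l}" for y
      have A_sets: "A y \<in> sets (coords (num_basis j))" for y
      proof -
        have "A y = F \<inter> {\<theta> \<in> space (coords (num_basis j)). \<forall>l\<in>{..<N}. z l \<theta> = y l}"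
          using sets.sets_into_space[OF F_sets] by (auto simp: A_def)
        moreover have "{\<theta> \<in> space (coords (num_basis j)). \<forall>l\<in>{..<N}. z l \<theta> = y l} \<in> sets (coords (num_basis j))"
        proof (rule sets.sets_Collect_finite_All)
          fix l
          note [measurable] = c(1)[of l]
          have "{\<theta> \<in> space (coords (num_basis j)). z l \<theta> = y l} =
            {\<theta> \<in> space (coords (num_basis j)). real_of_int (y l) \<le> (c l \<theta> - c l \<theta>0) / \<delta> \<and> (c l \<theta> - c l \<theta>0) / \<delta> < real_of_int (y l) + 1}"
            by (auto simp: z_def floor_eq_iff)
          also have "\<dots> \<in> sets (coords (num_basis j))" by measurable
          finally show "{\<theta> \<in> space (coords (num_basis j)). z l \<theta> = y l} \<in> sets (coords (num_basis j))" .
        qed simp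
        ultimately show ?thesis using F_sets by auto
      qed
      have \<theta>0T: "\<theta>0 \<in> Theta j" using \<theta>0(1) by (simp add: F_def)
      have zb: "z l \<theta> \<in> {-Z..Z}" if "\<theta> \<in> F" "l < N" for \<theta> l
      proof -
        have "\<theta> \<in> Theta j" using that by (simp add: F_def)
        have "(c l \<theta> - c l \<theta>0)\<^sup>2 \<le> logdist2 j \<theta> \<theta>0"
          unfolding c(2) using that(2) by (intro member_le_sum[where f="\<lambda>l. (c l \<theta> - c l \<theta>0)\<^sup>2"]) auto
        also have "\<dots> \<le> (2 * real L)\<^sup>2"
          using hellinger_logdist2(3)[OF j \<open>\<theta> \<in> Theta j\<close> \<theta>0T] by (simp add: jk power_mult_distrib)
        finally have "\<bar>c l \<theta> - c l \<theta>0\<bar> \<le> \<bar>2 * real L\<bar>" by (rule abs_le_square_iff[THEN iffD2])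
        then have "\<bar>c l \<theta> - c l \<theta>0\<bar> \<le> 2 * real L" by simp
        then have "\<bar>(c l \<theta> - c l \<theta>0) / \<delta>\<bar> \<le> 2 * real L / \<delta>" using \<delta> by (simp add: divide_right_mono)
        then show ?thesis unfolding z_def Z_def atLeastAtMost_iff by (intro conjI) linarith+
      qed
      define S where "S y = (\<Sum>l<N. (max 0 (\<bar>real_of_int (y l)\<bar> - 1))\<^sup>2)" for y :: "nat \<Rightarrow> int"
      \<comment> \<open>A nonempty cell at y has squared Hellinger distance at least
        \<open>exp (- L) * \<delta>^2 * S y / 4\<close> from \<theta>0, and at most
        \<open>10 * d^2\<close>, where 10 = 2 + 2 * 4 comes from the squared triangle inequality and
        the factor 2 in the choice of \<theta>0. Hence \<open>exp (- 2 * L) * S y\<close> is at most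
        \<open>40 * n * d^2\<close>, and 640 = 40 * 16 lets \<open>\<kappa> * S y\<close> take half
        of the exponent \<open>n * d^2 / 8\<close>.\<close>
      define \<kappa> where "\<kappa> = exp (- 2 * real L) / 640"
      have \<kappa>: "0 < \<kappa>" "\<kappa> \<le> 1"
      proof -
        show "0 < \<kappa>" by (simp add: \<kappa>_def)
        have "exp (- 2 * real L) \<le> 1" by simp
        then show "\<kappa> \<le> 1" unfolding \<kappa>_def by linarith
      qed
      have cell: "piece fo n j (A y) \<le> ennreal (exp (- (real n * t\<^sup>2 / 16)) * (\<Prod>l<N. exp (- (\<kappa> * (max 0 (\<bar>real_of_int (y l)\<bar> - 1))\<^sup>2))))" for y
      proof (cases "A y = {}")
        case True
        then show ?thesis by (simp add: piece_def)
      next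
        case False
        then obtain \<theta>1 where \<theta>1: "\<theta>1 \<in> A y" by blast
        then have F1: "\<theta>1 \<in> F" "\<theta>1 \<in> Theta j" by (auto simp: A_def F_def)
        define d where "d = hellinger (dens j \<theta>1) fo"
        have dt: "t\<^sup>2 \<le> d\<^sup>2" using far[OF F1(1)] t by (intro power_mono) (auto simp: d_def)
        have near: "(hellinger (dens j \<theta>1) (dens j \<theta>))\<^sup>2 \<le> d\<^sup>2 / 4" if "\<theta> \<in> A y" for \<theta>
        proof -
          have \<theta>: "\<theta> \<in> Theta j" "\<And>l. l < N \<Longrightarrow> z l \<theta> = z l \<theta>1" using that \<theta>1 by (auto simp: A_def F_def)
          have "(c l \<theta>1 - c l \<theta>)\<^sup>2 \<le> \<delta>\<^sup>2" if "l < N" for l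
          proof -
            have "\<bar>(c l \<theta>1 - c l \<theta>0) / \<delta> - (c l \<theta> - c l \<theta>0) / \<delta>\<bar> \<le> 1"
              using \<theta>(2)[OF that] unfolding z_def by linarith
            then have "\<bar>(c l \<theta>1 - c l \<theta>) / \<delta>\<bar> \<le> 1" by (simp add: diff_divide_distrib)
            then have "\<bar>c l \<theta>1 - c l \<theta>\<bar> \<le> \<delta>" using \<delta> by (simp add: abs_divide divide_le_eq)
            then show ?thesis using \<delta> by (simp add: abs_le_square_iff[symmetric])
          qed
          then have "logdist2 j \<theta>1 \<theta> \<le> (\<Sum>l<N. \<delta>\<^sup>2)" unfolding c(2) by (intro sum_mono) auto
          also have "\<dots> = exp (- real L) * t\<^sup>2" using N0 by (simp add: \<delta>2)
          finally have "exp (real L) / 4 * logdist2 j \<theta>1 \<theta> \<le> exp (real L) / 4 * (exp (- real L) * t\<^sup>2)"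
            by (intro mult_left_mono) auto
          also have "\<dots> = t\<^sup>2 / 4" by (simp add: exp_minus)
          finally show ?thesis using hellinger_logdist2(2)[OF j F1(2) \<theta>(1)] dt by (simp add: jk)
        qed
        have "piece fo n j (A y) \<le> ennreal (exp (- (real n * d\<^sup>2 / 8)))"
          by (rule piece_near[OF fo j A_sets _ near]) (simp add: d_def)
        moreover have "exp (- (real n * d\<^sup>2 / 8)) \<le> exp (- (real n * t\<^sup>2 / 16)) * (\<Prod>l<N. exp (- (\<kappa> * (max 0 (\<bar>real_of_int (y l)\<bar> - 1))\<^sup>2)))"
        proof -
          have "\<delta>\<^sup>2 * S y \<le> logdist2 j \<theta>1 \<theta>0"
            unfolding c(2) S_def sum_distrib_left
          proof (rule sum_mono)
            fix l assume "l \<in> {..<N}"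
            then have "z l \<theta>1 = y l" using \<theta>1 by (auto simp: A_def)
            \<comment> \<open>A floor of y only guarantees absolute value at least |y| - 1: for
              negative y the number may lie close to y + 1.\<close>
            then have "max 0 (\<bar>real_of_int (y l)\<bar> - 1) \<le> \<bar>(c l \<theta>1 - c l \<theta>0) / \<delta>\<bar>"
              unfolding z_def by linarith
            then have "(max 0 (\<bar>real_of_int (y l)\<bar> - 1))\<^sup>2 \<le> \<bar>(c l \<theta>1 - c l \<theta>0) / \<delta>\<bar>\<^sup>2"
              by (intro power_mono) auto
            then have "(max 0 (\<bar>real_of_int (y l)\<bar> - 1))\<^sup>2 \<le> (c l \<theta>1 - c l \<theta>0)\<^sup>2 / \<delta>\<^sup>2"
              by (simp add: power_divide)
            then show "\<delta>\<^sup>2 * (max 0 (\<bar>real_of_int (y l)\<bar> - 1))\<^sup>2 \<le> (c l \<theta>1 - c l \<theta>0)\<^sup>2"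
              using \<delta> by (simp add: pos_le_divide_eq mult.commute)
          qed
          then have "exp (- real L) / 4 * (\<delta>\<^sup>2 * S y) \<le> exp (- real L) / 4 * logdist2 j \<theta>1 \<theta>0"
            by (intro mult_left_mono) auto
          also have "\<dots> \<le> (hellinger (dens j \<theta>1) (dens j \<theta>0))\<^sup>2"
            using hellinger_logdist2(1)[OF j F1(2) \<theta>0T] by (simp add: jk)
          also have "\<dots> \<le> 2 * d\<^sup>2 + 2 * (hellinger fo (dens j \<theta>0))\<^sup>2"
            unfolding d_def by (rule hellinger_square_triangle[OF prob_density_dens fo prob_density_dens])
          also have "(hellinger fo (dens j \<theta>0))\<^sup>2 \<le> (2 * d)\<^sup>2"
            unfolding d_def using near0[OF F1(1)]
            by (intro power_mono) (auto simp: hellinger_commute[of fo] hellinger_nonneg)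
          finally have "exp (- real L) / 4 * (\<delta>\<^sup>2 * S y) \<le> 10 * d\<^sup>2" by (simp add: power_mult_distrib)
          moreover have "exp (- real L) * \<delta>\<^sup>2 = exp (- 2 * real L) * t\<^sup>2 / real N"
            unfolding \<delta>2 by (simp add: exp_add[symmetric])
          ultimately have dS: "exp (- 2 * real L) * t\<^sup>2 / real N * S y \<le> 40 * d\<^sup>2"
            by (simp add: mult.assoc[symmetric])
          have S0: "0 \<le> S y" by (simp add: S_def sum_nonneg)
          have "real n * (exp (- 2 * real L) * t\<^sup>2 / real N * S y) \<le> real n * (40 * d\<^sup>2)"
            by (rule mult_left_mono[OF dS]) simp
          moreover have "exp (- 2 * real L) * S y * 1 \<le> exp (- 2 * real L) * S y * (real n * t\<^sup>2 / real N)"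
            using Nnt N0 S0 by (intro mult_left_mono) (auto simp: le_divide_eq)
          ultimately have "exp (- 2 * real L) * S y \<le> 40 * (real n * d\<^sup>2)"
            by (simp add: mult_ac)
          moreover have "real n * t\<^sup>2 \<le> real n * d\<^sup>2" using dt by (intro mult_left_mono) auto
          ultimately have "real n * t\<^sup>2 / 16 + \<kappa> * S y \<le> real n * d\<^sup>2 / 8"
          proof -
            assume *: "exp (- 2 * real L) * S y \<le> 40 * (real n * d\<^sup>2)" "real n * t\<^sup>2 \<le> real n * d\<^sup>2"
            have "\<kappa> * S y = exp (- 2 * real L) * S y / 640" by (simp add: \<kappa>_def)
            then show ?thesis using * by linarith
          qed
          then have "exp (- (real n * d\<^sup>2 / 8)) \<le> exp (- (real n * t\<^sup>2 / 16) + (- (\<kappa> * S y)))" by simp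
          also have "\<dots> = exp (- (real n * t\<^sup>2 / 16)) * exp (\<Sum>l<N. - (\<kappa> * (max 0 (\<bar>real_of_int (y l)\<bar> - 1))\<^sup>2))"
            unfolding exp_add S_def sum_distrib_left sum_negf ..
          finally show ?thesis by (simp only: exp_sum finite_lessThan)
        qed
        ultimately show ?thesis by (meson ennreal_leI order_trans)
      qed
      define P where "P = PiE {..<N} (\<lambda>_. {-Z..Z})"
      have P: "finite P" unfolding P_def by (intro finite_PiE) auto
      have cover: "F \<subseteq> (\<Union>y\<in>P. A y)"
      proof
        fix \<theta> assume \<theta>: "\<theta> \<in> F"
        have "restrict (\<lambda>l. z l \<theta>) {..<N} \<in> P" unfolding P_def using zb[OF \<theta>] by auto
        moreover have "\<theta> \<in> A (restrict (\<lambda>l. z l \<theta>) {..<N})" using \<theta> by (auto simp: A_def)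
        ultimately show "\<theta> \<in> (\<Union>y\<in>P. A y)" by blast
      qed
      let ?h = "\<lambda>x::int. exp (- (\<kappa> * (max 0 (\<bar>real_of_int x\<bar> - 1))\<^sup>2))"
      have "piece fo n j F \<le> (\<Sum>y\<in>P. piece fo n j (A y))"
        by (rule piece_Union_le[OF fo j P cover F_sets A_sets])
      also have "\<dots> \<le> (\<Sum>y\<in>P. ennreal (exp (- (real n * t\<^sup>2 / 16)) * (\<Prod>l<N. ?h (y l))))"
        by (intro sum_mono cell)
      also have "\<dots> = ennreal (exp (- (real n * t\<^sup>2 / 16)) * (\<Sum>y\<in>P. \<Prod>l<N. ?h (y l)))"
        by (simp add: sum_ennreal sum_distrib_left prod_nonneg)
      also have "\<dots> \<le> ennreal (exp (E / 4 - real n * t\<^sup>2 / 192))"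
      proof (rule ennreal_leI)
        have "(\<Sum>y\<in>P. \<Prod>l<N. ?h (y l)) = (\<Prod>l<N. \<Sum>x\<in>{-Z..Z}. ?h x)"
          unfolding P_def by (rule prod_sum_PiE[symmetric]) auto
        also have "\<dots> = (\<Sum>x\<in>{-Z..Z}. ?h x) ^ N" by simp
        also have "\<dots> \<le> exp (2 * real L + 13) ^ N"
        proof (rule power_mono)
          have "(\<Sum>x\<in>{-Z..Z}. ?h x) \<le> 12 / \<kappa>" by (rule lattice_sum_bound[OF \<kappa>])
          also have "12 / \<kappa> = 7680 * exp (2 * real L)" by (simp add: \<kappa>_def exp_minus field_simps)
          \<comment> \<open>7680 = 12 * 640 is below 2^13, hence below exp 13.\<close>
          also have "\<dots> \<le> exp 13 * exp (2 * real L)"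
          proof (rule mult_right_mono)
            have "(2::real) ^ 13 \<le> exp 1 ^ 13" using exp_ge_add_one_self[of 1] by (intro power_mono) auto
            then show "(7680::real) \<le> exp 13" by (simp add: exp_of_nat_mult[symmetric])
          qed simp
          finally show "(\<Sum>x\<in>{-Z..Z}. ?h x) \<le> exp (2 * real L + 13)" by (simp add: exp_add mult.commute)
        qed (intro sum_nonneg, simp)
        also have "\<dots> = exp (real N * (2 * real L + 13))" by (simp add: exp_of_nat_mult)
        also have "\<dots> \<le> exp (3 * E)"
        proof -
          \<comment> \<open>The result \<open>4 * m * L + 26 * m\<close> is at most three times
            \<open>2 * m * L + 8 * m\<close> because L \<ge> 1.\<close>
          have "real N * (2 * real L + 13) \<le> 2 * m * (2 * real L + 13)" using N2 by (intro mult_right_mono) auto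
          also have "\<dots> = 4 * (m * real L) + 26 * m" by (simp add: algebra_simps)
          finally show ?thesis using E mL by simp
        qed
        finally have "exp (- (real n * t\<^sup>2 / 16)) * (\<Sum>y\<in>P. \<Prod>l<N. ?h (y l)) \<le> exp (- (real n * t\<^sup>2 / 16)) * exp (3 * E)"
          by (intro mult_left_mono) auto
        also have "\<dots> = exp (3 * E - real n * t\<^sup>2 / 16)" by (simp add: exp_add[symmetric])
        also have "\<dots> \<le> exp (E / 4 - real n * t\<^sup>2 / 192)" using False by simp
        finally show "exp (- (real n * t\<^sup>2 / 16)) * (\<Sum>y\<in>P. \<Prod>l<N. ?h (y l)) \<le> exp (E / 4 - real n * t\<^sup>2 / 192)" .
      qed
      finally show ?thesis .
    qed
  qed
qed

section \<open>The posterior of the mixture\<close>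

lemma ennreal_infsum_eq_suminf:
  fixes f :: "'a \<Rightarrow> ennreal" and e :: "nat \<Rightarrow> 'a"
  assumes "bij_betw e UNIV A"
  shows "infsum f A = (\<Sum>i. f (e i))"
proof -
  have "infsum f A = infsum (\<lambda>i. f (e i)) UNIV"
    by (rule infsum_reindex_bij_betw[OF assms, symmetric])
  moreover have "((\<lambda>i. f (e i)) has_sum infsum (\<lambda>i. f (e i)) UNIV) UNIV"
    by (intro has_sum_infsum nonneg_summable_on_complete) auto
  from has_sum_imp_sums[OF this] have "infsum (\<lambda>i. f (e i)) UNIV = (\<Sum>i. f (e i))"
    by (rule sums_unique)
  ultimately show ?thesis by simp
qed

lemma J_enumeration: "\<exists>e :: nat \<Rightarrow> index. bij_betw e UNIV J"
proof -
  have "countable J" by (rule countable_subset[of _ UNIV]) auto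
  moreover have "infinite J"
  proof
    assume fin: "finite J"
    have "range (\<lambda>k::nat. (k, 1::nat, 1::nat)) \<subseteq> J" by (auto simp: J_def)
    with fin have "finite (range (\<lambda>k::nat. (k, 1::nat, 1::nat)))" by (rule rev_finite_subset)
    then have "finite (UNIV :: nat set)" by (rule finite_imageD) (auto simp: inj_on_def)
    then show False by simp
  qed
  ultimately show ?thesis using bij_betw_from_nat_into by blast
qed

text \<open>\<open>eta\<close> is at least \<open>8 * (k + q + L)\<close>, so a product of three
  geometric series dominates. A quarter of \<open>eta\<close> is what the square root of a weight
  retains after the bound for its model.\<close>

lemma summable_exp_eta:
  assumes \<gamma>: "0 < \<gamma>" "\<gamma> < 1 / 4" "0.13 * \<gamma> / sqrt (1 - 4 * \<gamma>) = 0.0056"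
  shows "(\<lambda>j. exp (- (eta \<gamma> j / 4))) summable_on J"
proof -
  have g: "(\<lambda>n. exp (- 1 :: real) ^ n) summable_on UNIV"
    by (rule summable_nonneg_imp_summable_on) (auto intro: summable_geometric)
  have "(\<lambda>(k, q, L). exp (- 1 :: real) ^ k * (exp (- 1) ^ q * exp (- 1) ^ L)) summable_on UNIV \<times> UNIV \<times> UNIV"
    using summable_on_mult_Times[OF g _ summable_on_mult_Times[OF g _ g]]
    by (auto simp: case_prod_unfold)
  then have "(\<lambda>(k, q, L). exp (- 1 :: real) ^ k * (exp (- 1) ^ q * exp (- 1) ^ L)) summable_on J"
    by (rule summable_on_subset_banach) auto
  then show ?thesis
  proof (rule summable_on_comparison_test)
    fix j :: index assume j: "j \<in> J"
    obtain k q L where jk: "j = (k, q, L)" by (cases j) auto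
    have "8 * (real (k + q) + real L) \<le> eta \<gamma> j"
      using eta_lower_bounds(2)[OF \<gamma>] j by (auto simp: jk J_def)
    then have "exp (- (eta \<gamma> j / 4)) \<le> exp (- real k + (- real q + - real L))" by simp
    also have "\<dots> = exp (- 1) ^ k * (exp (- 1) ^ q * exp (- 1) ^ L)"
      by (simp only: exp_add exp_of_nat_mult[symmetric]) simp
    finally show "exp (- (eta \<gamma> j / 4)) \<le> (case j of (k, q, L) \<Rightarrow> exp (- 1) ^ k * (exp (- 1) ^ q * exp (- 1) ^ L))"
      by (simp add: jk)
  qed auto
qed

section \<open>Likelihoods as functions of the sample, and the lower bound for one model\<close>

context
  fixes fo :: "real \<Rightarrow> real" and j :: index
  assumes fo: "prob_density fo" and j: "j \<in> J"
begin

lemma product_measurable: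
  assumes B: "B \<in> sets (coords (num_basis j))" and g: "(\<lambda>(\<theta>, x). g \<theta> x) \<in> borel_measurable (coords (num_basis j) \<Otimes>\<^sub>M mu)"
  shows "(\<lambda>(X, \<theta>). indicator B \<theta> * (\<Prod>i=1..n. (g \<theta> (X i) :: ennreal))) \<in> borel_measurable (sample_law fo n \<Otimes>\<^sub>M prior j)"
proof -
  have [measurable]: "B \<in> sets (prior j)" using B sets_prior[OF fo j] by simp
  have s: "sets (coords (num_basis j) \<Otimes>\<^sub>M mu) = sets (prior j \<Otimes>\<^sub>M density mu (\<lambda>x. ennreal (fo x)))"
    by (intro sets_pair_measure_cong) (auto simp: sets_prior[OF fo j])
  have g': "(\<lambda>(\<theta>, x). g \<theta> x) \<in> borel_measurable (prior j \<Otimes>\<^sub>M density mu (\<lambda>x. ennreal (fo x)))"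
    using g by (subst (asm) measurable_cong_sets[OF s refl])
  have "(\<lambda>z. g (snd z) (fst z i)) \<in> borel_measurable (sample_law fo n \<Otimes>\<^sub>M prior j)" if "i \<in> {1..n}" for i
  proof -
    have "(\<lambda>z. (snd z, fst z i)) \<in> sample_law fo n \<Otimes>\<^sub>M prior j \<rightarrow>\<^sub>M prior j \<Otimes>\<^sub>M density mu (\<lambda>x. ennreal (fo x))"
      unfolding sample_law_def using that by measurable
    from measurable_compose[OF this g'] show ?thesis by (simp add: case_prod_beta)
  qed
  then show ?thesis unfolding case_prod_beta by measurable
qed

lemma dens_measurable_pair_mu: "(\<lambda>(\<theta>, x). dens j \<theta> x) \<in> borel_measurable (coords (num_basis j) \<Otimes>\<^sub>M mu)"
  by (rule measurable_pair_mu[OF dens_measurable_pair])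

lemma far_sets: "{\<theta> \<in> Theta j. hellinger (dens j \<theta>) fo > t} \<in> sets (coords (num_basis j))"
proof -
  have "{\<theta> \<in> Theta j. hellinger (dens j \<theta>) fo > t} = Theta j \<inter> {\<theta> \<in> space (coords (num_basis j)). hellinger (dens j \<theta>) fo > t}"
    using sets.sets_into_space[OF Theta_sets[OF j]] by auto
  moreover have "{\<theta> \<in> space (coords (num_basis j)). hellinger (dens j \<theta>) fo > t} \<in> sets (coords (num_basis j))"
    using hellinger_measurable[OF prob_densityD(1)[OF fo], of j] by measurable
  ultimately show ?thesis using Theta_sets[OF j] by auto
qed

lemma likelihood_integral_measurable:
  assumes B: "B \<in> sets (coords (num_basis j))" and g: "(\<lambda>(\<theta>, x). g \<theta> x) \<in> borel_measurable (coords (num_basis j) \<Otimes>\<^sub>M mu)"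
  shows "(\<lambda>X. \<integral>\<^sup>+\<theta>. indicator B \<theta> * (\<Prod>i=1..n. (g \<theta> (X i) :: ennreal)) \<partial>prior j) \<in> borel_measurable (sample_law fo n)"
proof -
  interpret fin: finite_measure "prior j" by (rule finite_measure_prior(1)[OF j])
  show ?thesis by (rule fin.borel_measurable_nn_integral[OF product_measurable[OF B g]])
qed

lemma sample_AE_pos: "AE X in sample_law fo n. \<forall>i\<in>{1..n}. 0 < fo (X i)"
proof (rule AE_finite_allI)
  fix i assume i: "i \<in> {1..n}"
  let ?P = "density mu (\<lambda>x. ennreal (fo x))"
  interpret P: prob_space ?P by (rule prob_space_fo[OF fo j])
  have "AE x in ?P. 0 < fo x" using prob_densityD(1,2)[OF fo] by (subst AE_density) (auto elim!: eventually_mono)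
  then show "AE X in sample_law fo n. 0 < fo (X i)"
    unfolding sample_law_def using i P.prob_space_axioms by (intro AE_PiM_component) auto
qed simp

lemma sample_prob_space: "prob_space (sample_law fo n)"
proof -
  interpret P: prob_space "density mu (\<lambda>x. ennreal (fo x))" by (rule prob_space_fo[OF fo j])
  show ?thesis unfolding sample_law_def by (intro prob_space_PiM P.prob_space_axioms)
qed

text \<open>The chi-square divergence is of order \<open>\<epsilon>\<^sup>2\<close>: the first-order terms cancel as both densities have mass 1.\<close>

lemma reciprocal_likelihood_mean:
  assumes \<epsilon>: "0 \<le> \<epsilon>" "AE x in mu. \<bar>ln (dens j \<theta> x) - ln (fo x)\<bar> \<le> \<epsilon>"
  shows "(\<integral>\<^sup>+X. (\<Prod>i=1..n. ennreal (fo (X i) / dens j \<theta> (X i))) \<partial>sample_law fo n) \<le> ennreal (exp (real n * (exp (2 * \<epsilon>) * \<epsilon>\<^sup>2)))"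
proof -
  let ?P = "density mu (\<lambda>x. ennreal (fo x))"
  interpret P: prob_space ?P by (rule prob_space_fo[OF fo j])
  interpret PP: product_sigma_finite "\<lambda>_::nat. ?P" by standard
  note [measurable] = prob_densityD(1)[OF fo] prob_densityD(1)[OF prob_density_dens[of j \<theta>]]
  define C where "C = exp (2 * \<epsilon>) * \<epsilon>\<^sup>2"
  have C: "0 \<le> C" by (simp add: C_def)
  have C_alt: "C = (exp \<epsilon> * \<epsilon>)\<^sup>2" by (simp add: C_def power_mult_distrib exp_double)
  have "(\<integral>\<^sup>+x. ennreal (fo x / dens j \<theta> x) \<partial>?P) = (\<integral>\<^sup>+x. ennreal (fo x) * ennreal (fo x / dens j \<theta> x) \<partial>mu)"
    by (subst nn_integral_density) auto
  \<comment> \<open>With \<open>fo = f * exp r\<close>, expanding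
    \<open>(exp r - 1)^2 \<le> C\<close> and multiplying by f gives this majorant, whose integral is
    1 + C.\<close>
  also have "\<dots> \<le> (\<integral>\<^sup>+x. ennreal (2 * fo x + (C - 1) * dens j \<theta> x) \<partial>mu)"
  proof (rule nn_integral_mono_AE)
    show "AE x in mu. ennreal (fo x) * ennreal (fo x / dens j \<theta> x) \<le> ennreal (2 * fo x + (C - 1) * dens j \<theta> x)"
      using \<epsilon>(2) prob_densityD(2)[OF fo]
    proof eventually_elim
      case (elim x)
      define f where "f = dens j \<theta> x"
      define r where "r = ln (fo x) - ln f"
      have f: "0 < f" by (simp add: f_def dens_pos)
      have r: "\<bar>r\<bar> \<le> \<epsilon>" using elim by (simp add: r_def f_def)
      have fr: "fo x = f * exp r" using elim f by (simp add: r_def exp_diff)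
      have "\<bar>exp r - exp 0\<bar> \<le> exp \<epsilon> * \<bar>r - 0\<bar>" by (rule exp_diff_bounds(2)) (use r \<epsilon> in auto)
      also have "\<dots> \<le> exp \<epsilon> * \<epsilon>" using r by simp
      finally have "\<bar>exp r - 1\<bar>\<^sup>2 \<le> (exp \<epsilon> * \<epsilon>)\<^sup>2" by (intro power_mono) auto
      then have "(exp r - 1)\<^sup>2 \<le> C"
        by (simp only: power2_abs C_alt)
      moreover have "(exp r - 1)\<^sup>2 = exp r * exp r - 2 * exp r + 1" by (simp add: power2_eq_square algebra_simps)
      ultimately have "exp r * exp r \<le> 2 * exp r + (C - 1)" by linarith
      then have "f * (exp r * exp r) \<le> f * (2 * exp r + (C - 1))"
        using f by (intro mult_left_mono) auto
      then have "fo x * (fo x / f) \<le> 2 * fo x + (C - 1) * f"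
        using f by (simp add: fr algebra_simps)
      then show ?case using elim f by (simp add: f_def ennreal_mult[symmetric] ennreal_leI)
    qed
  qed
  also have "\<dots> = ennreal (\<integral>x. 2 * fo x + (C - 1) * dens j \<theta> x \<partial>mu)"
  proof (rule nn_integral_eq_integral)
    show "integrable mu (\<lambda>x. 2 * fo x + (C - 1) * dens j \<theta> x)"
      using prob_densityD(3)[OF fo] dens_integral(1) by auto
    show "AE x in mu. 0 \<le> 2 * fo x + (C - 1) * dens j \<theta> x"
      using \<epsilon>(2) prob_densityD(2)[OF fo]
    proof eventually_elim
      case (elim x)
      define f where "f = dens j \<theta> x"
      define r where "r = ln (fo x) - ln f"
      have f: "0 < f" by (simp add: f_def dens_pos)
      have r: "\<bar>r\<bar> \<le> \<epsilon>" using elim by (simp add: r_def f_def)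
      have fr: "fo x = f * exp r" using elim f by (simp add: r_def exp_diff)
      have "\<bar>exp r - exp 0\<bar> \<le> exp \<epsilon> * \<bar>r - 0\<bar>" by (rule exp_diff_bounds(2)) (use r \<epsilon> in auto)
      also have "\<dots> \<le> exp \<epsilon> * \<epsilon>" using r by simp
      finally have "\<bar>exp r - 1\<bar>\<^sup>2 \<le> (exp \<epsilon> * \<epsilon>)\<^sup>2" by (intro power_mono) auto
      then have "(exp r - 1)\<^sup>2 \<le> C"
        by (simp only: power2_abs C_alt)
      moreover have "(exp r - 1)\<^sup>2 = exp r * exp r - 2 * exp r + 1" by (simp add: power2_eq_square algebra_simps)
      moreover have "0 \<le> exp r * exp r" by simp
      ultimately have "0 \<le> 2 * exp r + (C - 1)" by linarith
      then have "0 \<le> f * (2 * exp r + (C - 1))" using f by simp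
      then show "0 \<le> 2 * fo x + (C - 1) * dens j \<theta> x" unfolding f_def[symmetric] fr by (simp add: algebra_simps)
    qed
  qed
  also have "(\<integral>x. 2 * fo x + (C - 1) * dens j \<theta> x \<partial>mu) = 1 + C"
    using prob_densityD(3,4)[OF fo] dens_integral[of j \<theta>] by simp
  finally have one: "(\<integral>\<^sup>+x. ennreal (fo x / dens j \<theta> x) \<partial>?P) \<le> ennreal (1 + C)" .
  have "(\<integral>\<^sup>+X. (\<Prod>i=1..n. ennreal (fo (X i) / dens j \<theta> (X i))) \<partial>sample_law fo n) = (\<Prod>i=1..n. \<integral>\<^sup>+x. ennreal (fo x / dens j \<theta> x) \<partial>?P)"
    unfolding sample_law_def by (rule PP.product_nn_integral_prod) auto
  also have "\<dots> \<le> ennreal (1 + C) ^ n" using one by (simp add: power_mono)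
  also have "\<dots> = ennreal ((1 + C) ^ n)" by (rule ennreal_power) (use C in simp)
  also have "\<dots> \<le> ennreal (exp C ^ n)" using C by (intro ennreal_leI power_mono) auto
  also have "exp C ^ n = exp (real n * C)" by (simp add: exp_of_nat_mult)
  finally show ?thesis by (simp add: C_def)
qed

text \<open>By the Cauchy-Schwarz inequality the integrals over \<open>S\<close> of the likelihood
  ratio and of its reciprocal have product at least \<open>p^2\<close>. A small first integral thus
  forces a large second one, whose mean is at most p times the exponential factor; Markov's
  inequality makes this unlikely.\<close>

lemma denominator_bound:
  assumes S: "S \<in> sets (coords (num_basis j))" and p: "0 < p" "emeasure (prior j) S = ennreal p" and y: "0 < y"
    and \<epsilon>: "0 \<le> \<epsilon>" "\<And>\<theta>. \<theta> \<in> S \<Longrightarrow> AE x in mu. \<bar>ln (dens j \<theta> x) - ln (fo x)\<bar> \<le> \<epsilon>"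
  shows "measure (sample_law fo n) {X \<in> space (sample_law fo n).
      (\<integral>\<^sup>+\<theta>. indicator S \<theta> * (\<Prod>i=1..n. ennreal (dens j \<theta> (X i) / fo (X i))) \<partial>prior j) \<le> ennreal y}
    \<le> y / p * exp (real n * (exp (2 * \<epsilon>) * \<epsilon>\<^sup>2))"
proof -
  interpret fin: finite_measure "prior j" by (rule finite_measure_prior(1)[OF j])
  interpret PS: prob_space "sample_law fo n" by (rule sample_prob_space)
  interpret pair: pair_sigma_finite "sample_law fo n" "prior j" ..
  note [measurable] = prob_densityD(1)[OF fo]
  have [measurable]: "(\<lambda>z. dens j (fst z) (snd z)) \<in> borel_measurable (coords (num_basis j) \<Otimes>\<^sub>M mu)"
    using dens_measurable_pair_mu by (simp add: case_prod_beta)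
  have Sp[measurable]: "S \<in> sets (prior j)" using S sets_prior[OF fo j] by simp
  let ?D = "\<lambda>X. \<integral>\<^sup>+\<theta>. indicator S \<theta> * (\<Prod>i=1..n. ennreal (dens j \<theta> (X i) / fo (X i))) \<partial>prior j"
  let ?R = "\<lambda>X. \<integral>\<^sup>+\<theta>. indicator S \<theta> * (\<Prod>i=1..n. ennreal (fo (X i) / dens j \<theta> (X i))) \<partial>prior j"
  have g: "(\<lambda>(\<theta>, x). ennreal (dens j \<theta> x / fo x)) \<in> borel_measurable (coords (num_basis j) \<Otimes>\<^sub>M mu)"
    "(\<lambda>(\<theta>, x). ennreal (fo x / dens j \<theta> x)) \<in> borel_measurable (coords (num_basis j) \<Otimes>\<^sub>M mu)"
    unfolding case_prod_beta by measurable
  have D[measurable]: "?D \<in> borel_measurable (sample_law fo n)" and R[measurable]: "?R \<in> borel_measurable (sample_law fo n)"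
    by (rule likelihood_integral_measurable[OF S g(1)], rule likelihood_integral_measurable[OF S g(2)])
  have int: "(\<integral>\<^sup>+X. ?R X \<partial>sample_law fo n) \<le> ennreal (p * exp (real n * (exp (2 * \<epsilon>) * \<epsilon>\<^sup>2)))"
  proof -
    have "(\<integral>\<^sup>+X. ?R X \<partial>sample_law fo n) = (\<integral>\<^sup>+\<theta>. (\<integral>\<^sup>+X. indicator S \<theta> * (\<Prod>i=1..n. ennreal (fo (X i) / dens j \<theta> (X i))) \<partial>sample_law fo n) \<partial>prior j)"
      by (rule pair.Fubini'[symmetric]) (rule product_measurable[OF S g(2)])
    also have "\<dots> \<le> (\<integral>\<^sup>+\<theta>. ennreal (exp (real n * (exp (2 * \<epsilon>) * \<epsilon>\<^sup>2))) * indicator S \<theta> \<partial>prior j)"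
    proof (rule nn_integral_mono)
      fix \<theta>
      show "(\<integral>\<^sup>+X. indicator S \<theta> * (\<Prod>i=1..n. ennreal (fo (X i) / dens j \<theta> (X i))) \<partial>sample_law fo n) \<le> ennreal (exp (real n * (exp (2 * \<epsilon>) * \<epsilon>\<^sup>2))) * indicator S \<theta>"
      proof (cases "\<theta> \<in> S")
        case True
        then show ?thesis using reciprocal_likelihood_mean[OF \<epsilon>(1) \<epsilon>(2)[OF True], of n]
          by (simp only: indicator_simps mult_1_left mult_1_right)
      qed simp
    qed
    also have "\<dots> = ennreal (exp (real n * (exp (2 * \<epsilon>) * \<epsilon>\<^sup>2))) * ennreal p"
      using p by (simp add: nn_integral_cmult)
    finally show ?thesis using p by (simp add: ennreal_mult[symmetric] mult.commute)
  qed
  have imp: "AE X in sample_law fo n. ?D X \<le> ennreal y \<longrightarrow> ennreal (p\<^sup>2 / y) \<le> ?R X"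
    using sample_AE_pos[of n] AE_space
  proof eventually_elim
    case (elim X)
    show ?case
    proof
      assume Dy: "?D X \<le> ennreal y"
      let ?g = "\<lambda>\<theta>. \<Prod>i=1..n. dens j \<theta> (X i) / fo (X i)"
      have meas: "(\<lambda>\<theta>. indicator S \<theta> * (\<Prod>i=1..n. ennreal (dens j \<theta> (X i) / fo (X i)))) \<in> borel_measurable (prior j)"
        "(\<lambda>\<theta>. indicator S \<theta> * (\<Prod>i=1..n. ennreal (fo (X i) / dens j \<theta> (X i)))) \<in> borel_measurable (prior j)"
        using measurable_Pair2[OF product_measurable[OF S g(1)] elim(2)] measurable_Pair2[OF product_measurable[OF S g(2)] elim(2)] by auto
      have "ennreal (2 * p) = (\<integral>\<^sup>+\<theta>. 2 * indicator S \<theta> \<partial>prior j)"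
        using p by (simp add: nn_integral_cmult ennreal_mult)
      also have "\<dots> \<le> (\<integral>\<^sup>+\<theta>. ennreal (p / y) * (indicator S \<theta> * (\<Prod>i=1..n. ennreal (dens j \<theta> (X i) / fo (X i)))) +
          ennreal (y / p) * (indicator S \<theta> * (\<Prod>i=1..n. ennreal (fo (X i) / dens j \<theta> (X i)))) \<partial>prior j)"
      proof (rule nn_integral_mono)
        fix \<theta>
        have gpos: "0 < ?g \<theta>" using elim(1) dens_pos by (intro prod_pos) auto
        have e1: "(\<Prod>i=1..n. ennreal (dens j \<theta> (X i) / fo (X i))) = ennreal (?g \<theta>)"
          using elim(1) dens_pos by (intro prod_ennreal) (auto simp: less_imp_le)
        have "(\<Prod>i=1..n. ennreal (fo (X i) / dens j \<theta> (X i))) = ennreal (\<Prod>i=1..n. fo (X i) / dens j \<theta> (X i))"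
          using elim(1) dens_pos by (intro prod_ennreal) (auto simp: less_imp_le)
        also have "(\<Prod>i=1..n. fo (X i) / dens j \<theta> (X i)) = 1 / ?g \<theta>" by (simp add: prod_dividef)
        finally have e2: "(\<Prod>i=1..n. ennreal (fo (X i) / dens j \<theta> (X i))) = ennreal (1 / ?g \<theta>)" .
        \<comment> \<open>Cauchy-Schwarz in the form \<open>2 \<le> a + 1 / a\<close>, scaled so
          that the integral assumed to be small contributes at most p.\<close>
        define a where "a = p / y * ?g \<theta>"
        have a: "0 < a" using p y gpos by (simp add: a_def)
        have "0 \<le> (a - 1)\<^sup>2 / a" using a by simp
        then have "2 \<le> a + 1 / a" using a by (simp add: power2_eq_square field_simps)
        also have "1 / a = y / p * (1 / ?g \<theta>)" by (simp add: a_def)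
        finally have "ennreal 2 \<le> ennreal (p / y) * ennreal (?g \<theta>) + ennreal (y / p) * ennreal (1 / ?g \<theta>)"
          using p y gpos unfolding a_def by (simp add: ennreal_mult[symmetric] ennreal_plus[symmetric] less_imp_le del: ennreal_plus)
        then show "2 * indicator S \<theta> \<le> ennreal (p / y) * (indicator S \<theta> * (\<Prod>i=1..n. ennreal (dens j \<theta> (X i) / fo (X i)))) +
          ennreal (y / p) * (indicator S \<theta> * (\<Prod>i=1..n. ennreal (fo (X i) / dens j \<theta> (X i))))"
          unfolding e1 e2 by (cases "\<theta> \<in> S") auto
      qed
      also have "\<dots> = ennreal (p / y) * ?D X + ennreal (y / p) * ?R X"
        using meas by (simp add: nn_integral_add nn_integral_cmult)
      also have "\<dots> \<le> ennreal (p / y) * ennreal y + ennreal (y / p) * ?R X"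
        by (intro add_mono mult_left_mono Dy) auto
      also have "ennreal (p / y) * ennreal y = ennreal p" using p y by (simp add: ennreal_mult[symmetric])
      finally have le: "ennreal (2 * p) \<le> ennreal p + ennreal (y / p) * ?R X" .
      show "ennreal (p\<^sup>2 / y) \<le> ?R X"
      proof (cases "?R X")
        case (real r)
        then have "2 * p \<le> p + y / p * r"
          using le p y by (simp add: ennreal_mult[symmetric] ennreal_plus[symmetric] del: ennreal_plus)
        then have "p\<^sup>2 / y \<le> r" using p y by (simp add: power2_eq_square field_simps)
        then show ?thesis using real by (simp add: ennreal_leI)
      qed simp
    qed
  qed
  have "emeasure (sample_law fo n) {X \<in> space (sample_law fo n). ?D X \<le> ennreal y} \<le> emeasure (sample_law fo n) {X \<in> space (sample_law fo n). ennreal (p\<^sup>2 / y) \<le> ?R X}"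
  proof (rule emeasure_mono_AE)
    show "AE X in sample_law fo n. X \<in> {X \<in> space (sample_law fo n). ?D X \<le> ennreal y} \<longrightarrow> X \<in> {X \<in> space (sample_law fo n). ennreal (p\<^sup>2 / y) \<le> ?R X}"
      using imp by (rule eventually_mono) blast
    show "{X \<in> space (sample_law fo n). ennreal (p\<^sup>2 / y) \<le> ?R X} \<in> sets (sample_law fo n)" by measurable
  qed
  also have "\<dots> = emeasure (sample_law fo n) {X \<in> space (sample_law fo n). 1 \<le> ennreal (y / p\<^sup>2) * ?R X}"
  proof -
    have "ennreal (p\<^sup>2 / y) \<le> r \<longleftrightarrow> 1 \<le> ennreal (y / p\<^sup>2) * r" for r
      using p y by (cases r) (auto simp: ennreal_mult[symmetric] ennreal_mult_top field_simps)
    then show ?thesis by simp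
  qed
  also have "\<dots> \<le> ennreal (y / p\<^sup>2) * (\<integral>\<^sup>+X. ?R X * indicator (space (sample_law fo n)) X \<partial>sample_law fo n)"
    by (rule nn_integral_Markov_inequality[OF borel_measurable_times_ennreal[OF R borel_measurable_indicator[OF sets.top]] sets.top])
  also have "(\<integral>\<^sup>+X. ?R X * indicator (space (sample_law fo n)) X \<partial>sample_law fo n) = (\<integral>\<^sup>+X. ?R X \<partial>sample_law fo n)"
    by (intro nn_integral_cong) simp
  also have "ennreal (y / p\<^sup>2) * \<dots> \<le> ennreal (y / p\<^sup>2) * ennreal (p * exp (real n * (exp (2 * \<epsilon>) * \<epsilon>\<^sup>2)))"
    by (intro mult_left_mono int) simp
  also have "\<dots> = ennreal (y / p * exp (real n * (exp (2 * \<epsilon>) * \<epsilon>\<^sup>2)))"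
    using p y by (simp add: ennreal_mult[symmetric] power2_eq_square)
  finally show ?thesis using p y by (simp add: PS.emeasure_eq_measure)
qed

end

section \<open>Summing over the models\<close>

definition far_set :: "(real \<Rightarrow> real) \<Rightarrow> real \<Rightarrow> index \<Rightarrow> (nat \<Rightarrow> real) set" where
  "far_set fo t j = {\<theta> \<in> Theta j. hellinger (dens j \<theta>) fo > t}"

text \<open>The likelihood is divided by that of \<open>fo\<close>, so that it has bounded mean; the
  common factor cancels in the posterior.\<close>

definition evidence :: "(real \<Rightarrow> real) \<Rightarrow> nat \<Rightarrow> (nat \<Rightarrow> real) \<Rightarrow> index \<Rightarrow> (nat \<Rightarrow> real) set \<Rightarrow> ennreal" where
  "evidence fo n X j A = (\<integral>\<^sup>+\<theta>. indicator A \<theta> * (\<Prod>i=1..n. ennreal (dens j \<theta> (X i) / fo (X i))) \<partial>prior j)"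

lemma weight_nonneg: "0 \<le> weight \<gamma> j"
  by (auto simp: weight_def raw_weight_def intro!: mult_nonneg_nonneg divide_nonneg_nonneg infsum_nonneg)

lemma evidence_measurable:
  assumes fo: "prob_density fo" and "j \<in> J" "A \<in> sets (coords (num_basis j))"
  shows "(\<lambda>X. evidence fo n X j A) \<in> borel_measurable (sample_law fo n)"
proof -
  note [measurable] = prob_densityD(1)[OF fo]
  have [measurable]: "(\<lambda>z. dens j (fst z) (snd z)) \<in> borel_measurable (coords (num_basis j) \<Otimes>\<^sub>M mu)"
    using dens_measurable_pair_mu[OF fo assms(2)] by (simp add: case_prod_beta)
  have "(\<lambda>(\<theta>, x). ennreal (dens j \<theta> x / fo x)) \<in> borel_measurable (coords (num_basis j) \<Otimes>\<^sub>M mu)"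
    unfolding case_prod_beta by measurable
  then show ?thesis unfolding evidence_def
    by (rule likelihood_integral_measurable[OF assms])
qed

lemma posterior_far_measurable:
  assumes fo: "prob_density fo"
  shows "posterior_far \<gamma> fo n t \<in> borel_measurable (sample_law fo n)"
proof -
  obtain e :: "nat \<Rightarrow> index" where e: "bij_betw e UNIV J" using J_enumeration by blast
  have eJ: "e i \<in> J" for i using e by (auto simp: bij_betw_def)
  have g: "(\<lambda>(\<theta>, x). ennreal (dens j \<theta> x)) \<in> borel_measurable (coords (num_basis j) \<Otimes>\<^sub>M mu)" if "j \<in> J" for j
  proof -
    have [measurable]: "(\<lambda>z. dens j (fst z) (snd z)) \<in> borel_measurable (coords (num_basis j) \<Otimes>\<^sub>M mu)"
      using dens_measurable_pair_mu[OF fo that] by (simp add: case_prod_beta)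
    show ?thesis unfolding case_prod_beta by measurable
  qed
  have [measurable]: "(\<lambda>X. \<integral>\<^sup>+\<theta>\<in>{\<theta> \<in> Theta (e i). hellinger (dens (e i) \<theta>) fo > t}. (\<Prod>k = 1..n. ennreal (dens (e i) \<theta> (X k))) \<partial>prior (e i)) \<in> borel_measurable (sample_law fo n)" for i
    using likelihood_integral_measurable[OF fo eJ far_sets[OF fo eJ] g[OF eJ], of i t n] by (simp only: mult.commute)
  have [measurable]: "(\<lambda>X. \<integral>\<^sup>+\<theta>\<in>Theta (e i). (\<Prod>k = 1..n. ennreal (dens (e i) \<theta> (X k))) \<partial>prior (e i)) \<in> borel_measurable (sample_law fo n)" for i
    using likelihood_integral_measurable[OF fo eJ Theta_sets[OF eJ] g[OF eJ], of i n] by (simp only: mult.commute)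
  show ?thesis unfolding posterior_far_def[abs_def] ennreal_infsum_eq_suminf[OF e] by measurable
qed

lemma inverse_antimono_ennreal:
  fixes a b :: ennreal
  assumes "a \<le> b" shows "inverse b \<le> inverse a"
proof (cases "a = 0 \<or> b = top")
  case False
  then obtain x y where xy: "a = ennreal x" "b = ennreal y" "0 < x" "0 < y"
    using assms by (cases a; cases b) (auto simp: top_unique less_le)
  then have "x \<le> y" using assms by simp
  then show ?thesis using xy by (simp add: inverse_ennreal ennreal_leI le_imp_inverse_le)
qed auto

text \<open>Numerator and denominator of the posterior share the factor c, the likelihood of
  \<open>fo\<close>. The denominator is reduced to the single model j on \<open>S\<close>, and
  squaring u bounds the numerator.\<close>

lemma posterior_far_le:
  assumes fo: "prob_density fo" and X: "\<forall>i\<in>{1..n}. 0 < fo (X i)" "X \<in> space (sample_law fo n)"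
    and e: "bij_betw e UNIV J" and j: "j \<in> J" "0 < weight \<gamma> j"
    and S: "S \<subseteq> Theta j" "S \<in> sets (coords (num_basis j))" and y: "0 < y" "ennreal y < evidence fo n X j S"
    and u: "esqrt (\<Sum>i. ennreal (weight \<gamma> (e i)) * evidence fo n X (e i) (far_set fo t (e i))) \<le> ennreal u" "0 \<le> u"
  shows "posterior_far \<gamma> fo n t X \<le> ennreal (u\<^sup>2 / (weight \<gamma> j * y))"
proof -
  define c where "c = (\<Prod>i=1..n. fo (X i))"
  have c: "0 < c" using X unfolding c_def by (intro prod_pos) auto
  have eJ: "e i \<in> J" for i using e by (auto simp: bij_betw_def)
  have split: "(\<Prod>i = 1..n. ennreal (dens j \<theta> (X i))) = ennreal c * (\<Prod>i = 1..n. ennreal (dens j \<theta> (X i) / fo (X i)))" for j \<theta>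
  proof -
    have "(\<Prod>i = 1..n. ennreal (dens j \<theta> (X i))) = (\<Prod>i = 1..n. ennreal (fo (X i)) * ennreal (dens j \<theta> (X i) / fo (X i)))"
    proof (intro prod.cong refl)
      fix i assume "i \<in> {1..n}"
      then have "0 < fo (X i)" using X by auto
      then show "ennreal (dens j \<theta> (X i)) = ennreal (fo (X i)) * ennreal (dens j \<theta> (X i) / fo (X i))"
        using dens_pos[of j \<theta> "X i"] by (simp add: ennreal_mult[symmetric])
    qed
    also have "\<dots> = ennreal c * (\<Prod>i = 1..n. ennreal (dens j \<theta> (X i) / fo (X i)))"
      unfolding prod.distrib c_def using X by (subst prod_ennreal) (auto simp: less_imp_le)
    finally show ?thesis .
  qed
  have ev: "(\<integral>\<^sup>+\<theta>\<in>A. (\<Prod>i = 1..n. ennreal (dens j \<theta> (X i))) \<partial>prior j) = ennreal c * evidence fo n X j A"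
    if j: "j \<in> J" and A: "A \<in> sets (coords (num_basis j))" for j A
  proof -
    note [measurable] = prob_densityD(1)[OF fo]
    have [measurable]: "(\<lambda>z. dens j (fst z) (snd z)) \<in> borel_measurable (coords (num_basis j) \<Otimes>\<^sub>M mu)"
      using dens_measurable_pair_mu[OF fo j] by (simp add: case_prod_beta)
    have "(\<lambda>(\<theta>, x). ennreal (dens j \<theta> x / fo x)) \<in> borel_measurable (coords (num_basis j) \<Otimes>\<^sub>M mu)"
      unfolding case_prod_beta by measurable
    from measurable_Pair2[OF product_measurable[OF fo j A this] X(2)]
    have meas: "(\<lambda>\<theta>. indicator A \<theta> * (\<Prod>i=1..n. ennreal (dens j \<theta> (X i) / fo (X i)))) \<in> borel_measurable (prior j)" by simp
    have "(\<integral>\<^sup>+\<theta>\<in>A. (\<Prod>i = 1..n. ennreal (dens j \<theta> (X i))) \<partial>prior j) = (\<integral>\<^sup>+\<theta>. ennreal c * (indicator A \<theta> * (\<Prod>i=1..n. ennreal (dens j \<theta> (X i) / fo (X i)))) \<partial>prior j)"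
      unfolding split by (intro nn_integral_cong) (simp only: mult_ac)
    also have "\<dots> = ennreal c * evidence fo n X j A"
      unfolding evidence_def by (rule nn_integral_cmult[OF meas])
    finally show ?thesis .
  qed
  let ?N = "\<Sum>i. ennreal (weight \<gamma> (e i)) * evidence fo n X (e i) (far_set fo t (e i))"
  have num: "(\<Sum>\<^sub>\<infinity>j\<in>J. ennreal (weight \<gamma> j) *
        (\<integral>\<^sup>+\<theta>\<in>{\<theta> \<in> Theta j. hellinger (dens j \<theta>) fo > t}. (\<Prod>i = 1..n. ennreal (dens j \<theta> (X i))) \<partial>prior j)) = ennreal c * ?N"
    unfolding ennreal_infsum_eq_suminf[OF e] far_set_def ennreal_suminf_cmult[symmetric]
    unfolding ev[OF eJ far_sets[OF fo eJ]] by (intro suminf_cong) (simp only: mult_ac)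
  have "j \<in> range e" using e j(1) by (simp add: bij_betw_def)
  then obtain i0 where i0: "e i0 = j" by blast
  have den: "ennreal c * ennreal (weight \<gamma> j * y) \<le> (\<Sum>\<^sub>\<infinity>j\<in>J. ennreal (weight \<gamma> j) *
        (\<integral>\<^sup>+\<theta>\<in>Theta j. (\<Prod>i = 1..n. ennreal (dens j \<theta> (X i))) \<partial>prior j))"
  proof -
    have "ennreal c * ennreal (weight \<gamma> j * y) = ennreal (weight \<gamma> j) * (ennreal c * ennreal y)"
      using y j(2) by (simp add: ennreal_mult mult_ac)
    also have "\<dots> \<le> ennreal (weight \<gamma> j) * (ennreal c * evidence fo n X j (Theta j))"
    proof (intro mult_left_mono)
      have "evidence fo n X j S \<le> evidence fo n X j (Theta j)"
        unfolding evidence_def using S(1) by (intro nn_integral_mono mult_right_mono) (auto simp: indicator_def)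
      then show "ennreal y \<le> evidence fo n X j (Theta j)" using y(2) by (meson less_imp_le order_trans)
    qed auto
    also have "\<dots> = ennreal (weight \<gamma> (e i0)) * (\<integral>\<^sup>+\<theta>\<in>Theta (e i0). (\<Prod>i = 1..n. ennreal (dens (e i0) \<theta> (X i))) \<partial>prior (e i0))"
      unfolding i0 by (simp only: ev[OF j(1) Theta_sets[OF j(1)]])
    also have "\<dots> \<le> (\<Sum>i. ennreal (weight \<gamma> (e i)) * (\<integral>\<^sup>+\<theta>\<in>Theta (e i). (\<Prod>k = 1..n. ennreal (dens (e i) \<theta> (X k))) \<partial>prior (e i)))"
      using sum_le_suminf[of "\<lambda>i. ennreal (weight \<gamma> (e i)) * (\<integral>\<^sup>+\<theta>\<in>Theta (e i). (\<Prod>k = 1..n. ennreal (dens (e i) \<theta> (X k))) \<partial>prior (e i))" "{i0}"] by simp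
    finally show ?thesis unfolding ennreal_infsum_eq_suminf[OF e] .
  qed
  have N: "?N \<le> ennreal (u\<^sup>2)"
  proof -
    have "?N = esqrt ?N * esqrt ?N" by (simp only: esqrt_square)
    also have "\<dots> \<le> ennreal u * ennreal u" using u by (intro mult_mono) auto
    finally show ?thesis using u(2) by (simp add: ennreal_mult[symmetric] power2_eq_square)
  qed
  have wy: "0 < weight \<gamma> j * y" using y j by simp
  have anti: "a / b \<le> a / b'" if "b' \<le> b" for a b b' :: ennreal
    unfolding divide_ennreal_def using that by (intro mult_left_mono inverse_antimono_ennreal) auto
  have "posterior_far \<gamma> fo n t X \<le> ennreal c * ennreal (u\<^sup>2) / (ennreal c * ennreal (weight \<gamma> j * y))"
    unfolding posterior_far_def num
    by (rule order_trans[OF divide_right_mono_ennreal[OF mult_left_mono[OF N]] anti[OF den]]) simp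
  also have "\<dots> = ennreal (c * u\<^sup>2 / (c * (weight \<gamma> j * y)))"
    using c wy by (simp add: ennreal_mult[symmetric] divide_ennreal)
  also have "c * u\<^sup>2 / (c * (weight \<gamma> j * y)) = u\<^sup>2 / (weight \<gamma> j * y)" using c by simp
  finally show ?thesis .
qed

text \<open>The square root is taken inside the sum over the models. The square root of the weight
  supplies \<open>exp (- eta / 2)\<close>, the model costs \<open>exp (eta / 4)\<close>, and the
  remaining \<open>exp (- eta / 4)\<close> is summable.\<close>

lemma numerator_bound:
  assumes fo: "prob_density fo" and \<gamma>: "0 < \<gamma>" "\<gamma> < 1 / 4" "0.13 * \<gamma> / sqrt (1 - 4 * \<gamma>) = 0.0056"
    and e: "bij_betw e UNIV J"
  shows "\<exists>C\<ge>0. \<forall>n t. 0 < t \<longrightarrow>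
    (\<integral>\<^sup>+X. esqrt (\<Sum>i. ennreal (weight \<gamma> (e i)) * evidence fo n X (e i) (far_set fo t (e i))) \<partial>sample_law fo n)
      \<le> ennreal (C * exp (- (real n * t\<^sup>2 / 192)))"
proof -
  have eJ: "e i \<in> J" for i using e by (auto simp: bij_betw_def)
  define \<alpha> where "\<alpha> = 1 / (\<Sum>\<^sub>\<infinity>i\<in>J. raw_weight \<gamma> i)"
  have \<alpha>: "0 \<le> \<alpha>" by (auto simp: \<alpha>_def raw_weight_def intro!: divide_nonneg_nonneg infsum_nonneg)
  have "(\<lambda>i. exp (- (eta \<gamma> (e i) / 4))) summable_on UNIV"
    using summable_exp_eta[OF \<gamma>] by (subst summable_on_reindex_bij_betw[OF e]) auto
  then have sm: "summable (\<lambda>i. exp (- (eta \<gamma> (e i) / 4)))"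
    by (subst (asm) summable_on_UNIV_nonneg_real_iff) auto
  define C where "C = sqrt \<alpha> * (\<Sum>i. exp (- (eta \<gamma> (e i) / 4)))"
  show ?thesis
  proof (intro exI[of _ C] conjI allI impI)
    show "0 \<le> C" unfolding C_def using \<alpha> by (intro mult_nonneg_nonneg suminf_nonneg sm) auto
    fix n :: nat and t :: real assume t: "0 < t"
    have meas: "(\<lambda>X. evidence fo n X (e i) (far_set fo t (e i))) \<in> borel_measurable (sample_law fo n)" for i
      unfolding far_set_def by (rule evidence_measurable[OF fo eJ far_sets[OF fo eJ]])
    note [measurable] = meas
    define q where "q = exp (- (real n * t\<^sup>2 / 192))"
    have "(\<integral>\<^sup>+X. esqrt (\<Sum>i. ennreal (weight \<gamma> (e i)) * evidence fo n X (e i) (far_set fo t (e i))) \<partial>sample_law fo n)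
      \<le> (\<integral>\<^sup>+X. (\<Sum>i. esqrt (ennreal (weight \<gamma> (e i))) * esqrt (evidence fo n X (e i) (far_set fo t (e i)))) \<partial>sample_law fo n)"
      by (intro nn_integral_mono order_trans[OF esqrt_suminf_le]) (simp add: esqrt_mult)
    also have "\<dots> = (\<Sum>i. \<integral>\<^sup>+X. esqrt (ennreal (weight \<gamma> (e i))) * esqrt (evidence fo n X (e i) (far_set fo t (e i))) \<partial>sample_law fo n)"
      by (rule nn_integral_suminf) measurable
    also have "\<dots> = (\<Sum>i. esqrt (ennreal (weight \<gamma> (e i))) * piece fo n (e i) (far_set fo t (e i)))"
      unfolding piece_def evidence_def[symmetric] by (intro suminf_cong nn_integral_cmult) measurable
    also have "\<dots> \<le> (\<Sum>i. ennreal (sqrt \<alpha> * q) * ennreal (exp (- (eta \<gamma> (e i) / 4))))"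
    proof (intro suminf_le)
      fix i
      obtain k p L where ei: "e i = (k, p, L)" by (cases "e i") auto
      have eta: "0 \<le> eta \<gamma> (e i)"
        using eta_lower_bounds(2)[OF \<gamma>, of p k L] eJ[of i] by (auto simp: ei J_def)
      have "1 * eta \<gamma> (e i) \<le> (1 + (1 - 4 * \<gamma>) / 8) * eta \<gamma> (e i)"
        using eta \<gamma> by (intro mult_right_mono) auto
      then have "raw_weight \<gamma> (e i) \<le> exp (- eta \<gamma> (e i))"
        unfolding raw_weight_def exp_le_cancel_iff mult_minus_left by simp
      then have "raw_weight \<gamma> (e i) \<le> (exp (- (eta \<gamma> (e i) / 2)))\<^sup>2"
        by (simp add: power2_eq_square exp_add[symmetric])
      then have "sqrt (weight \<gamma> (e i)) \<le> sqrt (\<alpha> * (exp (- (eta \<gamma> (e i) / 2)))\<^sup>2)"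
        unfolding weight_def \<alpha>_def[symmetric] using \<alpha> by (intro real_sqrt_le_mono mult_left_mono) auto
      then have w: "sqrt (weight \<gamma> (e i)) \<le> sqrt \<alpha> * exp (- (eta \<gamma> (e i) / 2))"
        by (simp add: real_sqrt_mult)
      have "esqrt (ennreal (weight \<gamma> (e i))) * piece fo n (e i) (far_set fo t (e i)) \<le>
        ennreal (sqrt \<alpha> * exp (- (eta \<gamma> (e i) / 2))) * ennreal (exp (eta \<gamma> (e i) / 4 - real n * t\<^sup>2 / 192))"
        unfolding far_set_def using w weight_nonneg[of \<gamma> "e i"]
        by (intro mult_mono model_bound[OF fo eJ t \<gamma>]) (auto simp: ennreal_leI)
      also have "\<dots> = ennreal (sqrt \<alpha> * q) * ennreal (exp (- (eta \<gamma> (e i) / 4)))"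
      proof -
        have "exp (- (eta \<gamma> (e i) / 2)) * exp (eta \<gamma> (e i) / 4 - real n * t\<^sup>2 / 192) = q * exp (- (eta \<gamma> (e i) / 4))"
          by (simp add: q_def exp_add[symmetric])
        then have "sqrt \<alpha> * exp (- (eta \<gamma> (e i) / 2)) * exp (eta \<gamma> (e i) / 4 - real n * t\<^sup>2 / 192) = sqrt \<alpha> * q * exp (- (eta \<gamma> (e i) / 4))"
          by (simp only: mult.assoc)
        then show ?thesis using \<alpha> by (simp add: ennreal_mult[symmetric] q_def)
      qed
      finally show "esqrt (ennreal (weight \<gamma> (e i))) * piece fo n (e i) (far_set fo t (e i)) \<le> ennreal (sqrt \<alpha> * q) * ennreal (exp (- (eta \<gamma> (e i) / 4)))" .
    qed auto
    also have "\<dots> = ennreal (sqrt \<alpha> * q) * ennreal (\<Sum>i. exp (- (eta \<gamma> (e i) / 4)))"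
      using sm by (simp add: ennreal_suminf_cmult suminf_ennreal2)
    also have "\<dots> = ennreal (C * exp (- (real n * t\<^sup>2 / 192)))"
      using \<alpha> suminf_nonneg[OF sm] by (simp add: ennreal_mult[symmetric] C_def q_def mult_ac)
    finally show "(\<integral>\<^sup>+X. esqrt (\<Sum>i. ennreal (weight \<gamma> (e i)) * evidence fo n X (e i) (far_set fo t (e i))) \<partial>sample_law fo n)
      \<le> ennreal (C * exp (- (real n * t\<^sup>2 / 192)))" .
  qed
qed

theorem lemma1:
  fixes s :: nat and \<gamma> :: real and fo :: "real \<Rightarrow> real"
  assumes "s \<ge> 1"
    and "0 < \<gamma>" and "\<gamma> < 1 / 4" and "0.13 * \<gamma> / sqrt (1 - 4 * \<gamma>) = 0.0056"
    and "fo \<in> borel_measurable mu"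
    and "AE x in mu. 0 < fo x"
    and "(\<integral>\<^sup>+x. ennreal (fo x) \<partial>mu) = 1"
    and "(\<lambda>x. ln (fo x)) \<in> W_inf s"
  shows "\<exists>sn :: nat \<Rightarrow> real.
           (\<exists>K>0. \<forall>n\<ge>1. sn n = K * real n powr (- (real s / (1 + 2 * real s)))) \<and>
           tends_to_zero_in_prob (sample_law fo) (\<lambda>n. posterior_far \<gamma> fo n (sn n))"
proof -
  note s = assms(1) and \<gamma> = assms(2-4)
  have fo: "prob_density fo" unfolding prob_density_def by (intro conjI assms(5-7))
  obtain e :: "nat \<Rightarrow> index" where e: "bij_betw e UNIV J" using J_enumeration by (elim exE)
  obtain G B where chain: "smooth_chain s (\<lambda>x. ln (fo x)) G B"
    using W_inf_smooth_chain[OF assms(8) s] by (elim exE)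
  note G = chain[unfolded smooth_chain_def, THEN conjunct1]
    chain[unfolded smooth_chain_def, THEN conjunct2, THEN conjunct1, rule_format]
    chain[unfolded smooth_chain_def, THEN conjunct2, THEN conjunct2, rule_format]
  have foG: "AE x in mu. fo x = exp (G 0 x)"
    using G(1) assms(6)
  proof eventually_elim
    case (elim x)
    then show ?case using exp_ln[of "fo x"] by simp
  qed
  have "\<exists>K D. \<forall>b\<ge>1. \<exists>c. (\<forall>x\<in>{0..<1}. \<bar>sp (s * b - 1) (Suc s) c x - G 0 x\<bar> \<le> K / real b ^ s) \<and>
    (\<forall>r i. r \<le> s \<longrightarrow> 1 \<le> i \<longrightarrow> i \<le> s * b - 1 + Suc s - r \<longrightarrow> \<bar>dcs (s * b - 1) (Suc s) c r i\<bar> \<le> D)"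
    by (rule spline_approximation[of s G B]) (fact s, erule (1) G(2), erule (2) G(3))
  then obtain K D where "\<forall>b\<ge>1. \<exists>c. (\<forall>x\<in>{0..<1}. \<bar>sp (s * b - 1) (Suc s) c x - G 0 x\<bar> \<le> K / real b ^ s) \<and>
    (\<forall>r i. r \<le> s \<longrightarrow> 1 \<le> i \<longrightarrow> i \<le> s * b - 1 + Suc s - r \<longrightarrow> \<bar>dcs (s * b - 1) (Suc s) c r i\<bar> \<le> D)"
    by (elim exE)
  then have approx: "\<exists>c. (\<forall>x\<in>{0..<1}. \<bar>sp (s * b - 1) (Suc s) c x - G 0 x\<bar> \<le> K / real b ^ s) \<and>
    (\<forall>r i. r \<le> s \<longrightarrow> 1 \<le> i \<longrightarrow> i \<le> s * b - 1 + Suc s - r \<longrightarrow> \<bar>dcs (s * b - 1) (Suc s) c r i\<bar> \<le> D)" if "b \<ge> 1" for b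
    using that by (elim allE[of _ b] impE)
  have "\<exists>L \<kappa>. 1 \<le> L \<and> (\<forall>b\<ge>1. \<exists>S\<in>sets (coords (s * b - 1 + Suc s)). S \<subseteq> Theta (s * b - 1, Suc s, L) \<and>
     ennreal (exp (- (\<kappa> * real b))) \<le> emeasure (prior (s * b - 1, Suc s, L)) S \<and>
     (\<forall>\<theta>\<in>S. AE x in mu. \<bar>ln (dens (s * b - 1, Suc s, L) \<theta> x) - ln (fo x)\<bar> \<le> 2 * (1 + K) / real b ^ s))"
    by (rule prior_mass[of s fo "G 0" K D, OF s assms(5,7) foG]) (erule approx)
  then obtain L \<kappa> where L_mass: "1 \<le> L \<and> (\<forall>b\<ge>1. \<exists>S\<in>sets (coords (s * b - 1 + Suc s)). S \<subseteq> Theta (s * b - 1, Suc s, L) \<and>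
     ennreal (exp (- (\<kappa> * real b))) \<le> emeasure (prior (s * b - 1, Suc s, L)) S \<and>
     (\<forall>\<theta>\<in>S. AE x in mu. \<bar>ln (dens (s * b - 1, Suc s, L) \<theta> x) - ln (fo x)\<bar> \<le> 2 * (1 + K) / real b ^ s))"
    by (elim exE)
  note L = L_mass[THEN conjunct1] and mass = L_mass[THEN conjunct2, rule_format]
  obtain C where C_bound: "0 \<le> C \<and> (\<forall>n t. 0 < t \<longrightarrow>
    (\<integral>\<^sup>+X. esqrt (\<Sum>i. ennreal (weight \<gamma> (e i)) * evidence fo n X (e i) (far_set fo t (e i))) \<partial>sample_law fo n)
      \<le> ennreal (C * exp (- (real n * t\<^sup>2 / 192))))"
    using numerator_bound[OF fo \<gamma> e] by (elim exE)
  note C = C_bound[THEN conjunct1] C_bound[THEN conjunct2, rule_format]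
  define K' where "K' = \<bar>2 * (1 + K)\<bar>"
  \<comment> \<open>\<open>C1 * b\<close> will bound n times the chi-square bound of a single
    observation; the summand 1 makes \<open>C1\<close> positive.\<close>
  define C1 where "C1 = exp (2 * K') * K'\<^sup>2 + 1"
  have C1: "0 < C1" "exp (2 * K') * K'\<^sup>2 \<le> C1" by (auto simp: C1_def intro: add_nonneg_pos)
  define \<alpha> where "\<alpha> = 1 / (\<Sum>\<^sub>\<infinity>i\<in>J. raw_weight \<gamma> i)"
  have \<alpha>: "0 < \<alpha>"
  proof -
    have "0 \<le> \<alpha>" by (auto simp: \<alpha>_def raw_weight_def intro!: divide_nonneg_nonneg infsum_nonneg)
    moreover have "\<alpha> \<noteq> 0"
    proof
      assume "\<alpha> = 0"
      then have "weight \<gamma> = (\<lambda>_. 0)" by (auto simp: weight_def \<alpha>_def[symmetric])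
      then have "((\<lambda>_. 0 :: real) has_sum 1) J" using weight_has_sum[OF \<gamma>] by simp
      then show False using has_sum_unique[OF _ has_sum_0] by fastforce
    qed
    ultimately show ?thesis by linarith
  qed
  \<comment> \<open>\<open>A_const\<close> depends on q and L only, so this logarithm is the same
    for all b.\<close>
  define X0 where "X0 = \<bar>ln (46.2 * A_const (0, Suc s, L) * sqrt (1 - 4 * \<gamma>) / \<gamma>)\<bar>"
  \<comment> \<open>The dimension \<open>s * b + s\<close> is at most \<open>2 * s * b\<close>, so
    the exponent of the weight grows at most linearly in b, with this slope.\<close>
  define C2 where "C2 = (1 + (1 - 4 * \<gamma>) / 8) * (4 * (2 * real s) / (1 - 4 * \<gamma>) * X0 + 8 * (2 * real s + real L) / (1 - 4 * \<gamma>))"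
  have C2: "0 \<le> C2" using \<gamma> by (auto simp: C2_def X0_def intro!: mult_nonneg_nonneg add_nonneg_nonneg)
  have weight_ge: "\<alpha> * exp (- (C2 * real b)) \<le> weight \<gamma> (s * b - 1, Suc s, L)" if b: "b \<ge> 1" for b
  proof -
    define m where "m = real (s * b - 1 + Suc s)"
    have sb: "s * b \<ge> 1" using s b by (metis mult_le_mono nat_mult_1)
    have "s * b - 1 + Suc s \<le> 2 * s * b" using sb s b by simp
    then have "m \<le> real (2 * s * b)" unfolding m_def by (simp only: of_nat_le_iff)
    then have m: "m \<le> 2 * real s * real b" "0 \<le> m" by (auto simp: m_def)
    have Lb: "real L \<le> real L * real b" using mult_left_mono[of 1 "real b" "real L"] b by simp
    have Aeq: "A_const (s * b - 1, Suc s, L) = A_const (0, Suc s, L)" by simp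
    have "eta \<gamma> (s * b - 1, Suc s, L) = 4 * m / (1 - 4 * \<gamma>) * ln (46.2 * A_const (0, Suc s, L) * sqrt (1 - 4 * \<gamma>) / \<gamma>) + 8 * (m + real L) / (1 - 4 * \<gamma>)"
      unfolding eta_def Aeq by (simp add: m_def del: A_const.simps)
    also have "\<dots> \<le> 4 * (2 * real s * real b) / (1 - 4 * \<gamma>) * X0 + 8 * (2 * real s * real b + real L * real b) / (1 - 4 * \<gamma>)"
    proof (intro add_mono)
      have "4 * m / (1 - 4 * \<gamma>) * ln (46.2 * A_const (0, Suc s, L) * sqrt (1 - 4 * \<gamma>) / \<gamma>) \<le> 4 * m / (1 - 4 * \<gamma>) * X0"
        using \<gamma> m unfolding X0_def by (intro mult_left_mono) auto
      also have "\<dots> \<le> 4 * (2 * real s * real b) / (1 - 4 * \<gamma>) * X0"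
        using \<gamma> m unfolding X0_def by (intro mult_right_mono divide_right_mono) (auto simp: mult_ac)
      finally show "4 * m / (1 - 4 * \<gamma>) * ln (46.2 * A_const (0, Suc s, L) * sqrt (1 - 4 * \<gamma>) / \<gamma>) \<le> 4 * (2 * real s * real b) / (1 - 4 * \<gamma>) * X0" .
      show "8 * (m + real L) / (1 - 4 * \<gamma>) \<le> 8 * (2 * real s * real b + real L * real b) / (1 - 4 * \<gamma>)"
        using \<gamma> m Lb by (intro divide_right_mono mult_left_mono) auto
    qed
    also have "\<dots> = (4 * (2 * real s) / (1 - 4 * \<gamma>) * X0 + 8 * (2 * real s + real L) / (1 - 4 * \<gamma>)) * real b"
      by (simp add: field_simps)
    finally have "(1 + (1 - 4 * \<gamma>) / 8) * eta \<gamma> (s * b - 1, Suc s, L) \<le> C2 * real b"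
      unfolding C2_def mult.assoc using \<gamma> by (intro mult_left_mono) auto
    then have "exp (- (C2 * real b)) \<le> raw_weight \<gamma> (s * b - 1, Suc s, L)"
      unfolding raw_weight_def exp_le_cancel_iff mult_minus_left by simp
    then show ?thesis unfolding weight_def \<alpha>_def[symmetric] using \<alpha> by (intro mult_left_mono) auto
  qed
  \<comment> \<open>The exponential costs per unit of b of the weight, of the prior mass and of the
    lower bound for the evidence.\<close>
  define C4 where "C4 = C2 + \<bar>\<kappa>\<bar> + 2 * C1"
  have C4: "0 < C4" using C1 C2 by (simp add: C4_def)
  \<comment> \<open>Chosen so that \<open>u^2\<close> below equals
    \<open>exp (- ((2 * C4 + 1) * \<tau> n))\<close>, which beats the lower bound
    \<open>\<alpha> * exp (- (2 * C4 * \<tau> n))\<close> of the denominator by a factor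
    \<open>exp (- \<tau> n)\<close>.\<close>
  define M where "M = sqrt (200 * (2 * C4 + 1))"
  have M: "0 < M" "M\<^sup>2 = 200 * (2 * C4 + 1)" using C4 by (auto simp: M_def)
  define a where "a = 1 / (1 + 2 * real s)"
  have a: "0 < a" by (simp add: a_def)
  define \<tau> where "\<tau> n = real n powr a" for n
  define sn where "sn n = M * real n powr (- (real s / (1 + 2 * real s)))" for n
  define bound where "bound n = C * exp (- ((M\<^sup>2 / 192 - M\<^sup>2 / 400) * \<tau> n)) + exp (- (C1 * \<tau> n))" for n
  have key: "measure (sample_law fo n) {X \<in> space (sample_law fo n). posterior_far \<gamma> fo n (sn n) X > ennreal \<epsilon>} \<le> bound n"
    if n: "1 \<le> n" and \<epsilon>: "0 < \<epsilon>" "exp (- \<tau> n) / \<alpha> \<le> \<epsilon>" for n \<epsilon>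
  proof -
    interpret PS: prob_space "sample_law fo n" by (rule sample_prob_space[OF fo, of "(0, 1, 1)"]) (simp add: J_def)
    have n0: "0 < real n" using n by simp
    have \<tau>1: "1 \<le> \<tau> n" using n a by (simp add: \<tau>_def ge_one_powr_ge_zero)
    \<comment> \<open>Rounding up costs at most a factor 2 because \<open>\<tau> n\<close> is at
      least 1.\<close>
    define b where "b = nat \<lceil>\<tau> n\<rceil>"
    have b: "1 \<le> b" "\<tau> n \<le> real b" "real b \<le> 2 * \<tau> n" using \<tau>1 unfolding b_def by linarith+
    define j where "j = (s * b - 1, Suc s, L)"
    have j: "j \<in> J" "num_basis j = s * b - 1 + Suc s" using L by (auto simp: j_def J_def)
    have nb: "real n \<le> real b ^ (2 * s + 1)"
    proof -
      have "real n = \<tau> n powr real (2 * s + 1)"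
        using n0 unfolding \<tau>_def a_def powr_powr by simp
      also have "\<dots> = \<tau> n ^ (2 * s + 1)" using \<tau>1 by (intro powr_realpow) simp
      also have "\<dots> \<le> real b ^ (2 * s + 1)" using b \<tau>1 by (intro power_mono) auto
      finally show ?thesis .
    qed
    have t: "0 < sn n" "real n * (sn n)\<^sup>2 = M\<^sup>2 * \<tau> n"
    proof -
      show "0 < sn n" using M n0 by (simp add: sn_def)
      have "real n * (real n powr (- (real s / (1 + 2 * real s))))\<^sup>2 = real n powr 1 * (real n powr (- (real s / (1 + 2 * real s))) * real n powr (- (real s / (1 + 2 * real s))))"
        using n0 by (simp add: power2_eq_square)
      also have "\<dots> = real n powr (1 + (- (real s / (1 + 2 * real s)) + - (real s / (1 + 2 * real s))))"
        by (simp only: powr_add)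
      also have "1 + (- (real s / (1 + 2 * real s)) + - (real s / (1 + 2 * real s))) = a"
      proof -
        have "1 + 2 * real s \<noteq> 0" by linarith
        then show ?thesis unfolding a_def by (simp add: divide_simps)
      qed
      finally show "real n * (sn n)\<^sup>2 = M\<^sup>2 * \<tau> n" by (simp add: sn_def \<tau>_def power_mult_distrib)
    qed
    obtain S where S: "S \<in> sets (coords (num_basis j))" "S \<subseteq> Theta j" "ennreal (exp (- (\<kappa> * real b))) \<le> emeasure (prior j) S"
      "\<And>\<theta>. \<theta> \<in> S \<Longrightarrow> AE x in mu. \<bar>ln (dens j \<theta> x) - ln (fo x)\<bar> \<le> 2 * (1 + K) / real b ^ s"
      using mass[OF b(1)] unfolding j_def[symmetric] j(2)[symmetric] by blast
    have "emeasure (prior j) S \<le> 1" by (rule finite_measure_prior(2)[OF j(1) S(1)])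
    then obtain p where p: "emeasure (prior j) S = ennreal p" "0 \<le> p"
      by (cases "emeasure (prior j) S") (auto simp: top_unique)
    have pe: "exp (- (\<kappa> * real b)) \<le> p" using S(3) p by simp
    then have p0: "0 < p" using exp_gt_zero[of "- (\<kappa> * real b)"] by linarith
    define \<eta> where "\<eta> = K' / real b ^ s"
    have bs: "1 \<le> real b ^ s" using b by simp
    have \<eta>: "0 \<le> \<eta>" "\<eta> \<le> K'" "2 * (1 + K) / real b ^ s \<le> \<eta>"
    proof -
      show "0 \<le> \<eta>" by (simp add: \<eta>_def K'_def)
      have "K' / real b ^ s \<le> K' / 1" using bs b(1) by (intro divide_left_mono) (auto simp: K'_def)
      then show "\<eta> \<le> K'" by (simp add: \<eta>_def)
      show "2 * (1 + K) / real b ^ s \<le> \<eta>" unfolding \<eta>_def K'_def using b(1) by (intro divide_right_mono) auto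
    qed
    have close: "AE x in mu. \<bar>ln (dens j \<theta> x) - ln (fo x)\<bar> \<le> \<eta>" if "\<theta> \<in> S" for \<theta>
      using S(4)[OF that] by eventually_elim (use \<eta>(3) in linarith)
    \<comment> \<open>The balance behind the rate: \<open>\<eta>^2\<close> contains
      \<open>b^(-2 * s)\<close>, and n is at most \<open>b^(2 * s + 1)\<close>.\<close>
    have nC1: "real n * (exp (2 * \<eta>) * \<eta>\<^sup>2) \<le> C1 * real b"
    proof -
      have "real n * (exp (2 * \<eta>) * \<eta>\<^sup>2) \<le> real b ^ (2 * s + 1) * (exp (2 * K') * \<eta>\<^sup>2)"
        using nb \<eta> by (intro mult_mono) auto
      also have "\<dots> = exp (2 * K') * K'\<^sup>2 * real b"
        using bs b by (simp add: \<eta>_def power_divide power_mult[symmetric] power_add mult.commute[of 2 s])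
      also have "\<dots> \<le> C1 * real b" using C1 by (intro mult_right_mono) auto
      finally show ?thesis .
    qed
    \<comment> \<open>One \<open>C1 * b\<close> of the exponent is consumed by the mean of the
      reciprocal likelihood; the other makes the event \<open>E2\<close> unlikely.\<close>
    define y where "y = p * exp (- (2 * C1 * real b))"
    have y: "0 < y" using p0 by (simp add: y_def)
    \<comment> \<open>The threshold for the square root of the numerator. Its rate
      \<open>M^2 / 400\<close> is below the rate \<open>M^2 / 192\<close> of the mean, so Markov's
      inequality still leaves exponential decay.\<close>
    define u where "u = exp (- (M\<^sup>2 / 400 * \<tau> n))"
    let ?N = "\<lambda>X. esqrt (\<Sum>i. ennreal (weight \<gamma> (e i)) * evidence fo n X (e i) (far_set fo (sn n) (e i)))"
    have eJ: "e i \<in> J" for i using e by (auto simp: bij_betw_def)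
    have [measurable]: "(\<lambda>X. evidence fo n X (e i) (far_set fo (sn n) (e i))) \<in> borel_measurable (sample_law fo n)" for i
      unfolding far_set_def by (rule evidence_measurable[OF fo eJ far_sets[OF fo eJ]])
    have [measurable]: "(\<lambda>X. evidence fo n X j S) \<in> borel_measurable (sample_law fo n)"
      by (rule evidence_measurable[OF fo j(1) S(1)])
    have N[measurable]: "?N \<in> borel_measurable (sample_law fo n)" by measurable
    define E1 where "E1 = {X \<in> space (sample_law fo n). ennreal u \<le> ?N X}"
    define E2 where "E2 = {X \<in> space (sample_law fo n). evidence fo n X j S \<le> ennreal y}"
    have E_sets: "E1 \<in> sets (sample_law fo n)" "E2 \<in> sets (sample_law fo n)"
      unfolding E1_def E2_def by measurable
    have "AE X in sample_law fo n. X \<in> {X \<in> space (sample_law fo n). posterior_far \<gamma> fo n (sn n) X > ennreal \<epsilon>} \<longrightarrow> X \<in> E1 \<union> E2"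
      using sample_AE_pos[OF fo j(1), of n] AE_space[of "sample_law fo n"]
    proof eventually_elim
      case (elim X)
      have w: "0 < weight \<gamma> j" "\<alpha> * exp (- (C2 * real b)) \<le> weight \<gamma> j"
      proof -
        show w2: "\<alpha> * exp (- (C2 * real b)) \<le> weight \<gamma> j" using weight_ge[OF b(1)] by (simp add: j_def)
        have "0 < \<alpha> * exp (- (C2 * real b))" using \<alpha> by simp
        then show "0 < weight \<gamma> j" using w2 by linarith
      qed
      show ?case
      proof (rule impI, rule ccontr)
        assume big: "X \<in> {X \<in> space (sample_law fo n). posterior_far \<gamma> fo n (sn n) X > ennreal \<epsilon>}" and "X \<notin> E1 \<union> E2"
        then have "?N X \<le> ennreal u" "ennreal y < evidence fo n X j S"
          using elim(2) by (auto simp: E1_def E2_def not_le intro: less_imp_le)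
        then have le: "posterior_far \<gamma> fo n (sn n) X \<le> ennreal (u\<^sup>2 / (weight \<gamma> j * y))"
          by (intro posterior_far_le[OF fo elim(1,2) e j(1) w(1) S(2,1) y]) (auto simp: u_def)
        have "u\<^sup>2 / (weight \<gamma> j * y) \<le> exp (- \<tau> n) / \<alpha>"
        proof -
          have ex: "exp (- (C2 * real b)) * (exp (- (\<kappa> * real b)) * exp (- (2 * C1 * real b))) = exp (- ((C2 + \<kappa> + 2 * C1) * real b))"
            by (simp add: exp_add[symmetric] algebra_simps)
          have "(C2 + \<kappa> + 2 * C1) * real b \<le> C4 * real b"
            unfolding C4_def by (intro mult_right_mono) auto
          also have "\<dots> \<le> C4 * (2 * \<tau> n)" using C4 b by (intro mult_left_mono) auto
          finally have "\<alpha> * exp (- (2 * C4 * \<tau> n)) \<le> \<alpha> * exp (- ((C2 + \<kappa> + 2 * C1) * real b))" using \<alpha> by simp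
          also have "\<dots> = (\<alpha> * exp (- (C2 * real b))) * (exp (- (\<kappa> * real b)) * exp (- (2 * C1 * real b)))"
            unfolding ex[symmetric] by (simp only: mult.assoc)
          also have "\<dots> \<le> weight \<gamma> j * y"
            unfolding y_def using w pe p0 by (intro mult_mono) auto
          finally have wy: "\<alpha> * exp (- (2 * C4 * \<tau> n)) \<le> weight \<gamma> j * y" .
          have u2: "u\<^sup>2 = exp (- ((2 * C4 + 1) * \<tau> n))"
            unfolding u_def M(2) by (simp add: power2_eq_square exp_add[symmetric] field_simps)
          have "u\<^sup>2 / (weight \<gamma> j * y) \<le> u\<^sup>2 / (\<alpha> * exp (- (2 * C4 * \<tau> n)))"
            using wy \<alpha> w y by (intro divide_left_mono) auto
          also have "\<dots> = exp (- \<tau> n) / \<alpha>"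
          proof -
            have "u\<^sup>2 = exp (- \<tau> n) * exp (- (2 * C4 * \<tau> n))"
              unfolding u2 by (simp add: exp_add[symmetric] algebra_simps)
            then show ?thesis using \<alpha> by simp
          qed
          finally show ?thesis .
        qed
        then have "ennreal (u\<^sup>2 / (weight \<gamma> j * y)) \<le> ennreal \<epsilon>" using \<epsilon> by (intro ennreal_leI) linarith
        then show False using le big by (auto dest: order_trans leD)
      qed
    qed
    then have "emeasure (sample_law fo n) {X \<in> space (sample_law fo n). posterior_far \<gamma> fo n (sn n) X > ennreal \<epsilon>} \<le> emeasure (sample_law fo n) (E1 \<union> E2)"
      by (rule emeasure_mono_AE) (use E_sets in auto)
    then have "measure (sample_law fo n) {X \<in> space (sample_law fo n). posterior_far \<gamma> fo n (sn n) X > ennreal \<epsilon>} \<le> measure (sample_law fo n) (E1 \<union> E2)"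
      by (simp add: PS.emeasure_eq_measure)
    also have "\<dots> \<le> measure (sample_law fo n) E1 + measure (sample_law fo n) E2"
      by (rule measure_Un_le[OF E_sets])
    also have "measure (sample_law fo n) E1 \<le> C * exp (- ((M\<^sup>2 / 192 - M\<^sup>2 / 400) * \<tau> n))"
    proof -
      have "E1 = {X \<in> space (sample_law fo n). 1 \<le> ennreal (1 / u) * ?N X}"
      proof -
        have "ennreal u \<le> r \<longleftrightarrow> 1 \<le> ennreal (1 / u) * r" for r
          by (cases r) (auto simp: u_def ennreal_mult[symmetric] ennreal_mult_top field_simps)
        then show ?thesis by (simp add: E1_def)
      qed
      then have "emeasure (sample_law fo n) E1 \<le> ennreal (1 / u) * (\<integral>\<^sup>+X. ?N X * indicator (space (sample_law fo n)) X \<partial>sample_law fo n)"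
        by (simp only:) (rule nn_integral_Markov_inequality[OF borel_measurable_times_ennreal[OF N borel_measurable_indicator[OF sets.top]] sets.top])
      also have "(\<integral>\<^sup>+X. ?N X * indicator (space (sample_law fo n)) X \<partial>sample_law fo n) = (\<integral>\<^sup>+X. ?N X \<partial>sample_law fo n)"
        by (intro nn_integral_cong) simp
      also have "ennreal (1 / u) * \<dots> \<le> ennreal (1 / u) * ennreal (C * exp (- (real n * (sn n)\<^sup>2 / 192)))"
        by (intro mult_left_mono C(2) t(1)) simp
      also have "\<dots> = ennreal (C * exp (- ((M\<^sup>2 / 192 - M\<^sup>2 / 400) * \<tau> n)))"
      proof -
        have "1 / u * exp (- (real n * (sn n)\<^sup>2 / 192)) = exp (- ((M\<^sup>2 / 192 - M\<^sup>2 / 400) * \<tau> n))"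
          unfolding t(2) u_def by (simp add: exp_minus[symmetric] inverse_eq_divide[symmetric] exp_add[symmetric] algebra_simps)
        then have "1 / u * (C * exp (- (real n * (sn n)\<^sup>2 / 192))) = C * exp (- ((M\<^sup>2 / 192 - M\<^sup>2 / 400) * \<tau> n))"
          by (simp only: mult.left_commute)
        then show ?thesis using C(1) by (simp add: ennreal_mult[symmetric] u_def)
      qed
      finally show ?thesis using C(1) by (simp add: PS.emeasure_eq_measure)
    qed
    also have "measure (sample_law fo n) E2 \<le> exp (- (C1 * \<tau> n))"
    proof -
      have "measure (sample_law fo n) E2 \<le> y / p * exp (real n * (exp (2 * \<eta>) * \<eta>\<^sup>2))"
        unfolding E2_def evidence_def by (rule denominator_bound[OF fo j(1) S(1) p0 p(1) y \<eta>(1) close])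
      also have "\<dots> \<le> y / p * exp (C1 * real b)"
        using nC1 y p0 by (intro mult_left_mono) auto
      also have "\<dots> = exp (- (C1 * real b))"
        using p0 by (simp add: y_def exp_add[symmetric])
      also have "\<dots> \<le> exp (- (C1 * \<tau> n))" using C1 b by simp
      finally show ?thesis .
    qed
    finally show ?thesis by (simp add: bound_def)
  qed
  have cpos: "0 < M\<^sup>2 / 192 - M\<^sup>2 / 400" using M(1) by (simp add: zero_less_power)
  have lim: "(\<lambda>n. exp (- (c * \<tau> n))) \<longlonglongrightarrow> 0" if "0 < c" for c
    unfolding \<tau>_def using that a by real_asymp
  have bound_lim: "bound \<longlonglongrightarrow> 0"
    using tendsto_add[OF tendsto_mult_left[OF lim[OF cpos], of C] lim[OF C1(1)]] by (simp add: bound_def[abs_def])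
  show ?thesis
  proof (intro exI[of _ sn] conjI)
    show "\<exists>K>0. \<forall>n\<ge>1. sn n = K * real n powr (- (real s / (1 + 2 * real s)))"
      using M by (intro exI[of _ M]) (simp add: sn_def)
    show "tends_to_zero_in_prob (sample_law fo) (\<lambda>n. posterior_far \<gamma> fo n (sn n))"
      unfolding tends_to_zero_in_prob_def
    proof (intro conjI allI impI)
      show "posterior_far \<gamma> fo n (sn n) \<in> borel_measurable (sample_law fo n)" for n
        by (rule posterior_far_measurable[OF fo])
      fix \<epsilon> :: real assume \<epsilon>: "0 < \<epsilon>"
      have "(\<lambda>n. exp (- (1 * \<tau> n)) / \<alpha>) \<longlonglongrightarrow> 0 / \<alpha>"
        by (intro tendsto_divide lim tendsto_const) (use \<alpha> in auto)
      then have "eventually (\<lambda>n. exp (- (1 * \<tau> n)) / \<alpha> < \<epsilon>) sequentially"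
        using \<epsilon> by (intro order_tendstoD(2)) auto
      then have "eventually (\<lambda>n. measure (sample_law fo n) {X \<in> space (sample_law fo n). posterior_far \<gamma> fo n (sn n) X > ennreal \<epsilon>} \<le> bound n) sequentially"
        using eventually_ge_at_top[of 1] by eventually_elim (use key \<epsilon> in auto)
      then show "(\<lambda>n. measure (sample_law fo n) {X \<in> space (sample_law fo n). posterior_far \<gamma> fo n (sn n) X > ennreal \<epsilon>}) \<longlonglongrightarrow> 0"
        by (intro tendsto_sandwich[OF _ _ tendsto_const bound_lim]) auto
    qed
  qed
qed

end
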